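(* Let $h\sim\lambda\log N$ with $\lambda>0$, $\lambda\ll 1$, and for $1\le k\le 3$ let $R=N^{\theta_k}$ where $\theta_k$ is fixed and $0<\theta_k<\frac1k$ (the value $R=N^{\theta_k}$ being used in $M_k$). Then, as $N\to\infty$, $$M_1(N,h,\psi_R)\sim\lambda N\log N,\qquad M_2(N,h,\psi_R)\sim(\theta_2\lambda+\lambda^2)N\log^2N,$$ $$M_3(N,h,\psi_R)\sim\left(\tfrac34\theta_3^2\lambda+3\theta_3\lambda^2+\lambda^3\right)N\log^3N.$$
   Context: For $n\ge1$ and $R\ge1$, $\lambda_R(n)=\sum_{q\le R}\frac{\mu^2(q)}{\phi(q)}\sum_{d\mid (q,n)}d\,\mu(d)$ (with $\mu$ the Möbius function, $\phi$ Euler's function), and $\lambda_R(n)=0$ for $n\le0$. Put $\psi_R(x)=\sum_{n\le x}\lambda_R(n)$ and, for a positive integer $h$ and a positive integer $k$, $$M_k(N,h,\psi_R)=\sum_{n=1}^N\bigl(\psi_R(n+h)-\psi_R(n)\bigr)^k.$$ (The real parameter $\lambda$ is unrelated to the function $\lambda_R$.) *)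

theory Defs
  imports
    Complex_Main
    "HOL-Library.Landau_Symbols"
    "HOL-Computational_Algebra.Squarefree"
    "HOL-Number_Theory.Totient"
begin

definition moebius_mu :: "nat \<Rightarrow> real" where
  "moebius_mu n = (if squarefree n then (- 1) ^ card (prime_factors n) else 0)"

definition lambda_R :: "real \<Rightarrow> int \<Rightarrow> real" where
  "lambda_R R n =
     (if n \<le> 0 then 0
      else \<Sum>q | 1 \<le> q \<and> real q \<le> R.
             (moebius_mu q)\<^sup>2 / real (totient q) *
             (\<Sum>d | d dvd gcd q (nat n). real d * moebius_mu d))"

text \<open>Since \<^term>\<open>lambda_R R n\<close> vanishes for \<^term>\<open>n \<le> 0\<close>, the sum over all integers up to
  \<^term>\<open>x\<close> is taken over the finite range starting at 1 (a sum over an infinite set would be 0).\<close>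

definition psi_R :: "real \<Rightarrow> real \<Rightarrow> real" where
  "psi_R R x = (\<Sum>n = 1..\<lfloor>x\<rfloor>. lambda_R R n)"

definition moment :: "nat \<Rightarrow> nat \<Rightarrow> nat \<Rightarrow> (real \<Rightarrow> real) \<Rightarrow> real" where
  "moment k N h \<psi> = (\<Sum>n = 1..N. (\<psi> (real (n + h)) - \<psi> (real n)) ^ k)"

end

theory Submission
  imports Defs "HOL-Analysis.Analysis" "HOL-Number_Theory.Number_Theory"
begin

text \<open>
  Expanding \<open>\<lambda>\<^sub>R\<close> over the squarefree \<open>q \<le> R\<close>, the \<open>k\<close>-th power of the short sum
  \<open>\<lambda>\<^sub>R(n+1) + \<dots> + \<lambda>\<^sub>R(n+h)\<close> is a combination of indicators of residue classes of total weight
  \<open>O(h R)\<^sup>k = o(N)\<close>, all of whose moduli divide the product of the primes up to \<open>R\<close>. So its average over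
  \<open>n \<le> N\<close> may be replaced by the average over a full period, which factors over the primes.

  The term \<open>q = 1\<close> gives the constant \<open>h\<close>; let \<open>S'\<close> be the remaining, centred part. Terms with
  \<open>1 < q \<le> Q\<close> contribute a bounded amount to \<open>S'\<close>, since they sum to zero over a period. For \<open>q > Q\<close>, the
  correlations at shifts that are not all equal save a factor \<open>Q powr (-1/4)\<close> by Rankin's trick, the remaining
  Euler products being bounded on average over the shifts. Hence the second moment of \<open>S'\<close> is asymptotically
  \<open>h\<close> times the sum of \<open>1/\<phi>(q)\<close> over squarefree \<open>q \<le> R\<close>, i.e. \<open>h log R\<close>, and the third one is \<open>h\<close> times
  the average of \<open>(\<lambda>\<^sub>R - 1)\<^sup>3\<close>, a sum over triples \<open>(u b c, u a c, u a b)\<close>. Removing the primes one at a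
  time reduces this sum to the one of \<open>\<mu>(u)/(a b c u)\<close>, which is \<open>3/4 (log R)\<^sup>2 + O(log R)\<close>.
\<close>

text \<open>The cut \<open>Q\<close> stays fixed while \<open>N\<close> grows. Correlations of terms
  with bounded \<open>q\<close> at distinct shifts are not small one by one; they cancel only in the
  sum over the shifts, so these terms are bounded pointwise. The terms with \<open>q > Q\<close>
  leave an error of the order of the main term times \<open>Q powr (-(1/4))\<close>. All else that
  depends on \<open>Q\<close> is smaller by a factor \<open>h\<close> or \<open>ln R\<close>. Hence
  \<open>Q\<close> is chosen from \<epsilon>, and only then \<open>N\<close>. The constant 3/4 is 1
  - 1/4: the innermost variable of the quadruple sum is bounded by a minimum of two quantities. One
  of them alone would give \<open>(ln R)^2\<close>, and taking the minimum loses
  \<open>(ln R)^2 / 4\<close>. Correcting the weight at one prime \<open>p\<close> leaves the main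
  term alone because a constant total would not change at all. The deviation is
  \<open>p powr (-2)\<close> from this cancellation, times \<open>p powr (3/4)\<close> because
  bounds shrink by up to \<open>p^3\<close> inside an error of exponent 1/4. The result
  \<open>p powr (-(5/4))\<close> is summable, which makes the estimate uniform in the set of
  primes.\<close>

section \<open>Products over primes, subsets and squarefree divisors\<close>

lemma sum_Pow_prod:
  fixes f g :: "'a \<Rightarrow> 'b::comm_semiring_1"
  assumes "finite P"
  shows "(\<Sum>S\<in>Pow P. \<Prod>p\<in>P. if p \<in> S then f p else g p) = (\<Prod>p\<in>P. f p + g p)"
proof -
  have "(\<Prod>p\<in>P. if p \<in> S then f p else g p) = prod f S * prod g (P - S)" if "S \<subseteq> P" for S
    using that assms by (simp add: prod.If_cases Int_absorb1 Diff_eq)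
  then show ?thesis using assms by (simp add: prod_add)
qed

lemma sum_Pow_prod_subset:
  fixes f :: "'a \<Rightarrow> 'b::comm_semiring_1"
  assumes "finite P"
  shows "(\<Sum>S\<in>Pow P. \<Prod>p\<in>S. f p) = (\<Prod>p\<in>P. f p + 1)"
proof -
  have "(\<Prod>p\<in>P. if p \<in> S then f p else 1) = prod f S" if "S \<subseteq> P" for S
    using that assms by (simp add: prod.If_cases Int_absorb1)
  then show ?thesis using sum_Pow_prod[OF assms, of f "\<lambda>_. 1"] by simp
qed

lemma finite_subset_primes:
  assumes "finite S" "\<And>p. p \<in> S \<Longrightarrow> prime (p::nat)"
  shows prime_factors_prod_primes: "prime_factors (\<Prod>S) = S"
    and squarefree_prod_primes: "squarefree (\<Prod>S)"
    and prod_primes_dvd_iff: "\<Prod>S dvd n \<longleftrightarrow> (\<forall>p\<in>S. p dvd n)"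
proof -
  show *: "prime_factors (\<Prod>S) = S"
    using assms
    by (subst prime_factors_prod) (auto simp: prime_prime_factors dest: prime_gt_0_nat)
  show "squarefree (\<Prod>S)"
    using assms
  proof (induction S rule: finite_induct)
    case (insert p S)
    have "coprime p (\<Prod>S)"
      using insert by (intro prod_coprime_right) (auto intro: primes_coprime)
    then show ?case using insert by (auto simp: squarefree_mult_coprime squarefree_prime)
  qed auto
  show "\<Prod>S dvd n \<longleftrightarrow> (\<forall>p\<in>S. p dvd n)"
  proof
    assume "\<forall>p\<in>S. p dvd n"
    with assms show "\<Prod>S dvd n"
    proof (induction S rule: finite_induct)
      case (insert p S)
      have "coprime p (\<Prod>S)"
        using insert by (intro prod_coprime_right) (auto intro: primes_coprime)
      then show ?case using insert by (auto intro: divides_mult)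
    qed auto
  qed (use assms in \<open>auto intro: dvd_trans[OF dvd_prodI]\<close>)
qed

lemma squarefree_eq_prod_prime_factors:
  assumes "squarefree (n::nat)" shows "\<Prod>(prime_factors n) = n"
proof -
  have n: "n \<noteq> 0" using assms by (metis not_squarefree_0)
  have "n = (\<Prod>p\<in>prime_factors n. p ^ multiplicity p n)"
    using n by (simp add: prime_factorization_nat)
  also have "\<dots> = (\<Prod>p\<in>prime_factors n. p)"
  proof (intro prod.cong refl)
    fix p assume p: "p \<in> prime_factors n"
    then have "multiplicity p n \<le> 1"
      using assms n by (auto simp: squarefree_factorial_semiring'')
    moreover have "multiplicity p n > 0"
      using p n by (auto simp: prime_factors_multiplicity)
    ultimately show "p ^ multiplicity p n = p" by (simp add: le_Suc_eq)
  qed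
  finally show ?thesis by simp
qed

text \<open>Only squarefree divisors carry weight, and they are the products of the subsets of
  \<open>prime_factors n\<close>; the sum is then an expanded product.\<close>

lemma sum_squarefree_divisors:
  fixes f :: "nat \<Rightarrow> real"
  assumes "n > 0"
  shows "(\<Sum>d | d dvd n. moebius_mu d * (\<Prod>p\<in>prime_factors d. f p)) = (\<Prod>p\<in>prime_factors n. 1 - f p)"
proof -
  have "(\<Sum>d | d dvd n. moebius_mu d * (\<Prod>p\<in>prime_factors d. f p)) =
        (\<Sum>d | d dvd n \<and> squarefree d. moebius_mu d * (\<Prod>p\<in>prime_factors d. f p))"
    using assms by (intro sum.mono_neutral_right) (auto simp: moebius_mu_def)
  also have "\<dots> = (\<Sum>S\<in>Pow (prime_factors n). \<Prod>p\<in>S. - f p)"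
  proof (rule sum.reindex_bij_witness[where i = "\<lambda>S. \<Prod>S" and j = prime_factors])
    fix S assume S: "S \<in> Pow (prime_factors n)"
    then have fin: "finite S" "\<And>p. p \<in> S \<Longrightarrow> prime p" 
      by (auto intro: finite_subset)
    show "prime_factors (\<Prod>S) = S" by (rule prime_factors_prod_primes[OF fin])
    show "\<Prod>S \<in> {d. d dvd n \<and> squarefree d}"
      using squarefree_prod_primes[OF fin] prod_primes_dvd_iff[OF fin] S by auto
  next
    fix d assume d: "d \<in> {d. d dvd n \<and> squarefree d}"
    then show "\<Prod>(prime_factors d) = d" by (simp add: squarefree_eq_prod_prime_factors)
    show "prime_factors d \<in> Pow (prime_factors n)" using d assms dvd_prime_factors[of n d] by auto
    show "(\<Prod>p\<in>prime_factors d. - f p) = moebius_mu d * (\<Prod>p\<in>prime_factors d. f p)"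
      using d prod.distrib[of "\<lambda>_. -1" f "prime_factors d"] by (simp add: moebius_mu_def)
  qed
  also have "\<dots> = (\<Prod>p\<in>prime_factors n. 1 - f p)"
    by (subst sum_Pow_prod_subset) auto
  finally show ?thesis .
qed

lemma sum_moebius_divisors:
  assumes "n > 0"
  shows "(\<Sum>d | d dvd n. moebius_mu d) = (if n = 1 then 1 else 0)"
proof (cases "n = 1")
  case False
  then have "prime_factors n \<noteq> {}" using assms by (simp add: prime_factorization_empty_iff)
  then have "card (prime_factors n) > 0" by (simp add: card_gt_0_iff)
  then show ?thesis using sum_squarefree_divisors[OF assms, of "\<lambda>_. 1"] False by simp
qed (simp add: moebius_mu_def)

lemma abs_moebius_mu_le: "\<bar>moebius_mu n\<bar> \<le> 1"
  by (simp add: moebius_mu_def power_abs)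

section \<open>Harmonic sums and their logarithmic analogue\<close>

definition nats_le :: "real \<Rightarrow> nat set" where
  "nats_le x = {n. 1 \<le> n \<and> real n \<le> x}"

lemma nats_le_altdef: "nats_le x = {1..nat \<lfloor>x\<rfloor>}"
proof -
  have "real n \<le> x \<longleftrightarrow> n \<le> nat \<lfloor>x\<rfloor>" if "1 \<le> n" for n
    using that by (simp add: le_nat_iff le_floor_iff) linarith
  then show ?thesis by (auto simp: nats_le_def)
qed

lemma finite_nats_le [simp, intro]: "finite (nats_le x)"
  by (simp add: nats_le_altdef)

lemma nats_le_less_1 [simp]: "x < 1 \<Longrightarrow> nats_le x = {}"
  by (auto simp: nats_le_def)

lemma nats_le_mono: "x \<le> y \<Longrightarrow> nats_le x \<subseteq> nats_le y"
  by (auto simp: nats_le_def)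

definition harm_sum :: "real \<Rightarrow> real" where
  "harm_sum x = (\<Sum>n\<in>nats_le x. 1 / real n)"

definition log_harm_sum :: "real \<Rightarrow> real" where
  "log_harm_sum x = (\<Sum>n\<in>nats_le x. ln (real n) / real n)"

text \<open>\<open>s - v\<close> increases and \<open>s + v\<close> decreases, so the supremum of
  the former lies between them. This produces a limit together with its rate as soon as the
  increments have a telescoping majorant.\<close>

lemma sandwich_limit:
  fixes s v :: "nat \<Rightarrow> real"
  assumes "\<And>n. n \<ge> 1 \<Longrightarrow> \<bar>s (Suc n) - s n\<bar> \<le> v n - v (Suc n)" and v: "\<And>n. n \<ge> 1 \<Longrightarrow> v n \<ge> 0"
  shows "\<exists>l. \<forall>n\<ge>1. \<bar>s n - l\<bar> \<le> v n"
proof -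
  \<comment> \<open>The shift by one discards index 0, about which nothing is assumed.\<close>
  define a where "a n = s (Suc n) - v (Suc n)" for n
  define b where "b n = s (Suc n) + v (Suc n)" for n
  have a: "incseq a" unfolding a_def using assms(1)
    by (intro incseq_SucI) (smt (verit) One_nat_def Suc_le_mono bot_nat_0.extremum)
  have b: "decseq b" unfolding b_def using assms(1)
    by (intro decseq_SucI) (smt (verit) One_nat_def Suc_le_mono bot_nat_0.extremum)
  have ab: "a m \<le> b n" for m n
  proof -
    have "a m \<le> a (max m n)" using a by (simp add: incseq_def)
    also have "\<dots> \<le> b (max m n)" using v by (simp add: a_def b_def)
    also have "\<dots> \<le> b n" using b by (simp add: decseq_def)
    finally show ?thesis .
  qed
  have bdd: "bdd_above (range a)" using ab by (auto intro!: bdd_aboveI2)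
  define l where "l = (SUP n. a n)"
  have "a n \<le> l" "l \<le> b n" for n
    using bdd ab by (auto simp: l_def intro: cSUP_upper cSUP_least)
  then have "\<bar>s (Suc n) - l\<bar> \<le> v (Suc n)" for n
    by (smt (verit) a_def b_def)
  then show ?thesis by (intro exI[of _ l]) (metis One_nat_def Suc_le_D)
qed

lemma ln_le_powr_quarter:
  assumes "x > (0::real)" shows "ln x \<le> 4 * x powr (1/4)"
proof -
  have "ln (x powr (1/4)) \<le> x powr (1/4)" using assms by (intro ln_bound) auto
  then show ?thesis using assms by (simp add: ln_powr)
qed

lemma abs_ln_le_powr_quarter:
  assumes "0 < x" "x \<le> (1::real)" shows "\<bar>ln x\<bar> \<le> 4 * x powr (- (1/4))"
proof -
  have "ln (1/x) \<le> 4 * (1/x) powr (1/4)" using assms by (intro ln_le_powr_quarter) auto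
  also have "(1/x) powr (1/4) = x powr (-(1/4))" using assms by (simp add: powr_divide powr_minus_divide)
  finally show ?thesis using assms by (simp add: ln_div)
qed

lemma powr_neg_antimono:
  assumes "0 < x" "x \<le> (y::real)" "a \<ge> 0" shows "y powr (-a) \<le> x powr (-a)"
  using assms by (intro powr_mono2') auto

lemma ln_floor_diff:
  assumes "x \<ge> (1::real)"
  defines "n \<equiv> nat \<lfloor>x\<rfloor>"
  shows "n \<ge> 1" "real n \<le> x" "ln x - ln n \<le> 1 / n" "1 / n \<le> 2 / x"
proof -
  show n: "n \<ge> 1" "real n \<le> x" using assms by (simp_all add: le_nat_floor)
  have x: "x \<le> n + 1" using assms unfolding n_def by linarith
  have "ln x - ln n = ln (x / n)" using assms n by (simp add: ln_div)
  also have "\<dots> \<le> x / n - 1" using n assms by (intro ln_le_minus_one) auto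
  also have "\<dots> = (x - n) / n" using n by (simp add: diff_divide_distrib)
  also have "\<dots> \<le> 1 / n" using n x by (intro divide_right_mono) auto
  finally show "ln x - ln n \<le> 1 / n" .
  have "x \<le> 2 * n" using x n(1) by linarith
  then show "1 / n \<le> 2 / x" using n assms by (simp add: field_simps)
qed

lemma harm_sum_eq: "harm_sum x = (\<Sum>n=1..nat \<lfloor>x\<rfloor>. 1 / real n)"
  by (simp add: harm_sum_def nats_le_altdef)

lemma ln_Suc_diff_bounds:
  assumes "n \<ge> 1"
  shows "1 / (real n + 1) \<le> ln (real n + 1) - ln (real n)" "ln (real n + 1) - ln (real n) \<le> 1 / real n"
proof -
  have "ln (real n + 1) - ln (real n) = ln ((real n + 1) / n)" using assms by (simp add: ln_div)
  also have "\<dots> \<le> (real n + 1) / n - 1" using assms by (intro ln_le_minus_one) auto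
  finally show "ln (real n + 1) - ln (real n) \<le> 1 / real n" using assms by (simp add: field_simps)
  have "ln (real n) - ln (real n + 1) = ln (n / (real n + 1))" using assms by (simp add: ln_div)
  also have "\<dots> \<le> n / (real n + 1) - 1" using assms by (intro ln_le_minus_one) auto
  finally show "1 / (real n + 1) \<le> ln (real n + 1) - ln (real n)" using assms by (simp add: field_simps)
qed

text \<open>The constant \<open>g\<close> is Euler's. The range includes \<open>x < 1\<close>, where
  the sum is empty and the error has to absorb \<open>\<bar>ln x\<bar>\<close>; a negative power of
  \<open>x\<close> does so. Such arguments occur later as quotients of the bounds \<open>Y\<close>
  and \<open>Z\<close>.\<close>

lemma harm_sum_asymp:
  "\<exists>g C. C \<ge> 0 \<and> (\<forall>x>0. \<bar>harm_sum x - ln x - g\<bar> \<le> C * x powr (-(1/4)))"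
proof -
  define s where "s n = (\<Sum>k=1..n. 1 / real k) - ln n" for n
  have "\<bar>s (Suc n) - s n\<bar> \<le> 1 / n - 1 / Suc n" if "n \<ge> 1" for n
    using ln_Suc_diff_bounds[OF that] by (simp add: s_def add.commute)
  then obtain g where g: "\<And>n. n \<ge> 1 \<Longrightarrow> \<bar>s n - g\<bar> \<le> 1 / n"
    using sandwich_limit[of s "\<lambda>n. 1 / n"] by auto
  have large: "\<bar>harm_sum x - ln x - g\<bar> \<le> 4 * x powr (-(1/4))" if x: "x \<ge> 1" for x
  proof -
    note n = ln_floor_diff[OF x]
    have "harm_sum x - ln x - g = (s (nat \<lfloor>x\<rfloor>) - g) - (ln x - ln (nat \<lfloor>x\<rfloor>))"
      by (simp add: harm_sum_eq s_def)
    moreover have "0 \<le> ln x - ln (nat \<lfloor>x\<rfloor>)" using n x by (simp add: )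
    ultimately have "\<bar>harm_sum x - ln x - g\<bar> \<le> 4 / x" using g[OF n(1)] n by linarith
    also have "\<dots> \<le> 4 * x powr (-(1/4))" using powr_mono[of "-1" "-(1/4)" x] x
      by (simp add: powr_minus_divide)
    finally show ?thesis .
  qed
  have small: "\<bar>harm_sum x - ln x - g\<bar> \<le> (4 + \<bar>g\<bar>) * x powr (-(1/4))" if x: "0 < x" "x < 1" for x
  proof -
    have "1 \<le> x powr (-(1/4))" using powr_neg_antimono[of x 1 "1/4"] x by simp
    then have "\<bar>g\<bar> * 1 \<le> \<bar>g\<bar> * x powr (-(1/4))" by (intro mult_left_mono) auto
    then have "\<bar>ln x\<bar> + \<bar>g\<bar> \<le> (4 + \<bar>g\<bar>) * x powr (-(1/4))"
      using abs_ln_le_powr_quarter[of x] x by (simp add: ring_distribs)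
    moreover have "harm_sum x = 0" using x by (simp add: harm_sum_def)
    ultimately show ?thesis by linarith
  qed
  have "\<bar>harm_sum x - ln x - g\<bar> \<le> (4 + \<bar>g\<bar>) * x powr (-(1/4))" if "x > 0" for x
  proof (cases "x < 1")
    case False
    then have "\<bar>harm_sum x - ln x - g\<bar> \<le> 4 * x powr (-(1/4))" using large by simp
    also have "\<dots> \<le> (4 + \<bar>g\<bar>) * x powr (-(1/4))" by (intro mult_right_mono) auto
    finally show ?thesis .
  qed (use small that in auto)
  then show ?thesis by (intro exI[of _ g] exI[of _ "4 + \<bar>g\<bar>"]) auto
qed

text \<open>For \<open>a = sqrt n\<close>, \<open>b = sqrt (n + 1)\<close>. The two terms on the
  left are at most \<open>4 / (a * b^2)\<close> and \<open>2 / (a * b^2)\<close>; since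
  \<open>b - a = 1 / (a + b)\<close>, the right side is at least
  \<open>6 / (a * b^2)\<close>.\<close>

lemma sqrt_telescope:
  fixes a b :: real
  assumes "a \<ge> 1" "b > a" "b^2 = a^2 + 1"
  shows "(2 * b) * (1 / a^2 - 1 / b^2) + (1 / a^2)^2 / 2 \<le> 12 / a - 12 / b"
proof -
  have pos: "a > 0" "b > 0" using assms by auto
  have "1\<^sup>2 \<le> a\<^sup>2" using assms by (intro power_mono) auto
  then have b2': "b^2 \<le> (2*a)^2" using assms(3) by (simp add: power_mult_distrib)
  then have b2: "b \<le> 2 * a" using pos power2_le_imp_le[of b "2 * a"] by simp
  have "(b - a) * (b + a) = b^2 - a^2" by (simp add: power2_eq_square algebra_simps)
  then have ba: "b - a = 1 / (b + a)" using pos unfolding assms(3) by (simp add: eq_divide_eq)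
  have "1 / a^2 - 1 / b^2 = (b^2 - a^2) / (a^2 * b^2)" using pos by (simp add: diff_divide_distrib)
  then have 1: "(2 * b) * (1 / a^2 - 1 / b^2) = 2 * b / (a^2 * b^2)"
    by (simp add: assms(3))
  have "2 * b / (a^2 * b^2) = (2 * b / a) / (a * b^2)" using pos by (simp add: power2_eq_square)
  also have "\<dots> \<le> 4 / (a * b^2)" using pos b2 by (intro divide_right_mono) (auto simp: divide_le_eq)
  finally have 2: "2 * b / (a^2 * b^2) \<le> 4 / (a * b^2)" .
  have "(1 / a^2)^2 / 2 = (b^2 / (2 * a^3)) / (a * b^2)"
    using pos by (simp add: power2_eq_square power3_eq_cube)
  also have "\<dots> \<le> 2 / (a * b^2)"
  proof (rule divide_right_mono)
    have "b^2 \<le> 4 * a^2 * 1" using b2' by (simp add: power_mult_distrib)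
    also have "\<dots> \<le> 4 * a^2 * a" using assms(1) by (intro mult_left_mono) auto
    also have "\<dots> = 4 * a^3" by (simp add: power2_eq_square power3_eq_cube)
    finally show "b^2 / (2 * a^3) \<le> 2" using pos by (simp add: divide_le_eq)
  qed (use pos in auto)
  finally have 3: "(1 / a^2)^2 / 2 \<le> 2 / (a * b^2)" .
  have "12 / a - 12 / b = 12 * (b - a) / (a * b)"
    using pos by (simp add: right_diff_distrib diff_divide_distrib)
  also have "\<dots> = 12 / (a * b * (b + a))" unfolding ba by simp
  also have "\<dots> \<ge> 12 / (a * b * (2 * b))" 
  proof (rule frac_le)
    show "a * b * (b + a) \<le> a * b * (2 * b)" using pos assms(2) by (intro mult_left_mono) auto
    show "0 < a * b * (b + a)" using pos by simp
  qed auto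
  finally have 4: "12 / a - 12 / b \<ge> 12 / (a * b * (2 * b))" .
  have "12 / (a * b * (2 * b)) = 6 / (a * b^2)" by (simp add: power2_eq_square)
  with 4 have "12 / a - 12 / b \<ge> 6 / (a * b^2)" by linarith
  then show ?thesis using 1 2 3 by linarith
qed

text \<open>The increments of \<open>s\<close> have order \<open>ln n / n^2\<close> and are
  majorised by the differences of \<open>12 / sqrt n\<close>. The limit \<open>g\<close> is the
  first Stieltjes constant.\<close>

lemma log_harm_sum_asymp:
  "\<exists>g C. C \<ge> 0 \<and> (\<forall>x\<ge>1. \<bar>log_harm_sum x - (ln x)\<^sup>2 / 2 - g\<bar> \<le> C * x powr (-(1/4)))"
proof -
  define s where "s n = (\<Sum>k=1..n. ln (real k) / real k) - (ln n)\<^sup>2 / 2" for n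
  have "\<bar>s (Suc n) - s n\<bar> \<le> 12 / sqrt n - 12 / sqrt (Suc n)" if n: "n \<ge> 1" for n
  proof -
    define a b where "a = sqrt n" and "b = sqrt (Suc n)"
    have ab: "a \<ge> 1" "b > a" "a^2 = n" "b^2 = real n + 1" using n by (auto simp: a_def b_def)
    define d where "d = ln (real n + 1) - ln (real n)"
    have d: "1 / (real n + 1) \<le> d" "d \<le> 1 / n" using ln_Suc_diff_bounds[OF n] by (auto simp: d_def)
    have lnb: "ln (real n + 1) \<le> 2 * b"
    proof -
      have "ln b \<le> b" using ab by (intro ln_bound) auto
      moreover have "ln (real n + 1) = 2 * ln b" using ab ln_realpow[of b 2] by simp
      ultimately show ?thesis by simp
    qed
    have "s (Suc n) - s n = ln (real n + 1) / (real n + 1) - ((ln (real n + 1))\<^sup>2 - (ln n)\<^sup>2) / 2"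
      by (simp add: s_def add.commute diff_divide_distrib)
    also have "(ln (real n + 1))\<^sup>2 - (ln n)\<^sup>2 = d * (2 * ln (real n + 1) - d)"
      by (simp add: d_def power2_eq_square algebra_simps)
    \<comment> \<open>The first-order terms are paired, because \<open>1 / (real n + 1)\<close> and
      \<open>d\<close> differ only by \<open>O(1 / n^2)\<close>.\<close>
    also have "ln (real n + 1) / (real n + 1) - d * (2 * ln (real n + 1) - d) / 2 =
      ln (real n + 1) * (1 / (real n + 1) - d) + d^2 / 2"
      by (simp add: power2_eq_square field_simps)
    also have "\<bar>\<dots>\<bar> \<le> \<bar>ln (real n + 1) * (1 / (real n + 1) - d)\<bar> + \<bar>d^2/2\<bar>"
      by (rule abs_triangle_ineq)
    also have "\<bar>ln (real n + 1) * (1 / (real n + 1) - d)\<bar> \<le> (2 * b) * (1 / n - 1 / (real n + 1))"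
      unfolding abs_mult using lnb d ab by (intro mult_mono) auto
    also have "\<bar>d^2/2\<bar> \<le> (1 / n)^2 / 2"
    proof -
      have "0 \<le> d" using d(1) by (rule order_trans[rotated]) simp
      then have "d^2 \<le> (1 / n)^2" using d by (intro power_mono) auto
      then show ?thesis by simp
    qed
    also have "(2 * b) * (1 / n - 1 / (real n + 1)) + (1 / n)^2 / 2 =
        (2 * b) * (1 / a^2 - 1 / b^2) + (1 / a^2)^2 / 2" using ab by simp
    also have "\<dots> \<le> 12 / a - 12 / b" using ab by (intro sqrt_telescope) auto
    finally show ?thesis by (simp add: a_def b_def)
  qed
  then obtain g where g: "\<And>n. n \<ge> 1 \<Longrightarrow> \<bar>s n - g\<bar> \<le> 12 / sqrt n"
    using sandwich_limit[of s "\<lambda>n. 12 / sqrt n"] by auto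
  have "\<bar>log_harm_sum x - (ln x)\<^sup>2 / 2 - g\<bar> \<le> 26 * x powr (-(1/4))" if x: "x \<ge> 1" for x
  proof -
    note n = ln_floor_diff[OF x]
    define n where "n = nat \<lfloor>x\<rfloor>"
    note n = n[folded n_def]
    define D M where "D = (ln x - ln n) * (ln x + ln n)" and "M = (2 / x) * (2 * ln x)"
    have "log_harm_sum x - (ln x)\<^sup>2 / 2 - g = (s n - g) - D / 2"
      by (simp add: log_harm_sum_def nats_le_altdef s_def n_def D_def power2_eq_square field_simps)
    moreover have "D \<le> M"
      unfolding D_def M_def using n x by (intro mult_mono) auto
    moreover have "D \<ge> 0" using n x by (simp add: D_def)
    moreover have "\<bar>s n - g\<bar> \<le> 12 / sqrt n" using g n by auto
    moreover have "12 / sqrt n \<le> 18 * x powr (-(1/4))"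
    proof -
      have "1 / sqrt n = sqrt (1 / n)" by (simp add: real_sqrt_divide)
      also have "\<dots> \<le> sqrt (2 / x)" using n by simp
      also have "\<dots> = sqrt 2 * x powr (-(1/2))" using x
        by (simp add: real_sqrt_divide powr_half_sqrt powr_minus_divide)
      also have "\<dots> \<le> 1.5 * x powr (-(1/4))" using x
        by (intro mult_mono powr_mono real_le_lsqrt) (auto simp: power2_eq_square)
      finally show ?thesis by simp
    qed
    moreover have "M / 2 \<le> 8 * x powr (-(1/4))"
    proof -
      have "M / 2 = 2 * (ln x / x)" by (simp add: M_def)
      also have "\<dots> \<le> 2 * (4 * x powr (1/4) / x)" 
        using x ln_le_powr_quarter[of x] by (intro mult_left_mono divide_right_mono) auto
      also have "x powr (1/4) / x = x powr (-(3/4))" using x powr_diff[of x "1/4" 1] by simp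
      then have "2 * (4 * x powr (1/4) / x) = 8 * x powr (-(3/4))" by simp
      also have "\<dots> \<le> 8 * x powr (-(1/4))" using x by (intro mult_left_mono powr_mono) auto
      finally show ?thesis .
    qed
    ultimately show ?thesis by linarith
  qed
  then show ?thesis by (intro exI[of _ g] exI[of _ 26]) auto
qed

section \<open>Summation under the hyperbola and weighted sums of the Moebius function\<close>

lemma nats_le_divide_iff:
  assumes "d \<ge> 1"
  shows "m \<in> nats_le (x / real d) \<longleftrightarrow> 1 \<le> m \<and> real d * real m \<le> x"
  using assms by (simp add: nats_le_def field_simps)

lemma mult_le_imp_left_le:
  assumes "real d * real m \<le> x" "1 \<le> m" shows "real d \<le> x"
proof -
  have "real d * 1 \<le> real d * real m" using assms by (intro mult_left_mono) auto
  then show ?thesis using assms by simp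
qed

lemma nats_le_divide_eq:
  assumes "d \<in> nats_le x"
  shows "nats_le (x / real d) = {m \<in> nats_le x. real d * real m \<le> x}"
proof -
  have "real m \<le> x" if "real d * real m \<le> x" for m
    using mult_le_imp_left_le[of m d x] that assms by (simp add: nats_le_def mult.commute)
  then show ?thesis using assms nats_le_divide_iff[of d _ x] by (auto simp: nats_le_def)
qed

lemma sum_hyperbola:
  fixes f :: "nat \<Rightarrow> nat \<Rightarrow> real"
  shows "(\<Sum>d\<in>nats_le x. \<Sum>m\<in>nats_le (x / real d). f d m) = (\<Sum>n\<in>nats_le x. \<Sum>d | d dvd n. f d (n div d))"
proof -
  have "(\<Sum>d\<in>nats_le x. \<Sum>m\<in>nats_le (x / real d). f d m) =
        (\<Sum>(d, m)\<in>(SIGMA d:nats_le x. nats_le (x / real d)). f d m)"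
    by (simp add: sum.Sigma)
  also have "\<dots> = (\<Sum>(n, d)\<in>(SIGMA n:nats_le x. {d. d dvd n}). f d (n div d))"
  proof (rule sum.reindex_bij_witness[where i = "\<lambda>(n, d). (d, n div d)" and j = "\<lambda>(d, m). (d * m, d)"], goal_cases)
    case (2 a)
    then show ?case by (auto simp: nats_le_divide_eq) (auto simp: nats_le_def Suc_le_eq)
  next
    case (4 b)
    then obtain d m where b: "b = (d * m, d)" by (auto elim!: dvdE simp: mult.commute)
    then have dm: "1 \<le> d" "1 \<le> m" "real d * real m \<le> x"
      using 4 by (auto simp: nats_le_def Suc_le_eq)
    have "m \<in> nats_le (x / real d)" using dm by (simp only: nats_le_divide_iff)
    moreover have "d \<in> nats_le x" using mult_le_imp_left_le[OF dm(3,2)] dm by (simp add: nats_le_def)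
    ultimately show ?case using b dm by auto
  qed (auto simp: nats_le_def)
  also have "\<dots> = (\<Sum>n\<in>nats_le x. \<Sum>d | d dvd n. f d (n div d))"
  proof (subst sum.Sigma)
    show "\<forall>n\<in>nats_le x. finite {d. d dvd n}" by (auto simp: nats_le_def)
  qed simp_all
  finally show ?thesis .
qed

lemma sum_hyperbola_commute:
  fixes f :: "nat \<Rightarrow> nat \<Rightarrow> real"
  shows "(\<Sum>d\<in>nats_le x. \<Sum>m\<in>nats_le (x / real d). f d m) = (\<Sum>m\<in>nats_le x. \<Sum>d\<in>nats_le (x / real m). f d m)"
  using sum.swap_restrict[of "nats_le x" "nats_le x" f "\<lambda>d m. real d * real m \<le> x"]
  by (simp add: nats_le_divide_eq mult.commute)

text \<open>Grouping by the product \<open>d * m\<close> turns the weight into the full divisor sum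
  of the Moebius function, which is supported at 1. The choices \<open>f n = 1\<close>,
  \<open>1 / n\<close> and \<open>ln (y / n) / n\<close> yield the three Moebius sums below.\<close>

lemma sum_moebius_hyperbola:
  fixes f :: "nat \<Rightarrow> real"
  shows "(\<Sum>d\<in>nats_le x. \<Sum>m\<in>nats_le (x / real d). moebius_mu d * f (d * m)) = (if x \<ge> 1 then f 1 else 0)"
proof -
  have "(\<Sum>d\<in>nats_le x. \<Sum>m\<in>nats_le (x / real d). moebius_mu d * f (d * m)) =
     (\<Sum>n\<in>nats_le x. \<Sum>d | d dvd n. moebius_mu d * f (d * (n div d)))"
    by (rule sum_hyperbola)
  also have "\<dots> = (\<Sum>n\<in>nats_le x. f n * (\<Sum>d | d dvd n. moebius_mu d))"
    by (simp add: sum_distrib_left mult.commute)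
  also have "\<dots> = (\<Sum>n\<in>nats_le x. if 1 = n then f n else 0)"
    by (intro sum.cong refl) (auto simp: sum_moebius_divisors nats_le_def)
  also have "\<dots> = (if x \<ge> 1 then f 1 else 0)"
    by (subst sum.delta', simp) (simp add: nats_le_def)
  finally show ?thesis .
qed

lemma sum_nats_le_powr_le:
  assumes "0 < a" "a < (1::real)" "x \<ge> 0"
  shows "(\<Sum>d\<in>nats_le x. real d powr (a - 1)) \<le> x powr a / a"
proof -
  have *: "(\<Sum>d=1..n. real d powr (a - 1)) \<le> real n powr a / a" for n :: nat
  proof (induction n)
    case (Suc n)
    have "a * real (Suc n) powr (a - 1) \<le> real (Suc n) powr a - real n powr a"
    proof (cases "n = 0")
      case False
      define y where "y = real n / real (Suc n)"
      have y: "y > 0" "y = 1 - 1 / real (Suc n)" using False by (auto simp: y_def field_simps)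
      \<comment> \<open>Weighted AM-GM with weights \<open>a\<close> and \<open>1 - a\<close>, that
        is, Bernoulli's inequality for an exponent below 1.\<close>
      have "y powr a * 1 powr (1 - a) \<le> a * y + (1 - a) * 1"
        using assms y by (intro Youngs_inequality_0) auto
      also have "\<dots> = 1 - a / real (Suc n)" unfolding y(2) by (simp add: algebra_simps)
      finally have "real (Suc n) powr a * y powr a \<le> real (Suc n) powr a * (1 - a / real (Suc n))"
        by (intro mult_left_mono) auto
      also have "real (Suc n) powr a * y powr a = real n powr a"
        by (simp add: y_def powr_divide)
      also have "real (Suc n) powr a * (1 - a / real (Suc n)) = real (Suc n) powr a - a * real (Suc n) powr (a - 1)"
        by (simp add: powr_diff right_diff_distrib)
      finally show ?thesis by simp
    qed (use assms in auto)
    then have "real (Suc n) powr (a - 1) \<le> real (Suc n) powr a / a - real n powr a / a"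
      using assms by (simp add: field_simps)
    then show ?case using Suc by simp
  qed (use assms in auto)
  have "(\<Sum>d\<in>nats_le x. real d powr (a - 1)) \<le> real (nat \<lfloor>x\<rfloor>) powr a / a"
    using *[of "nat \<lfloor>x\<rfloor>"] by (simp add: nats_le_altdef)
  also have "\<dots> \<le> x powr a / a"
    using assms by (intro divide_right_mono powr_mono2) auto
  finally show ?thesis .
qed

lemma sum_nats_le_powr_bounded:
  assumes "0 < (a::real)"
  shows "(\<Sum>d\<in>nats_le x. real d powr (- 1 - a)) \<le> 1 + 1 / a"
proof -
  \<comment> \<open>The induction closes only with the tail subtracted:
    \<open>real (Suc n) powr (- a) / a\<close> is the integral of \<open>t powr (- 1 - a)\<close>
    from \<open>Suc n\<close> onwards.\<close>
  have *: "(\<Sum>d=1..Suc n. real d powr (- 1 - a)) \<le> 1 + 1 / a - real (Suc n) powr (- a) / a" for n :: nat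
  proof (induction n)
    case (Suc n)
    define m where "m = real (Suc n)"
    have m: "m > 0" by (simp add: m_def)
    define y where "y = m / (m + 1)"
    have y: "y > 0" using m by (simp add: y_def)
    have "y = 1 + (- 1 / (m+1))" using m by (simp add: y_def field_simps)
    then have "ln y \<le> - 1 / (m+1)" using y m by (metis ln_add_one_self_le_self2 add.commute less_add_same_cancel2 add_uminus_conv_diff ln_le_minus_one add_diff_cancel_left')
    then have "a * (1 / (m+1)) \<le> a * (- ln y)" using assms by (intro mult_left_mono) auto
    then have "1 + a / (m+1) \<le> 1 + (- a) * ln y" by simp
    also have "\<dots> \<le> exp ((- a) * ln y)" by (rule exp_ge_add_one_self)
    also have "\<dots> = y powr (- a)" using y by (simp add: powr_def)
    finally have "(m+1) powr (- a) * (1 + a / (m+1)) \<le> (m+1) powr (- a) * y powr (- a)"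
      by (intro mult_left_mono) auto
    also have "(m+1) powr (- a) * y powr (- a) = m powr (- a)"
      using m by (simp add: y_def powr_divide)
    also have "(m+1) powr (- a) * (1 + a / (m+1)) = (m+1) powr (- a) + a * (m+1) powr (- 1 - a)"
    proof -
      have e: "- 1 - a = - a - 1" by simp
      show ?thesis unfolding e powr_diff using m by (simp add: ring_distribs)
    qed
    finally have "(m+1) powr (- 1 - a) \<le> m powr (- a) / a - (m+1) powr (- a) / a"
      using assms by (simp add: field_simps)
    moreover have "m + 1 = real (Suc (Suc n))" by (simp add: m_def)
    ultimately show ?case using Suc by (simp add: m_def[symmetric])
  qed (use assms in auto)
  show ?thesis
  proof (cases "nat \<lfloor>x\<rfloor>")
    case (Suc n)
    have "real (Suc n) powr (- a) / a \<ge> 0" using assms by simp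
    then show ?thesis using *[of n] Suc by (simp add: nats_le_altdef)
  qed (use assms in \<open>auto simp: nats_le_altdef\<close>)
qed

text \<open>Inversion of the constant 1 writes 1 as the sum of \<open>moebius_mu n\<close> times the
  floor of \<open>y / n\<close>. Dropping the floors costs at most 1 for each
  \<open>n \<le> y\<close>, and \<open>1 + y \<le> 2 * y\<close>.\<close>

lemma sum_moebius_over_n_bounded:
  assumes "y \<ge> 1"
  shows "\<bar>\<Sum>n\<in>nats_le y. moebius_mu n / n\<bar> \<le> 2"
proof -
  have card: "real (card (nats_le z)) = of_int \<lfloor>z\<rfloor>" if "z \<ge> 0" for z
    using that by (simp add: nats_le_altdef)
  have "1 = (\<Sum>n\<in>nats_le y. moebius_mu n * real (card (nats_le (y / n))))"
    using sum_moebius_hyperbola[where x = y and f = "\<lambda>_. 1"] assms by (simp add: mult.commute)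
  also have "\<dots> = (\<Sum>n\<in>nats_le y. moebius_mu n * (y / n)) - (\<Sum>n\<in>nats_le y. moebius_mu n * frac (y / n))"
    using assms by (simp add: card frac_def right_diff_distrib sum_subtractf)
  finally have 1: "y * (\<Sum>n\<in>nats_le y. moebius_mu n / n) = 1 + (\<Sum>n\<in>nats_le y. moebius_mu n * frac (y / n))"
    by (simp add: sum_distrib_left mult.commute)
  have "\<bar>\<Sum>n\<in>nats_le y. moebius_mu n * frac (y / n)\<bar> \<le> (\<Sum>n\<in>nats_le y. 1 * 1)"
    by (intro order_trans[OF sum_abs] sum_mono, unfold abs_mult, intro mult_mono)
      (auto simp: abs_moebius_mu_le frac_lt_1 less_imp_le)
  also have "\<dots> \<le> y" using card[of y] assms by simp
  finally have "\<bar>y * (\<Sum>n\<in>nats_le y. moebius_mu n / n)\<bar> \<le> y * 2" using 1 assms by linarith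
  then show ?thesis using assms by (simp add: abs_mult)
qed

text \<open>Errors of size \<open>(y / d) powr (- a)\<close> are concentrated near
  \<open>d = y\<close>, so their sum with weights \<open>1 / d\<close> stays bounded although the
  weights alone would give a logarithm. This sums the error terms in the Moebius inversions.\<close>

lemma sum_inverse_powr_le:
  assumes "y \<ge> 1" "0 < a" "a < (1::real)"
  shows "(\<Sum>d\<in>nats_le y. (1 / real d) * (y / real d) powr (- a)) \<le> 1 / a"
proof -
  have "(\<Sum>d\<in>nats_le y. (1 / real d) * (y / real d) powr (- a)) =
        y powr (- a) * (\<Sum>d\<in>nats_le y. real d powr (a - 1))"
    unfolding sum_distrib_left
  proof (intro sum.cong refl)
    fix d assume "d \<in> nats_le y"
    then have d: "real d > 0" by (simp add: nats_le_def)
    have "(y / real d) powr (- a) = y powr (- a) * real d powr a"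
      using d assms by (simp add: powr_divide powr_minus divide_simps)
    moreover have "real d powr (a - 1) = real d powr a / real d" using d by (simp add: powr_diff)
    ultimately show "(1 / real d) * (y / real d) powr (- a) = y powr (- a) * real d powr (a - 1)"
      by simp
  qed
  also have "\<dots> \<le> y powr (- a) * (y powr a / a)"
    using assms by (intro mult_left_mono sum_nats_le_powr_le) auto
  also have "\<dots> = 1 / a" using assms by (simp add: powr_minus)
  finally show ?thesis .
qed

text \<open>Inversion of \<open>1 / n\<close>: the inner sum \<open>harm_sum (y / n)\<close> is
  \<open>ln (y / n) + g\<close> up to an error summed by \<open>sum_inverse_powr_le\<close>, and the
  share of \<open>g\<close> is \<open>sum_moebius_over_n_bounded\<close>.\<close>

lemma sum_moebius_log_bounded:
  "\<exists>C\<ge>0. \<forall>y\<ge>1. \<bar>\<Sum>n\<in>nats_le y. moebius_mu n / n * ln (y / n)\<bar> \<le> C"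
proof -
  from harm_sum_asymp obtain g C where C: "C \<ge> 0"
    "\<And>x. x > 0 \<Longrightarrow> \<bar>harm_sum x - ln x - g\<bar> \<le> C * x powr (-(1/4))" by blast
  have "\<bar>\<Sum>n\<in>nats_le y. moebius_mu n / n * ln (y / n)\<bar> \<le> 1 + 2 * \<bar>g\<bar> + C * 4" if y: "y \<ge> 1" for y
  proof -
    define m where "m = (\<Sum>n\<in>nats_le y. moebius_mu n / n)"
    define M where "M = (\<Sum>n\<in>nats_le y. moebius_mu n / n * ln (y / n))"
    define E where "E = (\<Sum>n\<in>nats_le y. moebius_mu n / n * (harm_sum (y / n) - ln (y / n) - g))"
    have "1 = (\<Sum>n\<in>nats_le y. moebius_mu n / n * harm_sum (y / n))"
      using sum_moebius_hyperbola[where x = y and f = "\<lambda>n. 1 / real n"] y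
      by (simp add: harm_sum_def sum_distrib_left)
    also have "\<dots> = E + M + g * m"
      unfolding E_def M_def m_def sum_distrib_left sum.distrib[symmetric]
      by (intro sum.cong refl) (simp add: algebra_simps)
    finally have 1: "1 = E + M + g * m" .
    have "\<bar>E\<bar> \<le> (\<Sum>n\<in>nats_le y. (1 / n) * (C * (y / n) powr (-(1/4))))"
      unfolding E_def using C y
      by (intro order_trans[OF sum_abs] sum_mono, unfold abs_mult, intro mult_mono)
         (auto simp: nats_le_def divide_right_mono abs_moebius_mu_le)
    also have "\<dots> = C * (\<Sum>n\<in>nats_le y. (1 / n) * (y / n) powr (-(1/4)))"
      by (simp add: sum_distrib_left mult_ac)
    also have "\<dots> \<le> C * (1 / (1/4))" using C y by (intro mult_left_mono sum_inverse_powr_le) auto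
    finally have E: "\<bar>E\<bar> \<le> C * 4" by simp
    have "\<bar>g * m\<bar> \<le> \<bar>g\<bar> * 2" unfolding abs_mult m_def
      by (intro mult_left_mono sum_moebius_over_n_bounded y) auto
    then show ?thesis unfolding M_def[symmetric] using E 1 by linarith
  qed
  then show ?thesis using C by (intro exI[of _ "1 + 2 * \<bar>g\<bar> + C * 4"]) auto
qed

text \<open>Inversion of \<open>ln (y / n) / n\<close>, with total \<open>ln y\<close>. At
  \<open>z = y / d\<close> the inner sum is about \<open>(ln z)^2 / 2 + g * ln z - c\<close>, so
  half of the sum in question equals \<open>ln y\<close> up to the two sums already bounded.\<close>

lemma sum_moebius_log_squared:
  "\<exists>C\<ge>0. \<forall>y\<ge>1. \<bar>(\<Sum>n\<in>nats_le y. moebius_mu n / n * (ln (y / n))\<^sup>2) - 2 * ln y\<bar> \<le> C"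
proof -
  from harm_sum_asymp obtain g C where C: "C \<ge> 0"
    "\<And>x. x > 0 \<Longrightarrow> \<bar>harm_sum x - ln x - g\<bar> \<le> C * x powr (-(1/4))" by blast
  from log_harm_sum_asymp obtain c C' where C': "C' \<ge> 0"
    "\<And>x. x \<ge> 1 \<Longrightarrow> \<bar>log_harm_sum x - (ln x)\<^sup>2 / 2 - c\<bar> \<le> C' * x powr (-(1/4))" by blast
  from sum_moebius_log_bounded obtain B where B: "B \<ge> 0"
    "\<And>y. y \<ge> 1 \<Longrightarrow> \<bar>\<Sum>n\<in>nats_le y. moebius_mu n / n * ln (y / n)\<bar> \<le> B" by blast
  define K where "K = 8 * C + C'"
  have K: "K \<ge> 0" using C C' by (simp add: K_def)
  \<comment> \<open>The exponent drops from 1/4 to 1/8 to pay for the factor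
    \<open>ln z \<le> 8 * z powr (1/8)\<close>.\<close>
  have inner: "\<bar>ln z * harm_sum z - log_harm_sum z - ((ln z)\<^sup>2 / 2 + g * ln z - c)\<bar> \<le> K * z powr (-(1/8))"
    if z: "z \<ge> 1" for z
  proof -
    have "ln z * harm_sum z - log_harm_sum z - ((ln z)\<^sup>2 / 2 + g * ln z - c) =
      ln z * (harm_sum z - ln z - g) - (log_harm_sum z - (ln z)\<^sup>2 / 2 - c)"
      by (simp add: power2_eq_square algebra_simps)
    also have "\<bar>\<dots>\<bar> \<le> \<bar>ln z * (harm_sum z - ln z - g)\<bar> + \<bar>log_harm_sum z - (ln z)\<^sup>2 / 2 - c\<bar>"
      by linarith
    also have "\<bar>ln z * (harm_sum z - ln z - g)\<bar> \<le> (8 * z powr (1/8)) * (C * z powr (-(1/4)))"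
      unfolding abs_mult using z C ln_powr_bound[of z "1/8"] by (intro mult_mono) auto
    also have "\<dots> = 8 * C * z powr (-(1/8))"
      using z powr_add[of z "1/8" "-(1/4)"] by simp
    also have "\<bar>log_harm_sum z - (ln z)\<^sup>2 / 2 - c\<bar> \<le> C' * z powr (-(1/8))"
      using z C' by (intro order_trans[OF C'(2)] mult_left_mono powr_mono) auto
    finally show ?thesis by (simp add: K_def algebra_simps)
  qed
  have "\<bar>(\<Sum>n\<in>nats_le y. moebius_mu n / n * (ln (y / n))\<^sup>2) - 2 * ln y\<bar> \<le> 2 * (\<bar>g\<bar> * B + \<bar>c\<bar> * 2 + K * 8)"
    if y: "y \<ge> 1" for y
  proof -
    define m where "m = (\<Sum>n\<in>nats_le y. moebius_mu n / n)"
    define M1 where "M1 = (\<Sum>n\<in>nats_le y. moebius_mu n / n * ln (y / n))"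
    define M2 where "M2 = (\<Sum>n\<in>nats_le y. moebius_mu n / n * (ln (y / n))\<^sup>2)"
    define e where "e z = ln z * harm_sum z - log_harm_sum z - ((ln z)\<^sup>2 / 2 + g * ln z - c)" for z
    define E where "E = (\<Sum>n\<in>nats_le y. moebius_mu n / n * e (y / n))"
    have "ln y = (\<Sum>d\<in>nats_le y. \<Sum>m\<in>nats_le (y / real d). moebius_mu d * (ln (y / real (d * m)) / real (d * m)))"
      by (subst sum_moebius_hyperbola[where x = y and f = "\<lambda>n. ln (y / real n) / real n"]) (use y in auto)
    also have "\<dots> = (\<Sum>d\<in>nats_le y. moebius_mu d / d * (ln (y / d) * harm_sum (y / d) - log_harm_sum (y / d)))"
    proof (intro sum.cong refl)
      fix d assume "d \<in> nats_le y"
      then have d: "real d > 0" by (simp add: nats_le_def)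
      have "(\<Sum>m\<in>nats_le (y / real d). moebius_mu d * (ln (y / real (d * m)) / real (d * m))) =
        (\<Sum>m\<in>nats_le (y / real d). moebius_mu d / d * (ln (y / d) * (1 / real m) - ln (real m) / real m))"
      proof (intro sum.cong refl)
        fix m assume "m \<in> nats_le (y / real d)"
        then have "real m > 0" by (simp add: nats_le_def)
        then have "ln (y / real (d * m)) = ln (y / d) - ln m" using d y by (simp add: ln_div ln_mult)
        then show "moebius_mu d * (ln (y / real (d * m)) / real (d * m)) =
          moebius_mu d / d * (ln (y / d) * (1 / real m) - ln (real m) / real m)"
          by (simp add: diff_divide_distrib right_diff_distrib)
      qed
      then show "(\<Sum>m\<in>nats_le (y / real d). moebius_mu d * (ln (y / real (d * m)) / real (d * m))) =
        moebius_mu d / d * (ln (y / d) * harm_sum (y / d) - log_harm_sum (y / d))"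
        unfolding harm_sum_def log_harm_sum_def by (simp only: sum_distrib_left sum_subtractf[symmetric])
    qed
    also have "\<dots> = E + (1/2) * M2 + g * M1 - c * m"
      unfolding E_def M1_def M2_def m_def e_def sum_distrib_left sum.distrib[symmetric] sum_subtractf[symmetric]
      by (intro sum.cong refl) (simp add: algebra_simps)
    finally have 1: "ln y = E + (1/2) * M2 + g * M1 - c * m" .
    have "\<bar>E\<bar> \<le> (\<Sum>n\<in>nats_le y. (1 / n) * (K * (y / n) powr (-(1/8))))"
      unfolding E_def e_def using K y
      by (intro order_trans[OF sum_abs] sum_mono, unfold abs_mult, intro mult_mono inner)
         (auto simp: nats_le_def divide_right_mono abs_moebius_mu_le)
    also have "\<dots> = K * (\<Sum>n\<in>nats_le y. (1 / n) * (y / n) powr (-(1/8)))"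
      by (simp add: sum_distrib_left mult_ac)
    also have "\<dots> \<le> K * (1 / (1/8))" using K y by (intro mult_left_mono sum_inverse_powr_le) auto
    finally have E: "\<bar>E\<bar> \<le> K * 8" by simp
    have m: "\<bar>c * m\<bar> \<le> \<bar>c\<bar> * 2" unfolding abs_mult m_def
      by (intro mult_left_mono sum_moebius_over_n_bounded y) auto
    have M1: "\<bar>g * M1\<bar> \<le> \<bar>g\<bar> * B" unfolding abs_mult M1_def
      by (intro mult_left_mono B y) auto
    show ?thesis unfolding M2_def[symmetric] using E m M1 1 by (simp add: abs_le_iff)
  qed
  then show ?thesis using B K by (intro exI[of _ "2 * (\<bar>g\<bar> * B + \<bar>c\<bar> * 2 + K * 8)"]) auto
qed

section \<open>The quadruple sum with the plain weight\<close>

lemma harm_sum_le: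
  assumes "x \<ge> 1" shows "harm_sum x \<le> 1 + ln x"
proof -
  have "(\<Sum>k=1..Suc n. 1 / real k) \<le> 1 + ln (Suc n)" for n
  proof (induction n)
    case (Suc n)
    then show ?case using ln_Suc_diff_bounds(1)[of "Suc n"] by (simp add: add_ac)
  qed auto
  moreover obtain n where "nat \<lfloor>x\<rfloor> = Suc n"
    using ln_floor_diff(1)[OF assms] by (cases "nat \<lfloor>x\<rfloor>") auto
  ultimately have "harm_sum x \<le> 1 + ln (nat \<lfloor>x\<rfloor>)"
    unfolding harm_sum_eq by metis
  also have "ln (nat \<lfloor>x\<rfloor>) \<le> ln x"
    using ln_floor_diff(1,2)[OF assms] by simp
  finally show ?thesis by simp
qed

lemma harm_sum_nonneg: "harm_sum x \<ge> 0"
  by (auto simp: harm_sum_def intro: sum_nonneg)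

text \<open>Only \<open>t < a \<le> A\<close> contributes, so the sum is a difference between the
  end points \<open>A\<close> and \<open>t\<close>. The constants of both harmonic asymptotics
  cancel, and the remaining error is governed by the smaller end point \<open>t\<close>.\<close>

lemma sum_log_plus_asymp:
  "\<exists>K\<ge>0. \<forall>A>0. \<forall>t\<ge>1.
     \<bar>(\<Sum>a\<in>nats_le A. 1 / real a * max 0 (ln (a / t))) - (max 0 (ln (A / t)))\<^sup>2 / 2\<bar> \<le> K * t powr (-(1/8))"
proof -
  from harm_sum_asymp obtain g C where C: "C \<ge> 0"
    "\<And>x. x > 0 \<Longrightarrow> \<bar>harm_sum x - ln x - g\<bar> \<le> C * x powr (-(1/4))" by blast
  from log_harm_sum_asymp obtain c C' where C': "C' \<ge> 0"
    "\<And>x. x \<ge> 1 \<Longrightarrow> \<bar>log_harm_sum x - (ln x)\<^sup>2 / 2 - c\<bar> \<le> C' * x powr (-(1/4))" by blast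
  define K where "K = 2 * C' + 16 * C"
  have K: "K \<ge> 0" using C C' by (simp add: K_def)
  have "\<bar>(\<Sum>a\<in>nats_le A. 1 / real a * max 0 (ln (a / t))) - (max 0 (ln (A / t)))\<^sup>2 / 2\<bar> \<le> K * t powr (-(1/8))"
    if A: "A > 0" and t: "t \<ge> 1" for A t
  proof (cases "A < t")
    case True
    have "(\<Sum>a\<in>nats_le A. 1 / real a * max 0 (ln (a / t))) = 0"
      using True t by (intro sum.neutral) (auto simp: nats_le_def max_def)
    moreover have "max 0 (ln (A / t)) = 0" using True t A by (auto simp: max_def)
    ultimately show ?thesis using K by simp
  next
    case False
    then have At: "t \<le> A" "A \<ge> 1" using t by auto
    have "(\<Sum>a\<in>nats_le A. 1 / real a * max 0 (ln (a / t))) =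
        (\<Sum>a\<in>nats_le A - nats_le t. 1 / real a * max 0 (ln (a / t))) + (\<Sum>a\<in>nats_le t. 1 / real a * max 0 (ln (a / t)))"
      using nats_le_mono[OF At(1)] by (intro sum.subset_diff) auto
    also have "(\<Sum>a\<in>nats_le t. 1 / real a * max 0 (ln (a / t))) = 0"
      using t by (intro sum.neutral) (auto simp: nats_le_def max_def)
    also have "(\<Sum>a\<in>nats_le A - nats_le t. 1 / real a * max 0 (ln (a / t))) =
       (\<Sum>a\<in>nats_le A - nats_le t. ln (real a) / real a - ln t * (1 / real a))"
      using t by (intro sum.cong refl) (auto simp: nats_le_def max_def ln_div diff_divide_distrib)
    also have "\<dots> = (log_harm_sum A - ln t * harm_sum A) - (log_harm_sum t - ln t * harm_sum t)"
      unfolding log_harm_sum_def harm_sum_def sum_distrib_left sum_subtractf[symmetric]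
      using nats_le_mono[OF At(1)] by (intro sum_diff) auto
    finally have 1: "(\<Sum>a\<in>nats_le A. 1 / real a * max 0 (ln (a / t))) =
      log_harm_sum A - log_harm_sum t - ln t * (harm_sum A - harm_sum t)" by (simp add: algebra_simps)
    have 2: "(max 0 (ln (A / t)))\<^sup>2 / 2 = (ln A - ln t)\<^sup>2 / 2"
      using At t by (simp add: max_def ln_div)
    have "log_harm_sum A - log_harm_sum t - ln t * (harm_sum A - harm_sum t) - (ln A - ln t)\<^sup>2 / 2 =
      (log_harm_sum A - (ln A)\<^sup>2 / 2 - c) - (log_harm_sum t - (ln t)\<^sup>2 / 2 - c)
      - (ln t * (harm_sum A - ln A - g) - ln t * (harm_sum t - ln t - g))"
      by (simp add: power2_eq_square field_simps)
    also have "\<bar>\<dots>\<bar> \<le> \<bar>log_harm_sum A - (ln A)\<^sup>2 / 2 - c\<bar> + \<bar>log_harm_sum t - (ln t)\<^sup>2 / 2 - c\<bar>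
      + \<bar>ln t * (harm_sum A - ln A - g)\<bar> + \<bar>ln t * (harm_sum t - ln t - g)\<bar>" by linarith
    finally have 3: "\<bar>log_harm_sum A - log_harm_sum t - ln t * (harm_sum A - harm_sum t) - (ln A - ln t)\<^sup>2 / 2\<bar> \<le> \<dots>" .
    have *: "x powr (-(1/4)) \<le> t powr (-(1/4))" "t powr (-(1/4)) \<le> t powr (-(1/8))" if "x \<ge> t" for x
      using that t by (auto intro!: powr_neg_antimono powr_mono)
    have 4: "\<bar>log_harm_sum x - (ln x)\<^sup>2 / 2 - c\<bar> \<le> C' * t powr (-(1/8))" if "x \<ge> t" for x
      using that t C' *[OF that] by (intro order_trans[OF C'(2)] mult_left_mono) auto
    have 5: "\<bar>ln t * (harm_sum x - ln x - g)\<bar> \<le> 8 * C * t powr (-(1/8))" if "x \<ge> t" for x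
    proof -
      have "\<bar>harm_sum x - ln x - g\<bar> \<le> C * t powr (-(1/4))"
        using that t C *[OF that] by (intro order_trans[OF C(2)] mult_left_mono) auto
      then have "\<bar>ln t * (harm_sum x - ln x - g)\<bar> \<le> (8 * t powr (1/8)) * (C * t powr (-(1/4)))"
        unfolding abs_mult using t C ln_powr_bound[of t "1/8"] by (intro mult_mono) auto
      also have "\<dots> = 8 * C * t powr (-(1/8))"
        using t powr_add[of t "1/8" "-(1/4)"] by simp
      finally show ?thesis .
    qed
    show ?thesis unfolding 1 2
      using 3 4[OF At(1)] 4[of t] 5[OF At(1)] 5[of t] by (simp add: K_def algebra_simps)
  qed
  then show ?thesis using K by blast
qed

text \<open>The three bounds are independent although only \<open>X = Y = Z = R\<close> is wanted in
  the end: pulling a prime out of \<open>a\<close>, \<open>b\<close> or \<open>c\<close> divides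
  just two of them.\<close>

definition quad_dom :: "real \<Rightarrow> real \<Rightarrow> real \<Rightarrow> (nat \<times> nat \<times> nat \<times> nat) set" where
  "quad_dom X Y Z = {(a, b, c, u). 1 \<le> a \<and> 1 \<le> b \<and> 1 \<le> c \<and> 1 \<le> u \<and>
     real (u * a * b) \<le> X \<and> real (u * a * c) \<le> Y \<and> real (u * b * c) \<le> Z}"

definition quad_sum :: "(nat \<times> nat \<times> nat \<times> nat \<Rightarrow> real) \<Rightarrow> real \<Rightarrow> real \<Rightarrow> real \<Rightarrow> real" where
  "quad_sum w X Y Z = (\<Sum>t\<in>quad_dom X Y Z. w t)"

definition quad_weight :: "nat \<times> nat \<times> nat \<times> nat \<Rightarrow> real" where
  "quad_weight = (\<lambda>(a, b, c, u). moebius_mu u / (real a * real b * real c * real u))"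

lemma quad_dom_le:
  assumes "(a, b, c, u) \<in> quad_dom X Y Z"
  shows "a \<in> nats_le X" "b \<in> nats_le X" "c \<in> nats_le Y" "u \<in> nats_le X"
  using assms
proof -
  have *: "real k \<le> x" if "real m \<le> x" "k dvd m" "1 \<le> m" for k m :: nat and x
    using that dvd_imp_le[of k m] by (smt (verit) of_nat_mono not_one_le_zero neq0_conv)
  show "a \<in> nats_le X" "b \<in> nats_le X" "c \<in> nats_le Y" "u \<in> nats_le X"
    using assms *[of "u*a*b" X a] *[of "u*a*b" X b] *[of "u*a*b" X u] *[of "u*a*c" Y c]
    by (auto simp: quad_dom_def nats_le_def)
qed

lemma finite_quad_dom [simp, intro]: "finite (quad_dom X Y Z)"
proof (rule finite_subset)
  show "quad_dom X Y Z \<subseteq> nats_le X \<times> nats_le X \<times> nats_le Y \<times> nats_le X"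
    by (auto dest: quad_dom_le)
qed auto

lemma quad_dom_empty: "X < 1 \<or> Y < 1 \<or> Z < 1 \<Longrightarrow> quad_dom X Y Z = {}"
proof (rule ccontr)
  assume *: "X < 1 \<or> Y < 1 \<or> Z < 1" "quad_dom X Y Z \<noteq> {}"
  then obtain a b c u where "(a, b, c, u) \<in> quad_dom X Y Z" by auto
  then have "real (u * a * b) \<ge> 1" "real (u * a * c) \<ge> 1" "real (u * b * c) \<ge> 1"
    "real (u * a * b) \<le> X" "real (u * a * c) \<le> Y" "real (u * b * c) \<le> Z"
    unfolding quad_dom_def by (auto simp del: of_nat_mult simp: Suc_le_eq)
  with * show False by linarith
qed

lemma quad_sum_commute: "quad_sum quad_weight X Y Z = quad_sum quad_weight X Z Y"
  unfolding quad_sum_def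
  by (rule sum.reindex_bij_witness[where i = "\<lambda>(a, b, c, u). (b, a, c, u)" and j = "\<lambda>(a, b, c, u). (b, a, c, u)"])
     (auto simp: quad_dom_def quad_weight_def mult_ac)

text \<open>\<open>c\<close> is summed first, since it alone is subject to both remaining
  constraints; it leaves a harmonic sum up to their minimum. The other variables fill the region
  \<open>u * b * a \<le> X\<close>, where Moebius inversion applies.\<close>

lemma quad_sum_iterated:
  "quad_sum quad_weight X Y Z =
    (\<Sum>u\<in>nats_le X. \<Sum>b\<in>nats_le (X / real u). \<Sum>a\<in>nats_le (X / real u / real b).
       moebius_mu u / (real u * real b * real a) * harm_sum (min (Y / (real u * real a)) (Z / (real u * real b))))"
proof -
  define m where "m u b a = min (Y / (real u * real a)) (Z / (real u * real b))" for u b a :: nat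
  have m: "c \<in> nats_le (m u b a) \<longleftrightarrow> 1 \<le> c \<and> real (u * a * c) \<le> Y \<and> real (u * b * c) \<le> Z"
    if "1 \<le> u" "1 \<le> b" "1 \<le> a" for u b a c
    using that by (auto simp: nats_le_def m_def field_simps)
  have "quad_sum quad_weight X Y Z = (\<Sum>(u, b, a, c)\<in>(SIGMA u:nats_le X. SIGMA b:nats_le (X / real u).
      SIGMA a:nats_le (X / real u / real b). nats_le (m u b a)).
        moebius_mu u / (real u * real b * real a) * (1 / real c))"
    unfolding quad_sum_def
  proof (rule sum.reindex_bij_witness[where i = "\<lambda>(u, b, a, c). (a, b, c, u)" and j = "\<lambda>(a, b, c, u). (u, b, a, c)"], goal_cases)
    case (2 t)
    obtain a b c u where t: "t = (a, b, c, u)" by (cases t) auto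
    have 1: "1 \<le> a" "1 \<le> b" "1 \<le> c" "1 \<le> u" "real u * real b * real a \<le> X" "real (u * a * c) \<le> Y" "real (u * b * c) \<le> Z"
      using 2 by (auto simp: t quad_dom_def mult_ac)
    have "u \<in> nats_le X" using 2 quad_dom_le(4)[of a b c u X Y Z] t by simp
    moreover have "real u * real b \<le> X"
      using mult_le_imp_left_le[of "u * b" a X] 1 by simp
    then have "b \<in> nats_le (X / real u)" using 1 by (simp add: nats_le_def field_simps)
    moreover have "a \<in> nats_le (X / real u / real b)" using 1 by (simp add: nats_le_def field_simps)
    moreover have "c \<in> nats_le (m u b a)" using 1 by (subst m) auto
    ultimately show ?case by (simp add: t)
  next
    case (4 s)
    obtain a b c u where s: "s = (u, b, a, c)" by (cases s) auto
    have 1: "1 \<le> a" "1 \<le> b" "1 \<le> u" "c \<in> nats_le (m u b a)" "a \<in> nats_le (X / real u / real b)"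
      using 4 by (auto simp: s nats_le_def)
    then have "real u * real b * real a \<le> X" by (auto simp: nats_le_def field_simps)
    with 1(1-3) show ?case using 1(4) m[OF 1(3,2,1), of c]
      by (auto simp: s quad_dom_def mult_ac)
  qed (auto simp: quad_weight_def mult_ac)
  also have "\<dots> = (\<Sum>u\<in>nats_le X. \<Sum>b\<in>nats_le (X / real u). \<Sum>a\<in>nats_le (X / real u / real b).
       \<Sum>c\<in>nats_le (m u b a). moebius_mu u / (real u * real b * real a) * (1 / real c))"
    by (simp add: sum.Sigma split_def)
  finally show ?thesis by (simp add: m_def harm_sum_def sum_distrib_left)
qed

text \<open>The sum over \<open>a\<close> is dominated by its end and gives
  \<open>4 * (X / Y) powr (1/4) * real b powr (-(1/4))\<close>. The additional power of
  \<open>b\<close> makes the sum over \<open>b\<close> converge to at most 5, and only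
  \<open>u\<close> costs a harmonic sum.\<close>

lemma triple_sum_weight_le:
  assumes X: "X \<ge> 1" and Y: "Y > 0"
  shows "(\<Sum>u\<in>nats_le X. \<Sum>b\<in>nats_le (X / real u). \<Sum>a\<in>nats_le (X / real u / real b).
            1 / (real u * real b * real a) * (Y / (real u * real a)) powr (-(1/4))) \<le> 20 * harm_sum X * (X / Y) powr (1/4)"
proof -
  have "(\<Sum>a\<in>nats_le (X / real u / real b). 1 / (real u * real b * real a) * (Y / (real u * real a)) powr (-(1/4)))
      \<le> 4 * (X / Y) powr (1/4) * (1 / real u) * real b powr (-1 - 1/4)"
    if "u \<in> nats_le X" "b \<in> nats_le (X / real u)" for u b
  proof -
    have ub: "real u > 0" "real b > 0" using that by (auto simp: nats_le_def)
    have "(\<Sum>a\<in>nats_le (X / real u / real b). 1 / (real u * real b * real a) * (Y / (real u * real a)) powr (-(1/4))) =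
      (\<Sum>a\<in>nats_le (X / real u / real b). 1 / (real u * real b) * (real u / Y) powr (1/4) * real a powr (1/4 - 1))"
    proof (intro sum.cong refl)
      fix a assume "a \<in> nats_le (X / real u / real b)"
      then have a: "real a > 0" by (simp add: nats_le_def)
      have "(Y / (real u * real a)) powr (-(1/4)) = (real u / Y) powr (1/4) * real a powr (1/4)"
        using ub a Y by (simp add: powr_divide powr_mult powr_minus field_simps)
      moreover have "real a powr (1/4 - 1) = real a powr (1/4) / real a" using a by (subst powr_diff) simp
      ultimately show "1 / (real u * real b * real a) * (Y / (real u * real a)) powr (-(1/4)) =
         1 / (real u * real b) * (real u / Y) powr (1/4) * real a powr (1/4 - 1)" by simp
    qed
    also have "\<dots> = 1 / (real u * real b) * (real u / Y) powr (1/4) * (\<Sum>a\<in>nats_le (X / real u / real b). real a powr (1/4 - 1))"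
      by (simp add: sum_distrib_left)
    also have "\<dots> \<le> 1 / (real u * real b) * (real u / Y) powr (1/4) * ((X / real u / real b) powr (1/4) / (1/4))"
      using ub X by (intro mult_left_mono sum_nats_le_powr_le) auto
    also have "(X / real u / real b) powr (1/4) = X powr (1/4) / real u powr (1/4) * real b powr (-(1/4))"
      using ub X by (simp add: powr_divide powr_minus powr_mult divide_simps)
    also have "(real u / Y) powr (1/4) = real u powr (1/4) / Y powr (1/4)" using ub Y by (simp add: powr_divide)
    also have "1 / (real u * real b) * (real u powr (1/4) / Y powr (1/4)) *
         (X powr (1/4) / real u powr (1/4) * real b powr (-(1/4)) / (1/4)) =
       4 * (X powr (1/4) / Y powr (1/4)) * (1 / real u) * (real b powr (-(1/4)) / real b)"
      using ub by (simp add: mult_ac)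
    also have "real b powr (-(1/4)) / real b = real b powr (-1 - 1/4)"
      using ub powr_diff[of "real b" "-(1/4)" 1] by simp
    also have "X powr (1/4) / Y powr (1/4) = (X / Y) powr (1/4)" using X Y by (simp add: powr_divide)
    finally show ?thesis .
  qed
  then have "(\<Sum>u\<in>nats_le X. \<Sum>b\<in>nats_le (X / real u). \<Sum>a\<in>nats_le (X / real u / real b).
            1 / (real u * real b * real a) * (Y / (real u * real a)) powr (-(1/4)))
     \<le> (\<Sum>u\<in>nats_le X. \<Sum>b\<in>nats_le (X / real u). 4 * (X / Y) powr (1/4) * (1 / real u) * real b powr (-1 - 1/4))"
    by (intro sum_mono) auto
  also have "\<dots> = (\<Sum>u\<in>nats_le X. 4 * (X / Y) powr (1/4) * (1 / real u) * (\<Sum>b\<in>nats_le (X / real u). real b powr (-1 - 1/4)))"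
    by (simp add: sum_distrib_left)
  also have "\<dots> \<le> (\<Sum>u\<in>nats_le X. 4 * (X / Y) powr (1/4) * (1 / real u) * (1 + 1 / (1/4)))"
    using X by (intro sum_mono mult_left_mono sum_nats_le_powr_bounded) auto
  also have "\<dots> = 20 * harm_sum X * (X / Y) powr (1/4)"
    by (simp add: harm_sum_def sum_distrib_left sum_distrib_right mult_ac)
  finally show ?thesis .
qed

text \<open>Source of the 1/4: with \<open>B = sqrt (X / r)\<close> the sum is
  \<open>2 * (ln B * harm_sum B - log_harm_sum B)\<close>, about \<open>(ln B)^2\<close>, and
  \<open>ln B\<close> is half of \<open>ln (X / r)\<close>.\<close>

lemma log_plus_square_sum:
  "\<exists>C\<ge>0. \<forall>X\<ge>1. \<forall>r\<ge>1. \<bar>(\<Sum>b\<in>nats_le X. 1 / real b * max 0 (ln (X / (real b ^ 2 * r))))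
      - (max 0 (ln (X / r)))\<^sup>2 / 4\<bar> \<le> C * (1 + ln X)"
proof -
  from harm_sum_asymp obtain g C where C: "C \<ge> 0"
    "\<And>x. x > 0 \<Longrightarrow> \<bar>harm_sum x - ln x - g\<bar> \<le> C * x powr (-(1/4))" by blast
  from log_harm_sum_asymp obtain c C' where C': "C' \<ge> 0"
    "\<And>x. x \<ge> 1 \<Longrightarrow> \<bar>log_harm_sum x - (ln x)\<^sup>2 / 2 - c\<bar> \<le> C' * x powr (-(1/4))" by blast
  define K where "K = 2 * (\<bar>g\<bar> + C + \<bar>c\<bar> + C')"
  have K: "K \<ge> 0" using C C' by (simp add: K_def)
  have "\<bar>(\<Sum>b\<in>nats_le X. 1 / real b * max 0 (ln (X / (real b ^ 2 * r)))) - (max 0 (ln (X / r)))\<^sup>2 / 4\<bar>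
     \<le> K * (1 + ln X)" if X: "X \<ge> 1" and r: "r \<ge> 1" for X r
  proof (cases "X / r < 1")
    case True
    have "X / (real b ^ 2 * r) \<le> 1" if "b \<in> nats_le X" for b
    proof -
      have "1 * X \<le> real b ^ 2 * r" using that True X r by (intro mult_mono) (auto simp: nats_le_def)
      moreover have "real b ^ 2 * r > 0" using that r by (auto simp: nats_le_def)
      ultimately show ?thesis by simp
    qed
    then have "(\<Sum>b\<in>nats_le X. 1 / real b * max 0 (ln (X / (real b ^ 2 * r)))) = 0"
    proof (intro sum.neutral ballI)
      fix b assume b: "b \<in> nats_le X"
      have "ln (X / (real b ^ 2 * r)) \<le> 0"
        using \<open>\<And>b. b \<in> nats_le X \<Longrightarrow> X / (real b ^ 2 * r) \<le> 1\<close>[OF b] b X r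
        by (intro ln_le_zero_iff[THEN iffD2]) (auto simp: nats_le_def)
      then show "1 / real b * max 0 (ln (X / (real b ^ 2 * r))) = 0" by simp
    qed
    moreover have "max 0 (ln (X / r)) = 0" using True X r by (simp add: max_def)
    ultimately show ?thesis using K X by simp
  next
    case False
    define B where "B = sqrt (X / r)"
    have B: "B \<ge> 1" "B^2 = X / r" using False X r by (auto simp: B_def)
    have "B \<le> B * B" using B(1) by simp
    also have "\<dots> = X / r" using B(2) by (simp add: power2_eq_square)
    also have "\<dots> \<le> X" using X r by (simp add: divide_le_eq)
    finally have BX: "B \<le> X" .
    have lnB: "ln (X / r) = 2 * ln B" using B ln_realpow[of B 2] by simp
    have log_eq: "ln (X / (real b ^ 2 * r)) = 2 * (ln B - ln b)" if "b \<ge> 1" for b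
    proof -
      have "X / (real b ^ 2 * r) = (B / b)^2" using B(2) by (simp add: power_divide)
      then show ?thesis using that B ln_realpow[of "B / b" 2] by (simp add: ln_div)
    qed
    have "(\<Sum>b\<in>nats_le X. 1 / real b * max 0 (ln (X / (real b ^ 2 * r)))) =
          (\<Sum>b\<in>nats_le B. 1 / real b * max 0 (ln (X / (real b ^ 2 * r))))"
    proof (rule sum.mono_neutral_right)
      show "\<forall>b\<in>nats_le X - nats_le B. 1 / real b * max 0 (ln (X / (real b ^ 2 * r))) = 0"
        using B by (auto simp: nats_le_def max_def log_eq)
    qed (use BX nats_le_mono in auto)
    also have "\<dots> = (\<Sum>b\<in>nats_le B. 2 * (ln B * (1 / real b) - ln (real b) / real b))"
      using B by (intro sum.cong refl) (auto simp: nats_le_def max_def log_eq diff_divide_distrib right_diff_distrib)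
    also have "\<dots> = 2 * (ln B * harm_sum B - log_harm_sum B)"
      by (simp only: harm_sum_def log_harm_sum_def sum_distrib_left sum_subtractf[symmetric])
    finally have 1: "(\<Sum>b\<in>nats_le X. 1 / real b * max 0 (ln (X / (real b ^ 2 * r)))) = 2 * (ln B * harm_sum B - log_harm_sum B)" .
    have 2: "(max 0 (ln (X / r)))\<^sup>2 / 4 = (ln B)\<^sup>2" using lnB B by (simp add: max_def power_mult_distrib)
    have L: "0 \<le> ln B" "ln B \<le> ln X" using B BX by auto
    have p: "B powr (-(1/4)) \<le> 1" using B powr_neg_antimono[of 1 B "1/4"] by simp
    have "\<bar>harm_sum B - ln B - g\<bar> \<le> C * 1"
      using B by (intro order_trans[OF C(2)] mult_left_mono p C) auto
    then have h: "\<bar>ln B * (harm_sum B - ln B - g)\<bar> \<le> ln X * C" unfolding abs_mult using L C by (intro mult_mono) auto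
    have j: "\<bar>log_harm_sum B - (ln B)\<^sup>2 / 2 - c\<bar> \<le> C' * 1"
      using B by (intro order_trans[OF C'(2)] mult_left_mono p C') auto
    have gl: "\<bar>g * ln B\<bar> \<le> \<bar>g\<bar> * ln X" unfolding abs_mult using L by (intro mult_left_mono) auto
    have "2 * (ln B * harm_sum B - log_harm_sum B) - (ln B)\<^sup>2 =
       2 * (ln B * (harm_sum B - ln B - g) + g * ln B - (log_harm_sum B - (ln B)\<^sup>2 / 2 - c) - c)"
      by (simp add: power2_eq_square algebra_simps)
    moreover have "\<bar>2 * (p + q - s - c)\<bar> \<le> 2 * (P + Q + S + \<bar>c\<bar>)"
      if "\<bar>p\<bar> \<le> P" "\<bar>q\<bar> \<le> Q" "\<bar>s\<bar> \<le> S * 1" for p q s P Q S :: real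
      using that by (smt (verit))
    from this[OF h gl j] have "\<bar>2 * (ln B * (harm_sum B - ln B - g) + g * ln B - (log_harm_sum B - (ln B)\<^sup>2 / 2 - c) - c)\<bar>
      \<le> 2 * (ln X * C + \<bar>g\<bar> * ln X + C' + \<bar>c\<bar>)" .
    ultimately have "\<bar>2 * (ln B * harm_sum B - log_harm_sum B) - (ln B)\<^sup>2\<bar> \<le> 2 * (ln X * C + \<bar>g\<bar> * ln X + C' + \<bar>c\<bar>)"
      by simp
    also have "\<dots> \<le> K * (1 + ln X)" using L C C' by (simp add: K_def algebra_simps)
    finally show ?thesis unfolding 1 2 .
  qed
  then show ?thesis using K by blast
qed

text \<open>The sum over \<open>a\<close> gives half the square of
  \<open>ln (X / (u * b^2 * r))\<close>. The Moebius sum over \<open>u\<close> lowers this square to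
  \<open>ln (X / (b^2 * r))\<close>, and \<open>log_plus_square_sum\<close> finishes with
  \<open>b\<close>. All logarithms are cut off at 0.\<close>

lemma triple_log_plus_sum:
  "\<exists>C\<ge>0. \<forall>X\<ge>1. \<forall>r\<ge>1.
    \<bar>(\<Sum>u\<in>nats_le X. \<Sum>b\<in>nats_le (X / real u). \<Sum>a\<in>nats_le (X / real u / real b).
       moebius_mu u / (real u * real b * real a) * max 0 (ln (real a / (real b * r))))
     - (max 0 (ln (X / r)))\<^sup>2 / 4\<bar> \<le> C * (1 + ln X)"
proof -
  from sum_log_plus_asymp obtain K where K: "K \<ge> 0" "\<And>A t. A > 0 \<Longrightarrow> t \<ge> 1 \<Longrightarrow>
     \<bar>(\<Sum>a\<in>nats_le A. 1 / real a * max 0 (ln (a / t))) - (max 0 (ln (A / t)))\<^sup>2 / 2\<bar> \<le> K * t powr (-(1/8))" by blast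
  from sum_moebius_log_squared obtain M where M: "M \<ge> 0" "\<And>y. y \<ge> 1 \<Longrightarrow>
     \<bar>(\<Sum>n\<in>nats_le y. moebius_mu n / n * (ln (y / n))\<^sup>2) - 2 * ln y\<bar> \<le> M" by blast
  from log_plus_square_sum obtain D where D: "D \<ge> 0" "\<And>X r. X \<ge> 1 \<Longrightarrow> r \<ge> 1 \<Longrightarrow>
     \<bar>(\<Sum>b\<in>nats_le X. 1 / real b * max 0 (ln (X / (real b ^ 2 * r)))) - (max 0 (ln (X / r)))\<^sup>2 / 4\<bar> \<le> D * (1 + ln X)" by blast
  have "\<bar>(\<Sum>u\<in>nats_le X. \<Sum>b\<in>nats_le (X / real u). \<Sum>a\<in>nats_le (X / real u / real b).
       moebius_mu u / (real u * real b * real a) * max 0 (ln (real a / (real b * r))))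
     - (max 0 (ln (X / r)))\<^sup>2 / 4\<bar> \<le> (K * 9 + M + D) * (1 + ln X)" if X: "X \<ge> 1" and r: "r \<ge> 1" for X r
  proof -
    define s where "s u b = (\<Sum>a\<in>nats_le (X / real u / real b). 1 / real a * max 0 (ln (real a / (real b * r))))" for u b
    define v where "v u b = (max 0 (ln (X / real u / real b / (real b * r))))\<^sup>2 / 2" for u b :: nat
    have inner: "\<bar>s u b - v u b\<bar> \<le> K * real b powr (-(1/8))"
      if "u \<in> nats_le X" "b \<in> nats_le (X / real u)" for u b
    proof -
      have ub: "real u > 0" "real b \<ge> 1" using that by (auto simp: nats_le_def)
      have br: "real b * 1 \<le> real b * r" using ub r by (intro mult_left_mono) auto
      have "\<bar>s u b - v u b\<bar> \<le> K * (real b * r) powr (-(1/8))"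
        unfolding s_def v_def
      proof (intro K)
        show "1 \<le> real b * r" using ub br by linarith
      qed (use ub X in auto)
      also have "\<dots> \<le> K * real b powr (-(1/8))"
        using ub br K by (intro mult_left_mono powr_neg_antimono) auto
      finally show ?thesis .
    qed
    define E where "E = (\<Sum>u\<in>nats_le X. \<Sum>b\<in>nats_le (X / real u). moebius_mu u / (real u * real b) * (s u b - v u b))"
    define V where "V = (\<Sum>u\<in>nats_le X. \<Sum>b\<in>nats_le (X / real u). moebius_mu u / (real u * real b) * v u b)"
    have "(\<Sum>u\<in>nats_le X. \<Sum>b\<in>nats_le (X / real u). \<Sum>a\<in>nats_le (X / real u / real b).
       moebius_mu u / (real u * real b * real a) * max 0 (ln (real a / (real b * r)))) = E + V"
      unfolding E_def V_def sum.distrib[symmetric]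
      by (intro sum.cong refl) (simp add: s_def sum_distrib_left right_diff_distrib)
    moreover have "\<bar>E\<bar> \<le> K * 9 * (1 + ln X)"
    proof -
      have "\<bar>E\<bar> \<le> (\<Sum>u\<in>nats_le X. \<Sum>b\<in>nats_le (X / real u). \<bar>moebius_mu u / (real u * real b) * (s u b - v u b)\<bar>)"
        unfolding E_def by (intro order_trans[OF sum_abs] sum_mono sum_abs)
      also have "\<dots> \<le> (\<Sum>u\<in>nats_le X. \<Sum>b\<in>nats_le (X / real u). 1 / real u * (K * real b powr (-1 - 1/8)))"
      proof (intro sum_mono)
        fix u b assume ub: "u \<in> nats_le X" "b \<in> nats_le (X / real u)"
        then have pos: "real u > 0" "real b > 0" by (auto simp: nats_le_def)
        have "\<bar>moebius_mu u / (real u * real b) * (s u b - v u b)\<bar> \<le> 1 / (real u * real b) * (K * real b powr (-(1/8)))"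
          unfolding abs_mult using ub pos inner[OF ub] abs_moebius_mu_le[of u] K(1)
          by (intro mult_mono) (auto simp: divide_right_mono)
        also have "\<dots> = 1 / real u * (K * (real b powr (-(1/8)) / real b))" by simp
        also have "real b powr (-(1/8)) / real b = real b powr (-1 - 1/8)"
          using pos powr_diff[of "real b" "-(1/8)" 1] by simp
        finally show "\<bar>moebius_mu u / (real u * real b) * (s u b - v u b)\<bar> \<le> 1 / real u * (K * real b powr (-1 - 1/8))" .
      qed
      also have "\<dots> = (\<Sum>u\<in>nats_le X. 1 / real u * (K * (\<Sum>b\<in>nats_le (X / real u). real b powr (-1 - 1/8))))"
        by (simp add: sum_distrib_left)
      also have "\<dots> \<le> (\<Sum>u\<in>nats_le X. 1 / real u * (K * (1 + 1 / (1/8))))"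
        using K by (intro sum_mono mult_left_mono sum_nats_le_powr_bounded) auto
      also have "\<dots> = K * 9 * harm_sum X"
        by (simp add: harm_sum_def sum_distrib_left mult_ac)
      also have "\<dots> \<le> K * 9 * (1 + ln X)" using K X by (intro mult_left_mono harm_sum_le) auto
      finally show ?thesis .
    qed
    moreover have "\<bar>V - (max 0 (ln (X / r)))\<^sup>2 / 4\<bar> \<le> (M + D) * (1 + ln X)"
    proof -
      define y where "y b = X / (real b ^ 2 * r)" for b :: nat
      \<comment> \<open>\<open>u\<close> becomes the inner variable, so that its range can be
        shortened to \<open>y b\<close>, beyond which the positive part vanishes; then
        \<open>sum_moebius_log_squared\<close> applies.\<close>
      have "V = (\<Sum>b\<in>nats_le X. \<Sum>u\<in>nats_le (X / real b). moebius_mu u / (real u * real b) * v u b)"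
        unfolding V_def by (rule sum_hyperbola_commute)
      also have "\<dots> = (\<Sum>b\<in>nats_le X. 1 / real b * ((\<Sum>u\<in>nats_le (y b). moebius_mu u / u * (ln (y b / u))\<^sup>2) / 2))"
      proof (intro sum.cong refl)
        fix b assume b: "b \<in> nats_le X"
        then have b1: "real b \<ge> 1" by (auto simp: nats_le_def)
        have br: "real b * 1 \<le> real b * (real b * r)" using b1 r mult_mono[of 1 "real b" 1 r] by (intro mult_left_mono) auto
        have yX: "y b \<le> X / real b"
          unfolding y_def using X b1 br by (intro frac_le) (auto simp: power2_eq_square mult_ac)
        have arg: "X / real u / real b / (real b * r) = y b / u" for u :: nat
          by (simp add: y_def power2_eq_square mult_ac)
        have ypos: "y b > 0" using X b1 r by (simp add: y_def)
        have v: "v u b = (max 0 (ln (y b / real u)))\<^sup>2 / 2" for u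
          by (simp only: v_def arg)
        have "(\<Sum>u\<in>nats_le (X / real b). moebius_mu u / (real u * real b) * v u b) =
              (\<Sum>u\<in>nats_le (y b). moebius_mu u / (real u * real b) * v u b)"
        proof (rule sum.mono_neutral_right)
          show "\<forall>u\<in>nats_le (X / real b) - nats_le (y b). moebius_mu u / (real u * real b) * v u b = 0"
            using ypos by (auto simp: nats_le_def v max_def)
        qed (use yX nats_le_mono in auto)
        also have "\<dots> = (\<Sum>u\<in>nats_le (y b). 1 / real b * (moebius_mu u / u * (ln (y b / u))\<^sup>2 / 2))"
          using ypos by (intro sum.cong refl) (auto simp: nats_le_def v max_def mult_ac)
        finally show "(\<Sum>u\<in>nats_le (X / real b). moebius_mu u / (real u * real b) * v u b) =
            1 / real b * ((\<Sum>u\<in>nats_le (y b). moebius_mu u / u * (ln (y b / u))\<^sup>2) / 2)"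
          by (simp only: sum_distrib_left sum_divide_distrib)
      qed
      finally have V: "V = \<dots>" .
      have "\<bar>V - (\<Sum>b\<in>nats_le X. 1 / real b * max 0 (ln (y b)))\<bar> \<le> (\<Sum>b\<in>nats_le X. 1 / real b * M)"
        unfolding V sum_subtractf[symmetric] right_diff_distrib[symmetric]
      proof (intro order_trans[OF sum_abs] sum_mono, unfold abs_mult, intro mult_mono)
        fix b assume b: "b \<in> nats_le X"
        then have ypos: "y b > 0" using X r by (simp add: y_def nats_le_def)
        show "\<bar>(\<Sum>u\<in>nats_le (y b). moebius_mu u / u * (ln (y b / u))\<^sup>2) / 2 - max 0 (ln (y b))\<bar> \<le> M"
        proof (cases "y b \<ge> 1")
          case True
          then show ?thesis using M(2)[OF True] M(1) by (simp add: max_def)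
        qed (use ypos M in \<open>auto simp: max_def\<close>)
      qed (use M in auto)
      also have "\<dots> = M * harm_sum X" by (simp add: harm_sum_def sum_distrib_left mult_ac)
      also have "\<dots> \<le> M * (1 + ln X)" using M X by (intro mult_left_mono harm_sum_le) auto
      finally have "\<bar>V - (\<Sum>b\<in>nats_le X. 1 / real b * max 0 (ln (y b)))\<bar> \<le> M * (1 + ln X)" .
      then show ?thesis using D(2)[OF X r] by (simp add: y_def algebra_simps)
    qed
    ultimately show ?thesis by (simp add: algebra_simps)
  qed
  then show ?thesis using K M D by (intro exI[of _ "K * 9 + M + D"]) auto
qed

text \<open>The bound on \<open>c\<close> is \<open>Z / (u * b)\<close>, diminished by the
  logarithmic amount \<open>lp\<close> by which \<open>Y / (u * a)\<close> undercuts it. The first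
  part collapses under Moebius inversion to \<open>(g + ln Z) * harm_sum X\<close>; the second is
  \<open>triple_log_plus_sum\<close> with \<open>r = Y / Z\<close>, and \<open>Y \<ge> Z\<close>
  makes \<open>r \<ge> 1\<close>.\<close>

lemma quad_sum_asymp_ordered:
  "\<exists>C\<ge>0. \<forall>X Y Z. X \<ge> 1 \<longrightarrow> Z \<ge> 1 \<longrightarrow> Y \<ge> Z \<longrightarrow>
    \<bar>quad_sum quad_weight X Y Z - (ln Z * ln X - (max 0 (ln (X * Z / Y)))\<^sup>2 / 4)\<bar>
      \<le> C * (1 + ln X + ln Z) * (1 + (X / Z) powr (1/4))"
proof -
  from harm_sum_asymp obtain g C where C: "C \<ge> 0"
    "\<And>x. x > 0 \<Longrightarrow> \<bar>harm_sum x - ln x - g\<bar> \<le> C * x powr (-(1/4))" by blast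
  from triple_log_plus_sum obtain D where D: "D \<ge> 0" "\<And>X r. X \<ge> 1 \<Longrightarrow> r \<ge> 1 \<Longrightarrow>
     \<bar>(\<Sum>u\<in>nats_le X. \<Sum>b\<in>nats_le (X / real u). \<Sum>a\<in>nats_le (X / real u / real b).
       moebius_mu u / (real u * real b * real a) * max 0 (ln (real a / (real b * r))))
     - (max 0 (ln (X / r)))\<^sup>2 / 4\<bar> \<le> D * (1 + ln X)" by blast
  define K where "K = 40 * C + D + 2 * (\<bar>g\<bar> + C)"
  have K: "K \<ge> 0" using C D by (simp add: K_def)
  have "\<bar>quad_sum quad_weight X Y Z - (ln Z * ln X - (max 0 (ln (X * Z / Y)))\<^sup>2 / 4)\<bar>
      \<le> K * (1 + ln X + ln Z) * (1 + (X / Z) powr (1/4))"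
    if X: "X \<ge> 1" and Z: "Z \<ge> 1" and YZ: "Y \<ge> Z" for X Y Z
  proof -
    have Y: "Y \<ge> 1" using Z YZ by simp
    define r where "r = Y / Z"
    have r: "r \<ge> 1" using YZ Z by (simp add: r_def)
    define w where "w u b a = moebius_mu u / (real u * real b * real a)" for u b a :: nat
    define m where "m u b a = min (Y / (real u * real a)) (Z / (real u * real b))" for u b a :: nat
    define S where "S F = (\<Sum>u\<in>nats_le X. \<Sum>b\<in>nats_le (X / real u). \<Sum>a\<in>nats_le (X / real u / real b). w u b a * F u b a)"
      for F :: "nat \<Rightarrow> nat \<Rightarrow> nat \<Rightarrow> real"
    define lp where "lp u b a = max 0 (ln (real a / (real b * r)))" for u b a :: nat
    have add: "S (\<lambda>u b a. F u b a + G u b a) = S F + S G" for F G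
      by (simp add: S_def sum.distrib ring_distribs)
    have Scong: "S F = S G" if "\<And>u b a. u \<ge> 1 \<Longrightarrow> b \<ge> 1 \<Longrightarrow> a \<ge> 1 \<Longrightarrow> F u b a = G u b a" for F G
      unfolding S_def using that by (intro sum.cong refl) (auto simp: nats_le_def)
    have logm: "ln (m u b a) = ln Z - ln (real u * real b) - lp u b a" if "u \<ge> 1" "b \<ge> 1" "a \<ge> 1" for u b a
    proof -
      have 1: "ln (Y / (real u * real a)) = ln Y - ln u - ln a" "ln (Z / (real u * real b)) = ln Z - ln u - ln b"
        "ln (real a / (real b * r)) = ln a - ln b - (ln Y - ln Z)" "ln (real u * real b) = ln u + ln b"
        using that Y Z by (simp_all add: ln_div ln_mult r_def)
      have "Y / (real u * real a) > 0" "Z / (real u * real b) > 0" using that Y Z by auto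
      then have "ln (m u b a) = min (ln (Y / (real u * real a))) (ln (Z / (real u * real b)))"
        by (auto simp: m_def min_def)
      then show ?thesis unfolding lp_def 1 by (simp add: min_def max_def 1(4))
    qed
    have "quad_sum quad_weight X Y Z = S (\<lambda>u b a. harm_sum (m u b a))"
      by (simp add: quad_sum_iterated S_def w_def m_def)
    also have "\<dots> = S (\<lambda>u b a. (harm_sum (m u b a) - ln (m u b a) - g) + ((g + ln Z - ln (real u * real b)) + (- lp u b a)))"
      by (rule Scong) (simp add: logm)
    also have "\<dots> = S (\<lambda>u b a. harm_sum (m u b a) - ln (m u b a) - g) + (S (\<lambda>u b a. g + ln Z - ln (real u * real b)) + S (\<lambda>u b a. - lp u b a))"
      by (simp only: add)
    also have "S (\<lambda>u b a. - lp u b a) = - S lp" by (simp add: S_def sum_negf)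
    also have "S (\<lambda>u b a. g + ln Z - ln (real u * real b)) = (g + ln Z) * harm_sum X"
    proof -
      \<comment> \<open>The summand does not involve \<open>a\<close> and depends on
        \<open>u\<close>, \<open>b\<close> only through \<open>u * b\<close>; Moebius inversion
        therefore leaves the value at 1.\<close>
      define f where "f k = (g + ln Z - ln k) / k * harm_sum (X / real k)" for k :: nat
      have "S (\<lambda>u b a. g + ln Z - ln (real u * real b)) =
         (\<Sum>u\<in>nats_le X. \<Sum>b\<in>nats_le (X / real u). moebius_mu u * f (u * b))"
        unfolding S_def by (intro sum.cong refl)
          (simp add: f_def w_def harm_sum_def sum_distrib_left sum_divide_distrib mult_ac)
      also have "\<dots> = f 1" using sum_moebius_hyperbola[where f = f and x = X] X by simp
      finally show ?thesis by (simp add: f_def)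
    qed
    finally have 1: "quad_sum quad_weight X Y Z = S (\<lambda>u b a. harm_sum (m u b a) - ln (m u b a) - g) + ((g + ln Z) * harm_sum X + (- S lp))" .
    have e1: "\<bar>S (\<lambda>u b a. harm_sum (m u b a) - ln (m u b a) - g)\<bar> \<le> 40 * C * (1 + ln X) * (X / Z) powr (1/4)"
    proof -
      define p where "p u b a = (Y / (real u * real a)) powr (-(1/4))" for u b a :: nat
      define q where "q u b a = (Z / (real u * real b)) powr (-(1/4))" for u b a :: nat
      have "\<bar>S (\<lambda>u b a. harm_sum (m u b a) - ln (m u b a) - g)\<bar> \<le>
        (\<Sum>u\<in>nats_le X. \<Sum>b\<in>nats_le (X / real u). \<Sum>a\<in>nats_le (X / real u / real b).
           \<bar>w u b a * (harm_sum (m u b a) - ln (m u b a) - g)\<bar>)"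
        unfolding S_def by (intro order_trans[OF sum_abs] sum_mono order_refl)
      also have "\<dots> \<le> (\<Sum>u\<in>nats_le X. \<Sum>b\<in>nats_le (X / real u). \<Sum>a\<in>nats_le (X / real u / real b).
           1 / (real u * real b * real a) * (C * (p u b a + q u b a)))"
      proof (intro sum_mono)
        fix u b a assume "u \<in> nats_le X" "b \<in> nats_le (X / real u)" "a \<in> nats_le (X / real u / real b)"
        then have pos: "real u > 0" "real b > 0" "real a > 0" by (auto simp: nats_le_def)
        then have mpos: "m u b a > 0" using Y Z by (simp add: m_def)
        have "m u b a powr (-(1/4)) \<le> p u b a + q u b a"
          by (simp add: m_def p_def q_def min_def)
        then have "\<bar>harm_sum (m u b a) - ln (m u b a) - g\<bar> \<le> C * (p u b a + q u b a)"
          using C mpos by (intro order_trans[OF C(2)] mult_left_mono) auto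
        moreover have "\<bar>w u b a\<bar> \<le> 1 / (real u * real b * real a)"
          using pos abs_moebius_mu_le[of u] by (simp add: w_def abs_mult divide_right_mono)
        ultimately show "\<bar>w u b a * (harm_sum (m u b a) - ln (m u b a) - g)\<bar> \<le> 1 / (real u * real b * real a) * (C * (p u b a + q u b a))"
          unfolding abs_mult using pos by (intro mult_mono) auto
      qed
      also have "\<dots> = C * ((\<Sum>u\<in>nats_le X. \<Sum>b\<in>nats_le (X / real u). \<Sum>a\<in>nats_le (X / real u / real b).
           1 / (real u * real b * real a) * p u b a) + (\<Sum>u\<in>nats_le X. \<Sum>b\<in>nats_le (X / real u). \<Sum>a\<in>nats_le (X / real u / real b).
           1 / (real u * real b * real a) * q u b a))"
        unfolding sum.distrib[symmetric] sum_distrib_left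
        by (intro sum.cong refl) (simp add: ring_distribs add_divide_distrib)
      \<comment> \<open>Exchanging \<open>a\<close> and \<open>b\<close> brings the second weight
        into the form of \<open>triple_sum_weight_le\<close>, with \<open>Z\<close> in place of
        \<open>Y\<close>.\<close>
      also have "(\<Sum>u\<in>nats_le X. \<Sum>b\<in>nats_le (X / real u). \<Sum>a\<in>nats_le (X / real u / real b).
           1 / (real u * real b * real a) * q u b a) =
         (\<Sum>u\<in>nats_le X. \<Sum>b\<in>nats_le (X / real u). \<Sum>a\<in>nats_le (X / real u / real b).
            1 / (real u * real b * real a) * (Z / (real u * real a)) powr (-(1/4)))"
        by (rule sum.cong[OF refl], subst sum_hyperbola_commute) (simp add: q_def mult_ac)
      also have "C * ((\<Sum>u\<in>nats_le X. \<Sum>b\<in>nats_le (X / real u). \<Sum>a\<in>nats_le (X / real u / real b).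
           1 / (real u * real b * real a) * p u b a) + \<dots>) \<le>
         C * (20 * harm_sum X * (X / Y) powr (1/4) + 20 * harm_sum X * (X / Z) powr (1/4))"
        unfolding p_def using X Y Z C by (intro mult_left_mono add_mono triple_sum_weight_le) auto
      also have "(X / Y) powr (1/4) \<le> (X / Z) powr (1/4)"
        using X Y Z YZ by (intro powr_mono2 divide_left_mono) auto
      finally have "\<bar>S (\<lambda>u b a. harm_sum (m u b a) - ln (m u b a) - g)\<bar> \<le>
         C * (20 * harm_sum X * (X / Z) powr (1/4) + 20 * harm_sum X * (X / Z) powr (1/4))"
        using C harm_sum_nonneg[of X] by (simp add: mult_left_mono)
      also have "\<dots> = 40 * C * harm_sum X * (X / Z) powr (1/4)" by (simp add: algebra_simps)
      also have "\<dots> \<le> 40 * C * (1 + ln X) * (X / Z) powr (1/4)"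
        using C X by (intro mult_right_mono mult_left_mono harm_sum_le) auto
      finally show ?thesis .
    qed
    have "Y > 0" using Y by simp
    have e2: "\<bar>S lp - (max 0 (ln (X * Z / Y)))\<^sup>2 / 4\<bar> \<le> D * (1 + ln X)"
      using D(2)[OF X r] by (simp add: S_def w_def lp_def r_def)
    have h0: "\<bar>harm_sum X - ln X - g\<bar> \<le> C"
    proof -
      have "X powr (-(1/4)) \<le> 1" using X powr_neg_antimono[of 1 X "1/4"] by simp
      then have "C * X powr (-(1/4)) \<le> C * 1" using C by (intro mult_left_mono) auto
      then show ?thesis using C(2)[of X] X by simp
    qed
    have lnX: "ln X \<ge> 0" "ln Z \<ge> 0" using X Z by auto
    have e3: "\<bar>(g + ln Z) * harm_sum X - ln Z * ln X\<bar> \<le> (\<bar>g\<bar> + C) * (1 + ln X + ln Z)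
         + \<bar>g\<bar> * ln Z"
    proof -
      have "(g + ln Z) * harm_sum X - ln Z * ln X = g * harm_sum X + ln Z * (harm_sum X - ln X - g) + g * ln Z"
        by (simp add: algebra_simps)
      also have "\<bar>\<dots>\<bar> \<le> \<bar>g * harm_sum X\<bar> + \<bar>ln Z * (harm_sum X - ln X - g)\<bar> + \<bar>g * ln Z\<bar>" by linarith
      also have "\<bar>g * harm_sum X\<bar> \<le> \<bar>g\<bar> * (1 + ln X)"
        unfolding abs_mult using harm_sum_le[OF X] harm_sum_nonneg[of X] by (intro mult_left_mono) auto
      also have "\<bar>ln Z * (harm_sum X - ln X - g)\<bar> \<le> ln Z * C"
        unfolding abs_mult using h0 lnX C by (intro mult_mono) auto
      also have "\<bar>g\<bar> * (1 + ln X) + ln Z * C + \<bar>g * ln Z\<bar> \<le> (\<bar>g\<bar> + C) * (1 + ln X + ln Z) + \<bar>g\<bar> * ln Z"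
        using C lnX by (simp add: abs_mult algebra_simps)
      finally show ?thesis by simp
    qed
    have "\<bar>quad_sum quad_weight X Y Z - (ln Z * ln X - (max 0 (ln (X * Z / Y)))\<^sup>2 / 4)\<bar> \<le>
       40 * C * (1 + ln X) * (X / Z) powr (1/4) + D * (1 + ln X) + ((\<bar>g\<bar> + C) * (1 + ln X + ln Z) + \<bar>g\<bar> * ln Z)"
      unfolding 1 using e1 e2 e3 by linarith
    also have "\<dots> \<le> 40 * C * (1 + ln X + ln Z) * (1 + (X / Z) powr (1/4)) + D * (1 + ln X + ln Z) * (1 + (X / Z) powr (1/4))
       + 2 * (\<bar>g\<bar> + C) * (1 + ln X + ln Z) * (1 + (X / Z) powr (1/4))"
    proof (intro add_mono)
      show "40 * C * (1 + ln X) * (X / Z) powr (1/4) \<le> 40 * C * (1 + ln X + ln Z) * (1 + (X / Z) powr (1/4))"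
        using C lnX by (intro mult_mono) auto
      have "D * (1 + ln X) * 1 \<le> D * (1 + ln X + ln Z) * (1 + (X / Z) powr (1/4))"
        using D lnX by (intro mult_mono) auto
      then show "D * (1 + ln X) \<le> D * (1 + ln X + ln Z) * (1 + (X / Z) powr (1/4))" by simp
      have "\<bar>g\<bar> * ln Z \<le> (\<bar>g\<bar> + C) * (1 + ln X + ln Z)" using lnX C by (intro mult_mono) auto
      then have "(\<bar>g\<bar> + C) * (1 + ln X + ln Z) + \<bar>g\<bar> * ln Z \<le> 2 * ((\<bar>g\<bar> + C) * (1 + ln X + ln Z))" by linarith
      also have "\<dots> = 2 * (\<bar>g\<bar> + C) * (1 + ln X + ln Z) * 1" by (simp only: mult.assoc mult_1_right)
      also have "\<dots> \<le> 2 * (\<bar>g\<bar> + C) * (1 + ln X + ln Z) * (1 + (X / Z) powr (1/4))"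
        using C lnX by (intro mult_left_mono) auto
      finally show "(\<bar>g\<bar> + C) * (1 + ln X + ln Z) + \<bar>g\<bar> * ln Z \<le> 2 * (\<bar>g\<bar> + C) * (1 + ln X + ln Z) * (1 + (X / Z) powr (1/4))" .
    qed
    also have "\<dots> = K * (1 + ln X + ln Z) * (1 + (X / Z) powr (1/4))"
      by (simp only: K_def ring_distribs)
    finally show ?thesis .
  qed
  then show ?thesis using K by blast
qed

text \<open>The shift-tolerant error \<open>(R / min X Y Z) powr (1/4)\<close> is what makes this estimate stable under
  modifying the summand at finitely many primes.\<close>

lemma quad_sum_asymp:
  "\<exists>C\<ge>0. \<forall>R X Y Z. ln R \<ge> 1 \<longrightarrow> 0 < X \<longrightarrow> X \<le> R \<longrightarrow> 0 < Y \<longrightarrow> Y \<le> R \<longrightarrow> 0 < Z \<longrightarrow> Z \<le> R \<longrightarrow>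
    \<bar>quad_sum quad_weight X Y Z - 3 / 4 * (ln R)\<^sup>2\<bar> \<le> C * ln R * (R / min X (min Y Z)) powr (1/4)"
proof -
  from quad_sum_asymp_ordered obtain C where C: "C \<ge> 0" "\<And>X Y Z. X \<ge> 1 \<Longrightarrow> Z \<ge> 1 \<Longrightarrow> Y \<ge> Z \<Longrightarrow>
    \<bar>quad_sum quad_weight X Y Z - (ln Z * ln X - (max 0 (ln (X * Z / Y)))\<^sup>2 / 4)\<bar>
      \<le> C * (1 + ln X + ln Z) * (1 + (X / Z) powr (1/4))" by blast
  define K where "K = 6 * C + 12"
  have ord: "\<bar>quad_sum quad_weight X Y Z - 3 / 4 * (ln R)\<^sup>2\<bar> \<le> K * ln R * (R / min X (min Y Z)) powr (1/4)"
    if R: "ln R \<ge> 1" and X: "0 < X" "X \<le> R" and Y: "0 < Y" "Y \<le> R" and Z: "0 < Z" "Z \<le> R" and YZ: "Y \<ge> Z" for R X Y Z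
  proof -
    define D where "D = R / min X (min Y Z)"
    have mn: "min X (min Y Z) > 0" "min X (min Y Z) \<le> R" using X Y Z by auto
    have Rpos: "R > 0" using X by simp
    have D: "D \<ge> 1" using mn by (simp add: D_def)
    have D4: "D powr (1/4) \<ge> 1" using D by (simp add: ge_one_powr_ge_zero)
    have lnD: "ln D \<le> 4 * D powr (1/4)" using D by (intro ln_le_powr_quarter) auto
    define L where "L = ln R"
    have L: "L \<ge> 1" using R by (simp add: L_def)
    show ?thesis
    proof (cases "X \<ge> 1 \<and> Z \<ge> 1")
      \<comment> \<open>The sum is empty here, and the error term must cover the whole main term: a
        bound below 1 forces \<open>R \<le> D\<close>, hence
        \<open>ln R \<le> 4 * D powr (1/4)\<close>.\<close>
      case False
      then have "quad_sum quad_weight X Y Z = 0"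
        unfolding quad_sum_def using quad_dom_empty[of X Y Z] by auto
      then have "\<bar>quad_sum quad_weight X Y Z - 3 / 4 * (ln R)\<^sup>2\<bar> \<le> L * L" by (simp add: L_def power2_eq_square)
      also have "R \<le> D" using False mn Rpos by (auto simp: D_def field_simps min_def split: if_splits)
      then have "L \<le> ln D" using Rpos by (simp add: L_def)
      then have "L * L \<le> L * (4 * D powr (1/4))" using lnD L by (intro mult_left_mono) auto
      also have "\<dots> = 4 * (L * D powr (1/4))" by simp
      also have "\<dots> \<le> K * (L * D powr (1/4))" using C L by (intro mult_right_mono) (auto simp: K_def)
      finally show ?thesis by (simp add: L_def D_def)
    next
      case True
      then have XZ: "X \<ge> 1" "Z \<ge> 1" by auto
      have lnge: "ln X \<ge> L - ln D" "ln Y \<ge> L - ln D" "ln Z \<ge> L - ln D"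
        using mn Rpos X Y Z by (auto simp: L_def D_def ln_div)
      have lnle: "ln X \<le> L" "ln Y \<le> L" "ln Z \<le> L" "0 \<le> ln X" "0 \<le> ln Z"
        using X Y Z XZ Rpos by (auto simp: L_def)
      have lnD0: "ln D \<ge> 0" using D by simp
      have "(X / Z) powr (1/4) \<le> D powr (1/4)"
        unfolding D_def using X Z mn by (intro powr_mono2 frac_le) auto
      then have "C * (1 + ln X + ln Z) * (1 + (X / Z) powr (1/4)) \<le> C * (3 * L) * (2 * D powr (1/4))"
        using C L lnle D4 by (intro mult_mono) auto
      then have 1: "\<bar>quad_sum quad_weight X Y Z - (ln Z * ln X - (max 0 (ln (X * Z / Y)))\<^sup>2 / 4)\<bar> \<le> 6 * C * L * D powr (1/4)"
        using C(2)[OF XZ YZ] by (simp add: mult_ac)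
      have "ln (X * Z / Y) = ln X + ln Z - ln Y" using X Y Z by (simp add: ln_div ln_mult)
      \<comment> \<open>At \<open>X = Y = Z = R\<close> both \<open>ln Z * ln X\<close> and
        \<open>v^2\<close> equal \<open>L^2\<close>, which gives 1 - 1/4. In general each deviates
        from \<open>L^2\<close> by at most a multiple of \<open>L * ln D\<close>.\<close>
      moreover define v where "v = max 0 (ln (X * Z / Y))"
      moreover have "ln Z \<le> ln Y" using Z YZ by simp
      ultimately have v: "v \<ge> L - 2 * ln D" "v \<le> L" "v \<ge> 0"
        using lnge lnle by (auto simp: max_def)
      have "\<bar>v\<^sup>2 - L\<^sup>2\<bar> = (L - v) * (L + v)" using v by (simp add: power2_eq_square algebra_simps abs_if)
          (smt (verit) mult_mono)
      also have "\<dots> \<le> (2 * ln D) * (2 * L)" using v lnD0 L by (intro mult_mono) auto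
      finally have 2: "\<bar>v\<^sup>2 - L\<^sup>2\<bar> \<le> 4 * (L * ln D)" by (simp add: mult_ac)
      have "L * L - ln Z * ln X = L * (L - ln X) + ln X * (L - ln Z)" by (simp add: algebra_simps)
      moreover have "L * (L - ln X) \<le> L * ln D" "ln X * (L - ln Z) \<le> L * ln D"
        using lnge lnle L by (auto intro!: mult_left_mono mult_mono)
      moreover have "L * (L - ln X) \<ge> 0" "ln X * (L - ln Z) \<ge> 0" using lnle L by auto
      ultimately have 3: "\<bar>ln Z * ln X - L\<^sup>2\<bar> \<le> 2 * (L * ln D)" by (simp add: power2_eq_square)
      have "L * ln D \<le> L * (4 * D powr (1/4))" using L lnD by (intro mult_left_mono) auto
      then have "\<bar>quad_sum quad_weight X Y Z - 3 / 4 * L\<^sup>2\<bar> \<le> 6 * C * L * D powr (1/4) + 12 * (L * D powr (1/4))"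
        using 1 2 3 unfolding v_def[symmetric] by linarith
      then show ?thesis by (simp add: K_def L_def D_def algebra_simps)
    qed
  qed
  have "\<bar>quad_sum quad_weight X Y Z - 3 / 4 * (ln R)\<^sup>2\<bar> \<le> K * ln R * (R / min X (min Y Z)) powr (1/4)"
    if "ln R \<ge> 1" "0 < X" "X \<le> R" "0 < Y" "Y \<le> R" "0 < Z" "Z \<le> R" for R X Y Z
  proof (cases "Y \<ge> Z")
    case False
    then show ?thesis using ord[of R X Z Y] that quad_sum_commute[of X Y Z] by (simp add: min.commute)
  qed (use ord that in auto)
  moreover have "K \<ge> 0" using C by (simp add: K_def)
  ultimately show ?thesis by blast
qed

section \<open>Local factors and the effect of inserting one prime\<close>

text \<open>Ratio at \<open>p\<close> between the exact correlation at equal shifts and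
  \<open>quad_weight\<close>: \<open>1 / (p - 1)\<close> against \<open>1 / p\<close> if
  \<open>p\<close> divides exactly two of the three moduli, \<open>-(p - 2) / (p - 1)^2\<close>
  against \<open>-1 / p\<close> if it divides all. It vanishes where \<open>p\<close> divides two of
  the variables or \<open>p^2\<close> divides \<open>a * b * c\<close> with \<open>p\<close> prime
  to \<open>u\<close>; the case \<open>p^2 dvd u\<close> is left to
  \<open>moebius_mu u\<close>.\<close>

definition quad_local :: "nat \<Rightarrow> nat \<times> nat \<times> nat \<times> nat \<Rightarrow> real" where
  "quad_local p = (\<lambda>(a, b, c, u).
     if p dvd u then (if p dvd a \<or> p dvd b \<or> p dvd c then 0 else real p * (real p - 2) / (real p - 1)\<^sup>2)
     else if \<not> p dvd a \<and> \<not> p dvd b \<and> \<not> p dvd c then 1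
     else if p\<^sup>2 dvd a * b * c then 0 else real p / (real p - 1))"

definition quad_weight_on :: "nat set \<Rightarrow> nat \<times> nat \<times> nat \<times> nat \<Rightarrow> real" where
  "quad_weight_on P t = quad_weight t * (\<Prod>p\<in>P. quad_local p t)"

lemma quad_sum_shift:
  fixes f :: "nat \<times> nat \<times> nat \<times> nat \<Rightarrow> real" and q :: nat
  assumes q: "q > 0"
  shows quad_sum_shift_a: "(\<Sum>t | t \<in> quad_dom X Y Z \<and> q dvd fst t. f t) =
       (\<Sum>(a, b, c, u)\<in>quad_dom (X / q) (Y / q) Z. f (q * a, b, c, u))"
    and quad_sum_shift_b: "(\<Sum>t | t \<in> quad_dom X Y Z \<and> q dvd fst (snd t). f t) =
       (\<Sum>(a, b, c, u)\<in>quad_dom (X / q) Y (Z / q). f (a, q * b, c, u))"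
    and quad_sum_shift_c: "(\<Sum>t | t \<in> quad_dom X Y Z \<and> q dvd fst (snd (snd t)). f t) =
       (\<Sum>(a, b, c, u)\<in>quad_dom X (Y / q) (Z / q). f (a, b, q * c, u))"
    and quad_sum_shift_u: "(\<Sum>t | t \<in> quad_dom X Y Z \<and> q dvd snd (snd (snd t)). f t) =
       (\<Sum>(a, b, c, u)\<in>quad_dom (X / q) (Y / q) (Z / q). f (a, b, c, q * u))"
proof -
  have *: "real x * (real q * real y) \<le> z \<longleftrightarrow> real x * real y \<le> z / real q"
     "real q * real x * real y \<le> z \<longleftrightarrow> real x * real y \<le> z / real q"
     "real q * (real x * real y) \<le> z \<longleftrightarrow> real x * real y \<le> z / real q"
     "real x * real w * (real q * real y) \<le> z \<longleftrightarrow> real x * real w * real y \<le> z / real q"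
     "real x * (real q * real w) * real y \<le> z \<longleftrightarrow> real x * real w * real y \<le> z / real q"
     "real q * real x * real w * real y \<le> z \<longleftrightarrow> real x * real w * real y \<le> z / real q" for x y z w
    using q by (simp_all add: field_simps)
  show "(\<Sum>t | t \<in> quad_dom X Y Z \<and> q dvd fst t. f t) =
       (\<Sum>(a, b, c, u)\<in>quad_dom (X / q) (Y / q) Z. f (q * a, b, c, u))"
    using q by (intro sum.reindex_bij_witness[where i = "\<lambda>(a, b, c, u). (q * a, b, c, u)" and j = "\<lambda>(a, b, c, u). (a div q, b, c, u)"])
       (auto simp: quad_dom_def * elim!: dvdE)
  show "(\<Sum>t | t \<in> quad_dom X Y Z \<and> q dvd fst (snd t). f t) =
       (\<Sum>(a, b, c, u)\<in>quad_dom (X / q) Y (Z / q). f (a, q * b, c, u))"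
    using q by (intro sum.reindex_bij_witness[where i = "\<lambda>(a, b, c, u). (a, q * b, c, u)" and j = "\<lambda>(a, b, c, u). (a, b div q, c, u)"])
       (auto simp: quad_dom_def * elim!: dvdE)
  show "(\<Sum>t | t \<in> quad_dom X Y Z \<and> q dvd fst (snd (snd t)). f t) =
       (\<Sum>(a, b, c, u)\<in>quad_dom X (Y / q) (Z / q). f (a, b, q * c, u))"
    using q by (intro sum.reindex_bij_witness[where i = "\<lambda>(a, b, c, u). (a, b, q * c, u)" and j = "\<lambda>(a, b, c, u). (a, b, c div q, u)"])
       (auto simp: quad_dom_def * elim!: dvdE)
  show "(\<Sum>t | t \<in> quad_dom X Y Z \<and> q dvd snd (snd (snd t)). f t) =
       (\<Sum>(a, b, c, u)\<in>quad_dom (X / q) (Y / q) (Z / q). f (a, b, c, q * u))"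
    using q by (intro sum.reindex_bij_witness[where i = "\<lambda>(a, b, c, u). (a, b, c, q * u)" and j = "\<lambda>(a, b, c, u). (a, b, c, u div q)"])
       (auto simp: quad_dom_def * elim!: dvdE)
qed

lemma moebius_mu_prime_mult:
  assumes "prime q" "u > 0"
  shows "moebius_mu (q * u) = (if q dvd u then 0 else - moebius_mu u)"
proof (cases "q dvd u")
  case True
  then have "q\<^sup>2 dvd q * u" by (simp add: power2_eq_square)
  moreover have "\<not> q dvd 1" using assms(1) by auto
  ultimately have "\<not> squarefree (q * u)" by (rule not_squarefreeI)
  then show ?thesis using True by (simp add: moebius_mu_def)
next
  case False
  then have cop: "coprime q u" using assms by (simp add: prime_imp_coprime)
  have "prime_factors (q * u) = insert q (prime_factors u)"
    using assms by (subst prime_factors_product) (auto simp: prime_prime_factors)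
  moreover have "q \<notin> prime_factors u" using False by auto
  moreover have "squarefree (q * u) \<longleftrightarrow> squarefree u"
    using squarefree_mult_coprime[OF cop squarefree_prime[OF assms(1)]] squarefree_multD(2)[of q u] by blast
  ultimately show ?thesis using False
    by (simp add: moebius_mu_def)
qed

context
  fixes P :: "nat set" and q :: nat
  assumes finP: "finite P" and primeP: "\<And>p. p \<in> P \<Longrightarrow> prime p" and q: "prime q" and qP: "q \<notin> P"
begin

lemma coprime_qP: "p \<in> P \<Longrightarrow> coprime p q"
  using primeP q qP by (auto intro: primes_coprime)

lemma dvd_q_mult: "p \<in> P \<Longrightarrow> p dvd q * n \<longleftrightarrow> p dvd n" "p \<in> P \<Longrightarrow> p\<^sup>2 dvd q * n \<longleftrightarrow> p\<^sup>2 dvd n"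
  using coprime_qP by (auto simp: coprime_dvd_mult_right_iff)

lemma quad_local_mult:
  assumes "p \<in> P"
  shows "quad_local p (q * a, b, c, u) = quad_local p (a, b, c, u)"
    "quad_local p (a, q * b, c, u) = quad_local p (a, b, c, u)"
    "quad_local p (a, b, q * c, u) = quad_local p (a, b, c, u)"
    "quad_local p (a, b, c, q * u) = quad_local p (a, b, c, u)"
proof -
  have e: "q * a * b * c = q * (a * b * c)" "a * (q * b) * c = q * (a * b * c)" "a * b * (q * c) = q * (a * b * c)"
    by simp_all
  show "quad_local p (q * a, b, c, u) = quad_local p (a, b, c, u)"
    "quad_local p (a, q * b, c, u) = quad_local p (a, b, c, u)"
    "quad_local p (a, b, q * c, u) = quad_local p (a, b, c, u)"
    "quad_local p (a, b, c, q * u) = quad_local p (a, b, c, u)"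
    by (simp_all only: quad_local_def prod.case e dvd_q_mult[OF assms])
qed

lemma quad_weight_on_mult:
  assumes "u \<ge> 1"
  shows "quad_weight_on P (q * a, b, c, u) = quad_weight_on P (a, b, c, u) / q"
    "quad_weight_on P (a, q * b, c, u) = quad_weight_on P (a, b, c, u) / q"
    "quad_weight_on P (a, b, q * c, u) = quad_weight_on P (a, b, c, u) / q"
    "quad_weight_on P (a, b, c, q * u) = (if q dvd u then 0 else - quad_weight_on P (a, b, c, u) / q)"
  using assms moebius_mu_prime_mult[OF q, of u]
  by (simp_all add: quad_weight_on_def quad_weight_def quad_local_mult)

private definition "SS pr X Y Z = (\<Sum>t | t \<in> quad_dom X Y Z \<and> pr t. quad_weight_on P t)"

private lemma SS_split: "SS pr X Y Z = SS (\<lambda>t. pr t \<and> \<not> d t) X Y Z + SS (\<lambda>t. pr t \<and> d t) X Y Z"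
proof -
  have "SS pr X Y Z = SS (\<lambda>t. pr t \<and> d t) X Y Z + SS (\<lambda>t. pr t \<and> \<not> d t) X Y Z"
    unfolding SS_def by (subst sum.union_disjoint[symmetric]) (auto intro!: sum.cong)
  then show ?thesis by simp
qed

private abbreviation "qa \<equiv> \<lambda>t::nat\<times>nat\<times>nat\<times>nat. q dvd fst t"
private abbreviation "qb \<equiv> \<lambda>t::nat\<times>nat\<times>nat\<times>nat. q dvd fst (snd t)"
private abbreviation "qc \<equiv> \<lambda>t::nat\<times>nat\<times>nat\<times>nat. q dvd fst (snd (snd t))"
private abbreviation "qu \<equiv> \<lambda>t::nat\<times>nat\<times>nat\<times>nat. q dvd snd (snd (snd t))"

private definition "TT = SS (\<lambda>_. True)"
text \<open>The quadruples free of \<open>q\<close>: every sum with a prescribed factor at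
  \<open>q\<close> is a combination of copies of \<open>EE\<close> with shifted bounds.\<close>

private definition "EE = SS (\<lambda>t. \<not> qa t \<and> \<not> qb t \<and> \<not> qc t \<and> \<not> qu t)"
text \<open>The operator product \<open>(1 - A / q) (1 - B / q) (1 - C / q)\<close> applied to
  \<open>TT\<close>, where \<open>A\<close>, \<open>B\<close>, \<open>C\<close> divide by
  \<open>q\<close> the two bounds that involve \<open>a\<close>, \<open>b\<close>, \<open>c\<close>
  respectively.\<close>

private definition "NN X Y Z = TT X Y Z - (TT (X/q) (Y/q) Z + TT (X/q) Y (Z/q) + TT X (Y/q) (Z/q)) / q
   + (TT (X/q/q) (Y/q) (Z/q) + TT (X/q) (Y/q/q) (Z/q) + TT (X/q) (Y/q) (Z/q/q)) / q^2
   - TT (X/q/q) (Y/q/q) (Z/q/q) / q^3"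

private lemma q_pos: "q > 0" using q by (simp add: prime_gt_0_nat)

private lemma sum_filter: "(\<Sum>t | t \<in> D \<and> pr t. f t) = (\<Sum>t\<in>D. if pr t then f t else 0)" if "finite D" for D pr and f :: "'x \<Rightarrow> real"
  using that by (simp add: sum.If_cases Collect_conj_eq)

private lemma SS_a: "SS (\<lambda>t. pr t \<and> qa t) X Y Z = SS (\<lambda>(a,b,c,u). pr (q * a, b, c, u)) (X/q) (Y/q) Z / q"
proof -
  have "SS (\<lambda>t. pr t \<and> qa t) X Y Z = (\<Sum>t | t \<in> quad_dom X Y Z \<and> qa t. if pr t then quad_weight_on P t else 0)"
    by (simp add: SS_def sum_filter) (intro sum.cong, auto)
  also have "\<dots> = (\<Sum>(a, b, c, u)\<in>quad_dom (X/q) (Y/q) Z. if pr (q * a, b, c, u) then quad_weight_on P (q * a, b, c, u) else 0)"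
    by (rule quad_sum_shift_a[OF q_pos])
  also have "\<dots> = SS (\<lambda>(a,b,c,u). pr (q * a, b, c, u)) (X/q) (Y/q) Z / q"
    unfolding SS_def sum_filter[OF finite_quad_dom] sum_divide_distrib
    by (intro sum.cong refl) (auto simp: quad_dom_def quad_weight_on_mult)
  finally show ?thesis .
qed

private lemma SS_b: "SS (\<lambda>t. pr t \<and> qb t) X Y Z = SS (\<lambda>(a,b,c,u). pr (a, q * b, c, u)) (X/q) Y (Z/q) / q"
proof -
  have "SS (\<lambda>t. pr t \<and> qb t) X Y Z = (\<Sum>t | t \<in> quad_dom X Y Z \<and> qb t. if pr t then quad_weight_on P t else 0)"
    by (simp add: SS_def sum_filter) (intro sum.cong, auto)
  also have "\<dots> = (\<Sum>(a, b, c, u)\<in>quad_dom (X/q) Y (Z/q). if pr (a, q * b, c, u) then quad_weight_on P (a, q * b, c, u) else 0)"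
    by (rule quad_sum_shift_b[OF q_pos])
  also have "\<dots> = SS (\<lambda>(a,b,c,u). pr (a, q * b, c, u)) (X/q) Y (Z/q) / q"
    unfolding SS_def sum_filter[OF finite_quad_dom] sum_divide_distrib
    by (intro sum.cong refl) (auto simp: quad_dom_def quad_weight_on_mult)
  finally show ?thesis .
qed

private lemma SS_c: "SS (\<lambda>t. pr t \<and> qc t) X Y Z = SS (\<lambda>(a,b,c,u). pr (a, b, q * c, u)) X (Y/q) (Z/q) / q"
proof -
  have "SS (\<lambda>t. pr t \<and> qc t) X Y Z = (\<Sum>t | t \<in> quad_dom X Y Z \<and> qc t. if pr t then quad_weight_on P t else 0)"
    by (simp add: SS_def sum_filter) (intro sum.cong, auto)
  also have "\<dots> = (\<Sum>(a, b, c, u)\<in>quad_dom X (Y/q) (Z/q). if pr (a, b, q * c, u) then quad_weight_on P (a, b, q * c, u) else 0)"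
    by (rule quad_sum_shift_c[OF q_pos])
  also have "\<dots> = SS (\<lambda>(a,b,c,u). pr (a, b, q * c, u)) X (Y/q) (Z/q) / q"
    unfolding SS_def sum_filter[OF finite_quad_dom] sum_divide_distrib
    by (intro sum.cong refl) (auto simp: quad_dom_def quad_weight_on_mult)
  finally show ?thesis .
qed

text \<open>Sign and side condition both come from the Moebius function: \<open>q * u\<close> has
  weight \<open>- moebius_mu u\<close>, or 0 if \<open>q\<close> divides \<open>u\<close>
  again.\<close>

private lemma SS_u: "SS (\<lambda>t. pr t \<and> qu t) X Y Z = - SS (\<lambda>(a,b,c,u). pr (a, b, c, q * u) \<and> \<not> q dvd u) (X/q) (Y/q) (Z/q) / q"
proof -
  have "SS (\<lambda>t. pr t \<and> qu t) X Y Z = (\<Sum>t | t \<in> quad_dom X Y Z \<and> qu t. if pr t then quad_weight_on P t else 0)"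
    by (simp add: SS_def sum_filter) (intro sum.cong, auto)
  also have "\<dots> = (\<Sum>(a, b, c, u)\<in>quad_dom (X/q) (Y/q) (Z/q). if pr (a, b, c, q * u) then quad_weight_on P (a, b, c, q * u) else 0)"
    by (rule quad_sum_shift_u[OF q_pos])
  also have "\<dots> = - SS (\<lambda>(a,b,c,u). pr (a, b, c, q * u) \<and> \<not> q dvd u) (X/q) (Y/q) (Z/q) / q"
    unfolding SS_def sum_filter[OF finite_quad_dom] sum_divide_distrib sum_negf[symmetric]
  proof (intro sum.cong refl)
    fix t assume t: "t \<in> quad_dom (X/q) (Y/q) (Z/q)"
    obtain a b c u where abcu: "t = (a, b, c, u)" by (cases t) auto
    then have "u \<ge> 1" using t by (simp add: quad_dom_def)
    then show "(case t of (a, b, c, u) \<Rightarrow> if pr (a, b, c, q * u) then quad_weight_on P (a, b, c, q * u) else 0) =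
      - (if case t of (a, b, c, u) \<Rightarrow> pr (a, b, c, q * u) \<and> \<not> q dvd u then quad_weight_on P t else 0) / q"
      unfolding abcu by (cases "pr (a, b, c, q * u)"; cases "q dvd u") (simp_all add: quad_weight_on_mult)
  qed
  finally show ?thesis .
qed

text \<open>Inclusion-exclusion over \<open>q\<close> dividing \<open>a\<close>, \<open>b\<close>,
  \<open>c\<close> produces \<open>NN\<close> out of \<open>TT\<close>; what is left still contains
  the quadruples with \<open>q dvd u\<close>, and these are \<open>EE\<close> at bounds divided by
  \<open>q\<close>. The relation is thus implicit in \<open>EE\<close>, and is unwound later by
  iteration.\<close>

private lemma EE_recurrence: "EE X Y Z - EE (X/q) (Y/q) (Z/q) / q = NN X Y Z"
proof -
  define Ga where "Ga = SS (\<lambda>t. \<not> qa t)"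
  define Gab where "Gab = SS (\<lambda>t. \<not> qa t \<and> \<not> qb t)"
  define Gabc where "Gabc = SS (\<lambda>t. \<not> qa t \<and> \<not> qb t \<and> \<not> qc t)"
  have 1: "Ga X Y Z = TT X Y Z - TT (X/q) (Y/q) Z / q" for X Y Z
    using SS_split[of "\<lambda>_. True" X Y Z qa] SS_a[of "\<lambda>_. True" X Y Z]
    by (simp add: Ga_def TT_def case_prod_unfold)
  have 2: "Gab X Y Z = Ga X Y Z - Ga (X/q) Y (Z/q) / q" for X Y Z
    using SS_split[of "\<lambda>t. \<not> qa t" X Y Z qb] SS_b[of "\<lambda>t. \<not> qa t" X Y Z]
    by (simp add: Ga_def Gab_def case_prod_unfold)
  have 3: "Gabc X Y Z = Gab X Y Z - Gab X (Y/q) (Z/q) / q" for X Y Z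
    using SS_split[of "\<lambda>t. \<not> qa t \<and> \<not> qb t" X Y Z qc] SS_c[of "\<lambda>t. \<not> qa t \<and> \<not> qb t" X Y Z]
    by (simp add: Gab_def Gabc_def case_prod_unfold)
  have 4: "Gabc X Y Z = EE X Y Z - EE (X/q) (Y/q) (Z/q) / q" for X Y Z
    using SS_split[of "\<lambda>t. \<not> qa t \<and> \<not> qb t \<and> \<not> qc t" X Y Z qu] SS_u[of "\<lambda>t. \<not> qa t \<and> \<not> qb t \<and> \<not> qc t" X Y Z]
    by (simp add: EE_def Gabc_def case_prod_unfold)
  show ?thesis
    unfolding 4[symmetric] 3 2 1 NN_def using q_pos by (simp add: field_simps power2_eq_square power3_eq_cube)
qed

text \<open>\<open>quad_local q\<close> is supported on quadruples with \<open>q\<close> nowhere,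
  once in exactly one of \<open>a\<close>, \<open>b\<close>, \<open>c\<close>, or in
  \<open>u\<close> alone. Moving \<open>q\<close> out contributes \<open>1 / q\<close>, respectively
  \<open>-1 / q\<close>, and leaves \<open>EE\<close>.\<close>

private lemma sum_quad_weight_insert:
  "quad_sum (quad_weight_on (insert q P)) X Y Z =
     EE X Y Z + (EE (X/q) (Y/q) Z + EE (X/q) Y (Z/q) + EE X (Y/q) (Z/q)) / (real q - 1)
     - (real q - 2) / (real q - 1)^2 * EE (X/q) (Y/q) (Z/q)"
proof -
  \<comment> \<open>\<open>pa\<close> lets \<open>q\<close> divide \<open>a\<close> once only, so
    that after the shift the condition reads \<open>\<not> q dvd a\<close>. In \<open>pu\<close> the
    same restriction on \<open>u\<close> is supplied by \<open>SS_u\<close>.\<close>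
  define pa where "pa = (\<lambda>(a::nat,b::nat,c::nat,u::nat). \<not> q\<^sup>2 dvd a \<and> \<not> q dvd b \<and> \<not> q dvd c \<and> \<not> q dvd u)"
  define pb where "pb = (\<lambda>(a::nat,b::nat,c::nat,u::nat). \<not> q dvd a \<and> \<not> q\<^sup>2 dvd b \<and> \<not> q dvd c \<and> \<not> q dvd u)"
  define pc where "pc = (\<lambda>(a::nat,b::nat,c::nat,u::nat). \<not> q dvd a \<and> \<not> q dvd b \<and> \<not> q\<^sup>2 dvd c \<and> \<not> q dvd u)"
  define pu where "pu = (\<lambda>(a::nat,b::nat,c::nat,u::nat). \<not> q dvd a \<and> \<not> q dvd b \<and> \<not> q dvd c)"
  have q1: "real q > 1" using prime_gt_1_nat[OF q] by simp
  have loc: "quad_local q t = (if \<not> qa t \<and> \<not> qb t \<and> \<not> qc t \<and> \<not> qu t then 1 else 0)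
     + real q / (real q - 1) * ((if pa t \<and> qa t then 1 else 0) + (if pb t \<and> qb t then 1 else 0) + (if pc t \<and> qc t then 1 else 0))
     + real q * (real q - 2) / (real q - 1)^2 * (if pu t \<and> qu t then 1 else 0)" for t
  proof -
    obtain a b c u where t: "t = (a, b, c, u)" by (cases t) auto
    have two: "q\<^sup>2 dvd a * b * c" if "q dvd a \<and> q dvd b \<or> q dvd a \<and> q dvd c \<or> q dvd b \<and> q dvd c"
    proof -
      have e: "a * b * c = (a * c) * b" "a * b * c = (b * c) * a" by simp_all
      from that consider "q * q dvd a * b" | "q * q dvd a * c" | "q * q dvd b * c"
        by (blast intro: mult_dvd_mono)
      then show ?thesis unfolding power2_eq_square by cases (metis e dvd_mult2)+
    qed
    have sqa: "q\<^sup>2 dvd a * b * c \<longleftrightarrow> q\<^sup>2 dvd a" if "\<not> q dvd b" "\<not> q dvd c"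
      using that q by (simp add: coprime_dvd_mult_left_iff prime_imp_coprime)
    have sqb: "q\<^sup>2 dvd a * b * c \<longleftrightarrow> q\<^sup>2 dvd b" if "\<not> q dvd a" "\<not> q dvd c"
      using that q by (simp add: coprime_dvd_mult_left_iff coprime_dvd_mult_right_iff prime_imp_coprime)
    have sqc: "q\<^sup>2 dvd a * b * c \<longleftrightarrow> q\<^sup>2 dvd c" if "\<not> q dvd a" "\<not> q dvd b"
      using that q by (simp add: coprime_dvd_mult_right_iff prime_imp_coprime mult.assoc)
    have sq: "q dvd x" if "q\<^sup>2 dvd x" for x using that by (metis dvd_mult_left power2_eq_square)
    show ?thesis
      unfolding t quad_local_def pa_def pb_def pc_def pu_def
      using two sqa sqb sqc
      by (cases "q dvd a"; cases "q dvd b"; cases "q dvd c"; cases "q dvd u") simp_all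
  qed
  have "quad_sum (quad_weight_on (insert q P)) X Y Z = (\<Sum>t\<in>quad_dom X Y Z. quad_weight_on P t * quad_local q t)"
    unfolding quad_sum_def quad_weight_on_def using finP qP by (intro sum.cong refl) (simp add: mult_ac)
  also have "\<dots> = SS (\<lambda>t. \<not> qa t \<and> \<not> qb t \<and> \<not> qc t \<and> \<not> qu t) X Y Z
     + real q / (real q - 1) * (SS (\<lambda>t. pa t \<and> qa t) X Y Z + SS (\<lambda>t. pb t \<and> qb t) X Y Z + SS (\<lambda>t. pc t \<and> qc t) X Y Z)
     + real q * (real q - 2) / (real q - 1)^2 * SS (\<lambda>t. pu t \<and> qu t) X Y Z"
    unfolding SS_def sum_filter[OF finite_quad_dom] sum_distrib_left sum.distrib[symmetric]
    by (intro sum.cong refl, subst loc) (simp add: ring_distribs mult_ac)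
  also have "SS (\<lambda>t. pa t \<and> qa t) X Y Z = EE (X/q) (Y/q) Z / q"
    unfolding SS_a EE_def pa_def using q_pos by (simp add: case_prod_unfold power2_eq_square conj_ac)
  also have "SS (\<lambda>t. pb t \<and> qb t) X Y Z = EE (X/q) Y (Z/q) / q"
    unfolding SS_b EE_def pb_def using q_pos by (simp add: case_prod_unfold power2_eq_square conj_ac)
  also have "SS (\<lambda>t. pc t \<and> qc t) X Y Z = EE X (Y/q) (Z/q) / q"
    unfolding SS_c EE_def pc_def using q_pos by (simp add: case_prod_unfold power2_eq_square conj_ac)
  also have "SS (\<lambda>t. pu t \<and> qu t) X Y Z = - EE (X/q) (Y/q) (Z/q) / q"
    unfolding SS_u EE_def pu_def using q_pos by (simp add: case_prod_unfold power2_eq_square conj_ac)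
  also have "SS (\<lambda>t. \<not> qa t \<and> \<not> qb t \<and> \<not> qc t \<and> \<not> qu t) X Y Z = EE X Y Z"
    by (simp only: EE_def)
  finally have eq: "quad_sum (quad_weight_on (insert q P)) X Y Z = EE X Y Z
     + real q / (real q - 1) * (EE (X/q) (Y/q) Z / q + EE (X/q) Y (Z/q) / q + EE X (Y/q) (Z/q) / q)
     + real q * (real q - 2) / (real q - 1)^2 * (- EE (X/q) (Y/q) (Z/q) / q)" .
  have alg: "e + real q / r * (x / q + y / q + z / q) + real q * s / r^2 * (- w / q) = e + (x + y + z) / r - s / r^2 * w"
    for e r x y z s w :: real
    using q_pos by (simp add: add_divide_distrib[symmetric])
  show ?thesis unfolding eq by (rule alg)
qed

private definition "DD X Y Z = quad_sum (quad_weight_on (insert q P)) X Y Z - quad_sum (quad_weight_on P) X Y Z"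

private lemma TT_eq: "TT = quad_sum (quad_weight_on P)"
  by (intro ext) (simp add: TT_def SS_def quad_sum_def)

text \<open>Every \<open>TT\<close> on the right is reduced by the same arbitrary \<open>w\<close>:
  if all totals were equal to \<open>w\<close>, inserting \<open>q\<close> would change nothing.
  This is why the main term survives the insertion of any number of primes.\<close>

private lemma DD_recurrence:
  fixes X Y Z w :: real
  defines "r \<equiv> 1 / (real q - 1)" and "s \<equiv> (real q - 2) / (real q - 1)^2"
  defines "n \<equiv> \<lambda>X Y Z. NN X Y Z - TT X Y Z + (1 - (1 - 1/q)^3) * w"
  shows "DD X Y Z - DD (X/q) (Y/q) (Z/q) / q =
    (r - 1/q) * (TT (X/q) (Y/q) Z - w + (TT (X/q) Y (Z/q) - w) + (TT X (Y/q) (Z/q) - w))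
    + (1/q - s) * (TT (X/q) (Y/q) (Z/q) - w)
    + ((TT (X/q/q) (Y/q) (Z/q) - w) + (TT (X/q) (Y/q/q) (Z/q) - w) + (TT (X/q) (Y/q) (Z/q/q) - w)) / q^2
    - (TT (X/q/q) (Y/q/q) (Z/q/q) - w) / q^3
    + r * (n (X/q) (Y/q) Z + n (X/q) Y (Z/q) + n X (Y/q) (Z/q)) - s * n (X/q) (Y/q) (Z/q)"
proof -
  have q1: "real q > 1" using prime_gt_1_nat[OF q] by simp
  define T' where "T' = quad_sum (quad_weight_on (insert q P))"
  have T': "T' X Y Z = EE X Y Z + r * (EE (X/q) (Y/q) Z + EE (X/q) Y (Z/q) + EE X (Y/q) (Z/q))
     - s * EE (X/q) (Y/q) (Z/q)" for X Y Z
    by (simp add: T'_def sum_quad_weight_insert r_def s_def)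
  have E: "EE X Y Z = NN X Y Z + EE (X/q) (Y/q) (Z/q) / q" for X Y Z
    using EE_recurrence[of X Y Z] by simp
  have alg1: "(e1 + r * (e2 + e3 + e4) - s * e5) - (f1 + r * (f2 + f3 + f4) - s * f5) / q
      = m1 + r * (m2 + m3 + m4) - s * m5"
    if "e1 = m1 + f1 / q" "e2 = m2 + f2 / q" "e3 = m3 + f3 / q" "e4 = m4 + f4 / q" "e5 = m5 + f5 / q"
    for e1 e2 e3 e4 e5 f1 f2 f3 f4 f5 m1 m2 m3 m4 m5 :: real
    unfolding that by (simp add: ring_distribs add_divide_distrib diff_divide_distrib)
  have 1: "T' X Y Z - T' (X/q) (Y/q) (Z/q) / q = NN X Y Z
    + r * (NN (X/q) (Y/q) Z + NN (X/q) Y (Z/q) + NN X (Y/q) (Z/q)) - s * NN (X/q) (Y/q) (Z/q)"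
    unfolding T' by (rule alg1) (rule E)+
  have 2: "DD X Y Z - DD (X/q) (Y/q) (Z/q) / q =
     NN X Y Z + r * (NN (X/q) (Y/q) Z + NN (X/q) Y (Z/q) + NN X (Y/q) (Z/q)) - s * NN (X/q) (Y/q) (Z/q)
     - TT X Y Z + TT (X/q) (Y/q) (Z/q) / q"
    unfolding DD_def TT_eq T'_def[symmetric] 1[symmetric] by (simp add: diff_divide_distrib)
  define i where "i = 1 / real q"
  define d where "d = (1 - i)^3"
  have N: "NN X Y Z = n X Y Z + TT X Y Z - (1 - d) * w" for X Y Z by (simp add: n_def d_def i_def)
  \<comment> \<open>Equivalent to \<open>1 + 3 * r - s = 1 / (1 - i)^2\<close>: the corrected
    weights at \<open>q\<close> exactly compensate the density lost by passing to
    \<open>EE\<close>.\<close>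
  have key: "(3 * r - s) * d = 2 * i - 3 * i^2 + i^3"
  proof -
    have "3 * r - s = (2 * real q - 1) / (real q - 1)^2"
      using q1 by (simp add: r_def s_def divide_simps power2_eq_square)
    moreover have "d = (real q - 1)^3 / real q^3"
      using q1 by (simp add: d_def i_def power_divide[symmetric] diff_divide_distrib)
    ultimately have "(3 * r - s) * d = (2 * real q - 1) * (real q - 1) / real q^3"
      using q1 by (simp add: power2_eq_square power3_eq_cube)
    also have "\<dots> = 2 * i - 3 * i^2 + i^3"
      using q1 by (simp add: i_def divide_simps power2_eq_square power3_eq_cube) (simp add: algebra_simps)
    finally show ?thesis .
  qed
  have alg2: "(t - (a1 + a2 + a3) * i + (b1 + b2 + b3) * i^2 - c1 * i^3)
      + r * ((n1 + a1 - (1 - d) * w) + (n2 + a2 - (1 - d) * w) + (n3 + a3 - (1 - d) * w))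
      - s * (n4 + u - (1 - d) * w) - t + u * i =
    (r - 1 * i) * (a1 - w + (a2 - w) + (a3 - w)) + (1 * i - s) * (u - w)
    + ((b1 - w) + (b2 - w) + (b3 - w)) * i^2 - (c1 - w) * i^3
    + r * (n1 + n2 + n3) - s * n4" for t a1 a2 a3 b1 b2 b3 c1 u n1 n2 n3 n4 :: real
  proof -
    have "(t - (a1 + a2 + a3) * i + (b1 + b2 + b3) * i^2 - c1 * i^3)
      + r * ((n1 + a1 - (1 - d) * w) + (n2 + a2 - (1 - d) * w) + (n3 + a3 - (1 - d) * w))
      - s * (n4 + u - (1 - d) * w) - t + u * i -
    ((r - i) * (a1 - w + (a2 - w) + (a3 - w)) + (i - s) * (u - w)
    + ((b1 - w) + (b2 - w) + (b3 - w)) * i^2 - (c1 - w) * i^3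
    + r * (n1 + n2 + n3) - s * n4) = w * ((3 * r - s) * d - (2 * i - 3 * i^2 + i^3))"
      by (simp add: algebra_simps)
    then show ?thesis unfolding key mult_1_left by simp
  qed
  have NX: "NN X Y Z = TT X Y Z - (TT (X/q) (Y/q) Z + TT (X/q) Y (Z/q) + TT X (Y/q) (Z/q)) * i
   + (TT (X/q/q) (Y/q) (Z/q) + TT (X/q) (Y/q/q) (Z/q) + TT (X/q) (Y/q) (Z/q/q)) * i^2
   - TT (X/q/q) (Y/q/q) (Z/q/q) * i^3"
    by (simp add: NN_def i_def power_one_over)
  have div: "x / q = x * i" "x / q^2 = x * i^2" "x / q^3 = x * i^3" for x :: real
    by (simp_all add: i_def power_one_over)
  show ?thesis
    apply (unfold 2)
    apply (unfold NX N[of "X/q" "Y/q" Z] N[of "X/q" Y "Z/q"] N[of X "Y/q" "Z/q"] N[of "X/q" "Y/q" "Z/q"])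
    apply (unfold div)
    apply (rule alg2)
    done
qed

private lemma DD_zero: "X < 1 \<Longrightarrow> DD X Y Z = 0"
  by (simp add: DD_def quad_sum_def quad_dom_empty)

private lemma div_q_chain:
  assumes "x > (0::real)"
  shows "0 < x / q / q / q" "x / q / q / q \<le> x / q / q" "x / q / q \<le> x / q" "x / q \<le> x"
  using assms prime_gt_0_nat[OF q] by (auto simp: field_simps)

text \<open>Each coefficient in \<open>DD_recurrence\<close>, together with the bound for
  \<open>n\<close>, is of order \<open>1 / q^2\<close>, and no bound is divided by more than
  \<open>q^3\<close>. In an error of exponent 1/4 the shift costs \<open>q powr (3/4)\<close>, in
  total \<open>q powr (-(5/4))\<close>. The coefficients add up to 68, rounded up to 72.\<close>

private lemma DD_difference_bound:
  fixes X Y Z w M R :: real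
  assumes bound: "\<And>X Y Z. 0 < X \<Longrightarrow> X \<le> R \<Longrightarrow> 0 < Y \<Longrightarrow> Y \<le> R \<Longrightarrow> 0 < Z \<Longrightarrow> Z \<le> R \<Longrightarrow>
      \<bar>TT X Y Z - w\<bar> \<le> M * (R / min X (min Y Z)) powr (1/4)" and M: "M \<ge> 0"
    and X: "0 < X" "X \<le> R" and Y: "0 < Y" "Y \<le> R" and Z: "0 < Z" "Z \<le> R"
  shows "\<bar>DD X Y Z - DD (X/q) (Y/q) (Z/q) / q\<bar> \<le> 72 * real q powr (-(5/4)) * M * (R / min X (min Y Z)) powr (1/4)"
proof -
  define D where "D = R / min X (min Y Z)"
  have q2: "real q \<ge> 2" using prime_ge_2_nat[OF q] by simp
  \<comment> \<open>A common bound for all deviations of \<open>TT\<close> that occur, at the worst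
    shift by \<open>q^3\<close>.\<close>
  define B where "B = M * (real q ^ 3 * D) powr (1/4)"
  have mn: "min X (min Y Z) > 0" using X Y Z by auto
  have B0: "B \<ge> 0" using M by (simp add: B_def)
  have eb: "\<bar>TT X' Y' Z' - w\<bar> \<le> B"
    if "X / q / q / q \<le> X'" "X' \<le> X" "Y / q / q / q \<le> Y'" "Y' \<le> Y" "Z / q / q / q \<le> Z'" "Z' \<le> Z" for X' Y' Z'
  proof -
    have pos: "0 < X'" "0 < Y'" "0 < Z'"
      using that div_q_chain(1)[OF X(1)] div_q_chain(1)[OF Y(1)] div_q_chain(1)[OF Z(1)] by linarith+
    have "min X (min Y Z) / q ^ 3 \<le> min X' (min Y' Z')"
    proof -
      have "min X (min Y Z) / q ^ 3 \<le> X / q / q / q" "min X (min Y Z) / q ^ 3 \<le> Y / q / q / q"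
        "min X (min Y Z) / q ^ 3 \<le> Z / q / q / q"
        using q2 by (auto simp: power3_eq_cube intro!: divide_right_mono)
      then show ?thesis using that by linarith
    qed
    then have "R / min X' (min Y' Z') \<le> R / (min X (min Y Z) / q ^ 3)"
      using mn pos X q2 by (intro divide_left_mono) auto
    also have "\<dots> = real q ^ 3 * D" by (simp add: D_def)
    finally have "M * (R / min X' (min Y' Z')) powr (1/4) \<le> B"
      unfolding B_def using M X pos by (intro mult_left_mono powr_mono2) auto
    moreover have "\<bar>TT X' Y' Z' - w\<bar> \<le> M * (R / min X' (min Y' Z')) powr (1/4)"
      using that pos X Y Z by (intro bound) auto
    ultimately show ?thesis by linarith
  qed
  note ch = div_q_chain[OF X(1)] div_q_chain[OF Y(1)] div_q_chain[OF Z(1)]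
  define n where "n = (\<lambda>X Y Z. NN X Y Z - TT X Y Z + (1 - (1 - 1/q)^3) * w)"
  define i where "i = 1 / real q"
  have i: "0 < i" "i \<le> 1/2" using q2 by (auto simp: i_def field_simps)
  have nb: "\<bar>n X' Y' Z'\<bar> \<le> 7 * i * B"
    if "X / q \<le> X'" "X' \<le> X" "Y / q \<le> Y'" "Y' \<le> Y" "Z / q \<le> Z'" "Z' \<le> Z" for X' Y' Z'
  proof -
    have pos: "0 < X'" "0 < Y'" "0 < Z'" using that ch by linarith+
    have low: "X / q / q / q \<le> X' / q / q" "Y / q / q / q \<le> Y' / q / q" "Z / q / q / q \<le> Z' / q / q"
      by (intro divide_right_mono; use that in simp)+
    note ch' = div_q_chain[OF pos(1)] div_q_chain[OF pos(2)] div_q_chain[OF pos(3)]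
    define a where "a = (TT (X'/q) (Y'/q) Z' - w) + (TT (X'/q) Y' (Z'/q) - w) + (TT X' (Y'/q) (Z'/q) - w)"
    define b where "b = (TT (X'/q/q) (Y'/q) (Z'/q) - w) + (TT (X'/q) (Y'/q/q) (Z'/q) - w) + (TT (X'/q) (Y'/q) (Z'/q/q) - w)"
    define c where "c = TT (X'/q/q) (Y'/q/q) (Z'/q/q) - w"
    have tri: "\<bar>x + y + z\<bar> \<le> 3 * B" if "\<bar>x\<bar> \<le> B" "\<bar>y\<bar> \<le> B" "\<bar>z\<bar> \<le> B" for x y z using that by linarith
    have "\<bar>a\<bar> \<le> 3 * B" unfolding a_def
      by (intro tri eb) (use ch' low that in linarith)+
    moreover have "\<bar>b\<bar> \<le> 3 * B" unfolding b_def
      by (intro tri eb) (use ch' low that in linarith)+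
    moreover have "\<bar>c\<bar> \<le> B" unfolding c_def
      by (intro eb) (use ch' low that in linarith)+
    moreover have "n X' Y' Z' = - (a * i) + b * i^2 - c * i^3"
    proof -
      have alg: "(t - (a1 + a2 + a3) * i + (b1 + b2 + b3) * i^2 - c1 * i^3) - t + (1 - (1 - 1 * i)^3) * w =
        - (((a1 - w) + (a2 - w) + (a3 - w)) * i) + ((b1 - w) + (b2 - w) + (b3 - w)) * i^2 - (c1 - w) * i^3"
        for t a1 a2 a3 b1 b2 b3 c1 :: real
        by (simp add: algebra_simps power2_eq_square power3_eq_cube)
      have div: "x / q = x * i" "x / q^2 = x * i^2" "x / q^3 = x * i^3" for x :: real
        by (simp_all add: i_def power_one_over)
      show ?thesis unfolding n_def NN_def a_def b_def c_def unfolding div by (rule alg)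
    qed
    moreover have "i^2 \<le> i * 1" "i^3 \<le> i * 1"
    proof -
      have "i * i \<le> 1 * 1" using i by (intro mult_mono) auto
      then have "i * (i * i) \<le> i * 1" using i by (intro mult_left_mono) auto
      then show "i^3 \<le> i * 1" by (simp add: power3_eq_cube mult.assoc)
      show "i^2 \<le> i * 1" unfolding power2_eq_square using i by (intro mult_left_mono) auto
    qed
    ultimately show ?thesis using i B0
    proof -
      assume *: "\<bar>a\<bar> \<le> 3 * B" "\<bar>b\<bar> \<le> 3 * B" "\<bar>c\<bar> \<le> B" "n X' Y' Z' = - (a * i) + b * i^2 - c * i^3" "i^2 \<le> i * 1" "i^3 \<le> i * 1"
      have "\<bar>a * i\<bar> \<le> 3 * B * i" "\<bar>b * i^2\<bar> \<le> 3 * B * (i * 1)" "\<bar>c * i^3\<bar> \<le> B * (i * 1)"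
        unfolding abs_mult using * i B0 by (intro mult_mono; simp)+
      moreover have "\<bar>- x + y - z\<bar> \<le> 7 * i * B"
        if "\<bar>x\<bar> \<le> 3 * B * i" "\<bar>y\<bar> \<le> 3 * B * (i * 1)" "\<bar>z\<bar> \<le> B * (i * 1)" for x y z
        using that by (simp add: mult_ac)
      ultimately show ?thesis unfolding *(4) by blast
    qed
  qed
  define r s where "r = 1 / (real q - 1)" and "s = (real q - 2) / (real q - 1)^2"
  have r: "0 \<le> r" "r \<le> 2 * i" using q2 by (auto simp: r_def i_def field_simps)
  have ri: "0 \<le> r - i" "r - i \<le> 2 * i^2"
    using q2 by (auto simp: r_def i_def divide_simps power2_eq_square)
  have s: "0 \<le> s" "s \<le> 2 * i"
  proof -
    show "0 \<le> s" using q2 by (simp add: s_def)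
    have "s \<le> (real q - 1) / (real q - 1)^2" unfolding s_def by (intro divide_right_mono) auto
    also have "\<dots> = r" using q2 by (simp add: r_def power2_eq_square)
    finally show "s \<le> 2 * i" using r by simp
  qed
  have si: "\<bar>i - s\<bar> \<le> 2 * i^2"
  proof -
    have "i - s = i * r^2"
      using q2 by (simp add: i_def s_def r_def divide_simps power2_eq_square) (simp add: algebra_simps)
    also have "r^2 \<le> (2 * i)^2" using r by (intro power_mono) auto
    finally have "i - s \<le> i * (2 * i)^2" using i by (simp add: mult_left_mono)
    also have "\<dots> = (4 * i) * i^2" by (simp add: power2_eq_square)
    also have "\<dots> \<le> 2 * i^2" using i by (intro mult_right_mono) auto
    finally show ?thesis using \<open>i - s = i * r^2\<close> i by (simp add: abs_le_iff)
  qed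
  have tri: "\<bar>x + y + z\<bar> \<le> 3 * b" if "\<bar>x\<bar> \<le> b" "\<bar>y\<bar> \<le> b" "\<bar>z\<bar> \<le> b" for x y z b :: real using that by linarith
  define a where "a = (TT (X/q) (Y/q) Z - w) + (TT (X/q) Y (Z/q) - w) + (TT X (Y/q) (Z/q) - w)"
  define u where "u = TT (X/q) (Y/q) (Z/q) - w"
  define b where "b = (TT (X/q/q) (Y/q) (Z/q) - w) + (TT (X/q) (Y/q/q) (Z/q) - w) + (TT (X/q) (Y/q) (Z/q/q) - w)"
  define c where "c = TT (X/q/q) (Y/q/q) (Z/q/q) - w"
  define n1 where "n1 = n (X/q) (Y/q) Z + n (X/q) Y (Z/q) + n X (Y/q) (Z/q)"
  define n2 where "n2 = n (X/q) (Y/q) (Z/q)"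
  have "\<bar>a\<bar> \<le> 3 * B" unfolding a_def by (intro tri eb) (use ch in linarith)+
  moreover have "\<bar>u\<bar> \<le> B" unfolding u_def by (intro eb) (use ch in linarith)+
  moreover have "\<bar>b\<bar> \<le> 3 * B" unfolding b_def by (intro tri eb) (use ch in linarith)+
  moreover have "\<bar>c\<bar> \<le> B" unfolding c_def by (intro eb) (use ch in linarith)+
  moreover have "\<bar>n1\<bar> \<le> 3 * (7 * i * B)" unfolding n1_def by (intro tri nb) (use ch in linarith)+
  moreover have "\<bar>n2\<bar> \<le> 7 * i * B" unfolding n2_def by (intro nb) (use ch in linarith)+
  moreover define k where "k = i^2 * B"
  ultimately have parts: "\<bar>(r - i) * a\<bar> \<le> 6 * k" "\<bar>(i - s) * u\<bar> \<le> 2 * k"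
     "\<bar>b * i^2\<bar> \<le> 3 * k" "\<bar>c * i^3\<bar> \<le> k" "\<bar>r * n1\<bar> \<le> 42 * k" "\<bar>s * n2\<bar> \<le> 14 * k"
  proof -
    assume *: "\<bar>a\<bar> \<le> 3 * B" "\<bar>u\<bar> \<le> B" "\<bar>b\<bar> \<le> 3 * B" "\<bar>c\<bar> \<le> B" "\<bar>n1\<bar> \<le> 3 * (7 * i * B)" "\<bar>n2\<bar> \<le> 7 * i * B"
    have "\<bar>(r - i) * a\<bar> \<le> (2 * i^2) * (3 * B)" unfolding abs_mult using * ri B0 by (intro mult_mono) auto
    then show "\<bar>(r - i) * a\<bar> \<le> 6 * k" by (simp add: k_def)
    have "\<bar>(i - s) * u\<bar> \<le> (2 * i^2) * B" unfolding abs_mult using * si B0 by (intro mult_mono) auto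
    then show "\<bar>(i - s) * u\<bar> \<le> 2 * k" by (simp add: k_def)
    have "\<bar>b * i^2\<bar> \<le> (3 * B) * i^2" unfolding abs_mult using * B0 by (intro mult_mono) auto
    then show "\<bar>b * i^2\<bar> \<le> 3 * k" by (simp add: k_def mult_ac)
    have "i^2 * i \<le> i^2 * 1" using i by (intro mult_left_mono) auto
    then have i3: "\<bar>i^3\<bar> \<le> i^2" using i by (simp add: power3_eq_cube power2_eq_square)
    have "\<bar>c * i^3\<bar> \<le> B * i^2" unfolding abs_mult by (intro mult_mono * i3) (use B0 in auto)
    then show "\<bar>c * i^3\<bar> \<le> k" by (simp add: k_def mult_ac)
    have "\<bar>r * n1\<bar> \<le> (2 * i) * (3 * (7 * i * B))" unfolding abs_mult using * r i B0 by (intro mult_mono) auto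
    then show "\<bar>r * n1\<bar> \<le> 42 * k" by (simp add: k_def power2_eq_square mult_ac)
    have "\<bar>s * n2\<bar> \<le> (2 * i) * (7 * i * B)" unfolding abs_mult using * s i B0 by (intro mult_mono) auto
    then show "\<bar>s * n2\<bar> \<le> 14 * k" by (simp add: k_def power2_eq_square mult_ac)
  qed
  have eq: "DD X Y Z - DD (X/q) (Y/q) (Z/q) / q = (r - i) * a + (i - s) * u + b * i^2 - c * i^3 + r * n1 - s * n2"
    unfolding DD_recurrence[of X Y Z w] r_def s_def n_def a_def u_def b_def c_def n1_def n2_def i_def power_one_over
    by (simp only: times_divide_eq_right mult_1_right of_nat_power)
  have comb: "\<bar>x1 + x2 + x3 - x4 + x5 - x6\<bar> \<le> 68 * k"
    if "\<bar>x1\<bar> \<le> 6 * k" "\<bar>x2\<bar> \<le> 2 * k" "\<bar>x3\<bar> \<le> 3 * k" "\<bar>x4\<bar> \<le> k" "\<bar>x5\<bar> \<le> 42 * k" "\<bar>x6\<bar> \<le> 14 * k"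
    for x1 x2 x3 x4 x5 x6 :: real using that by linarith
  have "\<bar>DD X Y Z - DD (X/q) (Y/q) (Z/q) / q\<bar> \<le> 68 * (i^2 * B)"
    unfolding eq k_def[symmetric] by (rule comb[OF parts])
  also have "\<dots> \<le> 72 * (i^2 * B)" using B0 by simp
  also have "i^2 * B = real q powr (-(5/4)) * M * D powr (1/4)"
  proof -
    have "(real q ^ 3 * D) powr (1/4) = real q powr (3/4) * D powr (1/4)"
    proof -
      have e: "real q ^ 3 = real q powr 3" using q2 by simp
      show ?thesis unfolding e powr_mult powr_powr using q2 X mn by (simp add: D_def)
    qed
    moreover have "i^2 = real q powr (-2)"
      using q2 by (simp add: i_def power_one_over powr_minus_divide)
    moreover have "real q powr (-2) * real q powr (3/4) = real q powr (-(5/4))"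
      by (simp add: powr_add[symmetric])
    ultimately show ?thesis by (simp add: B_def mult_ac)
  qed
  finally show ?thesis by (simp add: D_def mult_ac)
qed

text \<open>Iteration of the recurrence until \<open>X < 1\<close>, where \<open>DD\<close>
  vanishes. One step multiplies the bound by \<open>q powr (1/4) / q \<le> 3/4\<close>, so the
  geometric series contributes a factor 4 and \<open>288 = 4 * 72\<close>.\<close>

private lemma DD_bound:
  fixes w M R :: real
  assumes bound: "\<And>X Y Z. 0 < X \<Longrightarrow> X \<le> R \<Longrightarrow> 0 < Y \<Longrightarrow> Y \<le> R \<Longrightarrow> 0 < Z \<Longrightarrow> Z \<le> R \<Longrightarrow>
      \<bar>TT X Y Z - w\<bar> \<le> M * (R / min X (min Y Z)) powr (1/4)" and M: "M \<ge> 0"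
  shows "0 < X \<Longrightarrow> X \<le> R \<Longrightarrow> 0 < Y \<Longrightarrow> Y \<le> R \<Longrightarrow> 0 < Z \<Longrightarrow> Z \<le> R \<Longrightarrow> X < real q ^ m \<Longrightarrow>
     \<bar>DD X Y Z\<bar> \<le> 288 * real q powr (-(5/4)) * M * (R / min X (min Y Z)) powr (1/4)"
proof (induction m arbitrary: X Y Z)
  case 0
  then show ?case using M by (simp add: DD_zero)
next
  case (Suc m)
  have q2: "real q \<ge> 2" using prime_ge_2_nat[OF q] by simp
  define D where "D = R / min X (min Y Z)"
  define e where "e = real q powr (-(5/4)) * M * D powr (1/4)"
  have e: "e \<ge> 0" using M by (simp add: e_def)
  have D': "R / min (X/q) (min (Y/q) (Z/q)) = q * D"
  proof -
    have "min (X/q) (min (Y/q) (Z/q)) = min X (min Y Z) / q"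
      using q2 by (simp add: min_def divide_le_cancel)
    then show ?thesis by (simp add: D_def)
  qed
  have "\<bar>DD (X/q) (Y/q) (Z/q)\<bar> \<le> 288 * real q powr (-(5/4)) * M * (q * D) powr (1/4)"
    unfolding D'[symmetric]
  proof (rule Suc.IH)
    show "X / q < real q ^ m" using Suc.prems(7) q2 by (simp add: field_simps)
    show "X / q \<le> R" "Y / q \<le> R" "Z / q \<le> R"
      using div_q_chain(4)[of X] div_q_chain(4)[of Y] div_q_chain(4)[of Z] Suc.prems by linarith+
  qed (use Suc.prems q2 in auto)
  also have "(q * D) powr (1/4) = real q powr (1/4) * D powr (1/4)"
    by (rule powr_mult)
  finally have 1: "\<bar>DD (X/q) (Y/q) (Z/q)\<bar> \<le> 288 * real q powr (1/4) * e" by (simp add: e_def mult_ac)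
  have "\<bar>DD (X/q) (Y/q) (Z/q) / q\<bar> \<le> 288 * real q powr (1/4) * e / q"
    unfolding abs_divide using 1 q2 by (simp add: divide_right_mono)
  also have "\<dots> = 288 * e * (real q powr (1/4) / q)" by simp
  also have "real q powr (1/4) / q = real q powr (-(3/4))" using q2 powr_diff[of "real q" "1/4" 1] by simp
  also have "\<dots> \<le> 2 powr (-(3/4))" using q2 by (intro powr_neg_antimono) auto
  also have "\<dots> \<le> (2::real) powr (-(1/2))" by (intro powr_mono) auto
  also have "\<dots> = 1 / sqrt 2" by (simp add: powr_minus_divide powr_half_sqrt)
  also have "\<dots> \<le> 3/4"
  proof -
    have "4 / 3 \<le> sqrt (2::real)" by (intro real_le_rsqrt) (simp add: power2_eq_square)
    then show ?thesis by (simp add: field_simps)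
  qed
  finally have "\<bar>DD (X/q) (Y/q) (Z/q) / q\<bar> \<le> 288 * e * (3/4)" using e by (simp add: mult_left_mono)
  moreover have "\<bar>DD X Y Z - DD (X/q) (Y/q) (Z/q) / q\<bar> \<le> 72 * e"
    using DD_difference_bound[OF bound M, of X Y Z] Suc.prems by (simp add: e_def D_def mult_ac)
  ultimately have "\<bar>DD X Y Z\<bar> \<le> 288 * e" by linarith
  then show ?case by (simp add: e_def D_def mult_ac)
qed

text \<open>The main value \<open>w\<close> and the shape of the error are reproduced, only the
  constant grows, by a factor whose product over all primes converges. This is the step of an
  induction over the set of primes.\<close>

lemma quad_sum_insert_bound:
  fixes w M R :: real
  assumes bound: "\<And>X Y Z. 0 < X \<Longrightarrow> X \<le> R \<Longrightarrow> 0 < Y \<Longrightarrow> Y \<le> R \<Longrightarrow> 0 < Z \<Longrightarrow> Z \<le> R \<Longrightarrow>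
      \<bar>quad_sum (quad_weight_on P) X Y Z - w\<bar> \<le> M * (R / min X (min Y Z)) powr (1/4)" and M: "M \<ge> 0"
    and X: "0 < X" "X \<le> R" "0 < Y" "Y \<le> R" "0 < Z" "Z \<le> R"
  shows "\<bar>quad_sum (quad_weight_on (insert q P)) X Y Z - w\<bar>
    \<le> M * (1 + 288 * real q powr (-(5/4))) * (R / min X (min Y Z)) powr (1/4)"
proof -
  have "1 < real q" using prime_gt_1_nat[OF q] by simp
  then obtain m where m: "X < real q ^ m" using real_arch_pow by blast
  have "\<bar>DD X Y Z\<bar> \<le> 288 * real q powr (-(5/4)) * M * (R / min X (min Y Z)) powr (1/4)"
    by (rule DD_bound[OF bound[folded TT_eq] M X m])
  moreover have "\<bar>quad_sum (quad_weight_on P) X Y Z - w\<bar> \<le> M * (R / min X (min Y Z)) powr (1/4)"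
    by (rule bound[OF X])
  ultimately show ?thesis unfolding DD_def by (simp add: algebra_simps) linarith
qed

end

section \<open>Uniformity of the quadruple sum in the set of primes\<close>

lemma sum_primes_powr_le:
  assumes "finite P" "\<And>p. p \<in> P \<Longrightarrow> p \<ge> 1" "a > 0"
  shows "(\<Sum>p\<in>P. real p powr (- 1 - a)) \<le> 1 + 1 / a"
proof -
  have "(\<Sum>p\<in>P. real p powr (- 1 - a)) \<le> (\<Sum>p\<in>nats_le (real (Max (insert 1 P))). real p powr (- 1 - a))"
    using assms by (intro sum_mono2) (auto simp: nats_le_def)
  also have "\<dots> \<le> 1 + 1 / a" by (rule sum_nats_le_powr_bounded[OF assms(3)])
  finally show ?thesis .
qed

lemma prod_primes_bounded:
  fixes f :: "nat \<Rightarrow> real"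
  assumes "finite P" "\<And>p. p \<in> P \<Longrightarrow> p \<ge> 1" "a > 0" "c \<ge> 0"
    "\<And>p. p \<in> P \<Longrightarrow> 0 \<le> f p \<and> f p \<le> 1 + c * real p powr (- 1 - a)"
  shows "(\<Prod>p\<in>P. f p) \<le> exp (c * (1 + 1 / a))"
proof -
  have "(\<Prod>p\<in>P. f p) \<le> (\<Prod>p\<in>P. exp (c * real p powr (- 1 - a)))"
    using assms(5) exp_ge_add_one_self by (intro prod_mono) (metis order_trans)
  also have "\<dots> = exp (c * (\<Sum>p\<in>P. real p powr (- 1 - a)))"
    using assms(1) by (simp add: exp_sum sum_distrib_left)
  also have "\<dots> \<le> exp (c * (1 + 1 / a))"
    using sum_primes_powr_le[OF assms(1,2,3)] assms(4) by (simp add: mult_left_mono)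
  finally show ?thesis .
qed

text \<open>Induction on \<open>P\<close> with arbitrary bounds \<open>X\<close>, \<open>Y\<close>,
  \<open>Z\<close>, because inserting one prime refers to the previous sum at smaller bounds. The
  constant does not depend on \<open>P\<close>, so \<open>P\<close> may later consist of all primes
  up to \<open>R\<close>.\<close>

lemma quad_sum_primes_asymp:
  "\<exists>C\<ge>0. \<forall>R P. R > 0 \<longrightarrow> ln R \<ge> 1 \<longrightarrow> finite P \<longrightarrow> (\<forall>p\<in>P. prime p) \<longrightarrow>
    \<bar>quad_sum (quad_weight_on P) R R R - 3 / 4 * (ln R)\<^sup>2\<bar> \<le> C * ln R"
proof -
  from quad_sum_asymp obtain C where C: "C \<ge> 0" "\<And>R X Y Z. ln R \<ge> 1 \<Longrightarrow> 0 < X \<Longrightarrow> X \<le> R \<Longrightarrow> 0 < Y \<Longrightarrow> Y \<le> R \<Longrightarrow> 0 < Z \<Longrightarrow> Z \<le> R \<Longrightarrow>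
    \<bar>quad_sum quad_weight X Y Z - 3 / 4 * (ln R)\<^sup>2\<bar> \<le> C * ln R * (R / min X (min Y Z)) powr (1/4)" by blast
  have "\<bar>quad_sum (quad_weight_on P) R R R - 3 / 4 * (ln R)\<^sup>2\<bar> \<le> C * exp (288 * 5) * ln R"
    if Rpos: "R > 0" and R: "ln R \<ge> 1" and P: "finite P" "\<forall>p\<in>P. prime p" for R P
  proof -
    define f where "f p = 1 + 288 * real p powr (-(5/4))" for p :: nat
    have f0: "(\<Prod>p\<in>P. f p) \<ge> 0" for P by (intro prod_nonneg) (simp add: f_def)
    have "\<bar>quad_sum (quad_weight_on P) X Y Z - 3 / 4 * (ln R)\<^sup>2\<bar> \<le>
        (C * ln R * (\<Prod>p\<in>P. f p)) * (R / min X (min Y Z)) powr (1/4)"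
      if "0 < X" "X \<le> R" "0 < Y" "Y \<le> R" "0 < Z" "Z \<le> R" for X Y Z
      using P that
    proof (induction P arbitrary: X Y Z rule: finite_induct)
      case empty
      have "quad_weight_on {} = quad_weight" by (intro ext) (simp add: quad_weight_on_def)
      then show ?case using C(2)[OF R] empty by simp
    next
      case (insert q P)
      have "\<bar>quad_sum (quad_weight_on (insert q P)) X Y Z - 3 / 4 * (ln R)\<^sup>2\<bar>
        \<le> (C * ln R * (\<Prod>p\<in>P. f p)) * (1 + 288 * real q powr (-(5/4))) * (R / min X (min Y Z)) powr (1/4)"
      proof (rule quad_sum_insert_bound)
        show "0 \<le> C * ln R * (\<Prod>p\<in>P. f p)" using C R f0[of P] by simp
      qed (use insert in auto)
      then show ?case using insert by (simp add: f_def mult_ac)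
    qed
    from this[of R R R] have "\<bar>quad_sum (quad_weight_on P) R R R - 3 / 4 * (ln R)\<^sup>2\<bar> \<le> C * ln R * (\<Prod>p\<in>P. f p)"
      using Rpos by simp
    also have "(\<Prod>p\<in>P. f p) \<le> exp (288 * (1 + 1 / (1/4)))"
      using P by (intro prod_primes_bounded) (auto simp: f_def Suc_le_eq prime_gt_0_nat)
    then have "C * ln R * (\<Prod>p\<in>P. f p) \<le> C * ln R * exp (288 * (1 + 1 / (1/4)))"
      using C R by (intro mult_left_mono) auto
    finally show ?thesis by (simp add: mult_ac)
  qed
  then show ?thesis using C by (intro exI[of _ "C * exp (288 * 5)"]) auto
qed

section \<open>The sum of 1/\<phi>(q) over squarefree q\<close>

text \<open>One-variable counterpart of \<open>quad_local\<close>: the factor at \<open>p\<close>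
  that turns \<open>1 / n\<close> into \<open>1/\<phi>(n)\<close> on squarefree \<open>n\<close> and
  kills the other \<open>n\<close>.\<close>

definition sqf_local :: "nat \<Rightarrow> nat \<Rightarrow> real" where
  "sqf_local p n = (if p\<^sup>2 dvd n then 0 else if p dvd n then real p / (real p - 1) else 1)"

definition sqf_sum :: "nat set \<Rightarrow> real \<Rightarrow> real" where
  "sqf_sum P x = (\<Sum>n\<in>nats_le x. (\<Prod>p\<in>P. sqf_local p n) / real n)"

lemma nats_le_shift:
  fixes f :: "nat \<Rightarrow> real"
  assumes "q > 0"
  shows "(\<Sum>n | n \<in> nats_le x \<and> q dvd n. f n) = (\<Sum>n\<in>nats_le (x / real q). f (q * n))"
  using assms
  by (intro sum.reindex_bij_witness[where i = "\<lambda>n. q * n" and j = "\<lambda>n. n div q"])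
     (auto simp: nats_le_def field_simps elim!: dvdE)

text \<open>The new factor is 1, plus \<open>1 / (q - 1)\<close> where \<open>q dvd n\<close>, minus
  \<open>q / (q - 1)\<close> where \<open>q * q dvd n\<close>. After the shifts both corrections
  carry the weight \<open>1 / (q * (q - 1))\<close>, so constants cancel.\<close>

lemma sqf_sum_insert:
  assumes P: "finite P" "\<And>p. p \<in> P \<Longrightarrow> prime p" and q: "prime q" "q \<notin> P"
  shows "sqf_sum (insert q P) x = sqf_sum P x + (sqf_sum P (x / q) - sqf_sum P (x / q / q)) / (real q * (real q - 1))"
proof -
  define g where "g n = (\<Prod>p\<in>P. sqf_local p n)" for n
  have q1: "real q > 1" using prime_gt_1_nat[OF q(1)] by simp
  have gq: "g (q * n) = g n" for n
    unfolding g_def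
  proof (intro prod.cong refl)
    fix p assume "p \<in> P"
    then have "coprime p q" using P q by (auto intro: primes_coprime)
    then show "sqf_local p (q * n) = sqf_local p n"
      by (simp add: sqf_local_def coprime_dvd_mult_right_iff)
  qed
  have loc: "sqf_local q n = 1 + (if q dvd n then 1 / (real q - 1) else 0) - (if q * q dvd n then real q / (real q - 1) else 0)" for n
    using q1 dvd_mult_left[of q q n] by (auto simp: sqf_local_def power2_eq_square field_simps)
  have filt: "(\<Sum>n\<in>nats_le x. if d dvd n then f n else 0) = (\<Sum>n | n \<in> nats_le x \<and> d dvd n. f n)" for d and f :: "nat \<Rightarrow> real"
    by (simp add: sum.If_cases Collect_conj_eq)
  have "sqf_sum (insert q P) x = (\<Sum>n\<in>nats_le x. g n / n + (if q dvd n then 1 / (real q - 1) * (g n / n) else 0)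
      - (if q * q dvd n then real q / (real q - 1) * (g n / n) else 0))"
    unfolding sqf_sum_def using P q
    by (intro sum.cong refl) (simp add: g_def[symmetric] loc ring_distribs add_divide_distrib diff_divide_distrib)
  also have "\<dots> = sqf_sum P x + (\<Sum>n\<in>nats_le (x / q). 1 / (real q - 1) * (g (q * n) / real (q * n)))
     - (\<Sum>n\<in>nats_le (x / real (q * q)). real q / (real q - 1) * (g (q * q * n) / real (q * q * n)))"
    using q1 by (simp add: sum.distrib sum_subtractf filt nats_le_shift sqf_sum_def g_def[symmetric] del: of_nat_mult)
  also have "(\<Sum>n\<in>nats_le (x / q). 1 / (real q - 1) * (g (q * n) / real (q * n))) = sqf_sum P (x / q) / (real q * (real q - 1))"
    unfolding sqf_sum_def sum_divide_distrib g_def[symmetric] gq by (intro sum.cong refl) (simp add: mult_ac)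
  also have "(\<Sum>n\<in>nats_le (x / real (q * q)). real q / (real q - 1) * (g (q * q * n) / real (q * q * n))) =
      sqf_sum P (x / q / q) / (real q * (real q - 1))"
    unfolding sqf_sum_def sum_divide_distrib g_def[symmetric] mult.assoc gq
    using q1 by (intro sum.cong) (simp_all add: mult_ac)
  finally show ?thesis by (simp add: diff_divide_distrib)
qed

text \<open>The same induction over primes as for the quadruple sum: shifts of the bound by at most
  \<open>q^2\<close> cost \<open>q powr (1/2)\<close> against a denominator of order
  \<open>q^2\<close>, so the constants grow by a convergent product. The induction carries the error
  \<open>(R / x) powr (1/4)\<close> for all \<open>x \<le> R\<close>.\<close>

lemma sqf_sum_asymp:
  "\<exists>C\<ge>0. \<forall>R P. R \<ge> 1 \<longrightarrow> finite P \<longrightarrow> (\<forall>p\<in>P. prime p) \<longrightarrow> \<bar>sqf_sum P R - ln R\<bar> \<le> C"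
proof -
  from harm_sum_asymp obtain g C where C: "C \<ge> 0"
    "\<And>x. x > 0 \<Longrightarrow> \<bar>harm_sum x - ln x - g\<bar> \<le> C * x powr (-(1/4))" by blast
  define K where "K = 4 + \<bar>g\<bar> + C"
  have K: "K \<ge> 0" using C by (simp add: K_def)
  have base: "\<bar>harm_sum x - ln R\<bar> \<le> K * (R / x) powr (1/4)" if R: "R \<ge> 1" and x: "0 < x" "x \<le> R" for R x
  proof -
    define D where "D = R / x"
    have D: "D \<ge> 1" using x by (simp add: D_def)
    have D4: "D powr (1/4) \<ge> 1" using D by (simp add: ge_one_powr_ge_zero)
    have lnD: "ln D \<le> 4 * D powr (1/4)" "ln D = ln R - ln x"
      using ln_le_powr_quarter[of D] D R x by (simp_all add: D_def ln_div)
    show ?thesis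
    proof (cases "x < 1")
      case True
      then have "\<bar>harm_sum x - ln R\<bar> \<le> ln D" using R x lnD by (simp add: harm_sum_def)
      also have "\<dots> \<le> 4 * D powr (1/4)" by (rule lnD)
      also have "\<dots> \<le> K * D powr (1/4)" using C by (intro mult_right_mono) (auto simp: K_def)
      finally show ?thesis by (simp add: D_def)
    next
      case False
      then have "x powr (-(1/4)) \<le> 1" using powr_neg_antimono[of 1 x "1/4"] by simp
      then have "C * x powr (-(1/4)) \<le> C * 1" using C by (intro mult_left_mono) auto
      then have "\<bar>harm_sum x - ln x - g\<bar> \<le> C" using C(2)[of x] x by simp
      moreover have "ln D \<ge> 0" using D by simp
      ultimately have "\<bar>harm_sum x - ln R\<bar> \<le> 4 * D powr (1/4) + (\<bar>g\<bar> + C) * 1" using lnD by simp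
      also have "\<dots> \<le> 4 * D powr (1/4) + (\<bar>g\<bar> + C) * D powr (1/4)" using D4 C by (intro add_left_mono mult_left_mono) auto
      finally show ?thesis by (simp add: D_def K_def algebra_simps)
    qed
  qed
  have "\<bar>sqf_sum P R - ln R\<bar> \<le> K * exp (4 * 3)" if R: "R \<ge> 1" and P: "finite P" "\<forall>p\<in>P. prime p" for R P
  proof -
    define f where "f p = 1 + 4 * real p powr (-1 - 1/2)" for p :: nat
    have "\<bar>sqf_sum P x - ln R\<bar> \<le> (K * (\<Prod>p\<in>P. f p)) * (R / x) powr (1/4)"
      if "0 < x" "x \<le> R" for x
      using P that
    proof (induction P arbitrary: x rule: finite_induct)
      case empty
      then show ?case using base[OF R] by (simp add: sqf_sum_def harm_sum_def)
    next
      case (insert q P)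
      define M where "M = K * (\<Prod>p\<in>P. f p)"
      have M: "M \<ge> 0" unfolding M_def by (intro mult_nonneg_nonneg K prod_nonneg) (simp add: f_def)
      define D where "D = (R / x) powr (1/4)"
      have D: "D \<ge> 0" by (simp add: D_def)
      have q2: "real q \<ge> 2" using prime_ge_2_nat[of q] insert by simp
      have x: "x / q / q \<le> x / q" "x / q \<le> x" "0 < x / q / q" "0 < x / q" using insert.prems q2 by (auto simp: field_simps)
      have ih: "\<bar>sqf_sum P y - ln R\<bar> \<le> M * (R / y) powr (1/4)" if "0 < y" "y \<le> R" for y
        using insert that by (simp add: M_def)
      have sh: "\<bar>sqf_sum P y - ln R\<bar> \<le> M * (real q powr (1/2) * D)" if "y = x / q \<or> y = x / q / q" for y
      proof -
        have y: "0 < y" "y \<le> x" "x / q / q \<le> y" using that x by auto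
        have "R / y \<le> R / (x / q / q)" by (rule frac_le) (use y x R in linarith)+
        also have "\<dots> = real q ^ 2 * (R / x)" by (simp add: power2_eq_square)
        finally have "(R / y) powr (1/4) \<le> (real q ^ 2 * (R / x)) powr (1/4)" using y R by (intro powr_mono2) auto
        also have "\<dots> = (real q powr 2) powr (1/4) * D" unfolding powr_mult D_def using q2 by simp
        also have "(real q powr 2) powr (1/4) = real q powr (1/2)" unfolding powr_powr by simp
        finally have "M * (R / y) powr (1/4) \<le> M * (real q powr (1/2) * D)" using M by (intro mult_left_mono) auto
        moreover have "\<bar>sqf_sum P y - ln R\<bar> \<le> M * (R / y) powr (1/4)" using y insert.prems by (intro ih) auto
        ultimately show ?thesis by linarith
      qed
      have "\<bar>sqf_sum P (x / q) - sqf_sum P (x / q / q)\<bar> \<le> 2 * (M * (real q powr (1/2) * D))"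
        using sh[of "x / q"] sh[of "x / q / q"] by simp
      then have "\<bar>(sqf_sum P (x / q) - sqf_sum P (x / q / q)) / (real q * (real q - 1))\<bar> \<le>
         2 * (M * (real q powr (1/2) * D)) / (real q * (real q - 1))"
        unfolding abs_divide using q2 by (simp add: divide_right_mono)
      also have "\<dots> \<le> 2 * (M * (real q powr (1/2) * D)) / (real q * (real q / 2))"
        using q2 M D by (intro divide_left_mono mult_left_mono) auto
      also have "\<dots> = 4 * M * D * (real q powr (1/2) / real q ^ 2)" by (simp add: power2_eq_square)
      also have "real q powr (1/2) / real q ^ 2 = real q powr (-1 - 1/2)"
        using q2 powr_diff[of "real q" "1/2" 2] by simp
      finally have "\<bar>(sqf_sum P (x / q) - sqf_sum P (x / q / q)) / (real q * (real q - 1))\<bar> \<le> 4 * M * D * real q powr (-1 - 1/2)" .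
      moreover have "\<bar>sqf_sum P x - ln R\<bar> \<le> M * D" unfolding D_def using insert.prems by (intro ih) auto
      moreover have "sqf_sum (insert q P) x - ln R = (sqf_sum P x - ln R) + (sqf_sum P (x / q) - sqf_sum P (x / q / q)) / (real q * (real q - 1))"
        using insert by (subst sqf_sum_insert) auto
      ultimately have "\<bar>sqf_sum (insert q P) x - ln R\<bar> \<le> M * D + 4 * M * D * real q powr (-1 - 1/2)" by linarith
      then show ?case using insert by (simp add: M_def D_def f_def algebra_simps)
    qed
    from this[of R] have "\<bar>sqf_sum P R - ln R\<bar> \<le> K * (\<Prod>p\<in>P. f p)" using R by simp
    also have "(\<Prod>p\<in>P. f p) \<le> exp (4 * (1 + 1 / (1/2)))"
      using P by (intro prod_primes_bounded) (auto simp: f_def Suc_le_eq prime_gt_0_nat)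
    then have "K * (\<Prod>p\<in>P. f p) \<le> K * exp (4 * (1 + 1 / (1/2)))" using K by (intro mult_left_mono)
    finally show ?thesis by simp
  qed
  then show ?thesis using K by (intro exI[of _ "K * exp (4 * 3)"]) auto
qed

definition primes_le :: "real \<Rightarrow> nat set" where
  "primes_le R = {p. prime p \<and> real p \<le> R}"

text \<open>A squarefree number \<open>q \<le> R\<close> is encoded by its set of prime factors.\<close>

definition sqf_sets :: "real \<Rightarrow> nat set set" where
  "sqf_sets R = {S. S \<subseteq> primes_le R \<and> real (\<Prod>S) \<le> R}"

lemma finite_primes_le [simp, intro]: "finite (primes_le R)"
  by (rule finite_subset[OF _ finite_nats_le[of R]]) (auto simp: primes_le_def nats_le_def Suc_le_eq prime_gt_0_nat)

lemma finite_sqf_sets [simp, intro]: "finite (sqf_sets R)"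
  by (rule finite_subset[of _ "Pow (primes_le R)"]) (auto simp: sqf_sets_def)

lemma sqf_setsD:
  assumes "S \<in> sqf_sets R"
  shows "finite S" "\<And>p. p \<in> S \<Longrightarrow> prime p" "real (\<Prod>S) \<le> R" "S \<subseteq> primes_le R"
proof -
  show S: "S \<subseteq> primes_le R" "real (\<Prod>S) \<le> R" using assms by (simp_all only: sqf_sets_def mem_Collect_eq)
  show "finite S" by (rule finite_subset[OF S(1)]) simp
  show "\<And>p. p \<in> S \<Longrightarrow> prime p" using S(1) by (auto simp: primes_le_def)
qed

lemma prime_factors_in_sqf_sets:
  assumes "squarefree q" "real q \<le> R"
  shows "prime_factors q \<in> sqf_sets R"
proof -
  have "q \<noteq> 0" using assms(1) by (metis not_squarefree_0)
  then have "real p \<le> R" if "p dvd q" for p using dvd_imp_le[OF that] assms(2) by linarith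
  then show ?thesis using squarefree_eq_prod_prime_factors[OF assms(1)] assms(2)
    by (auto simp: sqf_sets_def primes_le_def simp del: of_nat_prod)
qed

lemma sum_squarefree_eq_sum_sqf_sets:
  fixes f :: "nat set \<Rightarrow> real"
  shows "(\<Sum>q | squarefree q \<and> real q \<le> R. f (prime_factors q)) = (\<Sum>S\<in>sqf_sets R. f S)"
  by (rule sum.reindex_bij_witness[where i = "\<lambda>S. \<Prod>S" and j = prime_factors])
     (auto simp: squarefree_eq_prod_prime_factors prime_factors_in_sqf_sets prime_factors_prod_primes
        squarefree_prod_primes sqf_setsD simp del: of_nat_prod)

definition totient_sum :: "real \<Rightarrow> real" where
  "totient_sum R = (\<Sum>S\<in>sqf_sets R. \<Prod>p\<in>S. 1 / (real p - 1))"

text \<open>If \<open>p^2\<close> divides some \<open>n \<le> R\<close> then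
  \<open>p \<le> R\<close>, so the primes up to \<open>R\<close> detect every non-squarefree
  \<open>n\<close> in range.\<close>

lemma totient_sum_eq_sqf_sum: "totient_sum R = sqf_sum (primes_le R) R"
proof -
  have "sqf_sum (primes_le R) R = (\<Sum>n | squarefree n \<and> real n \<le> R. (\<Prod>p\<in>primes_le R. sqf_local p n) / real n)"
    unfolding sqf_sum_def
  proof (rule sum.mono_neutral_right)
    show "{n. squarefree n \<and> real n \<le> R} \<subseteq> nats_le R"
      by (auto simp: nats_le_def Suc_le_eq) (metis gr0I not_squarefree_0)
    show "\<forall>n\<in>nats_le R - {n. squarefree n \<and> real n \<le> R}. (\<Prod>p\<in>primes_le R. sqf_local p n) / real n = 0"
    proof
      fix n assume n: "n \<in> nats_le R - {n. squarefree n \<and> real n \<le> R}"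
      then have n0: "n \<noteq> 0" "real n \<le> R" "\<not> squarefree n" by (auto simp: nats_le_def)
      then obtain p where p: "prime p" "p\<^sup>2 dvd n" by (auto simp: squarefree_factorial_semiring)
      then have "p dvd n" by (metis dvd_mult_left power2_eq_square)
      then have "p \<le> n" using n0 by (auto dest: dvd_imp_le)
      then have "p \<in> primes_le R" using p n0 by (auto simp: primes_le_def)
      then show "(\<Prod>p\<in>primes_le R. sqf_local p n) / real n = 0" using p
        by (auto simp: sqf_local_def intro!: prod_zero)
    qed
  qed auto
  also have "\<dots> = (\<Sum>n | squarefree n \<and> real n \<le> R. \<Prod>p\<in>prime_factors n. 1 / (real p - 1))"
  proof (intro sum.cong refl)
    fix n assume n: "n \<in> {n. squarefree n \<and> real n \<le> R}"
    have n0: "n \<noteq> 0" using n by (cases "n = 0") auto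
    have sub: "prime_factors n \<subseteq> primes_le R" using prime_factors_in_sqf_sets[of n R] n by (auto simp: sqf_sets_def)
    have "(\<Prod>p\<in>primes_le R. sqf_local p n) = (\<Prod>p\<in>prime_factors n. sqf_local p n)"
    proof (rule prod.mono_neutral_right)
      show "\<forall>p\<in>primes_le R - prime_factors n. sqf_local p n = 1"
        using n0 by (auto simp: sqf_local_def primes_le_def prime_factors_dvd dest: dvd_mult_left simp: power2_eq_square)
    qed (use sub in auto)
    also have "\<dots> = (\<Prod>p\<in>prime_factors n. real p * (1 / (real p - 1)))"
    proof (intro prod.cong refl)
      fix p assume p: "p \<in> prime_factors n"
      then have pp: "prime p" "p dvd n" by auto
      then have "\<not> p\<^sup>2 dvd n" using n not_prime_unit squarefreeD[of n p] by auto
      then show "sqf_local p n = real p * (1 / (real p - 1))" using pp by (simp add: sqf_local_def)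
    qed
    also have "\<dots> = real n * (\<Prod>p\<in>prime_factors n. 1 / (real p - 1))"
      using squarefree_eq_prod_prime_factors[of n] n by (simp only: prod.distrib flip: of_nat_prod) simp
    finally show "(\<Prod>p\<in>primes_le R. sqf_local p n) / real n = (\<Prod>p\<in>prime_factors n. 1 / (real p - 1))"
      using n0 by simp
  qed
  also have "\<dots> = totient_sum R" unfolding totient_sum_def by (rule sum_squarefree_eq_sum_sqf_sets)
  finally show ?thesis by simp
qed

lemma totient_sum_asymp: "\<exists>C\<ge>0. \<forall>R\<ge>1. \<bar>totient_sum R - ln R\<bar> \<le> C"
proof -
  from sqf_sum_asymp obtain C where C: "C \<ge> 0" "\<And>R P. R \<ge> 1 \<Longrightarrow> finite P \<Longrightarrow> (\<forall>p\<in>P. prime p) \<Longrightarrow> \<bar>sqf_sum P R - ln R\<bar> \<le> C"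
    by blast
  have "\<bar>totient_sum R - ln R\<bar> \<le> C" if "R \<ge> 1" for R
    unfolding totient_sum_eq_sqf_sum by (rule C(2)[OF that finite_primes_le]) (auto simp: primes_le_def)
  with C(1) show ?thesis by blast
qed

section \<open>Averages over a full period and local correlations\<close>

text \<open>Chinese remainder theorem: the map to the pair of residues is injective by coprimality
  and onto by counting.\<close>

lemma sum_mult_coprime_periods:
  fixes f g :: "nat \<Rightarrow> real"
  assumes cop: "coprime m k" and pos: "m > 0" "k > 0"
    and f: "\<And>n. f (n mod m) = f n" and g: "\<And>n. g (n mod k) = g n"
  shows "(\<Sum>n<m * k. f n * g n) = (\<Sum>n<m. f n) * (\<Sum>n<k. g n)"
proof -
  define h where "h n = (n mod m, n mod k)" for n
  have inj: "inj_on h {..<m * k}"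
  proof (rule inj_onI)
    fix x y assume xy: "x \<in> {..<m * k}" "y \<in> {..<m * k}" "h x = h y"
    then have "[x = y] (mod m)" "[x = y] (mod k)" by (auto simp: h_def Cong.cong_def)
    then have "[x = y] (mod m * k)" using cop by (simp add: coprime_cong_mult_nat)
    then show "x = y" using xy by (simp add: Cong.cong_def)
  qed
  have img: "h ` {..<m * k} = {..<m} \<times> {..<k}"
  proof (rule card_subset_eq)
    show "h ` {..<m * k} \<subseteq> {..<m} \<times> {..<k}" using pos by (auto simp: h_def)
    show "card (h ` {..<m * k}) = card ({..<m} \<times> {..<k})"
      using inj by (simp add: card_image)
  qed auto
  have "(\<Sum>n<m * k. f n * g n) = (\<Sum>n<m * k. (\<lambda>(a, b). f a * g b) (h n))"
    by (simp add: h_def f g)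
  also have "\<dots> = (\<Sum>(a, b)\<in>{..<m} \<times> {..<k}. f a * g b)"
    unfolding img[symmetric] by (subst sum.reindex[OF inj]) simp
  also have "\<dots> = (\<Sum>n<m. f n) * (\<Sum>n<k. g n)"
    by (simp add: sum_product sum.cartesian_product)
  finally show ?thesis .
qed

lemma sum_prod_periodic_primes:
  fixes F :: "nat \<Rightarrow> nat \<Rightarrow> real"
  assumes "finite P" "\<And>p. p \<in> P \<Longrightarrow> prime p" "\<And>p n. p \<in> P \<Longrightarrow> F p (n mod p) = F p n"
  shows "(\<Sum>n<\<Prod>P. \<Prod>p\<in>P. F p n) = (\<Prod>p\<in>P. \<Sum>n<p. F p n)"
  using assms
proof (induction P rule: finite_induct)
  case (insert q P)
  have q: "prime q" and P: "\<And>p. p \<in> P \<Longrightarrow> prime p" using insert by auto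
  have cop: "coprime q (\<Prod>P)"
    using insert by (intro prod_coprime_right) (auto intro: primes_coprime)
  have per: "(\<Prod>p\<in>P. F p (n mod \<Prod>P)) = (\<Prod>p\<in>P. F p n)" for n
  proof (intro prod.cong refl)
    fix p assume p: "p \<in> P"
    then have "p dvd \<Prod>P" using insert by (intro dvd_prodI) auto
    then have "n mod \<Prod>P mod p = n mod p" by (rule mod_mod_cancel)
    then show "F p (n mod \<Prod>P) = F p n" using insert.prems(2)[of p] p by (metis insertCI)
  qed
  have "(\<Sum>n<q * \<Prod>P. F q n * (\<Prod>p\<in>P. F p n)) = (\<Sum>n<q. F q n) * (\<Sum>n<\<Prod>P. \<Prod>p\<in>P. F p n)"
    using insert q P by (intro sum_mult_coprime_periods cop per) (auto simp: prime_gt_0_nat intro!: prod_pos)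
  then show ?case using insert by simp
qed auto

text \<open>Over the period \<open>\<Prod>P\<close> the residues modulo the primes in
  \<open>P\<close> are independent and uniform, so this is an exact expectation that factors over
  primes.\<close>

definition mean :: "nat set \<Rightarrow> (nat \<Rightarrow> real) \<Rightarrow> real" where
  "mean P f = (\<Sum>n<\<Prod>P. f n) / real (\<Prod>P)"

lemma mean_prod:
  fixes F :: "nat \<Rightarrow> nat \<Rightarrow> real"
  assumes "finite P" "\<And>p. p \<in> P \<Longrightarrow> prime p" "\<And>p n. p \<in> P \<Longrightarrow> F p (n mod p) = F p n"
  shows "mean P (\<lambda>n. \<Prod>p\<in>P. F p n) = (\<Prod>p\<in>P. (\<Sum>n<p. F p n) / real p)"
proof -
  have "(\<Sum>n<\<Prod>P. \<Prod>p\<in>P. F p n) = (\<Prod>p\<in>P. \<Sum>n<p. F p n)"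
    by (rule sum_prod_periodic_primes) (use assms in auto)
  then show ?thesis by (simp add: mean_def prod_dividef)
qed

lemma mean_add: "mean P (\<lambda>n. f n + g n) = mean P f + mean P g"
  and mean_diff: "mean P (\<lambda>n. f n - g n) = mean P f - mean P g"
  and mean_cmult: "mean P (\<lambda>n. c * f n) = c * mean P f"
  and mean_sum: "mean P (\<lambda>n. \<Sum>x\<in>A. h x n) = (\<Sum>x\<in>A. mean P (h x))"
  by (simp_all add: mean_def sum.distrib sum_subtractf add_divide_distrib diff_divide_distrib
    flip: sum_distrib_left sum_divide_distrib) (subst sum.swap, simp)

lemma mean_const:
  assumes "finite P" "\<And>p. p \<in> P \<Longrightarrow> prime p"
  shows "mean P (\<lambda>_. c) = c"
proof -
  have "\<Prod>P > 0" using assms by (intro prod_pos) (auto simp: prime_gt_0_nat)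
  then show ?thesis by (simp add: mean_def del: of_nat_prod)
qed

lemma mean_mono: "(\<And>n. f n \<le> g n) \<Longrightarrow> mean P f \<le> mean P g"
  unfolding mean_def by (intro divide_right_mono sum_mono) (auto simp del: of_nat_prod)

lemma abs_mean_le: "\<bar>mean P f\<bar> \<le> mean P (\<lambda>n. \<bar>f n\<bar>)"
  unfolding mean_def abs_divide by (auto intro!: divide_right_mono sum_abs simp del: of_nat_prod)

text \<open>The Ramanujan sum modulo \<open>p\<close> at \<open>n\<close>, multiplied by
  \<open>moebius_mu p = -1\<close>. Its mean over a period is 0.\<close>

definition local_factor :: "nat \<Rightarrow> nat \<Rightarrow> real" where
  "local_factor p n = 1 - (if p dvd n then real p else 0)"

definition dvd_ind :: "nat \<Rightarrow> nat \<Rightarrow> real" where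
  "dvd_ind p n = (if p dvd n then 1 else 0)"

definition cong_dvd_ind :: "nat \<Rightarrow> nat \<Rightarrow> nat \<Rightarrow> real" where
  "cong_dvd_ind p i j = (if [i = j] (mod p) then 1 else 0)"

lemma local_factor_dvd_ind: "local_factor p n = 1 - real p * dvd_ind p n"
  by (simp add: local_factor_def dvd_ind_def)

lemma sum_dvd_ind:
  assumes "p > 0" shows "(\<Sum>n<p. dvd_ind p (n + i)) = 1"
proof -
  have *: "p dvd n + i \<longleftrightarrow> n = (p - i mod p) mod p" if n: "n < p" for n
  proof -
    have "p dvd n + i \<longleftrightarrow> p dvd n + i mod p" by (simp add: dvd_eq_mod_eq_0 mod_simps)
    also have "\<dots> \<longleftrightarrow> n = (p - i mod p) mod p"
    proof (cases "i mod p = 0")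
      case False
      then have r: "i mod p < p" "0 < i mod p" using assms by auto
      have "p dvd n + i mod p \<longleftrightarrow> n + i mod p = p"
      proof
        assume "p dvd n + i mod p"
        then obtain k where k: "n + i mod p = p * k" by (auto elim: dvdE)
        then have "p * k < p * 2" "p * k > 0" using n r by linarith+
        then have "k = 1" using assms by (simp add: less_2_cases_iff)
        then show "n + i mod p = p" using k by simp
      qed simp
      then show ?thesis using r n by auto
    qed (use n in \<open>auto dest: dvd_imp_le\<close>)
    finally show ?thesis .
  qed
  have "(\<Sum>n<p. dvd_ind p (n + i)) = (\<Sum>n<p. if n = (p - i mod p) mod p then 1 else 0)"
    by (intro sum.cong refl) (simp add: dvd_ind_def *)
  also have "\<dots> = 1" using assms by (subst sum.delta) auto
  finally show ?thesis .
qed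

text \<open>Both indicators can be 1 only for congruent shifts. This makes products of local factors
  linear in the indicators, each of which sums to 1 over a period.\<close>

lemma dvd_ind_mult: "dvd_ind p (n + i) * dvd_ind p (n + j) = cong_dvd_ind p i j * dvd_ind p (n + i)"
proof (cases "p dvd n + i")
  case True
  then have "p dvd n + j \<longleftrightarrow> [n + i = n + j] (mod p)"
    by (metis Cong.cong_def cong_dvd_iff cong_sym dvd_eq_mod_eq_0)
  also have "\<dots> \<longleftrightarrow> [i = j] (mod p)" by (simp add: cong_add_lcancel_nat)
  finally show ?thesis using True by (simp add: dvd_ind_def cong_dvd_ind_def)
qed (simp add: dvd_ind_def)

lemma sum_local_factor1: "p > 0 \<Longrightarrow> (\<Sum>n<p. local_factor p (n + i)) = 0"
  by (simp add: local_factor_dvd_ind sum_subtractf sum_dvd_ind flip: sum_distrib_left)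

lemma sum_local_factor2:
  assumes "p > 0"
  shows "(\<Sum>n<p. local_factor p (n + i) * local_factor p (n + j)) = p * (p * cong_dvd_ind p i j - 1)"
proof -
  have "(\<Sum>n<p. local_factor p (n + i) * local_factor p (n + j)) =
    (\<Sum>n<p. 1 - p * dvd_ind p (n + i) - p * dvd_ind p (n + j) + p^2 * cong_dvd_ind p i j * dvd_ind p (n + i))"
  proof (intro sum.cong refl)
    fix n
    have "local_factor p (n + i) * local_factor p (n + j) = 1 - p * dvd_ind p (n + i) - p * dvd_ind p (n + j) + p^2 * (dvd_ind p (n + i) * dvd_ind p (n + j))"
      by (simp add: local_factor_dvd_ind algebra_simps power2_eq_square)
    then show "local_factor p (n + i) * local_factor p (n + j) = 1 - p * dvd_ind p (n + i) - p * dvd_ind p (n + j) + p^2 * cong_dvd_ind p i j * dvd_ind p (n + i)"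
      by (simp add: dvd_ind_mult)
  qed
  also have "\<dots> = real p - real p * 1 - real p * 1 + real p^2 * cong_dvd_ind p i j * 1"
    by (simp only: sum.distrib sum_subtractf sum_distrib_left[symmetric] sum_dvd_ind[OF assms]) simp
  finally show ?thesis by (simp add: power2_eq_square algebra_simps)
qed

lemma sum_local_factor3:
  assumes "p > 0"
  shows "(\<Sum>n<p. local_factor p (n + i) * local_factor p (n + j) * local_factor p (n + k)) =
    p * (-2 + real p * (cong_dvd_ind p i j + cong_dvd_ind p i k + cong_dvd_ind p j k) - real p^2 * cong_dvd_ind p i j * cong_dvd_ind p i k)"
proof -
  have "(\<Sum>n<p. local_factor p (n + i) * local_factor p (n + j) * local_factor p (n + k)) =
    (\<Sum>n<p. local_factor p (n + i) * local_factor p (n + j) - p * (dvd_ind p (n + k) - p * cong_dvd_ind p i k * dvd_ind p (n + i)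
       - p * cong_dvd_ind p j k * dvd_ind p (n + j) + p^2 * cong_dvd_ind p i j * cong_dvd_ind p i k * dvd_ind p (n + i)))"
  proof (intro sum.cong refl)
    fix n
    have "local_factor p (n + i) * local_factor p (n + j) * local_factor p (n + k) = local_factor p (n + i) * local_factor p (n + j)
      - p * (dvd_ind p (n + k) - p * (dvd_ind p (n + i) * dvd_ind p (n + k)) - p * (dvd_ind p (n + j) * dvd_ind p (n + k))
        + p^2 * (dvd_ind p (n + i) * dvd_ind p (n + j) * dvd_ind p (n + k)))"
      by (simp add: local_factor_dvd_ind algebra_simps power2_eq_square)
    moreover have "dvd_ind p (n + i) * dvd_ind p (n + j) * dvd_ind p (n + k) = cong_dvd_ind p i j * cong_dvd_ind p i k * dvd_ind p (n + i)"
      by (simp add: dvd_ind_mult)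
    ultimately show "local_factor p (n + i) * local_factor p (n + j) * local_factor p (n + k) =
       local_factor p (n + i) * local_factor p (n + j) - p * (dvd_ind p (n + k) - p * cong_dvd_ind p i k * dvd_ind p (n + i)
       - p * cong_dvd_ind p j k * dvd_ind p (n + j) + p^2 * cong_dvd_ind p i j * cong_dvd_ind p i k * dvd_ind p (n + i))"
      by (simp add: dvd_ind_mult)
  qed
  also have "\<dots> = p * (p * cong_dvd_ind p i j - 1) - p * (1 - p * cong_dvd_ind p i k * 1 - p * cong_dvd_ind p j k * 1 + p^2 * cong_dvd_ind p i j * cong_dvd_ind p i k * 1)"
    by (simp only: sum.distrib sum_subtractf sum_distrib_left[symmetric] sum_dvd_ind[OF assms] sum_local_factor2[OF assms])
  finally show ?thesis by (simp add: algebra_simps)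
qed

lemma local_factor_mod: "local_factor p (n mod p + i) = local_factor p (n + i)"
proof -
  have "p dvd n mod p + i \<longleftrightarrow> p dvd n + i" by (simp add: dvd_eq_mod_eq_0 mod_simps)
  then show ?thesis by (simp add: local_factor_def)
qed

definition lambda_term :: "nat set \<Rightarrow> nat \<Rightarrow> real" where
  "lambda_term S n = (\<Prod>p\<in>S. local_factor p n / (real p - 1))"

text \<open>Expectation modulo \<open>p\<close> of the normalised local factors at the shifts
  \<open>i\<close>, \<open>j\<close>, \<open>k\<close>; the booleans say which of the three moduli
  \<open>p\<close> divides. A single factor has mean 0, which is the case
  \<open>x \<or> y \<or> z\<close> near the end.\<close>

definition local_corr :: "nat \<Rightarrow> bool \<Rightarrow> bool \<Rightarrow> bool \<Rightarrow> nat \<Rightarrow> nat \<Rightarrow> nat \<Rightarrow> real" where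
  "local_corr p x y z i j k =
     (if x \<and> y \<and> z then (-2 + real p * (cong_dvd_ind p i j + cong_dvd_ind p i k + cong_dvd_ind p j k) - real p^2 * cong_dvd_ind p i j * cong_dvd_ind p i k) / (real p - 1)^3
      else if x \<and> y then (p * cong_dvd_ind p i j - 1) / (real p - 1)^2
      else if x \<and> z then (p * cong_dvd_ind p i k - 1) / (real p - 1)^2
      else if y \<and> z then (p * cong_dvd_ind p j k - 1) / (real p - 1)^2
      else if x \<or> y \<or> z then 0 else 1)"

lemma mean_lam_set3:
  assumes P: "finite P" "\<And>p. p \<in> P \<Longrightarrow> prime p" and S: "S1 \<subseteq> P" "S2 \<subseteq> P" "S3 \<subseteq> P"
  shows "mean P (\<lambda>n. lambda_term S1 (n + i) * lambda_term S2 (n + j) * lambda_term S3 (n + k)) =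
     (\<Prod>p\<in>P. local_corr p (p \<in> S1) (p \<in> S2) (p \<in> S3) i j k)"
proof -
  define F where "F S i p n = (if p \<in> S then local_factor p (n + i) / (real p - 1) else 1)" for S i p n
  have lam: "lambda_term S (n + i) = (\<Prod>p\<in>P. F S i p n)" if "S \<subseteq> P" for S i n
    unfolding lambda_term_def F_def using that P(1) by (simp add: prod.If_cases Int_absorb1)
  have per: "F S i p (n mod p) = F S i p n" for S i p n by (simp add: F_def local_factor_mod)
  have "mean P (\<lambda>n. lambda_term S1 (n + i) * lambda_term S2 (n + j) * lambda_term S3 (n + k)) =
        mean P (\<lambda>n. \<Prod>p\<in>P. F S1 i p n * F S2 j p n * F S3 k p n)"
    by (simp add: lam[OF S(1)] lam[OF S(2)] lam[OF S(3)] prod.distrib)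
  also have "\<dots> = (\<Prod>p\<in>P. (\<Sum>n<p. F S1 i p n * F S2 j p n * F S3 k p n) / real p)"
    by (rule mean_prod) (use P in \<open>auto simp: per\<close>)
  also have "\<dots> = (\<Prod>p\<in>P. local_corr p (p \<in> S1) (p \<in> S2) (p \<in> S3) i j k)"
  proof (intro prod.cong refl)
    fix p assume "p \<in> P"
    then have p: "p > 0" "real p > 1" using P prime_gt_1_nat[of p] by auto
    have pp: "real p / real p = 1" using p by simp
    define A where "A i n = local_factor p (n + i) / (real p - 1)" for i n
    have A1: "(\<Sum>n<p. A i n) = 0" for i
      using sum_local_factor1[OF p(1), of i] by (simp add: A_def flip: sum_divide_distrib)
    have A2: "(\<Sum>n<p. A i n * A j n) / p = (p * cong_dvd_ind p i j - 1) / (real p - 1)^2" for i j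
    proof -
      have "(\<Sum>n<p. A i n * A j n) = (\<Sum>n<p. local_factor p (n + i) * local_factor p (n + j)) / (real p - 1)^2"
        by (simp add: A_def sum_divide_distrib power2_eq_square)
      then show ?thesis using p by (simp add: sum_local_factor2)
    qed
    have A3: "(\<Sum>n<p. A i n * A j n * A k n) / p =
      (-2 + real p * (cong_dvd_ind p i j + cong_dvd_ind p i k + cong_dvd_ind p j k) - real p^2 * cong_dvd_ind p i j * cong_dvd_ind p i k) / (real p - 1)^3"
    proof -
      have "(\<Sum>n<p. A i n * A j n * A k n) =
          (\<Sum>n<p. local_factor p (n + i) * local_factor p (n + j) * local_factor p (n + k)) / (real p - 1)^3"
        by (simp add: A_def sum_divide_distrib power3_eq_cube)
      then show ?thesis using p by (simp add: sum_local_factor3)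
    qed
    show "(\<Sum>n<p. F S1 i p n * F S2 j p n * F S3 k p n) / real p = local_corr p (p \<in> S1) (p \<in> S2) (p \<in> S3) i j k"
      unfolding F_def local_corr_def A_def[symmetric] using pp
      by (cases "p \<in> S1"; cases "p \<in> S2"; cases "p \<in> S3")
         (simp_all only: if_True if_False simp_thms A1 A2 A3 mult_1_left mult_1_right div_0 sum_constant card_lessThan)
  qed
  finally show ?thesis .
qed

section \<open>Expansion of \<open>lambda_R\<close> and the triple correlation at equal
  shifts\<close>

lemma totient_prod_prime_factors:
  assumes "squarefree n"
  shows "totient n = (\<Prod>p\<in>prime_factors n. p - 1)"
proof -
  have "n \<noteq> 0" using assms by (metis not_squarefree_0)
  then have "totient n = totient (\<Prod>(prime_factors n))"
    by (simp add: squarefree_eq_prod_prime_factors[OF assms])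
  also have "\<dots> = (\<Prod>p\<in>prime_factors n. totient p)"
    by (rule totient_prod_coprime) (auto simp: pairwise_def intro: primes_coprime)
  also have "\<dots> = (\<Prod>p\<in>prime_factors n. p - 1)"
  proof (intro prod.cong refl)
    fix p assume "p \<in> prime_factors n"
    then have "prime p" by auto
    then show "totient p = p - 1" by (rule totient_prime)
  qed
  finally show ?thesis .
qed

lemma lambda_R_eq_sum_sqf_sets:
  assumes "n \<ge> 1"
  shows "lambda_R R (int n) = (\<Sum>S\<in>sqf_sets R. lambda_term S n)"
proof -
  have "lambda_R R (int n) = (\<Sum>q | 1 \<le> q \<and> real q \<le> R. (moebius_mu q)\<^sup>2 / real (totient q) *
             (\<Sum>d | d dvd gcd q n. real d * moebius_mu d))"
    using assms by (simp add: lambda_R_def)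
  also have "\<dots> = (\<Sum>q | squarefree q \<and> real q \<le> R. (moebius_mu q)\<^sup>2 / real (totient q) *
             (\<Sum>d | d dvd gcd q n. real d * moebius_mu d))"
  proof (rule sum.mono_neutral_right)
    show "finite {q. 1 \<le> q \<and> real q \<le> R}" using finite_nats_le[of R] by (simp only: nats_le_def)
    show "{q. squarefree q \<and> real q \<le> R} \<subseteq> {q. 1 \<le> q \<and> real q \<le> R}"
    proof
      fix q assume q: "q \<in> {q. squarefree q \<and> real q \<le> R}"
      then have "q \<noteq> 0" by (cases "q = 0") auto
      then show "q \<in> {q. 1 \<le> q \<and> real q \<le> R}" using q by auto
    qed
  qed (auto simp: moebius_mu_def)
  also have "\<dots> = (\<Sum>q | squarefree q \<and> real q \<le> R. lambda_term (prime_factors q) n)"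
  proof (intro sum.cong refl)
    fix q assume "q \<in> {q. squarefree q \<and> real q \<le> R}"
    then have q: "squarefree q" by simp
    then have q0: "q \<noteq> 0" by (metis not_squarefree_0)
    have "(\<Sum>d | d dvd gcd q n. real d * moebius_mu d) =
          (\<Sum>d | d dvd gcd q n. moebius_mu d * (\<Prod>p\<in>prime_factors d. real p))"
    proof (intro sum.cong refl)
      fix d
      show "real d * moebius_mu d = moebius_mu d * (\<Prod>p\<in>prime_factors d. real p)"
        using squarefree_eq_prod_prime_factors[of d] by (auto simp: moebius_mu_def simp flip: of_nat_prod)
    qed
    also have "\<dots> = (\<Prod>p\<in>prime_factors (gcd q n). 1 - real p)"
      using q0 by (intro sum_squarefree_divisors) simp
    also have "prime_factors (gcd q n) = {p \<in> prime_factors q. p dvd n}"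
      using q0 assms by (auto simp: prime_factors_dvd)
    also have "(\<Prod>p\<in>{p \<in> prime_factors q. p dvd n}. 1 - real p) = (\<Prod>p\<in>prime_factors q. local_factor p n)"
      by (rule prod.mono_neutral_cong_left) (auto simp: local_factor_def)
    finally have 1: "(\<Sum>d | d dvd gcd q n. real d * moebius_mu d) = (\<Prod>p\<in>prime_factors q. local_factor p n)" .
    have "real (totient q) = (\<Prod>p\<in>prime_factors q. real p - 1)"
      unfolding totient_prod_prime_factors[OF q] of_nat_prod
    proof (intro prod.cong refl)
      fix p assume "p \<in> prime_factors q"
      then have "prime p" by auto
      then show "real (p - 1) = real p - 1" using prime_gt_0_nat[of p] by (simp add: of_nat_diff)
    qed
    moreover have "(moebius_mu q)\<^sup>2 = 1" using q by (simp add: moebius_mu_def flip: power_mult)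
    ultimately show "(moebius_mu q)\<^sup>2 / real (totient q) * (\<Sum>d | d dvd gcd q n. real d * moebius_mu d) = lambda_term (prime_factors q) n"
      unfolding 1 by (simp add: lambda_term_def prod_dividef)
  qed
  also have "\<dots> = (\<Sum>S\<in>sqf_sets R. lambda_term S n)" by (rule sum_squarefree_eq_sum_sqf_sets)
  finally show ?thesis .
qed

definition corr3 :: "nat set \<Rightarrow> nat set set \<Rightarrow> nat \<Rightarrow> nat \<Rightarrow> nat \<Rightarrow> real" where
  "corr3 P \<A> i j k = (\<Sum>S1\<in>\<A>. \<Sum>S2\<in>\<A>. \<Sum>S3\<in>\<A>. \<Prod>p\<in>P. local_corr p (p \<in> S1) (p \<in> S2) (p \<in> S3) i j k)"

lemma sum_product3:
  fixes f g h :: "'a \<Rightarrow> real"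
  shows "sum f A * sum g A * sum h A = (\<Sum>x\<in>A. \<Sum>y\<in>A. \<Sum>z\<in>A. f x * g y * h z)"
proof -
  have "sum f A * sum g A * sum h A = (\<Sum>x\<in>A. f x * (sum g A * sum h A))"
    by (simp only: sum_distrib_right mult.assoc)
  also have "sum g A * sum h A = (\<Sum>y\<in>A. \<Sum>z\<in>A. g y * h z)" by (rule sum_product)
  finally show ?thesis by (simp only: sum_distrib_left mult.assoc)
qed

lemma mean_triple_product:
  assumes P: "finite P" "\<And>p. p \<in> P \<Longrightarrow> prime p" and A: "\<And>S. S \<in> \<A> \<Longrightarrow> S \<subseteq> P"
  shows "mean P (\<lambda>n. (\<Sum>S\<in>\<A>. lambda_term S (n + i)) * (\<Sum>S\<in>\<A>. lambda_term S (n + j)) * (\<Sum>S\<in>\<A>. lambda_term S (n + k))) = corr3 P \<A> i j k"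
proof -
  have "(\<Sum>S\<in>\<A>. lambda_term S (n + i)) * (\<Sum>S\<in>\<A>. lambda_term S (n + j)) * (\<Sum>S\<in>\<A>. lambda_term S (n + k)) =
    (\<Sum>S1\<in>\<A>. \<Sum>S2\<in>\<A>. \<Sum>S3\<in>\<A>. lambda_term S1 (n + i) * lambda_term S2 (n + j) * lambda_term S3 (n + k))" for n
    by (rule sum_product3)
  then have "mean P (\<lambda>n. (\<Sum>S\<in>\<A>. lambda_term S (n + i)) * (\<Sum>S\<in>\<A>. lambda_term S (n + j)) * (\<Sum>S\<in>\<A>. lambda_term S (n + k))) =
    (\<Sum>S1\<in>\<A>. \<Sum>S2\<in>\<A>. \<Sum>S3\<in>\<A>. mean P (\<lambda>n. lambda_term S1 (n + i) * lambda_term S2 (n + j) * lambda_term S3 (n + k)))"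
    by (simp only: mean_sum)
  also have "\<dots> = corr3 P \<A> i j k"
    unfolding corr3_def by (intro sum.cong refl mean_lam_set3 P A)
  finally show ?thesis .
qed

text \<open>Only triples of squarefree numbers in which no prime divides exactly one of the three contribute;
  they are parameterised by \<open>q1 = u b c\<close>, \<open>q2 = u a c\<close>, \<open>q3 = u a b\<close>.\<close>

lemma corr3_diagonal:
  "corr3 (primes_le R) (sqf_sets R) i i i = quad_sum (quad_weight_on (primes_le R)) R R R"
proof -
  define P where "P = primes_le R"
  have P: "finite P" "\<And>p. p \<in> P \<Longrightarrow> prime p"
    unfolding P_def by (rule finite_primes_le) (simp add: primes_le_def)
  define f where "f = (\<lambda>(S1, S2, S3). \<Prod>p\<in>P. local_corr p (p \<in> S1) (p \<in> S2) (p \<in> S3) i i i)"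
  define D where "D = {(S1, S2, S3). S1 \<in> sqf_sets R \<and> S2 \<in> sqf_sets R \<and> S3 \<in> sqf_sets R \<and>
     S1 \<subseteq> S2 \<union> S3 \<and> S2 \<subseteq> S1 \<union> S3 \<and> S3 \<subseteq> S1 \<union> S2}"
  define Q where "Q = {t \<in> quad_dom R R R. case t of (a, b, c, u) \<Rightarrow> squarefree (a * b * c * u)}"
  have "corr3 (primes_le R) (sqf_sets R) i i i = (\<Sum>s\<in>sqf_sets R \<times> sqf_sets R \<times> sqf_sets R. f s)"
    by (simp add: corr3_def P_def f_def sum.cartesian_product split_def)
  also have "\<dots> = (\<Sum>s\<in>D. f s)"
  \<comment> \<open>Outside \<open>D\<close> some prime lies in exactly one of the three sets, and
    its local correlation is the mean of a single local factor, namely 0.\<close>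
  proof (rule sum.mono_neutral_right)
    show "\<forall>s\<in>sqf_sets R \<times> sqf_sets R \<times> sqf_sets R - D. f s = 0"
    proof
      fix s assume s: "s \<in> sqf_sets R \<times> sqf_sets R \<times> sqf_sets R - D"
      obtain S1 S2 S3 where s3: "s = (S1, S2, S3)" by (cases s) auto
      then obtain p where p: "p \<in> S1 \<and> p \<notin> S2 \<and> p \<notin> S3 \<or> p \<in> S2 \<and> p \<notin> S1 \<and> p \<notin> S3 \<or> p \<in> S3 \<and> p \<notin> S1 \<and> p \<notin> S2"
        using s unfolding D_def by auto
      moreover from this have "p \<in> P" using s s3 by (auto simp: P_def sqf_sets_def)
      moreover from p have "local_corr p (p \<in> S1) (p \<in> S2) (p \<in> S3) i i i = 0" by (auto simp: local_corr_def)
      ultimately show "f s = 0" unfolding s3 f_def using P(1) by (auto intro!: prod_zero)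
    qed
  qed (auto simp: D_def)
  also have "\<dots> = (\<Sum>t\<in>Q. quad_weight_on P t)"
  proof (rule sum.reindex_bij_witness[where
      i = "\<lambda>(a, b, c, u). (prime_factors (u * b * c), prime_factors (u * a * c), prime_factors (u * a * b))" and
      j = "\<lambda>(S1, S2, S3). (\<Prod>(S2 \<inter> S3 - S1), \<Prod>(S1 \<inter> S3 - S2), \<Prod>(S1 \<inter> S2 - S3), \<Prod>(S1 \<inter> S2 \<inter> S3))"])
    fix s assume s: "s \<in> D"
    obtain S1 S2 S3 where s3: "s = (S1, S2, S3)" by (cases s) auto
    have S: "S1 \<in> sqf_sets R" "S2 \<in> sqf_sets R" "S3 \<in> sqf_sets R" "S1 \<subseteq> S2 \<union> S3" "S2 \<subseteq> S1 \<union> S3" "S3 \<subseteq> S1 \<union> S2"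
      using s by (auto simp: D_def s3)
    note fin = sqf_setsD(1)[OF S(1)] sqf_setsD(1)[OF S(2)] sqf_setsD(1)[OF S(3)]
    note pr = sqf_setsD(2)[OF S(1)] sqf_setsD(2)[OF S(2)] sqf_setsD(2)[OF S(3)]
    define A B C U where "A = S2 \<inter> S3 - S1" and "B = S1 \<inter> S3 - S2" and "C = S1 \<inter> S2 - S3" and "U = S1 \<inter> S2 \<inter> S3"
    note defs = A_def B_def C_def U_def
    have finA: "finite A" "finite B" "finite C" "finite U" using fin by (auto simp: defs)
    have pos: "\<Prod>A > 0" "\<Prod>B > 0" "\<Prod>C > 0" "\<Prod>U > 0"
      using pr by (auto simp: defs intro!: prod_pos intro: prime_gt_0_nat simp del: prod_pos_nat_iff)
    have S': "S1 = U \<union> B \<union> C" "S2 = U \<union> A \<union> C" "S3 = U \<union> A \<union> B"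
      using S(4-6) by (auto simp: defs)
    have un: "\<Prod>(V \<union> W) = \<Prod>V * \<Prod>W" if "finite V" "finite W" "V \<inter> W = {}" for V W :: "nat set"
      using that by (rule prod.union_disjoint)
    have disj: "A \<inter> B = {}" "A \<inter> C = {}" "A \<inter> U = {}" "B \<inter> C = {}" "B \<inter> U = {}" "C \<inter> U = {}"
      by (auto simp: defs)
    have prods: "\<Prod>S1 = \<Prod>U * \<Prod>B * \<Prod>C" "\<Prod>S2 = \<Prod>U * \<Prod>A * \<Prod>C" "\<Prod>S3 = \<Prod>U * \<Prod>A * \<Prod>B"
      "\<Prod>(A \<union> B \<union> C \<union> U) = \<Prod>A * \<Prod>B * \<Prod>C * \<Prod>U"
    proof -
      have un3: "\<Prod>(V \<union> W \<union> T) = \<Prod>V * \<Prod>W * \<Prod>T"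
        if "finite V" "finite W" "finite T" "V \<inter> W = {}" "V \<inter> T = {}" "W \<inter> T = {}" for V W T :: "nat set"
        using that un[of "V \<union> W" T] un[of V W] by (simp add: Int_Un_distrib2)
      show "\<Prod>S1 = \<Prod>U * \<Prod>B * \<Prod>C" "\<Prod>S2 = \<Prod>U * \<Prod>A * \<Prod>C" "\<Prod>S3 = \<Prod>U * \<Prod>A * \<Prod>B"
        unfolding S' by (rule un3; use finA disj in blast)+
      have "\<Prod>(A \<union> B \<union> C \<union> U) = \<Prod>(A \<union> B \<union> C) * \<Prod>U"
        by (rule un) (use finA disj in auto)
      also have "\<Prod>(A \<union> B \<union> C) = \<Prod>A * \<Prod>B * \<Prod>C"
        by (rule un3; use finA disj in blast)
      finally show "\<Prod>(A \<union> B \<union> C \<union> U) = \<Prod>A * \<Prod>B * \<Prod>C * \<Prod>U" .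
    qed
    show "(case (case s of (S1, S2, S3) \<Rightarrow> (\<Prod>(S2 \<inter> S3 - S1), \<Prod>(S1 \<inter> S3 - S2), \<Prod>(S1 \<inter> S2 - S3), \<Prod>(S1 \<inter> S2 \<inter> S3))) of
       (a, b, c, u) \<Rightarrow> (prime_factors (u * b * c), prime_factors (u * a * c), prime_factors (u * a * b))) = s"
      unfolding s3 prod.case defs[symmetric] prods[symmetric]
      using prime_factors_prod_primes[OF fin(1) pr(1)] prime_factors_prod_primes[OF fin(2) pr(2)]
        prime_factors_prod_primes[OF fin(3) pr(3)] by simp
    have prU: "prime p" if "p \<in> A \<union> B \<union> C \<union> U" for p using that pr by (auto simp: defs)
    have sqf: "squarefree (\<Prod>A * \<Prod>B * \<Prod>C * \<Prod>U)"
      unfolding prods(4)[symmetric] using finA prU by (intro squarefree_prod_primes) auto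
    show "(case s of (S1, S2, S3) \<Rightarrow> (\<Prod>(S2 \<inter> S3 - S1), \<Prod>(S1 \<inter> S3 - S2), \<Prod>(S1 \<inter> S2 - S3), \<Prod>(S1 \<inter> S2 \<inter> S3))) \<in> Q"
      unfolding s3 prod.case defs[symmetric] Q_def quad_dom_def mem_Collect_eq
      using pos sqf sqf_setsD(3)[OF S(1)] sqf_setsD(3)[OF S(2)] sqf_setsD(3)[OF S(3)] unfolding prods
      by (simp add: Suc_le_eq del: of_nat_prod)
    \<comment> \<open>All parts of the weight are written as products over the whole of
      \<open>P\<close>, with factor 1 at absent primes, so that the equality can be checked prime by
      prime.\<close>
    have "quad_weight_on P (\<Prod>A, \<Prod>B, \<Prod>C, \<Prod>U) = f s"
    proof -
      have dvd: "p dvd \<Prod>V \<longleftrightarrow> p \<in> V" if "p \<in> P" "finite V" "V \<subseteq> A \<union> B \<union> C \<union> U" for p V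
      proof -
        have "prime_factors (\<Prod>V) = V" using that prU by (intro prime_factors_prod_primes) auto
        moreover have "\<Prod>V > 0" using that prU by (auto intro!: prod_pos prime_gt_0_nat)
        ultimately show ?thesis using P(2)[OF that(1)] by (metis in_prime_factors_iff neq0_conv)
      qed
      have sub: "A \<union> B \<union> C \<union> U \<subseteq> P" using S by (auto simp: defs P_def sqf_sets_def)
      have prodP: "real (\<Prod>V) = (\<Prod>p\<in>P. if p \<in> V then real p else 1)" if "V \<subseteq> A \<union> B \<union> C \<union> U" for V
      proof -
        have "V \<subseteq> P" using that sub by auto
        then show ?thesis using P(1) by (simp add: prod.If_cases Int_absorb1)
      qed
      have mu: "moebius_mu (\<Prod>U) = (\<Prod>p\<in>P. if p \<in> U then -1 else 1)"
      proof -
        have pf: "prime_factors (\<Prod>U) = U" "squarefree (\<Prod>U)"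
          using finA prU by (auto intro!: prime_factors_prod_primes squarefree_prod_primes)
        have "U \<subseteq> P" using sub by auto
        then show ?thesis unfolding moebius_mu_def pf using pf P(1) by (simp add: prod.If_cases Int_absorb1)
      qed
      have "quad_weight_on P (\<Prod>A, \<Prod>B, \<Prod>C, \<Prod>U) =
        (\<Prod>p\<in>P. (if p \<in> U then -1 else 1) / ((if p \<in> A then real p else 1) * (if p \<in> B then real p else 1) *
            (if p \<in> C then real p else 1) * (if p \<in> U then real p else 1)) * quad_local p (\<Prod>A, \<Prod>B, \<Prod>C, \<Prod>U))"
        unfolding quad_weight_on_def quad_weight_def prod.case prod.distrib prod_dividef mu
        using prodP[of A] prodP[of B] prodP[of C] prodP[of U] by (simp only: Un_upper1 Un_upper2 le_supI1 le_supI2)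
      also have "\<dots> = (\<Prod>p\<in>P. local_corr p (p \<in> S1) (p \<in> S2) (p \<in> S3) i i i)"
      proof (intro prod.cong refl)
        fix p assume p: "p \<in> P"
        have p1: "real p > 1" using P(2)[OF p] prime_gt_1_nat[of p] by simp
        have dv: "p dvd \<Prod>A \<longleftrightarrow> p \<in> A" "p dvd \<Prod>B \<longleftrightarrow> p \<in> B" "p dvd \<Prod>C \<longleftrightarrow> p \<in> C" "p dvd \<Prod>U \<longleftrightarrow> p \<in> U"
          by (rule dvd[OF p]; use finA in auto)+
        have sq: "\<not> p\<^sup>2 dvd \<Prod>A * \<Prod>B * \<Prod>C"
        proof
          assume "p\<^sup>2 dvd \<Prod>A * \<Prod>B * \<Prod>C"
          then have "p\<^sup>2 dvd \<Prod>A * \<Prod>B * \<Prod>C * \<Prod>U" by (rule dvd_mult2)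
          then have "p dvd 1" using sqf by (rule squarefreeD[rotated])
          then show False using p1 by simp
        qed
        have loc: "local_corr p x y z i i i = (if x \<and> y \<and> z then - (real p - 2) / (real p - 1)^2
          else if x \<and> y \<or> x \<and> z \<or> y \<and> z then 1 / (real p - 1) else if x \<or> y \<or> z then 0 else 1)" for x y z
        proof -
          have "-2 + real p * 3 - real p ^ 2 = - (real p - 2) * (real p - 1)" by (simp add: algebra_simps power2_eq_square)
          then have "(-2 + real p * 3 - real p ^ 2) / (real p - 1)^3 = - (real p - 2) / (real p - 1)^2"
            using p1 by (simp add: power2_eq_square power3_eq_cube)
          moreover have "(real p - 1) / (real p - 1)^2 = 1 / (real p - 1)" using p1 by (simp add: power2_eq_square)
          ultimately show ?thesis by (auto simp: local_corr_def cong_dvd_ind_def)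
        qed
        show "(if p \<in> U then -1 else 1) / ((if p \<in> A then real p else 1) * (if p \<in> B then real p else 1) *
            (if p \<in> C then real p else 1) * (if p \<in> U then real p else 1)) * quad_local p (\<Prod>A, \<Prod>B, \<Prod>C, \<Prod>U) =
          local_corr p (p \<in> S1) (p \<in> S2) (p \<in> S3) i i i"
          unfolding loc quad_local_def prod.case dv using p1 sq S(4-6)
          by (cases "p \<in> S1"; cases "p \<in> S2"; cases "p \<in> S3") (auto simp: defs)
      qed
      finally show ?thesis by (simp add: f_def s3)
    qed
    then show "quad_weight_on P (case s of (S1, S2, S3) \<Rightarrow> (\<Prod>(S2 \<inter> S3 - S1), \<Prod>(S1 \<inter> S3 - S2), \<Prod>(S1 \<inter> S2 - S3), \<Prod>(S1 \<inter> S2 \<inter> S3))) = f s"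
      unfolding s3 prod.case defs by simp
  next
    fix t assume t: "t \<in> Q"
    obtain a b c u where abcu: "t = (a, b, c, u)" by (cases t) auto
    have pos: "a > 0" "b > 0" "c > 0" "u > 0" and sqf: "squarefree (a * b * c * u)"
      and le: "real (u * a * b) \<le> R" "real (u * a * c) \<le> R" "real (u * b * c) \<le> R"
      using t by (auto simp: abcu quad_dom_def Q_def simp del: of_nat_mult)
    have dis: "\<not> (p dvd x \<and> p dvd y)" if "prime p" "x * y dvd a * b * c * u" for p x y
    proof
      assume "p dvd x \<and> p dvd y"
      then have "p\<^sup>2 dvd x * y" by (simp add: power2_eq_square mult_dvd_mono)
      then have "p\<^sup>2 dvd a * b * c * u" using that(2) by (rule dvd_trans)
      then have "p dvd 1" using sqf by (rule squarefreeD[rotated])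
      then show False using that(1) by auto
    qed
    have d: "a * b dvd a * b * c * u" "a * c dvd a * b * c * u" "a * u dvd a * b * c * u"
      "b * c dvd a * b * c * u" "b * u dvd a * b * c * u" "c * u dvd a * b * c * u"
      "u * b * c dvd a * b * c * u" "u * a * c dvd a * b * c * u" "u * a * b dvd a * b * c * u"
      "a dvd a * b * c * u" "b dvd a * b * c * u" "c dvd a * b * c * u" "u dvd a * b * c * u"
    proof -
      have "a * b * c * u = a * b * (c * u)" "a * b * c * u = a * c * (b * u)" "a * b * c * u = a * u * (b * c)"
        "a * b * c * u = b * c * (a * u)" "a * b * c * u = b * u * (a * c)" "a * b * c * u = c * u * (a * b)"
        "a * b * c * u = u * b * c * a" "a * b * c * u = u * a * c * b" "a * b * c * u = u * a * b * c"
        "a * b * c * u = a * (b * c * u)" "a * b * c * u = b * (a * c * u)" "a * b * c * u = c * (a * b * u)" "a * b * c * u = u * (a * b * c)"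
        by simp_all
      then show "a * b dvd a * b * c * u" "a * c dvd a * b * c * u" "a * u dvd a * b * c * u"
      "b * c dvd a * b * c * u" "b * u dvd a * b * c * u" "c * u dvd a * b * c * u"
      "u * b * c dvd a * b * c * u" "u * a * c dvd a * b * c * u" "u * a * b dvd a * b * c * u"
      "a dvd a * b * c * u" "b dvd a * b * c * u" "c dvd a * b * c * u" "u dvd a * b * c * u"
        by (metis dvd_triv_left)+
    qed
    have pf: "prime_factors (x * y * z) = prime_factors x \<union> prime_factors y \<union> prime_factors z" if "x > 0" "y > 0" "z > 0" for x y z :: nat
      using that by (simp add: prime_factors_product)
    note sq = squarefree_mono[OF d(7) sqf] squarefree_mono[OF d(8) sqf] squarefree_mono[OF d(9) sqf]
    show "(case t of (a, b, c, u) \<Rightarrow> (prime_factors (u * b * c), prime_factors (u * a * c), prime_factors (u * a * b))) \<in> D"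
      unfolding abcu prod.case D_def mem_Collect_eq
      using prime_factors_in_sqf_sets[OF sq(1) le(3)] prime_factors_in_sqf_sets[OF sq(2) le(2)] prime_factors_in_sqf_sets[OF sq(3) le(1)] pos
      by (auto simp: pf)
    have disj: "prime_factors a \<inter> prime_factors b = {}" "prime_factors a \<inter> prime_factors c = {}" "prime_factors a \<inter> prime_factors u = {}"
      "prime_factors b \<inter> prime_factors c = {}" "prime_factors b \<inter> prime_factors u = {}" "prime_factors c \<inter> prime_factors u = {}"
      using dis[OF _ d(1)] dis[OF _ d(2)] dis[OF _ d(3)] dis[OF _ d(4)] dis[OF _ d(5)] dis[OF _ d(6)]
      by (auto simp: in_prime_factors_iff)
    have sets: "(prime_factors (u * a * c) \<inter> prime_factors (u * a * b) - prime_factors (u * b * c)) = prime_factors a"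
      "(prime_factors (u * b * c) \<inter> prime_factors (u * a * b) - prime_factors (u * a * c)) = prime_factors b"
      "(prime_factors (u * b * c) \<inter> prime_factors (u * a * c) - prime_factors (u * a * b)) = prime_factors c"
      "(prime_factors (u * b * c) \<inter> prime_factors (u * a * c) \<inter> prime_factors (u * a * b)) = prime_factors u"
      unfolding pf[OF pos(4,1,3)] pf[OF pos(4,1,2)] pf[OF pos(4,2,3)] using disj by blast+
    show "(case (case t of (a, b, c, u) \<Rightarrow> (prime_factors (u * b * c), prime_factors (u * a * c), prime_factors (u * a * b))) of
        (S1, S2, S3) \<Rightarrow> (\<Prod>(S2 \<inter> S3 - S1), \<Prod>(S1 \<inter> S3 - S2), \<Prod>(S1 \<inter> S2 - S3), \<Prod>(S1 \<inter> S2 \<inter> S3))) = t"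
      unfolding abcu prod.case sets
      using squarefree_eq_prod_prime_factors[OF squarefree_mono[OF d(10) sqf]] squarefree_eq_prod_prime_factors[OF squarefree_mono[OF d(11) sqf]]
        squarefree_eq_prod_prime_factors[OF squarefree_mono[OF d(12) sqf]] squarefree_eq_prod_prime_factors[OF squarefree_mono[OF d(13) sqf]]
      by simp
  qed
  \<comment> \<open>Quadruples with non-squarefree product weigh 0: either \<open>u\<close> itself
    has a square factor, or the repeated prime is at most \<open>R\<close>, as every variable is,
    and its factor \<open>quad_local\<close> vanishes.\<close>
  also have "\<dots> = (\<Sum>t\<in>quad_dom R R R. quad_weight_on P t)"
  proof (rule sum.mono_neutral_left)
    show "\<forall>t\<in>quad_dom R R R - Q. quad_weight_on P t = 0"
    proof
      fix t assume t: "t \<in> quad_dom R R R - Q"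
      obtain a b c u where abcu: "t = (a, b, c, u)" by (cases t) auto
      have pos: "a > 0" "b > 0" "c > 0" "u > 0" "\<not> squarefree (a * b * c * u)"
        using t by (auto simp: abcu quad_dom_def Q_def)
      then obtain p where p: "prime p" "p\<^sup>2 dvd a * b * c * u" 
        using squarefree_factorial_semiring[of "a * b * c * u"] by auto
      have pu: "p dvd a * b * c \<or> p\<^sup>2 dvd u"
        using p by (metis prime_dvd_mult_iff prime_imp_coprime coprime_commute coprime_power_right_iff coprime_dvd_mult_right_iff zero_less_numeral)
      have pP: "p \<in> P"
      proof -
        have "p dvd a * b * c * u" using p by (metis dvd_mult_left power2_eq_square)
        then have "p dvd a \<or> p dvd b \<or> p dvd c \<or> p dvd u" using p by (auto simp: prime_dvd_mult_iff)
        then have "p \<le> a \<or> p \<le> b \<or> p \<le> c \<or> p \<le> u" using pos by (auto dest: dvd_imp_le)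
        moreover have "real a \<le> R" "real b \<le> R" "real c \<le> R" "real u \<le> R"
          using quad_dom_le[of a b c u R R R] t by (auto simp: abcu nats_le_def)
        ultimately show ?thesis using p by (auto simp: P_def primes_le_def)
      qed
      show "quad_weight_on P t = 0"
      proof (cases "squarefree u")
        case False
        then show ?thesis by (simp add: abcu quad_weight_on_def quad_weight_def moebius_mu_def)
      next
        case True
        then have "\<not> p\<^sup>2 dvd u" using p not_prime_unit squarefreeD[of u p] by auto
        then have "p dvd a \<or> p dvd b \<or> p dvd c" using pu p by (auto simp: prime_dvd_mult_iff)
        moreover have "p\<^sup>2 dvd a * b * c" if "\<not> p dvd u"
        proof -
          have "coprime (p\<^sup>2) u" using that p by (simp add: prime_imp_coprime)
          then show ?thesis using p by (simp add: coprime_dvd_mult_left_iff)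
        qed
        ultimately have "quad_local p t = 0" by (auto simp: quad_local_def abcu)
        then show ?thesis unfolding quad_weight_on_def using P(1) pP by (auto intro!: prod_zero)
      qed
    qed
  qed (auto simp: Q_def)
  finally show ?thesis by (simp add: P_def quad_sum_def)
qed

section \<open>Correlations at unequal shifts: Rankin's trick and Euler products\<close>

lemma sum_Pow_prod_bool:
  fixes f :: "'a \<Rightarrow> bool \<Rightarrow> real"
  assumes "finite P"
  shows "(\<Sum>S\<in>Pow P. \<Prod>p\<in>P. f p (p \<in> S)) = (\<Prod>p\<in>P. f p True + f p False)"
proof -
  have "(\<Sum>S\<in>Pow P. \<Prod>p\<in>P. f p (p \<in> S)) = (\<Sum>S\<in>Pow P. \<Prod>p\<in>P. if p \<in> S then f p True else f p False)"
    by (intro sum.cong prod.cong refl) simp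
  then show ?thesis using sum_Pow_prod[OF assms] by simp
qed

text \<open>Choosing three subsets independently is choosing one of eight patterns at each
  prime.\<close>

lemma sum_Pow_prod_bool3:
  fixes f :: "'a \<Rightarrow> bool \<Rightarrow> bool \<Rightarrow> bool \<Rightarrow> real"
  assumes "finite P"
  shows "(\<Sum>S1\<in>Pow P. \<Sum>S2\<in>Pow P. \<Sum>S3\<in>Pow P. \<Prod>p\<in>P. f p (p \<in> S1) (p \<in> S2) (p \<in> S3)) =
     (\<Prod>p\<in>P. f p True True True + f p True True False + f p True False True + f p True False False
        + f p False True True + f p False True False + f p False False True + f p False False False)"
proof -
  have "(\<Sum>S1\<in>Pow P. \<Sum>S2\<in>Pow P. \<Sum>S3\<in>Pow P. \<Prod>p\<in>P. f p (p \<in> S1) (p \<in> S2) (p \<in> S3)) =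
    (\<Sum>S1\<in>Pow P. \<Sum>S2\<in>Pow P. \<Prod>p\<in>P. f p (p \<in> S1) (p \<in> S2) True + f p (p \<in> S1) (p \<in> S2) False)"
    by (intro sum.cong refl sum_Pow_prod_bool[OF assms])
  also have "\<dots> = (\<Sum>S1\<in>Pow P. \<Prod>p\<in>P. (f p (p \<in> S1) True True + f p (p \<in> S1) True False)
       + (f p (p \<in> S1) False True + f p (p \<in> S1) False False))"
  proof (rule sum.cong[OF refl])
    fix S1
    show "(\<Sum>S2\<in>Pow P. \<Prod>p\<in>P. f p (p \<in> S1) (p \<in> S2) True + f p (p \<in> S1) (p \<in> S2) False) =
      (\<Prod>p\<in>P. (f p (p \<in> S1) True True + f p (p \<in> S1) True False) + (f p (p \<in> S1) False True + f p (p \<in> S1) False False))"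
      by (rule sum_Pow_prod_bool[OF assms, where f = "\<lambda>p y. f p (p \<in> S1) y True + f p (p \<in> S1) y False"])
  qed
  also have "\<dots> = (\<Prod>p\<in>P. ((f p True True True + f p True True False) + (f p True False True + f p True False False))
     + ((f p False True True + f p False True False) + (f p False False True + f p False False False)))"
    by (rule sum_Pow_prod_bool[OF assms, where f = "\<lambda>p x. (f p x True True + f p x True False) + (f p x False True + f p x False False)"])
  finally show ?thesis by (simp add: add_ac)
qed

text \<open>Expanding the product gives a sum over subsets \<open>D\<close> with
  \<open>\<Prod>D dvd r\<close>. At most \<open>h / \<Prod>D\<close> of the \<open>r\<close>
  qualify, which turns each \<open>g p\<close> into \<open>g p / p\<close>. Used for differences of
  shifts and again for the weights of the moduli up to \<open>R\<close>.\<close>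

lemma sum_divisor_product_le:
  fixes g :: "nat \<Rightarrow> real" and h :: nat
  assumes P: "finite P" "\<And>p. p \<in> P \<Longrightarrow> prime p" and g: "\<And>p. p \<in> P \<Longrightarrow> g p \<ge> 0"
  shows "(\<Sum>r=1..h. \<Prod>p\<in>P. if p dvd r then 1 + g p else 1) \<le> h * (\<Prod>p\<in>P. 1 + g p / p)"
proof -
  have "(\<Sum>r=1..h. \<Prod>p\<in>P. if p dvd r then 1 + g p else 1) =
        (\<Sum>r=1..h. \<Sum>D\<in>Pow P. (\<Prod>p\<in>D. g p) * (if \<Prod>D dvd r then 1 else 0))"
  proof (intro sum.cong refl)
    fix r
    have "(\<Prod>p\<in>P. if p dvd r then 1 + g p else 1) = (\<Prod>p\<in>P. (if p dvd r then g p else 0) + 1)"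
      by (intro prod.cong) auto
    also have "\<dots> = (\<Sum>D\<in>Pow P. \<Prod>p\<in>D. if p dvd r then g p else 0)"
      by (rule sum_Pow_prod_subset[symmetric, OF P(1)])
    also have "\<dots> = (\<Sum>D\<in>Pow P. (\<Prod>p\<in>D. g p) * (if \<Prod>D dvd r then 1 else 0))"
    proof (intro sum.cong refl)
      fix D assume D: "D \<in> Pow P"
      then have fin: "finite D" "\<And>p. p \<in> D \<Longrightarrow> prime p" using P finite_subset by auto
      show "(\<Prod>p\<in>D. if p dvd r then g p else 0) = (\<Prod>p\<in>D. g p) * (if \<Prod>D dvd r then 1 else 0)"
        using fin by (auto simp: prod_primes_dvd_iff[OF fin] intro!: prod_zero)
    qed
    finally show "(\<Prod>p\<in>P. if p dvd r then 1 + g p else 1) = \<dots>" .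
  qed
  also have "\<dots> = (\<Sum>D\<in>Pow P. (\<Prod>p\<in>D. g p) * (\<Sum>r=1..h. if \<Prod>D dvd r then 1 else 0))"
    by (subst sum.swap) (simp add: sum_distrib_left)
  also have "\<dots> \<le> (\<Sum>D\<in>Pow P. (\<Prod>p\<in>D. g p) * (h / real (\<Prod>D)))"
  proof (intro sum_mono mult_left_mono)
    fix D assume D: "D \<in> Pow P"
    then have pos: "\<Prod>D > 0" using P by (intro prod_pos) (auto simp: prime_gt_0_nat subset_iff)
    have "(\<Sum>r=1..h. if \<Prod>D dvd r then 1 else 0) = real (card {r \<in> {1..h}. \<Prod>D dvd r})"
      by (simp add: sum.If_cases Int_def)
    also have "card {r \<in> {1..h}. \<Prod>D dvd r} \<le> card ((\<lambda>m. \<Prod>D * m) ` {1..h div \<Prod>D})"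
    proof (rule card_mono)
      show "{r \<in> {1..h}. \<Prod>D dvd r} \<subseteq> (\<lambda>m. \<Prod>D * m) ` {1..h div \<Prod>D}"
      proof
        fix r assume r: "r \<in> {r \<in> {1..h}. \<Prod>D dvd r}"
        then obtain m where m: "r = \<Prod>D * m" by (auto elim: dvdE)
        then have "m \<ge> 1" "m \<le> h div \<Prod>D" using r pos by (auto simp: less_eq_div_iff_mult_less_eq mult.commute Suc_le_eq)
        then show "r \<in> (\<lambda>m. \<Prod>D * m) ` {1..h div \<Prod>D}" using m by auto
      qed
    qed auto
    also have "\<dots> \<le> h div \<Prod>D" using card_image_le[of "{1..h div \<Prod>D}" "\<lambda>m. \<Prod>D * m"] by simp
    also have "real (h div \<Prod>D) \<le> h / real (\<Prod>D)" by (rule of_nat_div_le_of_nat)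
    finally show "(\<Sum>r=1..h. if \<Prod>D dvd r then 1 else 0) \<le> h / real (\<Prod>D)" by simp
    show "0 \<le> prod g D" using D g by (intro prod_nonneg) auto
  qed
  also have "\<dots> = h * (\<Sum>D\<in>Pow P. \<Prod>p\<in>D. g p / p)"
    by (simp add: sum_distrib_left prod_dividef mult_ac)
  also have "\<dots> = h * (\<Prod>p\<in>P. 1 + g p / p)"
    by (subst sum_Pow_prod_subset[OF P(1)]) (simp add: add.commute)
  finally show ?thesis .
qed

text \<open>Majorants for the Rankin-weighted local correlations: \<open>base_factor\<close> where
  all shifts are incongruent modulo \<open>p\<close>, \<open>pair_factor\<close> where
  \<open>i\<close> and \<open>j\<close> coincide. The 5 comes from
  \<open>local_corr_abs_sum\<close>, the power 1/4 from Rankin's weight. The product of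
  \<open>base_factor\<close> converges; for \<open>i \<noteq> j\<close> the factor
  \<open>pair_factor\<close> differs from 1 only at divisors of \<open>i - j\<close>.\<close>

definition pair_factor :: "nat \<Rightarrow> nat \<Rightarrow> nat \<Rightarrow> real" where
  "pair_factor p i j = 1 + cong_dvd_ind p i j * (5 * p powr (1/4) / (real p - 1))"

definition base_factor :: "nat \<Rightarrow> real" where
  "base_factor p = 1 + 5 * p powr (1/4) / (real p - 1)^2"

definition pair_prod :: "nat set \<Rightarrow> nat \<Rightarrow> nat \<Rightarrow> real" where
  "pair_prod P i j = (\<Prod>p\<in>P. pair_factor p i j)"

lemma cong_dvd_ind_range: "0 \<le> cong_dvd_ind p i j" "cong_dvd_ind p i j \<le> 1" "cong_dvd_ind p i j = 0 \<or> cong_dvd_ind p i j = 1"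
  by (auto simp: cong_dvd_ind_def)

lemma cong_dvd_ind_commute: "cong_dvd_ind p i j = cong_dvd_ind p j i"
  by (auto simp: cong_dvd_ind_def cong_sym_eq)

lemma pair_factor_ge_1: "p > 1 \<Longrightarrow> pair_factor p i j \<ge> 1"
  using cong_dvd_ind_range[of p i j] by (simp add: pair_factor_def)

lemma pair_factor_commute: "pair_factor p i j = pair_factor p j i"
  by (simp add: pair_factor_def cong_dvd_ind_commute)

lemma cong_dvd_ind_trans: "cong_dvd_ind p i j = 1 \<Longrightarrow> cong_dvd_ind p i k = cong_dvd_ind p j k"
  by (auto simp: cong_dvd_ind_def split: if_splits dest: cong_trans cong_sym)

text \<open>With \<open>r = p - 1\<close>: for incongruent shifts the sum is \<open>2 / r^3\<close>
  plus three times \<open>1 / r^2\<close>; otherwise each of the four terms is at most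
  \<open>1 / r\<close>. The other patterns give 0, or 1 when \<open>p\<close> divides no
  modulus.\<close>

lemma local_corr_abs_sum:
  assumes p: "prime p"
  shows "\<bar>local_corr p True True True i j k\<bar> + \<bar>local_corr p True True False i j k\<bar> + \<bar>local_corr p True False True i j k\<bar> + \<bar>local_corr p False True True i j k\<bar>
     \<le> (if cong_dvd_ind p i j = 0 \<and> cong_dvd_ind p i k = 0 \<and> cong_dvd_ind p j k = 0 then 5 / (real p - 1)^2 else 5 / (real p - 1))"
proof -
  define r where "r = real p - 1"
  have r: "r \<ge> 1" "real p = r + 1" using prime_ge_2_nat[OF p] by (auto simp: r_def)
  have i1: "1 / r^2 \<le> 1 / r" "1 / r^3 \<le> 1 / r^2" "1 / r \<le> 1" "0 \<le> 1 / r"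
    using r by (simp_all add: field_simps power2_eq_square power3_eq_cube)
  have pr: "(r + 1 - 1) / r^2 = 1 / r" using r by (simp add: power2_eq_square)
  \<comment> \<open>Congruence is transitive, so exactly two coincidences cannot occur and five of
    the eight cases remain.\<close>
  have cases: "cong_dvd_ind p i j = 0 \<and> cong_dvd_ind p i k = 0 \<and> cong_dvd_ind p j k = 0 \<or> cong_dvd_ind p i j = 1 \<and> cong_dvd_ind p i k = 0 \<and> cong_dvd_ind p j k = 0 \<or>
    cong_dvd_ind p i j = 0 \<and> cong_dvd_ind p i k = 1 \<and> cong_dvd_ind p j k = 0 \<or> cong_dvd_ind p i j = 0 \<and> cong_dvd_ind p i k = 0 \<and> cong_dvd_ind p j k = 1 \<or>
    cong_dvd_ind p i j = 1 \<and> cong_dvd_ind p i k = 1 \<and> cong_dvd_ind p j k = 1"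
    using cong_dvd_ind_range(3)[of p i j] cong_dvd_ind_range(3)[of p i k] cong_dvd_ind_range(3)[of p j k]
      cong_dvd_ind_trans[of p i j k] cong_dvd_ind_trans[of p i k j] cong_dvd_ind_trans[of p j k i] by (auto simp: cong_dvd_ind_commute)
  have one: "\<bar>(-2 + (r + 1)) / r^3\<bar> \<le> 1 / r^2"
  proof -
    have "\<bar>(-2 + (r + 1)) / r^3\<bar> = (r - 1) / r^3" using r by simp
    also have "\<dots> \<le> r / r^3" using r by (intro divide_right_mono) auto
    finally show ?thesis using r by (simp add: power2_eq_square power3_eq_cube)
  qed
  have all: "\<bar>(-2 + (r + 1) * 3 - (r + 1)^2) / r^3\<bar> \<le> 1 / r"
  proof -
    have "-2 + (r + 1) * 3 - (r + 1)^2 = - (r * (r - 1))" by (simp add: power2_eq_square algebra_simps)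
    then have "\<bar>(-2 + (r + 1) * 3 - (r + 1)^2) / r^3\<bar> = r * (r - 1) / r^3" using r by simp
    also have "\<dots> \<le> r * r / r^3" using r by (intro divide_right_mono mult_left_mono) auto
    finally show ?thesis using r by (simp add: power3_eq_cube)
  qed
  have two: "\<bar>local_corr p True True False i j k\<bar> = (if cong_dvd_ind p i j = 1 then 1 / r else 1 / r^2)"
    "\<bar>local_corr p True False True i j k\<bar> = (if cong_dvd_ind p i k = 1 then 1 / r else 1 / r^2)"
    "\<bar>local_corr p False True True i j k\<bar> = (if cong_dvd_ind p j k = 1 then 1 / r else 1 / r^2)"
    using cong_dvd_ind_range(3)[of p i j] cong_dvd_ind_range(3)[of p i k] cong_dvd_ind_range(3)[of p j k] r pr
    by (auto simp: local_corr_def r(2) abs_divide power2_eq_square)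
  define v where "v = \<bar>local_corr p True True True i j k\<bar>"
  have v: "v = \<bar>(-2 + (r + 1) * (cong_dvd_ind p i j + cong_dvd_ind p i k + cong_dvd_ind p j k) - (r + 1)^2 * cong_dvd_ind p i j * cong_dvd_ind p i k) / r^3\<bar>"
    by (simp add: v_def local_corr_def r(2))
  have f5: "5 / (real p - 1)\<^sup>2 = 5 * (1 / r^2)" "5 / (real p - 1) = 5 * (1 / r)" by (simp_all add: r_def)
  have none: "\<bar>-2 / r^3\<bar> = 2 * (1 / r^3)" using r by (simp add: abs_divide)
  show ?thesis
    unfolding two v_def[symmetric] using cases
  proof (elim disjE conjE)
    assume c: "cong_dvd_ind p i j = 0" "cong_dvd_ind p i k = 0" "cong_dvd_ind p j k = 0"
    have "v = 2 * (1 / r^3)" unfolding v c using none by simp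
    then show "v + (if cong_dvd_ind p i j = 1 then 1 / r else 1 / r\<^sup>2) + (if cong_dvd_ind p i k = 1 then 1 / r else 1 / r\<^sup>2) + (if cong_dvd_ind p j k = 1 then 1 / r else 1 / r\<^sup>2)
      \<le> (if cong_dvd_ind p i j = 0 \<and> cong_dvd_ind p i k = 0 \<and> cong_dvd_ind p j k = 0 then 5 / (real p - 1)\<^sup>2 else 5 / (real p - 1))"
      using i1 unfolding f5 by (simp only: c simp_thms if_True if_False zero_neq_one one_neq_zero)
  next
    assume c: "cong_dvd_ind p i j = 1" "cong_dvd_ind p i k = 0" "cong_dvd_ind p j k = 0"
    have "v \<le> 1 / r^2" unfolding v c using one by simp
    then show "v + (if cong_dvd_ind p i j = 1 then 1 / r else 1 / r\<^sup>2) + (if cong_dvd_ind p i k = 1 then 1 / r else 1 / r\<^sup>2) + (if cong_dvd_ind p j k = 1 then 1 / r else 1 / r\<^sup>2)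
      \<le> (if cong_dvd_ind p i j = 0 \<and> cong_dvd_ind p i k = 0 \<and> cong_dvd_ind p j k = 0 then 5 / (real p - 1)\<^sup>2 else 5 / (real p - 1))"
      using i1 unfolding f5 by (simp only: c simp_thms if_True if_False zero_neq_one one_neq_zero)
  next
    assume c: "cong_dvd_ind p i j = 0" "cong_dvd_ind p i k = 1" "cong_dvd_ind p j k = 0"
    have "v \<le> 1 / r^2" unfolding v c using one by simp
    then show "v + (if cong_dvd_ind p i j = 1 then 1 / r else 1 / r\<^sup>2) + (if cong_dvd_ind p i k = 1 then 1 / r else 1 / r\<^sup>2) + (if cong_dvd_ind p j k = 1 then 1 / r else 1 / r\<^sup>2)
      \<le> (if cong_dvd_ind p i j = 0 \<and> cong_dvd_ind p i k = 0 \<and> cong_dvd_ind p j k = 0 then 5 / (real p - 1)\<^sup>2 else 5 / (real p - 1))"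
      using i1 unfolding f5 by (simp only: c simp_thms if_True if_False zero_neq_one one_neq_zero)
  next
    assume c: "cong_dvd_ind p i j = 0" "cong_dvd_ind p i k = 0" "cong_dvd_ind p j k = 1"
    have "v \<le> 1 / r^2" unfolding v c using one by simp
    then show "v + (if cong_dvd_ind p i j = 1 then 1 / r else 1 / r\<^sup>2) + (if cong_dvd_ind p i k = 1 then 1 / r else 1 / r\<^sup>2) + (if cong_dvd_ind p j k = 1 then 1 / r else 1 / r\<^sup>2)
      \<le> (if cong_dvd_ind p i j = 0 \<and> cong_dvd_ind p i k = 0 \<and> cong_dvd_ind p j k = 0 then 5 / (real p - 1)\<^sup>2 else 5 / (real p - 1))"
      using i1 unfolding f5 by (simp only: c simp_thms if_True if_False zero_neq_one one_neq_zero)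
  next
    assume c: "cong_dvd_ind p i j = 1" "cong_dvd_ind p i k = 1" "cong_dvd_ind p j k = 1"
    have "v \<le> 1 / r" unfolding v c using all by simp
    then show "v + (if cong_dvd_ind p i j = 1 then 1 / r else 1 / r\<^sup>2) + (if cong_dvd_ind p i k = 1 then 1 / r else 1 / r\<^sup>2) + (if cong_dvd_ind p j k = 1 then 1 / r else 1 / r\<^sup>2)
      \<le> (if cong_dvd_ind p i j = 0 \<and> cong_dvd_ind p i k = 0 \<and> cong_dvd_ind p j k = 0 then 5 / (real p - 1)\<^sup>2 else 5 / (real p - 1))"
      using i1 unfolding f5 by (simp only: c simp_thms if_True if_False zero_neq_one one_neq_zero)
  qed
qed

lemma local_corr_zero [simp]: "local_corr p True False False i j k = 0" "local_corr p False True False i j k = 0"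
    "local_corr p False False True i j k = 0" "local_corr p False False False i j k = 1"
  by (simp_all add: local_corr_def)

lemma prod_base_factor_bounded:
  assumes P: "finite P" "\<And>p. p \<in> P \<Longrightarrow> prime p"
  shows "(\<Prod>p\<in>P. base_factor p) \<le> exp (20 * (1 + 1 / (3/4)))"
proof (rule prod_primes_bounded[OF P(1)])
  fix p assume p: "p \<in> P"
  show "1 \<le> p" using P(2)[OF p] prime_gt_0_nat[of p] by simp
  have r: "real p \<ge> 2" using P(2)[OF p] prime_ge_2_nat[of p] by simp
  have "5 * p powr (1/4) / (real p - 1)^2 \<le> 5 * p powr (1/4) / (p / 2)^2"
    using r by (intro divide_left_mono power_mono) auto
  also have "\<dots> = 20 * (p powr (1/4) / p^2)" by (simp add: power_divide)
  also have "p powr (1/4) / p^2 = p powr (-1 - 3/4)" using r powr_diff[of "real p" "1/4" 2] by simp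
  finally show "0 \<le> base_factor p \<and> base_factor p \<le> 1 + 20 * p powr (-1 - 3/4)" by (simp add: base_factor_def)
qed auto

lemma pair_prod_ge_1: "(\<And>p. p \<in> P \<Longrightarrow> prime p) \<Longrightarrow> pair_prod P i j \<ge> 1"
  unfolding pair_prod_def by (intro prod_ge_1 pair_factor_ge_1) (use prime_gt_1_nat in blast)

text \<open>Cubes appear because a product of three \<open>pair_prod\<close> is separated by AM-GM.
  The excess \<open>x\<close> of \<open>pair_factor\<close> is at most
  \<open>10 * p powr (-(3/4))\<close> and at most 10, so
  \<open>(1 + x)^3 \<le> 1 + (3 + 30 + 100) * x\<close>, whence
  \<open>1330 = 10 * 133\<close>.\<close>

lemma sum_pair_prod_cubed:
  assumes P: "finite P" "\<And>p. p \<in> P \<Longrightarrow> prime p"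
  defines "g \<equiv> \<lambda>p::nat. 1330 * p powr (-(3/4))"
  shows "pair_prod P i j ^ 3 \<le> (\<Prod>p\<in>P. if [i = j] (mod p) then 1 + g p else 1)"
proof -
  have "pair_prod P i j ^ 3 = (\<Prod>p\<in>P. pair_factor p i j ^ 3)" by (simp add: pair_prod_def prod_power_distrib)
  also have "\<dots> \<le> (\<Prod>p\<in>P. if [i = j] (mod p) then 1 + g p else 1)"
  proof (intro prod_mono conjI)
    fix p assume "p \<in> P"
    then have r: "real p \<ge> 2" using P(2)[of p] prime_ge_2_nat[of p] by simp
    then have k1: "pair_factor p i j \<ge> 1" by (intro pair_factor_ge_1) simp
    then show "0 \<le> pair_factor p i j ^ 3" by simp
    show "pair_factor p i j ^ 3 \<le> (if [i = j] (mod p) then 1 + g p else 1)"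
    proof (cases "[i = j] (mod p)")
      case True
      define x where "x = 5 * p powr (1/4) / (real p - 1)"
      have x: "pair_factor p i j = 1 + x" "x \<ge> 0" using True r by (auto simp: pair_factor_def cong_dvd_ind_def x_def)
      have "x \<le> 5 * p powr (1/4) / (p / 2)" unfolding x_def using r by (intro divide_left_mono) auto
      also have "\<dots> = 10 * (p powr (1/4) / p)" by simp
      also have "p powr (1/4) / p = p powr (-(3/4))" using r powr_diff[of "real p" "1/4" 1] by simp
      finally have xg: "x \<le> 10 * p powr (-(3/4))" .
      have "p powr (-(3/4)) \<le> 1" using r powr_neg_antimono[of 1 "real p" "3/4"] by simp
      then have x10: "x \<le> 10" using xg by simp
      have "x * x \<le> 10 * x" using x x10 by (intro mult_right_mono)
      moreover have "x * x * x \<le> 10 * (10 * x)"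
        using mult_mono[of "x * x" "10 * x" x 10] x x10 \<open>x * x \<le> 10 * x\<close> by (simp add: mult_ac)
      ultimately have "(1 + x)^3 \<le> 1 + 133 * x" by (simp add: power3_eq_cube algebra_simps)
      then show ?thesis using True xg x(1) by (simp add: g_def)
    qed (auto simp: pair_factor_def cong_dvd_ind_def)
  qed
  finally show ?thesis .
qed

definition large :: "real \<Rightarrow> real \<Rightarrow> nat set set" where
  "large Q R = {S \<in> sqf_sets R. real (\<Prod>S) > Q}"

lemma largeD: "S \<in> large Q R \<Longrightarrow> S \<in> sqf_sets R" "S \<in> large Q R \<Longrightarrow> real (\<Prod>S) > Q"
  by (simp_all only: large_def mem_Collect_eq)

lemma finite_large [simp, intro]: "finite (large Q R)"
  by (simp add: large_def)

lemma large_subset_Pow: "large Q R \<subseteq> Pow (primes_le R)"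
  using sqf_setsD(4) largeD(1) by blast

text \<open>The weight is \<open>(\<Prod>S / Q) powr (1/4)\<close>. It trades the condition
  \<open>\<Prod>S > Q\<close>, which does not factor over primes, for a multiplicative
  majorant.\<close>

lemma rankin_weight:
  assumes S: "S \<in> large Q R" and Q: "Q > 0"
  shows "1 \<le> Q powr (-(1/4)) * (\<Prod>p\<in>primes_le R. if p \<in> S then real p powr (1/4) else 1)"
proof -
  note A = sqf_setsD[OF largeD(1)[OF S]]
  have "(\<Prod>p\<in>primes_le R. if p \<in> S then real p powr (1/4) else 1) = (\<Prod>p\<in>S. real p powr (1/4))"
    using A(4) by (simp add: prod.If_cases Int_absorb1)
  also have "\<dots> = real (\<Prod>S) powr (1/4)" unfolding of_nat_prod by (rule prod_powr_distrib[symmetric])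
  finally have eq: "(\<Prod>p\<in>primes_le R. if p \<in> S then real p powr (1/4) else 1) = real (\<Prod>S) powr (1/4)" .
  have "Q powr (1/4) \<le> real (\<Prod>S) powr (1/4)" using largeD(2)[OF S] Q by (intro powr_mono2) auto
  then have "Q powr (-(1/4)) * Q powr (1/4) \<le> Q powr (-(1/4)) * real (\<Prod>S) powr (1/4)" by (intro mult_left_mono) auto
  moreover have "Q powr (-(1/4)) * Q powr (1/4) = 1" using Q by (simp add: powr_add[symmetric])
  ultimately show ?thesis unfolding eq by simp
qed

text \<open>The counterpart for the upper cut: \<open>n powr (-(1 / ln R))\<close> is at least
  \<open>exp (-1)\<close> for \<open>1 \<le> n \<le> R\<close>. It keeps products over primes with
  terms of order \<open>1 / p\<close> at size \<open>ln R\<close>.\<close>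

lemma inverse_weight:
  assumes S: "S \<in> sqf_sets R" and R: "R > 1"
  shows "1 \<le> exp 1 * (\<Prod>p\<in>primes_le R. if p \<in> S then real p powr (-(1 / ln R)) else 1)"
proof -
  note A = sqf_setsD[OF S]
  have "(\<Prod>p\<in>primes_le R. if p \<in> S then real p powr (-(1 / ln R)) else 1) = (\<Prod>p\<in>S. real p powr (-(1 / ln R)))"
    using A(4) by (simp add: prod.If_cases Int_absorb1)
  also have "\<dots> = real (\<Prod>S) powr (-(1 / ln R))" unfolding of_nat_prod by (rule prod_powr_distrib[symmetric])
  also have "\<dots> \<ge> R powr (-(1 / ln R))"
  proof (rule powr_mono2')
    have "\<Prod>S > 0" using A(2) by (intro prod_pos) (auto simp: prime_gt_0_nat)
    then show "0 < real (\<Prod>S)" by (simp del: of_nat_prod)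
  qed (use A(3) R in auto)
  also have "R powr (-(1 / ln R)) = exp (-1)" using R by (simp add: powr_def)
  finally have "exp 1 * exp (-1) \<le> exp 1 * (\<Prod>p\<in>primes_le R. if p \<in> S then real p powr (-(1 / ln R)) else 1)"
    by (intro mult_left_mono) auto
  then show ?thesis by (simp add: exp_minus)
qed

text \<open>Once the summand has a nonnegative multiplicative majorant, the three sets may run over
  all subsets of \<open>P\<close>, and the triple sum becomes an Euler product.\<close>

lemma corr3_abs_le:
  assumes sub: "\<A> \<subseteq> Pow P" and P: "finite P" and c: "c \<ge> 0"
    and f: "\<And>p x y z. f p x y z \<ge> 0"
    and le: "\<And>S1 S2 S3. S1 \<in> \<A> \<Longrightarrow> S2 \<in> \<A> \<Longrightarrow> S3 \<in> \<A> \<Longrightarrow>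
      \<bar>\<Prod>p\<in>P. local_corr p (p \<in> S1) (p \<in> S2) (p \<in> S3) i j k\<bar> \<le> c * (\<Prod>p\<in>P. f p (p \<in> S1) (p \<in> S2) (p \<in> S3))"
  shows "\<bar>corr3 P \<A> i j k\<bar> \<le> c * (\<Prod>p\<in>P. f p True True True + f p True True False + f p True False True + f p True False False
        + f p False True True + f p False True False + f p False False True + f p False False False)"
proof -
  have fin: "finite \<A>" using sub P by (meson finite_Pow_iff finite_subset)
  have "\<bar>corr3 P \<A> i j k\<bar> \<le> (\<Sum>S1\<in>\<A>. \<Sum>S2\<in>\<A>. \<Sum>S3\<in>\<A>. c * (\<Prod>p\<in>P. f p (p \<in> S1) (p \<in> S2) (p \<in> S3)))"
    unfolding corr3_def by (intro order_trans[OF sum_abs] sum_mono le)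
  also have "\<dots> \<le> (\<Sum>S1\<in>Pow P. \<Sum>S2\<in>Pow P. \<Sum>S3\<in>Pow P. c * (\<Prod>p\<in>P. f p (p \<in> S1) (p \<in> S2) (p \<in> S3)))"
  proof -
    have nn: "0 \<le> c * (\<Prod>p\<in>P. f p (p \<in> S1) (p \<in> S2) (p \<in> S3))" for S1 S2 S3
      using c f by (intro mult_nonneg_nonneg prod_nonneg) auto
    have "(\<Sum>S1\<in>\<A>. \<Sum>S2\<in>\<A>. \<Sum>S3\<in>\<A>. c * (\<Prod>p\<in>P. f p (p \<in> S1) (p \<in> S2) (p \<in> S3))) \<le>
      (\<Sum>S1\<in>\<A>. \<Sum>S2\<in>\<A>. \<Sum>S3\<in>Pow P. c * (\<Prod>p\<in>P. f p (p \<in> S1) (p \<in> S2) (p \<in> S3)))"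
      using sub P nn by (intro sum_mono sum_mono2) auto
    also have "\<dots> \<le> (\<Sum>S1\<in>\<A>. \<Sum>S2\<in>Pow P. \<Sum>S3\<in>Pow P. c * (\<Prod>p\<in>P. f p (p \<in> S1) (p \<in> S2) (p \<in> S3)))"
      using sub P nn by (intro sum_mono sum_mono2 sum_nonneg) auto
    also have "\<dots> \<le> (\<Sum>S1\<in>Pow P. \<Sum>S2\<in>Pow P. \<Sum>S3\<in>Pow P. c * (\<Prod>p\<in>P. f p (p \<in> S1) (p \<in> S2) (p \<in> S3)))"
      using sub P nn by (intro sum_mono2 sum_nonneg) auto
    finally show ?thesis .
  qed
  also have "\<dots> = c * (\<Sum>S1\<in>Pow P. \<Sum>S2\<in>Pow P. \<Sum>S3\<in>Pow P. \<Prod>p\<in>P. f p (p \<in> S1) (p \<in> S2) (p \<in> S3))"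
    by (simp add: sum_distrib_left)
  finally show ?thesis by (simp only: sum_Pow_prod_bool3[OF P])
qed

definition base_const :: real where "base_const = exp (20 * (1 + 1 / (3/4)))"

lemma base_const_pos: "base_const > 0" by (simp add: base_const_def)

lemma primes_leD: "p \<in> primes_le R \<Longrightarrow> prime p" by (simp add: primes_le_def)

lemma base_factor_ge_1: "base_factor p \<ge> 1" by (simp add: base_factor_def)

text \<open>One Rankin weight, on the first modulus, suffices. At a prime that separates the shifts
  the sum over patterns is bounded by \<open>base_factor\<close>, at the others one
  \<open>pair_factor\<close> absorbs it. The bound has value for pairwise distinct shifts, since
  \<open>pair_prod\<close> at two equal shifts runs over every prime.\<close>

lemma corr3_distinct:
  assumes Q: "Q > 0"
  shows "\<bar>corr3 (primes_le R) (large Q R) i j k\<bar> \<le>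
    Q powr (-(1/4)) * base_const * pair_prod (primes_le R) i j * pair_prod (primes_le R) i k * pair_prod (primes_le R) j k"
proof -
  define P where "P = primes_le R"
  have P: "finite P" "\<And>p. p \<in> P \<Longrightarrow> prime p" using primes_leD by (auto simp: P_def)
  define f where "f p x y z = (if x then real p powr (1/4) else 1) * \<bar>local_corr p x y z i j k\<bar>" for p x y z
  have "\<bar>corr3 P (large Q R) i j k\<bar> \<le> Q powr (-(1/4)) * (\<Prod>p\<in>P. f p True True True + f p True True False + f p True False True + f p True False False
        + f p False True True + f p False True False + f p False False True + f p False False False)"
  proof (rule corr3_abs_le)
    fix S1 S2 S3 assume S: "S1 \<in> large Q R"
    have "1 * \<bar>\<Prod>p\<in>P. local_corr p (p \<in> S1) (p \<in> S2) (p \<in> S3) i j k\<bar> \<le>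
       (Q powr (-(1/4)) * (\<Prod>p\<in>P. if p \<in> S1 then real p powr (1/4) else 1)) * \<bar>\<Prod>p\<in>P. local_corr p (p \<in> S1) (p \<in> S2) (p \<in> S3) i j k\<bar>"
      using rankin_weight[OF S Q] by (intro mult_right_mono) (auto simp: P_def)
    also have "\<dots> = Q powr (-(1/4)) * (\<Prod>p\<in>P. f p (p \<in> S1) (p \<in> S2) (p \<in> S3))"
      by (simp add: f_def prod.distrib abs_prod)
    finally show "\<bar>\<Prod>p\<in>P. local_corr p (p \<in> S1) (p \<in> S2) (p \<in> S3) i j k\<bar> \<le> Q powr (-(1/4)) * (\<Prod>p\<in>P. f p (p \<in> S1) (p \<in> S2) (p \<in> S3))" by simp
  qed (use P large_subset_Pow in \<open>auto simp: f_def P_def\<close>)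
  also have "(\<Prod>p\<in>P. f p True True True + f p True True False + f p True False True + f p True False False
        + f p False True True + f p False True False + f p False False True + f p False False False) \<le>
       (\<Prod>p\<in>P. base_factor p * pair_factor p i j * pair_factor p i k * pair_factor p j k)"
  proof (intro prod_mono conjI)
    fix p assume p: "p \<in> P"
    have r: "real p \<ge> 2" using P(2)[OF p] prime_ge_2_nat[of p] by simp
    show "0 \<le> f p True True True + f p True True False + f p True False True + f p True False False
        + f p False True True + f p False True False + f p False False True + f p False False False"
      by (simp add: f_def)
    define q where "q = real p powr (1/4)"
    have q: "q \<ge> 1" unfolding q_def using r by (simp add: ge_one_powr_ge_zero)
    have k: "pair_factor p i j \<ge> 1" "pair_factor p i k \<ge> 1" "pair_factor p j k \<ge> 1" using r by (auto intro: pair_factor_ge_1)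
    define T where "T = \<bar>local_corr p True True True i j k\<bar> + \<bar>local_corr p True True False i j k\<bar> + \<bar>local_corr p True False True i j k\<bar> + \<bar>local_corr p False True True i j k\<bar>"
    have "\<bar>local_corr p False True True i j k\<bar> * 1 \<le> \<bar>local_corr p False True True i j k\<bar> * q" using q by (intro mult_left_mono) auto
    then have "f p True True True + f p True True False + f p True False True + f p True False False
        + f p False True True + f p False True False + f p False False True + f p False False False \<le> 1 + q * T"
      by (simp add: f_def T_def q_def algebra_simps)
    also have "\<dots> \<le> base_factor p * pair_factor p i j * pair_factor p i k * pair_factor p j k"
    proof (cases "cong_dvd_ind p i j = 0 \<and> cong_dvd_ind p i k = 0 \<and> cong_dvd_ind p j k = 0")
      case True
      then have "q * T \<le> q * (5 / (real p - 1)^2)" using local_corr_abs_sum[OF P(2)[OF p], of i j k] q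
        by (intro mult_left_mono) (auto simp: T_def)
      then show ?thesis using True by (simp add: base_factor_def pair_factor_def q_def mult_ac)
    next
      case False
      then have "q * T \<le> q * (5 / (real p - 1))" using local_corr_abs_sum[OF P(2)[OF p], of i j k] q
        by (intro mult_left_mono) (auto simp: T_def)
      then have 1: "1 + q * T \<le> 1 + 5 * q / (real p - 1)" by (simp add: mult_ac)
      have kk: "pair_factor p i' j' = 1 + 5 * q / (real p - 1)" if "cong_dvd_ind p i' j' \<noteq> 0" for i' j'
        using that cong_dvd_ind_range(3)[of p i' j'] by (simp add: pair_factor_def q_def)
      from False consider "pair_factor p i j = 1 + 5 * q / (real p - 1)" | "pair_factor p i k = 1 + 5 * q / (real p - 1)" | "pair_factor p j k = 1 + 5 * q / (real p - 1)"
        using kk by blast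
      then show ?thesis
      proof cases
        case 1
        have "1 * pair_factor p i j * 1 * 1 \<le> base_factor p * pair_factor p i j * pair_factor p i k * pair_factor p j k"
          using base_factor_ge_1[of p] k by (intro mult_mono) auto
        then show ?thesis using 1 \<open>1 + q * T \<le> 1 + 5 * q / (real p - 1)\<close> by linarith
      next
        case 2
        have "1 * 1 * pair_factor p i k * 1 \<le> base_factor p * pair_factor p i j * pair_factor p i k * pair_factor p j k"
          using base_factor_ge_1[of p] k by (intro mult_mono) auto
        then show ?thesis using 2 \<open>1 + q * T \<le> 1 + 5 * q / (real p - 1)\<close> by linarith
      next
        case 3
        have "1 * 1 * 1 * pair_factor p j k \<le> base_factor p * pair_factor p i j * pair_factor p i k * pair_factor p j k"
          using base_factor_ge_1[of p] k by (intro mult_mono) auto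
        then show ?thesis using 3 \<open>1 + q * T \<le> 1 + 5 * q / (real p - 1)\<close> by linarith
      qed
    qed
    finally show "f p True True True + f p True True False + f p True False True + f p True False False
        + f p False True True + f p False True False + f p False False True + f p False False False \<le> base_factor p * pair_factor p i j * pair_factor p i k * pair_factor p j k" .
  qed
  also have "\<dots> = (\<Prod>p\<in>P. base_factor p) * (pair_prod P i j * pair_prod P i k * pair_prod P j k)"
    by (simp add: prod.distrib pair_prod_def mult_ac)
  also have "\<dots> \<le> base_const * (pair_prod P i j * pair_prod P i k * pair_prod P j k)"
    unfolding base_const_def using P pair_prod_ge_1[of P, OF P(2)]
    by (intro mult_right_mono prod_base_factor_bounded mult_nonneg_nonneg) (auto intro: order_trans[OF zero_le_one])
  finally have "\<bar>corr3 P (large Q R) i j k\<bar> \<le> Q powr (-(1/4)) * (base_const * (pair_prod P i j * pair_prod P i k * pair_prod P j k))"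
    by (simp add: mult_left_mono)
  then show ?thesis by (simp only: P_def mult.assoc)
qed

text \<open>Each factor is at most \<open>(1 + p powr (-1 - s)) * (1 + 2 * p powr (-2))\<close>. The
  first product expands into part of the series of \<open>n powr (-1 - s)\<close>, bounded by
  \<open>1 + 1 / s\<close>; the second converges. With \<open>s = 1 / ln R\<close> this has order
  \<open>ln R\<close>.\<close>

lemma prod_primes_inverse_power_le:
  assumes P: "finite P" "\<And>p. p \<in> P \<Longrightarrow> prime p" and s: "s > 0"
  shows "(\<Prod>p\<in>P. 1 + real p powr (-s) / (real p - 1)) \<le> exp (2 * 2) * (1 + 1 / s)"
proof -
  have "(\<Prod>p\<in>P. 1 + real p powr (-s) / (real p - 1)) \<le> (\<Prod>p\<in>P. (1 + real p powr (-1 - s)) * (1 + 2 * real p powr (-1 - 1)))"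
  proof (intro prod_mono conjI)
    fix p assume "p \<in> P"
    then have r: "real p \<ge> 2" using P prime_ge_2_nat[of p] by simp
    show "0 \<le> 1 + real p powr (-s) / (real p - 1)" using r by simp
    define a where "a = real p powr (-s)"
    have a: "0 \<le> a" "a \<le> 1" using r s powr_neg_antimono[of 1 "real p" s] by (auto simp: a_def)
    have "a / (real p - 1) = a / p + a / (p * (real p - 1))"
      using r by (simp add: field_simps)
    also have "a / (p * (real p - 1)) \<le> 1 / (p * (p / 2))"
      using r a by (intro frac_le mult_left_mono) auto
    also have "\<dots> = 2 * real p powr (-1 - 1)" using r by (simp add: powr_minus_divide power2_eq_square)
    also have "a / p = real p powr (-1 - s)" 
    proof -
      have e: "- 1 - s = - s - 1" by simp
      show ?thesis unfolding e powr_diff using r by (simp add: a_def)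
    qed
    finally have "1 + a / (real p - 1) \<le> 1 + real p powr (-1 - s) + 2 * real p powr (-1 - 1)" by simp
    also have "\<dots> \<le> (1 + real p powr (-1 - s)) * (1 + 2 * real p powr (-1 - 1))"
      by (simp add: algebra_simps)
    finally show "1 + real p powr (-s) / (real p - 1) \<le> (1 + real p powr (-1 - s)) * (1 + 2 * real p powr (-1 - 1))"
      by (simp add: a_def)
  qed
  also have "\<dots> = (\<Prod>p\<in>P. 1 + 2 * real p powr (-1 - 1)) * (\<Prod>p\<in>P. real p powr (-1 - s) + 1)"
    by (simp add: prod.distrib mult.commute add.commute)
  also have "(\<Prod>p\<in>P. real p powr (-1 - s) + 1) = (\<Sum>S\<in>Pow P. \<Prod>p\<in>S. real p powr (-1 - s))"
    by (rule sum_Pow_prod_subset[symmetric, OF P(1)])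
  also have "\<dots> = (\<Sum>S\<in>Pow P. real (\<Prod>S) powr (-1 - s))"
    unfolding of_nat_prod by (intro sum.cong refl prod_powr_distrib[symmetric])
  also have "\<dots> = (\<Sum>n\<in>(\<lambda>S. \<Prod>S) ` Pow P. real n powr (-1 - s))"
  proof (rule sum.reindex_cong[symmetric, where l = "\<lambda>S. \<Prod>S"])
    show "inj_on (\<lambda>S. \<Prod>S) (Pow P)"
    proof (rule inj_onI)
      fix S T assume ST: "S \<in> Pow P" "T \<in> Pow P" "\<Prod>S = \<Prod>T"
      have "prime_factors (\<Prod>V) = V" if "V \<in> Pow P" for V
        using that P finite_subset by (intro prime_factors_prod_primes) auto
      then show "S = T" using ST by metis
    qed
  qed auto
  finally have 1: "(\<Prod>p\<in>P. 1 + real p powr (-s) / (real p - 1)) \<le>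
    (\<Prod>p\<in>P. 1 + 2 * real p powr (-1 - 1)) * (\<Sum>n\<in>(\<lambda>S. \<Prod>S) ` Pow P. real n powr (-1 - s))" .
  have 2: "(\<Sum>n\<in>(\<lambda>S. \<Prod>S) ` Pow P. real n powr (-1 - s)) \<le> 1 + 1 / s"
  proof (rule sum_primes_powr_le)
    fix n assume "n \<in> (\<lambda>S. \<Prod>S) ` Pow P"
    then obtain S where S: "S \<subseteq> P" "n = \<Prod>S" by auto
    have "\<Prod>S > 0" using S P by (intro prod_pos) (auto simp: prime_gt_0_nat subset_iff)
    then show "n \<ge> 1" using S by simp
  qed (use P s in auto)
  have 3: "(\<Prod>p\<in>P. 1 + 2 * real p powr (-1 - 1)) \<le> exp (2 * (1 + 1 / 1))"
    using P by (intro prod_primes_bounded) (auto simp: Suc_le_eq prime_gt_0_nat)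
  have "(\<Prod>p\<in>P. 1 + 2 * real p powr (-1 - 1)) * (\<Sum>n\<in>(\<lambda>S. \<Prod>S) ` Pow P. real n powr (-1 - s)) \<le> exp (2 * (1 + 1 / 1)) * (1 + 1 / s)"
    by (intro mult_mono 2 3) (auto intro: sum_nonneg)
  with 1 show ?thesis by simp
qed

text \<open>Primes dividing just the two moduli at the repeated shift contribute
  \<open>1 / (p - 1)\<close> each, and their product would diverge without the upper cut;
  \<open>inverse_weight\<close> on \<open>S1\<close> limits it to \<open>ln R\<close>. Rankin's
  weight sits on \<open>S3\<close>, which leaves these primes unweighted. The constant is
  \<open>exp 1\<close> from \<open>inverse_weight\<close>, \<open>exp 4\<close> from the Euler
  product, and 2 from \<open>1 + ln R \<le> 2 * ln R\<close>.\<close>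

lemma corr3_pair:
  assumes Q: "Q > 0" and R: "ln R \<ge> 1" "R > 1"
  shows "\<bar>corr3 (primes_le R) (large Q R) i i k\<bar> \<le>
    Q powr (-(1/4)) * (2 * exp 5 * base_const) * ln R * pair_prod (primes_le R) i k"
proof -
  define P where "P = primes_le R"
  have P: "finite P" "\<And>p. p \<in> P \<Longrightarrow> prime p" using primes_leD by (auto simp: P_def)
  define s where "s = 1 / ln R"
  have s: "s > 0" using R by (simp add: s_def)
  define f where "f p x y z = (if x then real p powr (-s) else 1) * (if z then real p powr (1/4) else 1) * \<bar>local_corr p x y z i i k\<bar>" for p x y z
  define c where "c = exp 1 * Q powr (-(1/4))"
  have "\<bar>corr3 P (large Q R) i i k\<bar> \<le> c * (\<Prod>p\<in>P. f p True True True + f p True True False + f p True False True + f p True False False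
        + f p False True True + f p False True False + f p False False True + f p False False False)"
  proof (rule corr3_abs_le)
    fix S1 S2 S3 assume S: "S1 \<in> large Q R" "S3 \<in> large Q R"
    define l where "l = \<bar>\<Prod>p\<in>P. local_corr p (p \<in> S1) (p \<in> S2) (p \<in> S3) i i k\<bar>"
    have "1 * 1 \<le> (exp 1 * (\<Prod>p\<in>P. if p \<in> S1 then real p powr (-s) else 1)) *
        (Q powr (-(1/4)) * (\<Prod>p\<in>P. if p \<in> S3 then real p powr (1/4) else 1))"
      unfolding P_def s_def
      using inverse_weight[OF largeD(1)[OF S(1)] R(2)] rankin_weight[OF S(2) Q]
      by (intro mult_mono) (auto intro!: mult_nonneg_nonneg prod_nonneg)
    from mult_right_mono[OF this, of l] have "1 * l \<le> ((exp 1 * (\<Prod>p\<in>P. if p \<in> S1 then real p powr (-s) else 1)) *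
        (Q powr (-(1/4)) * (\<Prod>p\<in>P. if p \<in> S3 then real p powr (1/4) else 1))) * l"
      by (simp add: l_def)
    also have "\<dots> = c * (\<Prod>p\<in>P. f p (p \<in> S1) (p \<in> S2) (p \<in> S3))"
      by (simp add: f_def prod.distrib abs_prod c_def l_def mult_ac)
    finally show "\<bar>\<Prod>p\<in>P. local_corr p (p \<in> S1) (p \<in> S2) (p \<in> S3) i i k\<bar> \<le> c * (\<Prod>p\<in>P. f p (p \<in> S1) (p \<in> S2) (p \<in> S3))"
      by (simp add: l_def)
  qed (use P large_subset_Pow in \<open>auto simp: f_def P_def c_def\<close>)
  also have "(\<Prod>p\<in>P. f p True True True + f p True True False + f p True False True + f p True False False
        + f p False True True + f p False True False + f p False False True + f p False False False) \<le>
       (\<Prod>p\<in>P. (1 + real p powr (-s) / (real p - 1)) * base_factor p * pair_factor p i k)"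
  proof (intro prod_mono conjI)
    fix p assume p: "p \<in> P"
    have r: "real p \<ge> 2" using P(2)[OF p] prime_ge_2_nat[of p] by simp
    show "0 \<le> f p True True True + f p True True False + f p True False True + f p True False False
        + f p False True True + f p False True False + f p False False True + f p False False False"
      by (simp add: f_def)
    define q a where "q = real p powr (1/4)" and "a = real p powr (-s)"
    have q: "q \<ge> 1" unfolding q_def using r by (simp add: ge_one_powr_ge_zero)
    have a: "0 \<le> a" "a \<le> 1" using r s powr_neg_antimono[of 1 "real p" s] by (auto simp: a_def)
    have k: "pair_factor p i k \<ge> 1" using r by (auto intro: pair_factor_ge_1)
    define w where "w = real p - 1"
    have w: "w \<ge> 1" "real p = w + 1" using r by (auto simp: w_def)
    have cii: "cong_dvd_ind p i i = 1" by (simp add: cong_dvd_ind_def)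
    have v0: "\<bar>local_corr p True True False i i k\<bar> = 1 / w"
      using w by (simp add: local_corr_def cii power2_eq_square)
    define T where "T = \<bar>local_corr p True True True i i k\<bar> + \<bar>local_corr p True False True i i k\<bar> + \<bar>local_corr p False True True i i k\<bar>"
    have T: "T \<le> (if cong_dvd_ind p i k = 0 then 3 / w^2 else 3 / w)"
    proof -
      have ar: "1 / w^2 \<le> 1 / w" using w by (simp add: field_simps power2_eq_square)
      show ?thesis
      proof (cases "cong_dvd_ind p i k = 0")
        case True
        have "local_corr p True True True i i k = (w - 1) / w^3" using w True by (simp add: local_corr_def cii)
        also have "\<bar>\<dots>\<bar> \<le> w / w^3" using w by (simp add: abs_divide divide_right_mono)
        also have "\<dots> = 1 / w^2" using w by (simp add: power2_eq_square power3_eq_cube)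
        finally have "\<bar>local_corr p True True True i i k\<bar> \<le> 1 / w^2" .
        moreover have "\<bar>local_corr p True False True i i k\<bar> = 1 / w^2" "\<bar>local_corr p False True True i i k\<bar> = 1 / w^2"
          using w True by (simp_all add: local_corr_def abs_divide)
        ultimately show ?thesis using True by (simp add: T_def divide_inverse)
      next
        case False
        then have c1: "cong_dvd_ind p i k = 1" using cong_dvd_ind_range(3)[of p i k] by simp
        have "-2 + (w + 1) * 3 - (w + 1)^2 = - (w * (w - 1))" by (simp add: power2_eq_square algebra_simps)
        then have "local_corr p True True True i i k = - (w * (w - 1)) / w^3" using w c1 by (simp add: local_corr_def cii)
        also have "\<bar>\<dots>\<bar> = w * (w - 1) / w^3" using w by (simp add: abs_divide abs_mult)
        also have "\<dots> \<le> w * w / w^3" using w by (intro divide_right_mono mult_left_mono) auto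
        also have "\<dots> = 1 / w" using w by (simp add: power3_eq_cube)
        finally have "\<bar>local_corr p True True True i i k\<bar> \<le> 1 / w" .
        moreover have "\<bar>local_corr p True False True i i k\<bar> = 1 / w" "\<bar>local_corr p False True True i i k\<bar> = 1 / w"
          using w c1 by (simp_all add: local_corr_def power2_eq_square)
        ultimately show ?thesis using c1 by (simp add: T_def divide_inverse)
      qed
    qed
    have T0: "T \<ge> 0" by (simp add: T_def)
    have "a * q * \<bar>local_corr p True True True i i k\<bar> \<le> 1 * q * \<bar>local_corr p True True True i i k\<bar>"
      "a * q * \<bar>local_corr p True False True i i k\<bar> \<le> 1 * q * \<bar>local_corr p True False True i i k\<bar>"
      using a q by (intro mult_right_mono; simp)+
    then have "f p True True True + f p True True False + f p True False True + f p True False False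
        + f p False True True + f p False True False + f p False False True + f p False False False \<le> 1 + a / w + q * T"
      unfolding f_def T_def q_def[symmetric] a_def[symmetric] by (simp add: v0 ring_distribs)
    also have "\<dots> \<le> (1 + a / w) * (1 + q * T)"
      using a w T0 q by (simp add: ring_distribs)
    finally have le0: "f p True True True + f p True True False + f p True False True + f p True False False
        + f p False True True + f p False True False + f p False False True + f p False False False \<le> (1 + a / w) * (1 + q * T)" .
    have le1: "1 + q * T \<le> base_factor p * pair_factor p i k"
    proof (cases "cong_dvd_ind p i k = 0")
      case True
      have "3 / w^2 \<le> 5 / w^2" by (intro divide_right_mono) auto
      then have "T \<le> 5 / w^2" using T True by simp
      then have "q * T \<le> q * (5 / w^2)" using q by (intro mult_left_mono) auto
      then show ?thesis using True by (simp add: base_factor_def pair_factor_def q_def w_def mult_ac)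
    next
      case False
      have "3 / w \<le> 5 / w" using w by (intro divide_right_mono) auto
      then have "T \<le> 5 / w" using T False by simp
      then have "q * T \<le> q * (5 / w)" using q by (intro mult_left_mono) auto
      moreover have "pair_factor p i k = 1 + q * (5 / w)"
        using False cong_dvd_ind_range(3)[of p i k] by (simp add: pair_factor_def q_def w_def)
      moreover have "1 * pair_factor p i k \<le> base_factor p * pair_factor p i k" using k base_factor_ge_1[of p] by (intro mult_right_mono) auto
      ultimately show ?thesis by linarith
    qed
    have "(1 + a / w) * (1 + q * T) \<le> (1 + a / w) * (base_factor p * pair_factor p i k)"
      using a w le1 by (intro mult_left_mono) auto
    with le0 show "f p True True True + f p True True False + f p True False True + f p True False False
        + f p False True True + f p False True False + f p False False True + f p False False False \<le>
        (1 + real p powr (-s) / (real p - 1)) * base_factor p * pair_factor p i k"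
      unfolding a_def w_def mult.assoc by (rule order_trans)
  qed
  also have "\<dots> = (\<Prod>p\<in>P. 1 + real p powr (-s) / (real p - 1)) * (\<Prod>p\<in>P. base_factor p) * pair_prod P i k"
    by (simp add: prod.distrib pair_prod_def)
  also have "\<dots> \<le> (exp (2 * 2) * (2 * ln R)) * base_const * pair_prod P i k"
  proof (intro mult_mono)
    have "(\<Prod>p\<in>P. 1 + real p powr (-s) / (real p - 1)) \<le> exp (2 * 2) * (1 + 1 / s)"
      using P s by (intro prod_primes_inverse_power_le) auto
    also have "1 + 1 / s \<le> 2 * ln R" using R by (simp add: s_def)
    finally show "(\<Prod>p\<in>P. 1 + real p powr (-s) / (real p - 1)) \<le> exp (2 * 2) * (2 * ln R)" by simp
    show "(\<Prod>p\<in>P. base_factor p) \<le> base_const" unfolding base_const_def by (rule prod_base_factor_bounded[OF P])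
    show "0 \<le> (\<Prod>p\<in>P. base_factor p)" by (intro prod_nonneg) (auto intro: order_trans[OF zero_le_one base_factor_ge_1])
    show "0 \<le> pair_prod P i k" using pair_prod_ge_1[of P i k, OF P(2)] by simp
  qed (use R base_const_pos in auto)
  finally have "\<bar>corr3 P (large Q R) i i k\<bar> \<le> c * ((exp (2 * 2) * (2 * ln R)) * base_const * pair_prod P i k)"
    by (simp add: c_def mult_left_mono)
  also have "\<dots> = Q powr (-(1/4)) * (2 * (exp 1 * exp (2*2)) * base_const) * ln R * pair_prod P i k"
    by (simp add: c_def mult_ac)
  also have "exp 1 * exp (2*2) = exp (5::real)" by (simp flip: exp_add)
  finally show ?thesis by (simp add: P_def)
qed

text \<open>The third modulus is switched off by \<open>False\<close>, so the last shift argument is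
  a dummy.\<close>

definition corr2 :: "nat set \<Rightarrow> nat set set \<Rightarrow> nat \<Rightarrow> nat \<Rightarrow> real" where
  "corr2 P \<A> i j = (\<Sum>S1\<in>\<A>. \<Sum>S2\<in>\<A>. \<Prod>p\<in>P. local_corr p (p \<in> S1) (p \<in> S2) False i j j)"

lemma mean_pair_product:
  assumes P: "finite P" "\<And>p. p \<in> P \<Longrightarrow> prime p" and A: "\<And>S. S \<in> \<A> \<Longrightarrow> S \<subseteq> P"
  shows "mean P (\<lambda>n. (\<Sum>S\<in>\<A>. lambda_term S (n + i)) * (\<Sum>S\<in>\<A>. lambda_term S (n + j))) = corr2 P \<A> i j"
proof -
  have "mean P (\<lambda>n. lambda_term S1 (n + i) * lambda_term S2 (n + j)) = (\<Prod>p\<in>P. local_corr p (p \<in> S1) (p \<in> S2) False i j j)"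
    if "S1 \<in> \<A>" "S2 \<in> \<A>" for S1 S2
    using mean_lam_set3[OF P A[OF that(1)] A[OF that(2)], of "{}" i j j] by (simp add: lambda_term_def)
  then show ?thesis by (simp add: sum_product mean_sum corr2_def)
qed

text \<open>Orthogonality: if the two sets differ, some prime lies in exactly one of them and its
  factor is 0.\<close>

lemma corr2_diagonal_terms:
  assumes P: "finite P" and A: "\<And>S. S \<in> \<A> \<Longrightarrow> S \<subseteq> P" and fin: "finite \<A>"
  shows "corr2 P \<A> i j = (\<Sum>S\<in>\<A>. \<Prod>p\<in>S. (real p * cong_dvd_ind p i j - 1) / (real p - 1)^2)"
proof -
  have "corr2 P \<A> i j = (\<Sum>S1\<in>\<A>. \<Sum>S2\<in>\<A>. if S2 = S1 then \<Prod>p\<in>S1. (real p * cong_dvd_ind p i j - 1) / (real p - 1)^2 else 0)"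
    unfolding corr2_def
  proof (intro sum.cong refl)
    fix S1 S2 assume S: "S1 \<in> \<A>" "S2 \<in> \<A>"
    show "(\<Prod>p\<in>P. local_corr p (p \<in> S1) (p \<in> S2) False i j j) =
      (if S2 = S1 then \<Prod>p\<in>S1. (real p * cong_dvd_ind p i j - 1) / (real p - 1)^2 else 0)"
    proof (cases "S2 = S1")
      case True
      have "(\<Prod>p\<in>P. local_corr p (p \<in> S1) (p \<in> S1) False i j j) = (\<Prod>p\<in>S1. (real p * cong_dvd_ind p i j - 1) / (real p - 1)^2)"
        using A[OF S(1)] P by (intro prod.mono_neutral_cong_right) (auto simp: local_corr_def)
      then show ?thesis using True by simp
    next
      case False
      then obtain p where p: "p \<in> S1 \<and> p \<notin> S2 \<or> p \<notin> S1 \<and> p \<in> S2" by auto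
      then have "p \<in> P" "local_corr p (p \<in> S1) (p \<in> S2) False i j j = 0" using A S by (auto simp: local_corr_def)
      then have "(\<Prod>p\<in>P. local_corr p (p \<in> S1) (p \<in> S2) False i j j) = 0" using P by (auto intro!: prod_zero)
      then show ?thesis using False by simp
    qed
  qed
  then show ?thesis using fin by simp
qed

text \<open>As for triples, but orthogonality leaves a single set, so Rankin's weight leads to the
  Euler product directly.\<close>

lemma corr2_large_off_diagonal:
  assumes Q: "Q > 0"
  shows "\<bar>corr2 (primes_le R) (large Q R) i j\<bar> \<le> Q powr (-(1/4)) * base_const * pair_prod (primes_le R) i j"
proof -
  define P where "P = primes_le R"
  have P: "finite P" "\<And>p. p \<in> P \<Longrightarrow> prime p" using primes_leD by (auto simp: P_def)
  define g where "g p = real p powr (1/4) * \<bar>(real p * cong_dvd_ind p i j - 1) / (real p - 1)^2\<bar>" for p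
  have "\<bar>corr2 P (large Q R) i j\<bar> \<le> (\<Sum>S\<in>large Q R. \<bar>\<Prod>p\<in>S. (real p * cong_dvd_ind p i j - 1) / (real p - 1)^2\<bar>)"
  proof -
    have sub: "\<And>S. S \<in> large Q R \<Longrightarrow> S \<subseteq> P" using large_subset_Pow[of Q R] by (auto simp: P_def)
    have "corr2 P (large Q R) i j = (\<Sum>S\<in>large Q R. \<Prod>p\<in>S. (real p * cong_dvd_ind p i j - 1) / (real p - 1)^2)"
      by (rule corr2_diagonal_terms[OF P(1)]) (use sub in auto)
    then show ?thesis by (simp only: sum_abs)
  qed
  also have "\<dots> \<le> (\<Sum>S\<in>large Q R. Q powr (-(1/4)) * (\<Prod>p\<in>S. g p))"
  proof (intro sum_mono)
    fix S assume S: "S \<in> large Q R"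
    have sub: "S \<subseteq> P" using large_subset_Pow[of Q R] S by (auto simp: P_def)
    have "1 * \<bar>\<Prod>p\<in>S. (real p * cong_dvd_ind p i j - 1) / (real p - 1)^2\<bar> \<le> (Q powr (-(1/4)) * (\<Prod>p\<in>P. if p \<in> S then real p powr (1/4) else 1))
       * \<bar>\<Prod>p\<in>S. (real p * cong_dvd_ind p i j - 1) / (real p - 1)^2\<bar>"
      using rankin_weight[OF S Q] by (intro mult_right_mono) (auto simp: P_def)
    also have "(\<Prod>p\<in>P. if p \<in> S then real p powr (1/4) else 1) = (\<Prod>p\<in>S. real p powr (1/4))"
      using sub P by (simp add: prod.If_cases Int_absorb1)
    finally show "\<bar>\<Prod>p\<in>S. (real p * cong_dvd_ind p i j - 1) / (real p - 1)^2\<bar> \<le> Q powr (-(1/4)) * (\<Prod>p\<in>S. g p)"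
      by (simp only: g_def prod.distrib abs_prod mult.assoc mult_1_left)
  qed
  also have "\<dots> \<le> (\<Sum>S\<in>Pow P. Q powr (-(1/4)) * (\<Prod>p\<in>S. g p))"
    using P large_subset_Pow[of Q R] by (intro sum_mono2) (auto simp: P_def g_def intro!: mult_nonneg_nonneg prod_nonneg)
  also have "\<dots> = Q powr (-(1/4)) * (\<Prod>p\<in>P. g p + 1)"
    by (simp only: sum_distrib_left[symmetric] sum_Pow_prod_subset[OF P(1)])
  also have "\<dots> \<le> Q powr (-(1/4)) * (base_const * pair_prod P i j)"
  proof (intro mult_left_mono)
    have "(\<Prod>p\<in>P. g p + 1) \<le> (\<Prod>p\<in>P. base_factor p * pair_factor p i j)"
    proof (intro prod_mono conjI)
      fix p assume p: "p \<in> P"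
      have r: "real p \<ge> 2" using P(2)[OF p] prime_ge_2_nat[of p] by simp
      define q w where "q = real p powr (1/4)" and "w = real p - 1"
      have w: "w \<ge> 1" "real p = w + 1" using r by (auto simp: w_def)
      have q: "q \<ge> 0" by (simp add: q_def)
      show "0 \<le> g p + 1" by (simp add: g_def)
      show "g p + 1 \<le> base_factor p * pair_factor p i j"
      proof (cases "cong_dvd_ind p i j = 0")
        case True
        have "g p = q * (1 / w^2)" using w True by (simp add: g_def q_def abs_divide)
        also have "\<dots> \<le> q * (5 / w^2)" using w q by (intro mult_left_mono divide_right_mono) auto
        finally show ?thesis using True by (simp add: base_factor_def pair_factor_def q_def w_def mult_ac)
      next
        case False
        then have c1: "cong_dvd_ind p i j = 1" using cong_dvd_ind_range(3)[of p i j] by simp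
        have "g p = q * (1 / w)" using w c1 by (simp add: g_def q_def power2_eq_square)
        also have "\<dots> \<le> q * (5 / w)" using w q by (intro mult_left_mono divide_right_mono) auto
        finally have "g p + 1 \<le> pair_factor p i j" using c1 by (simp add: pair_factor_def q_def w_def mult_ac)
        moreover have "1 * pair_factor p i j \<le> base_factor p * pair_factor p i j" using base_factor_ge_1[of p] pair_factor_ge_1[of p i j] r by (intro mult_right_mono) auto
        ultimately show ?thesis by linarith
      qed
    qed
    also have "\<dots> = (\<Prod>p\<in>P. base_factor p) * pair_prod P i j" by (simp add: prod.distrib pair_prod_def)
    also have "\<dots> \<le> base_const * pair_prod P i j" unfolding base_const_def
      using P pair_prod_ge_1[of P i j, OF P(2)] by (intro mult_right_mono prod_base_factor_bounded) auto
    finally show "(\<Prod>p\<in>P. g p + 1) \<le> base_const * pair_prod P i j" .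
  qed auto
  finally show ?thesis by (simp add: P_def mult_ac)
qed

definition pair_const :: real where "pair_const = exp (1330 * (1 + 1 / (3/4)))"

text \<open>\<open>pair_prod\<close> depends only on the primes dividing the distance of
  \<open>i\<close> and \<open>j\<close>. The indices on either side of \<open>i\<close> have
  distinct distances in \<open>{1..h}\<close>, hence the factor 2 and an average over
  \<open>r \<le> h\<close> bounded by \<open>pair_const\<close>.\<close>

lemma sum_pair_prod_cubed_le:
  assumes i: "i \<in> {1..h}"
  shows "(\<Sum>j\<in>{1..h} - {i}. pair_prod (primes_le R) i j ^ 3) \<le> 2 * (h * pair_const)"
proof -
  define P where "P = primes_le R"
  have P: "finite P" "\<And>p. p \<in> P \<Longrightarrow> prime p" using primes_leD by (auto simp: P_def)
  define G where "G r = (\<Prod>p\<in>P. if p dvd r then 1 + 1330 * real p powr (-(3/4)) else 1)" for r :: nat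
  have G0: "G r \<ge> 0" for r unfolding G_def by (intro prod_nonneg) auto
  have tot: "(\<Sum>r=1..h. G r) \<le> h * pair_const"
  proof -
    have "(\<Sum>r=1..h. G r) \<le> h * (\<Prod>p\<in>P. 1 + 1330 * real p powr (-(3/4)) / p)"
      unfolding G_def by (rule sum_divisor_product_le) (use P in auto)
    also have "(\<Prod>p\<in>P. 1 + 1330 * real p powr (-(3/4)) / p) \<le> pair_const"
      unfolding pair_const_def
    proof (rule prod_primes_bounded[OF P(1)])
      fix p assume "p \<in> P"
      then have r: "p > 0" using P prime_gt_0_nat by auto
      then show "1 \<le> p" by simp
      have "real p powr (-(3/4)) / p = real p powr (-1 - 3/4)" using r powr_diff[of "real p" "-(3/4)" 1] by simp
      then show "0 \<le> 1 + 1330 * real p powr (-(3/4)) / p \<and> 1 + 1330 * real p powr (-(3/4)) / p \<le> 1 + 1330 * real p powr (-1 - 3/4)"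
        by simp
    qed auto
    finally show ?thesis by (simp add: mult_left_mono)
  qed
  have le: "pair_prod P i j ^ 3 \<le> G (if j < i then i - j else j - i)" for j
  proof -
    have "pair_prod P i j ^ 3 \<le> (\<Prod>p\<in>P. if [i = j] (mod p) then 1 + 1330 * real p powr (-(3/4)) else 1)"
      using sum_pair_prod_cubed[OF P] by simp
    also have "\<dots> = G (if j < i then i - j else j - i)"
    proof -
      have "[i = j] (mod p) \<longleftrightarrow> p dvd (if j < i then i - j else j - i)" for p
        using cong_altdef_nat[of j i p] cong_altdef_nat[of i j p] cong_sym_eq[of i j p] by (cases "j < i") auto
      then show ?thesis by (simp add: G_def)
    qed
    finally show ?thesis .
  qed
  have "(\<Sum>j\<in>{1..h} - {i}. pair_prod P i j ^ 3) \<le> (\<Sum>j\<in>{1..h} - {i}. G (if j < i then i - j else j - i))"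
    by (intro sum_mono le)
  moreover have "{1..h} - {i} = {1..<i} \<union> {i<..h}" using i by auto
  ultimately have "(\<Sum>j\<in>{1..h} - {i}. pair_prod P i j ^ 3) \<le> (\<Sum>j\<in>{1..<i} \<union> {i<..h}. G (if j < i then i - j else j - i))" by simp
  also have "(\<Sum>j\<in>{1..<i} \<union> {i<..h}. G (if j < i then i - j else j - i)) =
     (\<Sum>j\<in>{1..<i}. G (i - j)) + (\<Sum>j\<in>{i<..h}. G (j - i))"
    by (subst sum.union_disjoint) auto
  also have "(\<Sum>j\<in>{1..<i}. G (i - j)) = (\<Sum>r\<in>(\<lambda>j. i - j) ` {1..<i}. G r)"
    by (rule sum.reindex_cong[symmetric, where l = "\<lambda>j. i - j"]) (auto simp: inj_on_def)
  also have "\<dots> \<le> (\<Sum>r=1..h. G r)" using i G0 by (intro sum_mono2) auto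
  also have "(\<Sum>j\<in>{i<..h}. G (j - i)) = (\<Sum>r\<in>(\<lambda>j. j - i) ` {i<..h}. G r)"
    by (rule sum.reindex_cong[symmetric, where l = "\<lambda>j. j - i"]) (auto simp: inj_on_def)
  also have "\<dots> \<le> (\<Sum>r=1..h. G r)" using i G0 by (intro sum_mono2) auto
  finally show ?thesis using tot by (simp add: P_def)
qed

section \<open>Pointwise bound for the terms with small modulus\<close>

lemma sum_dvd_ind_interval:
  assumes "D > 0"
  shows "(\<Sum>j=1..h. dvd_ind D (n + j)) = real ((n + h) div D) - real (n div D)"
proof (induction h)
  case (Suc h)
  have "(n + Suc h) div D = (n + h) div D + (if D dvd n + Suc h then 1 else 0)"
    using assms div_Suc[of "n + h" D] by (auto simp: dvd_eq_mod_eq_0)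
  then show ?case using Suc by (simp add: dvd_ind_def)
qed simp

lemma sum_dvd_ind_interval_approx:
  assumes "D > 0"
  shows "\<bar>(\<Sum>j=1..h. dvd_ind D (n + j)) - h / D\<bar> \<le> 1"
proof -
  have *: "real m / D - 1 < real (m div D)" "real (m div D) \<le> real m / D" for m
  proof -
    show "real (m div D) \<le> real m / D" by (rule of_nat_div_le_of_nat)
    have "real (m div D) = real_of_int \<lfloor>real m / D\<rfloor>" by (simp add: floor_divide_of_nat_eq)
    then show "real m / D - 1 < real (m div D)" by linarith
  qed
  have "real (n + h) / D = n / D + h / D" by (simp add: add_divide_distrib)
  then show ?thesis unfolding sum_dvd_ind_interval[OF assms]
    using *(1)[of "n + h"] *(2)[of "n + h"] *(1)[of n] *(2)[of n] by linarith
qed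

lemma prod_local_factor_expand:
  assumes "finite S" "\<And>p. p \<in> S \<Longrightarrow> prime p"
  shows "(\<Prod>p\<in>S. local_factor p m) = (\<Sum>D\<in>Pow S. (-1) ^ card D * real (\<Prod>D) * dvd_ind (\<Prod>D) m)"
proof -
  have "(\<Prod>p\<in>S. local_factor p m) = (\<Prod>p\<in>S. - real p * dvd_ind p m + 1)" by (simp add: local_factor_dvd_ind)
  also have "\<dots> = (\<Sum>D\<in>Pow S. \<Prod>p\<in>D. - real p * dvd_ind p m)" by (rule sum_Pow_prod_subset[symmetric, OF assms(1)])
  also have "\<dots> = (\<Sum>D\<in>Pow S. (-1) ^ card D * real (\<Prod>D) * dvd_ind (\<Prod>D) m)"
  proof (intro sum.cong refl)
    fix D assume D: "D \<in> Pow S"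
    then have fin: "finite D" "\<And>p. p \<in> D \<Longrightarrow> prime p" using assms finite_subset by auto
    have "(\<Prod>p\<in>D. dvd_ind p m) = dvd_ind (\<Prod>D) m"
      using fin by (auto simp: dvd_ind_def prod_primes_dvd_iff[OF fin] intro!: prod_zero)
    moreover have "(\<Prod>p\<in>D. - real p) = (-1) ^ card D * real (\<Prod>D)"
      using prod.distrib[of "\<lambda>_. -1" real D] by simp
    ultimately show "(\<Prod>p\<in>D. - real p * dvd_ind p m) = (-1) ^ card D * real (\<Prod>D) * dvd_ind (\<Prod>D) m"
      by (simp only: prod.distrib)
  qed
  finally show ?thesis .
qed

text \<open>Expanded over \<open>D \<subseteq> S\<close>, the densities \<open>h / \<Prod>D\<close>
  enter with total \<open>h\<close> times the product of \<open>1 - 1\<close> over \<open>S\<close>,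
  which is 0 as \<open>S\<close> is non-empty. The remainders are at most 1 each, so the bound
  depends on neither \<open>h\<close> nor \<open>n\<close>.\<close>

lemma sum_lam_set_interval_bound:
  assumes S: "finite S" "\<And>p. p \<in> S \<Longrightarrow> prime p" "S \<noteq> {}"
  shows "\<bar>\<Sum>j=1..h. lambda_term S (n + j)\<bar> \<le> real (\<Prod>S) ^ 2"
proof -
  have posD: "\<Prod>D > 0" if "D \<in> Pow S" for D
    using that S by (intro prod_pos) (auto simp: prime_gt_0_nat subset_iff)
  define c where "c D = (-1) ^ card D * real (\<Prod>D)" for D :: "nat set"
  define I where "I D = (\<Sum>j=1..h. dvd_ind (\<Prod>D) (n + j))" for D :: "nat set"
  have "(\<Sum>j=1..h. \<Prod>p\<in>S. local_factor p (n + j)) = (\<Sum>j=1..h. \<Sum>D\<in>Pow S. c D * dvd_ind (\<Prod>D) (n + j))"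
    unfolding c_def by (intro sum.cong refl prod_local_factor_expand S(1,2))
  also have "\<dots> = (\<Sum>D\<in>Pow S. c D * I D)"
    unfolding I_def by (subst sum.swap) (simp only: sum_distrib_left)
  also have "\<dots> = (\<Sum>D\<in>Pow S. c D * (I D - h / real (\<Prod>D))) + (\<Sum>D\<in>Pow S. real h * (-1) ^ card D)"
    unfolding sum.distrib[symmetric]
  proof (intro sum.cong refl)
    fix D assume "D \<in> Pow S"
    from posD[OF this] have "real (\<Prod>D) \<noteq> 0" by (simp only: of_nat_0_eq_iff)
    then have "c D * (h / real (\<Prod>D)) = real h * (-1) ^ card D" by (simp add: c_def del: of_nat_prod)
    then show "c D * I D = c D * (I D - h / real (\<Prod>D)) + real h * (-1) ^ card D"
      by (simp only: right_diff_distrib)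
  qed
  also have "(\<Sum>D\<in>Pow S. real h * (-1) ^ card D) = real h * (\<Sum>D\<in>Pow S. \<Prod>p\<in>D. -1 :: real)"
    by (simp add: sum_distrib_left)
  also have "(\<Sum>D\<in>Pow S. \<Prod>p\<in>D. -1 :: real) = 0"
    using S by (subst sum_Pow_prod_subset) (auto simp: prod_zero_iff card_gt_0_iff)
  finally have "\<bar>\<Sum>j=1..h. \<Prod>p\<in>S. local_factor p (n + j)\<bar> \<le> (\<Sum>D\<in>Pow S. \<bar>c D * (I D - h / real (\<Prod>D))\<bar>)"
    by (simp only: mult_zero_right add_0_right sum_abs)
  also have "\<dots> \<le> (\<Sum>D\<in>Pow S. real (\<Prod>D) * 1)"
  proof (intro sum_mono, unfold abs_mult, rule mult_mono)
    fix D assume "D \<in> Pow S"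
    from posD[OF this] show "\<bar>I D - h / real (\<Prod>D)\<bar> \<le> 1" unfolding I_def by (rule sum_dvd_ind_interval_approx)
    show "\<bar>c D\<bar> \<le> real (\<Prod>D)" by (simp add: c_def abs_mult power_abs del: of_nat_prod)
  qed (auto simp del: of_nat_prod)
  also have "\<dots> = (\<Prod>p\<in>S. real p + 1)" using sum_Pow_prod_subset[OF S(1), of real] by simp
  finally have 1: "\<bar>\<Sum>j=1..h. \<Prod>p\<in>S. local_factor p (n + j)\<bar> \<le> (\<Prod>p\<in>S. real p + 1)" .
  have r: "real p \<ge> 2" if "p \<in> S" for p using S(2)[OF that] prime_ge_2_nat[of p] by simp
  have pp: "(\<Prod>p\<in>S. real p - 1) > 0" using r by (intro prod_pos) force
  have "(\<Sum>j=1..h. lambda_term S (n + j)) = (\<Sum>j=1..h. \<Prod>p\<in>S. local_factor p (n + j)) / (\<Prod>p\<in>S. real p - 1)"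
    by (simp add: lambda_term_def prod_dividef sum_divide_distrib)
  then have "\<bar>\<Sum>j=1..h. lambda_term S (n + j)\<bar> \<le> (\<Prod>p\<in>S. real p + 1) / (\<Prod>p\<in>S. real p - 1)"
    using 1 pp by (simp add: abs_divide divide_right_mono)
  also have "\<dots> = (\<Prod>p\<in>S. (real p + 1) / (real p - 1))" by (simp add: prod_dividef)
  also have "\<dots> \<le> (\<Prod>p\<in>S. real p ^ 2)"
  proof (intro prod_mono conjI)
    fix p assume "p \<in> S"
    then have p2: "real p \<ge> 2" by (rule r)
    then show "0 \<le> (real p + 1) / (real p - 1)" by simp
    have "real p + 1 \<le> real p * 2" using p2 by simp
    also have "\<dots> \<le> real p * real p" using p2 by (intro mult_left_mono) auto
    also have "\<dots> * 1 \<le> real p * real p * (real p - 1)" using p2 by (intro mult_left_mono) auto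
    finally show "(real p + 1) / (real p - 1) \<le> real p ^ 2" using p2 by (simp add: divide_le_eq power2_eq_square)
  qed
  also have "\<dots> = real (\<Prod>S) ^ 2" by (simp add: prod_power_distrib)
  finally show ?thesis .
qed

text \<open>The empty set, that is \<open>q = 1\<close>, is excluded: it supplies the constant
  \<open>h\<close> and has no cancellation over an interval.\<close>

definition small :: "real \<Rightarrow> real \<Rightarrow> nat set set" where
  "small Q R = {S \<in> sqf_sets R. S \<noteq> {} \<and> real (\<Prod>S) \<le> Q}"

lemma card_small_le:
  assumes "Q \<ge> 1" shows "real (card (small Q R)) \<le> Q"
proof -
  have "card (small Q R) = card ((\<lambda>S. \<Prod>S) ` small Q R)"
  proof (rule card_image[symmetric], rule inj_onI)
    fix S T assume ST: "S \<in> small Q R" "T \<in> small Q R" "\<Prod>S = \<Prod>T"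
    have "prime_factors (\<Prod>V) = V" if "V \<in> small Q R" for V
      using that sqf_setsD[of V R] by (intro prime_factors_prod_primes) (auto simp: small_def)
    then show "S = T" using ST by metis
  qed
  also have "\<dots> \<le> card (nats_le Q)"
  proof (rule card_mono)
    show "(\<lambda>S. \<Prod>S) ` small Q R \<subseteq> nats_le Q"
    proof
      fix n assume "n \<in> (\<lambda>S. \<Prod>S) ` small Q R"
      then obtain S where S: "S \<in> sqf_sets R" "real (\<Prod>S) \<le> Q" "n = \<Prod>S" by (auto simp: small_def simp del: of_nat_prod)
      have "\<Prod>S > 0" using sqf_setsD(2)[OF S(1)] by (intro prod_pos) (auto simp: prime_gt_0_nat)
      then show "n \<in> nats_le Q" using S by (simp add: nats_le_def Suc_le_eq del: of_nat_prod)
    qed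
  qed simp
  also have "real (card (nats_le Q)) \<le> Q" using assms by (simp add: nats_le_altdef)
  finally show ?thesis by simp
qed

definition short_sum :: "nat set set \<Rightarrow> nat \<Rightarrow> nat \<Rightarrow> real" where
  "short_sum \<A> h n = (\<Sum>j=1..h. \<Sum>S\<in>\<A>. lambda_term S (n + j))"

lemma short_sum_small_bound:
  assumes "Q \<ge> 1" shows "\<bar>short_sum (small Q R) h n\<bar> \<le> Q ^ 3"
proof -
  have "\<bar>short_sum (small Q R) h n\<bar> \<le> (\<Sum>S\<in>small Q R. \<bar>\<Sum>j=1..h. lambda_term S (n + j)\<bar>)"
    unfolding short_sum_def by (subst sum.swap) (rule sum_abs)
  also have "\<dots> \<le> (\<Sum>S\<in>small Q R. Q ^ 2)"
  proof (intro sum_mono)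
    fix S assume S: "S \<in> small Q R"
    then have A: "S \<in> sqf_sets R" "S \<noteq> {}" "real (\<Prod>S) \<le> Q" by (auto simp: small_def simp del: of_nat_prod)
    have "\<bar>\<Sum>j=1..h. lambda_term S (n + j)\<bar> \<le> real (\<Prod>S) ^ 2"
      by (rule sum_lam_set_interval_bound) (use sqf_setsD[OF A(1)] A(2) in auto)
    also have "\<dots> \<le> Q ^ 2" using A(3) by (intro power_mono) (auto simp del: of_nat_prod)
    finally show "\<bar>\<Sum>j=1..h. lambda_term S (n + j)\<bar> \<le> Q ^ 2" .
  qed
  also have "\<dots> = real (card (small Q R)) * Q ^ 2" by simp
  also have "\<dots> \<le> Q * Q ^ 2" using card_small_le[OF assms, of R] by (intro mult_right_mono) auto
  finally show ?thesis by (simp add: power2_eq_square power3_eq_cube)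
qed

section \<open>Second and third moments over a full period\<close>

context
  fixes R Q :: real and P :: "nat set"
  assumes R: "R > 1" "ln R \<ge> 1" and Q: "Q \<ge> 1"
  defines "P \<equiv> primes_le R"
begin

private lemma P: "finite P" "\<And>p. p \<in> P \<Longrightarrow> prime p"
  using primes_leD by (auto simp: P_def)

lemma sqf_sets_subset_P: "S \<in> sqf_sets R \<Longrightarrow> S \<subseteq> P"
  using sqf_setsD(4) by (simp add: P_def)

lemma sqf_sets_split: "sqf_sets R = insert {} (small Q R \<union> large Q R)" "{} \<notin> small Q R \<union> large Q R" "small Q R \<inter> large Q R = {}"
  using R Q by (auto simp: sqf_sets_def small_def large_def)

private abbreviation "small_sum \<equiv> short_sum (small Q R)"
private abbreviation "large_sum \<equiv> short_sum (large Q R)"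

lemma finite_small: "finite (small Q R)" by (simp add: small_def)

lemma short_sum_split: "short_sum (sqf_sets R) h n = h + (small_sum h n + large_sum h n)"
proof -
  have "(\<Sum>S\<in>sqf_sets R. lambda_term S m) = 1 + ((\<Sum>S\<in>small Q R. lambda_term S m) + (\<Sum>S\<in>large Q R. lambda_term S m))" for m
    using sqf_sets_split finite_small by (simp add: sum.union_disjoint lambda_term_def)
  then show ?thesis by (simp add: short_sum_def sum.distrib)
qed

lemma mean_short_sum_square: 
  assumes "\<And>S. S \<in> \<A> \<Longrightarrow> S \<subseteq> P"
  shows "mean P (\<lambda>n. (short_sum \<A> h n)\<^sup>2) = (\<Sum>i=1..h. \<Sum>j=1..h. corr2 P \<A> i j)"
proof -
  define f where "f j n = (\<Sum>S\<in>\<A>. lambda_term S (n + j))" for j n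
  have "(short_sum \<A> h n)\<^sup>2 = (\<Sum>i=1..h. \<Sum>j=1..h. f i n * f j n)" for n
    by (simp only: short_sum_def f_def[symmetric] power2_eq_square sum_product)
  then have "mean P (\<lambda>n. (short_sum \<A> h n)\<^sup>2) = (\<Sum>i=1..h. \<Sum>j=1..h. mean P (\<lambda>n. f i n * f j n))"
    by (simp only: mean_sum)
  also have "\<dots> = (\<Sum>i=1..h. \<Sum>j=1..h. corr2 P \<A> i j)"
    unfolding f_def by (intro sum.cong refl mean_pair_product P assms)
  finally show ?thesis .
qed

lemma mean_short_sum_cube: 
  assumes "\<And>S. S \<in> \<A> \<Longrightarrow> S \<subseteq> P"
  shows "mean P (\<lambda>n. (short_sum \<A> h n) ^ 3) = (\<Sum>i=1..h. \<Sum>j=1..h. \<Sum>k=1..h. corr3 P \<A> i j k)"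
proof -
  have "mean P (\<lambda>n. (short_sum \<A> h n) ^ 3) = mean P (\<lambda>n. \<Sum>i=1..h. \<Sum>j=1..h. \<Sum>k=1..h.
     (\<Sum>S\<in>\<A>. lambda_term S (n + i)) * (\<Sum>S\<in>\<A>. lambda_term S (n + j)) * (\<Sum>S\<in>\<A>. lambda_term S (n + k)))"
    unfolding short_sum_def power3_eq_cube sum_product3 ..
  also have "\<dots> = (\<Sum>i=1..h. \<Sum>j=1..h. \<Sum>k=1..h. corr3 P \<A> i j k)"
    unfolding mean_sum by (intro sum.cong refl mean_triple_product P assms)
  finally show ?thesis .
qed

lemma mean_lam_set_zero:
  assumes "S \<subseteq> P" "S \<noteq> {}" shows "mean P (\<lambda>n. lambda_term S (n + i)) = 0"
proof -
  from assms obtain p where p: "p \<in> S" "p \<in> P" by auto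
  have "mean P (\<lambda>n. lambda_term S (n + i)) = (\<Prod>p\<in>P. local_corr p (p \<in> S) False False i i i)"
    using mean_lam_set3[OF P assms(1), of "{}" "{}" i i i] by (simp add: lambda_term_def)
  also have "\<dots> = 0" using p P(1) by (auto intro!: prod_zero simp: local_corr_def)
  finally show ?thesis .
qed

lemma small_large_subset: "S \<in> small Q R \<Longrightarrow> S \<subseteq> P" "S \<in> large Q R \<Longrightarrow> S \<subseteq> P"
  using sqf_sets_subset_P by (auto simp: small_def large_def)

lemma mean_small_sum_square: "mean P (\<lambda>n. (small_sum h n)\<^sup>2) = (\<Sum>i=1..h. \<Sum>j=1..h. corr2 P (small Q R) i j)"
  by (rule mean_short_sum_square) (rule small_large_subset)

lemma mean_large_sum_square: "mean P (\<lambda>n. (large_sum h n)\<^sup>2) = (\<Sum>i=1..h. \<Sum>j=1..h. corr2 P (large Q R) i j)"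
  by (rule mean_short_sum_square) (rule small_large_subset)

lemma mean_large_sum_cube: "mean P (\<lambda>n. (large_sum h n) ^ 3) = (\<Sum>i=1..h. \<Sum>j=1..h. \<Sum>k=1..h. corr3 P (large Q R) i j k)"
  by (rule mean_short_sum_cube) (rule small_large_subset)

lemma mean_short_sum_zero:
  assumes "\<And>S. S \<in> \<A> \<Longrightarrow> S \<subseteq> P" "{} \<notin> \<A>"
  shows "mean P (short_sum \<A> h) = 0"
proof -
  have "mean P (\<lambda>n. short_sum \<A> h n) = (\<Sum>j=1..h. \<Sum>S\<in>\<A>. mean P (\<lambda>n. lambda_term S (n + j)))"
    unfolding short_sum_def mean_sum ..
  also have "\<dots> = 0" using assms by (intro sum.neutral ballI mean_lam_set_zero) auto
  finally show ?thesis .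
qed

text \<open>\<open>small\<close> and \<open>large\<close> are disjoint, so by orthogonality the
  cross terms have mean 0.\<close>

lemma mean_small_large_square: "mean P (\<lambda>n. (small_sum h n + large_sum h n)\<^sup>2) = mean P (\<lambda>n. (small_sum h n)\<^sup>2) + mean P (\<lambda>n. (large_sum h n)\<^sup>2)"
proof -
  have un: "small_sum h n + large_sum h n = short_sum (small Q R \<union> large Q R) h n" for n
    using sqf_sets_split(3) finite_small by (simp add: short_sum_def sum.union_disjoint sum.distrib)
  have c2: "corr2 P (small Q R \<union> large Q R) i j = corr2 P (small Q R) i j + corr2 P (large Q R) i j" for i j
  proof -
    have "corr2 P (small Q R \<union> large Q R) i j = (\<Sum>S\<in>small Q R \<union> large Q R. \<Prod>p\<in>S. (real p * cong_dvd_ind p i j - 1) / (real p - 1)^2)"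
      by (rule corr2_diagonal_terms[OF P(1)]) (use small_large_subset finite_small in auto)
    moreover have "corr2 P (small Q R) i j = (\<Sum>S\<in>small Q R. \<Prod>p\<in>S. (real p * cong_dvd_ind p i j - 1) / (real p - 1)^2)"
      by (rule corr2_diagonal_terms[OF P(1)]) (use small_large_subset finite_small in auto)
    moreover have "corr2 P (large Q R) i j = (\<Sum>S\<in>large Q R. \<Prod>p\<in>S. (real p * cong_dvd_ind p i j - 1) / (real p - 1)^2)"
      by (rule corr2_diagonal_terms[OF P(1)]) (use small_large_subset in auto)
    ultimately show ?thesis using sqf_sets_split(3) finite_small by (simp add: sum.union_disjoint)
  qed
  have "S \<subseteq> P" if "S \<in> small Q R \<union> large Q R" for S using that small_large_subset[of S] by blast
  then have "mean P (\<lambda>n. (short_sum (small Q R \<union> large Q R) h n)\<^sup>2) = (\<Sum>i=1..h. \<Sum>j=1..h. corr2 P (small Q R \<union> large Q R) i j)"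
    by (rule mean_short_sum_square)
  then show ?thesis
    unfolding un mean_small_sum_square mean_large_sum_square c2 sum.distrib .
qed

lemma corr2_large_diagonal: "corr2 P (large Q R) i i = (\<Sum>S\<in>large Q R. \<Prod>p\<in>S. 1 / (real p - 1))"
proof -
  have "corr2 P (large Q R) i i = (\<Sum>S\<in>large Q R. \<Prod>p\<in>S. (real p * cong_dvd_ind p i i - 1) / (real p - 1)^2)"
    by (rule corr2_diagonal_terms[OF P(1)]) (use small_large_subset in auto)
  also have "\<dots> = (\<Sum>S\<in>large Q R. \<Prod>p\<in>S. 1 / (real p - 1))"
  proof (intro sum.cong prod.cong refl)
    fix S p assume "S \<in> large Q R" "p \<in> S"
    then have "prime p" using small_large_subset(2) P(2) by (meson subsetD)
    then have "real p > 1" using prime_gt_1_nat[of p] by simp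
    then show "(real p * cong_dvd_ind p i i - 1) / (real p - 1)^2 = 1 / (real p - 1)"
      by (simp add: cong_dvd_ind_def power2_eq_square)
  qed
  finally show ?thesis .
qed

text \<open>The sets missing from \<open>large\<close> are the empty one and at most
  \<open>Q\<close> small ones, each of weight at most 1; with \<open>1 \<le> Q\<close> this makes
  \<open>2 * Q\<close>.\<close>

lemma corr2_large_diagonal_bounds: "totient_sum R - 2 * Q \<le> corr2 P (large Q R) i i" "corr2 P (large Q R) i i \<le> totient_sum R"
proof -
  define w where "w S = (\<Prod>p\<in>S. 1 / (real p - 1))" for S :: "nat set"
  have w: "0 \<le> w S" "w S \<le> 1" if "S \<in> sqf_sets R" for S
  proof -
    have "real p \<ge> 2" if "p \<in> S" for p using sqf_setsD(2)[OF \<open>S \<in> sqf_sets R\<close> that] prime_ge_2_nat[of p] by simp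
    then have *: "0 \<le> 1 / (real p - 1) \<and> 1 / (real p - 1) \<le> 1" if "p \<in> S" for p
      using that by (fastforce simp: divide_le_eq)
    show "0 \<le> w S" unfolding w_def using * by (intro prod_nonneg) auto
    show "w S \<le> 1" unfolding w_def using * by (intro prod_le_1) auto
  qed
  have "totient_sum R = w {} + ((\<Sum>S\<in>small Q R. w S) + (\<Sum>S\<in>large Q R. w S))"
    unfolding totient_sum_def w_def[symmetric] using sqf_sets_split finite_small by (simp add: sum.union_disjoint)
  moreover have "(\<Sum>S\<in>small Q R. w S) \<le> (\<Sum>S\<in>small Q R. 1)" by (intro sum_mono w) (auto simp: small_def)
  moreover have "(\<Sum>S\<in>small Q R. w S) \<ge> 0" by (intro sum_nonneg w) (auto simp: small_def)
  moreover have "w {} = 1" by (simp add: w_def)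
  ultimately show "totient_sum R - 2 * Q \<le> corr2 P (large Q R) i i" "corr2 P (large Q R) i i \<le> totient_sum R"
    using card_small_le[OF Q, of R] Q by (simp_all add: corr2_large_diagonal w_def[symmetric])
qed

lemma pair_prod_bounds: "pair_prod P i j \<ge> 1" "pair_prod P i j \<le> pair_prod P i j ^ 3"
proof -
  show 1: "pair_prod P i j \<ge> 1" using pair_prod_ge_1[OF P(2)] by simp
  show "pair_prod P i j \<le> pair_prod P i j ^ 3" using power_increasing[OF _ 1, of 1 3] by simp
qed

lemma sum_off_diagonal_pair_prod: "(\<Sum>i=1..h. \<Sum>j\<in>{1..h} - {i}. pair_prod P i j ^ 3) \<le> 2 * pair_const * real h ^ 2"
proof -
  have "(\<Sum>i=1..h. \<Sum>j\<in>{1..h} - {i}. pair_prod P i j ^ 3) \<le> (\<Sum>i=1..h. 2 * (h * pair_const))"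
    unfolding P_def by (intro sum_mono sum_pair_prod_cubed_le)
  then show ?thesis by (simp add: power2_eq_square mult_ac)
qed

lemma mean_large_sum_square_approx:
  "\<bar>mean P (\<lambda>n. (large_sum h n)\<^sup>2) - h * totient_sum R\<bar> \<le> 2 * Q * h + 2 * (base_const * pair_const) * Q powr (-(1/4)) * real h ^ 2"
proof -
  have eq: "mean P (\<lambda>n. (large_sum h n)\<^sup>2) = (\<Sum>i=1..h. corr2 P (large Q R) i i) + (\<Sum>i=1..h. \<Sum>j\<in>{1..h} - {i}. corr2 P (large Q R) i j)"
    unfolding mean_large_sum_square sum.distrib[symmetric]
    by (intro sum.cong refl sum.remove) auto
  have "(\<Sum>i=1..h. corr2 P (large Q R) i i) \<le> (\<Sum>i=1..h. totient_sum R)" "(\<Sum>i=1..h. totient_sum R - 2 * Q) \<le> (\<Sum>i=1..h. corr2 P (large Q R) i i)"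
    by (intro sum_mono corr2_large_diagonal_bounds)+
  then have 1: "\<bar>(\<Sum>i=1..h. corr2 P (large Q R) i i) - h * totient_sum R\<bar> \<le> 2 * Q * h"
    by (simp add: right_diff_distrib mult.commute) 
  have "\<bar>\<Sum>i=1..h. \<Sum>j\<in>{1..h} - {i}. corr2 P (large Q R) i j\<bar> \<le> (\<Sum>i=1..h. \<Sum>j\<in>{1..h} - {i}. Q powr (-(1/4)) * base_const * pair_prod P i j ^ 3)"
  proof (intro order_trans[OF sum_abs] sum_mono)
    fix i j
    have "\<bar>corr2 P (large Q R) i j\<bar> \<le> Q powr (-(1/4)) * base_const * pair_prod P i j"
      using corr2_large_off_diagonal[of Q R i j] Q by (simp add: P_def)
    also have "\<dots> \<le> Q powr (-(1/4)) * base_const * pair_prod P i j ^ 3" using pair_prod_bounds base_const_pos by (intro mult_left_mono) auto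
    finally show "\<bar>corr2 P (large Q R) i j\<bar> \<le> Q powr (-(1/4)) * base_const * pair_prod P i j ^ 3" .
  qed
  also have "\<dots> = Q powr (-(1/4)) * base_const * (\<Sum>i=1..h. \<Sum>j\<in>{1..h} - {i}. pair_prod P i j ^ 3)"
    by (simp add: sum_distrib_left)
  also have "\<dots> \<le> Q powr (-(1/4)) * base_const * (2 * pair_const * real h ^ 2)"
    using base_const_pos by (intro mult_left_mono sum_off_diagonal_pair_prod) auto
  finally show ?thesis unfolding eq using 1 by (simp add: mult_ac)
qed

text \<open>Read off from the mean of a product, where symmetry is commutativity; the formula for
  \<open>local_corr\<close> hides it.\<close>

lemma corr3_symmetric:
  assumes "\<And>S. S \<in> \<A> \<Longrightarrow> S \<subseteq> P"
  shows "corr3 P \<A> i j k = corr3 P \<A> i k j" "corr3 P \<A> i j k = corr3 P \<A> j k i"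
proof -
  have "corr3 P \<A> i j k = mean P (\<lambda>n. (\<Sum>S\<in>\<A>. lambda_term S (n + i)) * (\<Sum>S\<in>\<A>. lambda_term S (n + j)) * (\<Sum>S\<in>\<A>. lambda_term S (n + k)))" for i j k
    by (rule mean_triple_product[symmetric]) (use P assms in auto)
  then show "corr3 P \<A> i j k = corr3 P \<A> i k j" "corr3 P \<A> i j k = corr3 P \<A> j k i"
    by (simp_all only: mult_ac)
qed

lemma sum_triple_split:
  fixes F :: "nat \<Rightarrow> nat \<Rightarrow> nat \<Rightarrow> real"
  assumes "finite J"
  shows "(\<Sum>i\<in>J. \<Sum>j\<in>J. \<Sum>k\<in>J. F i j k) = (\<Sum>i\<in>J. F i i i) + (\<Sum>i\<in>J. \<Sum>j\<in>J - {i}. F i i j + F i j i + F i j j)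
     + (\<Sum>i\<in>J. \<Sum>j\<in>J - {i}. \<Sum>k\<in>J - {i} - {j}. F i j k)"
  unfolding sum.distrib[symmetric]
proof (rule sum.cong[OF refl])
  fix i assume i: "i \<in> J"
  have "(\<Sum>j\<in>J. \<Sum>k\<in>J. F i j k) = (\<Sum>k\<in>J. F i i k) + (\<Sum>j\<in>J - {i}. \<Sum>k\<in>J. F i j k)"
    using assms i by (rule sum.remove)
  also have "(\<Sum>k\<in>J. F i i k) = F i i i + (\<Sum>j\<in>J - {i}. F i i j)" using assms i by (rule sum.remove)
  also have "(\<Sum>j\<in>J - {i}. \<Sum>k\<in>J. F i j k) = (\<Sum>j\<in>J - {i}. F i j i + (F i j j + (\<Sum>k\<in>J - {i} - {j}. F i j k)))"
  proof (rule sum.cong[OF refl])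
    fix j assume j: "j \<in> J - {i}"
    have "(\<Sum>k\<in>J. F i j k) = F i j i + (\<Sum>k\<in>J - {i}. F i j k)" using assms i by (rule sum.remove)
    also have "(\<Sum>k\<in>J - {i}. F i j k) = F i j j + (\<Sum>k\<in>J - {i} - {j}. F i j k)" using assms j by (intro sum.remove) auto
    finally show "(\<Sum>k\<in>J. F i j k) = F i j i + (F i j j + (\<Sum>k\<in>J - {i} - {j}. F i j k))" .
  qed
  finally show "(\<Sum>j\<in>J. \<Sum>k\<in>J. F i j k) = F i i i + (\<Sum>j\<in>J - {i}. F i i j + F i j i + F i j j) + (\<Sum>j\<in>J - {i}. \<Sum>k\<in>J - {i} - {j}. F i j k)"
    by (simp add: sum.distrib)
qed

text \<open>AM-GM, from the factorisation of \<open>x^3 + y^3 + z^3 - 3 * x * y * z\<close>. It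
  separates the three \<open>pair_prod\<close> factors, so that each can be averaged over its own
  pair of shifts.\<close>

lemma product3_le_cubes:
  fixes x y z :: real
  assumes "x \<ge> 0" "y \<ge> 0" "z \<ge> 0"
  shows "x * y * z \<le> (x^3 + y^3 + z^3) / 3"
proof -
  have "0 \<le> (x + y + z) * ((x - y)^2 + (y - z)^2 + (x - z)^2)" using assms by (intro mult_nonneg_nonneg) auto
  also have "\<dots> = 2 * (x^3 + y^3 + z^3 - 3 * (x * y * z))"
    by (simp add: power2_eq_square power3_eq_cube algebra_simps)
  finally show ?thesis by simp
qed

lemma sum_distinct_pair_prod:
  "(\<Sum>i=1..h. \<Sum>j\<in>{1..h} - {i}. \<Sum>k\<in>{1..h} - {i} - {j}. pair_prod P i j ^ 3 + pair_prod P i k ^ 3 + pair_prod P j k ^ 3) \<le> 6 * pair_const * real h ^ 3"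
proof -
  have nn: "0 \<le> pair_prod P i j ^ 3" for i j using pair_prod_bounds(1)[of i j] by simp
  have Kc0: "pair_const \<ge> 0" by (simp add: pair_const_def)
  have "(\<Sum>i=1..h. \<Sum>j\<in>{1..h} - {i}. \<Sum>k\<in>{1..h} - {i} - {j}. pair_prod P i j ^ 3) \<le> (\<Sum>i=1..h. \<Sum>j\<in>{1..h} - {i}. \<Sum>k\<in>{1..h}. pair_prod P i j ^ 3)"
    using nn by (intro sum_mono sum_mono2) auto
  also have "\<dots> = h * (\<Sum>i=1..h. \<Sum>j\<in>{1..h} - {i}. pair_prod P i j ^ 3)" by (simp add: sum_distrib_left)
  also have "\<dots> \<le> h * (2 * pair_const * real h ^ 2)" by (intro mult_left_mono sum_off_diagonal_pair_prod) auto
  finally have 1: "(\<Sum>i=1..h. \<Sum>j\<in>{1..h} - {i}. \<Sum>k\<in>{1..h} - {i} - {j}. pair_prod P i j ^ 3) \<le> 2 * pair_const * real h ^ 3"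
    by (simp add: power2_eq_square power3_eq_cube mult_ac)
  have "(\<Sum>i=1..h. \<Sum>j\<in>{1..h} - {i}. \<Sum>k\<in>{1..h} - {i} - {j}. pair_prod P i k ^ 3) \<le> (\<Sum>i=1..h. \<Sum>j\<in>{1..h} - {i}. \<Sum>k\<in>{1..h} - {i}. pair_prod P i k ^ 3)"
    by (intro sum_mono sum_mono2 nn) auto
  also have "\<dots> \<le> (\<Sum>i=1..h. \<Sum>j\<in>{1..h}. \<Sum>k\<in>{1..h} - {i}. pair_prod P i k ^ 3)"
    by (intro sum_mono sum_mono2 sum_nonneg nn) auto
  also have "\<dots> = h * (\<Sum>i=1..h. \<Sum>k\<in>{1..h} - {i}. pair_prod P i k ^ 3)" by (simp add: sum_distrib_left)
  also have "\<dots> \<le> h * (2 * pair_const * real h ^ 2)" by (intro mult_left_mono sum_off_diagonal_pair_prod) auto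
  finally have 2: "(\<Sum>i=1..h. \<Sum>j\<in>{1..h} - {i}. \<Sum>k\<in>{1..h} - {i} - {j}. pair_prod P i k ^ 3) \<le> 2 * pair_const * real h ^ 3"
    by (simp add: power2_eq_square power3_eq_cube mult_ac)
  have "(\<Sum>i=1..h. \<Sum>j\<in>{1..h} - {i}. \<Sum>k\<in>{1..h} - {i} - {j}. pair_prod P j k ^ 3) \<le> (\<Sum>i=1..h. \<Sum>j\<in>{1..h} - {i}. \<Sum>k\<in>{1..h} - {j}. pair_prod P j k ^ 3)"
    by (intro sum_mono sum_mono2 nn) auto
  also have "\<dots> \<le> (\<Sum>i=1..h. \<Sum>j\<in>{1..h}. \<Sum>k\<in>{1..h} - {j}. pair_prod P j k ^ 3)"
    by (intro sum_mono sum_mono2 sum_nonneg nn) auto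
  also have "\<dots> = h * (\<Sum>j=1..h. \<Sum>k\<in>{1..h} - {j}. pair_prod P j k ^ 3)" by simp
  also have "\<dots> \<le> h * (2 * pair_const * real h ^ 2)" by (intro mult_left_mono sum_off_diagonal_pair_prod) auto
  finally have 3: "(\<Sum>i=1..h. \<Sum>j\<in>{1..h} - {i}. \<Sum>k\<in>{1..h} - {i} - {j}. pair_prod P j k ^ 3) \<le> 2 * pair_const * real h ^ 3"
    by (simp add: power2_eq_square power3_eq_cube mult_ac)
  show ?thesis using 1 2 3 by (simp add: sum.distrib)
qed

lemma corr3_diagonal_const: "corr3 P \<A> i i i = corr3 P \<A> 1 1 1"
proof -
  have "cong_dvd_ind p i i = cong_dvd_ind p 1 1" for p by (simp add: cong_dvd_ind_def)
  then show ?thesis unfolding corr3_def local_corr_def by (simp only:)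
qed

text \<open>The shifts \<open>(i, j, k)\<close> are sorted by coincidences. All equal: the main
  part, the same for every \<open>i\<close>. Exactly two equal: about \<open>h^2\<close> triples,
  each costing a factor \<open>ln R\<close>. All distinct: about \<open>h^3\<close> triples. The
  last two kinds carry the saving in \<open>Q\<close>.\<close>

lemma mean_large_sum_cube_approx:
  "\<bar>mean P (\<lambda>n. (large_sum h n) ^ 3) - h * corr3 P (large Q R) 1 1 1\<bar> \<le>
     Q powr (-(1/4)) * (base_const * pair_const) * (12 * exp 5 * ln R * real h ^ 2 + 2 * real h ^ 3)"
proof -
  define F where "F = corr3 P (large Q R)"
  define q where "q = Q powr (-(1/4))"
  have q: "q \<ge> 0" by (simp add: q_def)
  have pair_prod_nn: "pair_prod P i j \<ge> 0" for i j using pair_prod_bounds(1)[of i j] by linarith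
  have sym: "F i j k = F i k j" "F i j k = F j k i" for i j k
    unfolding F_def by (rule corr3_symmetric[OF small_large_subset(2)]; assumption)+
  have pair: "\<bar>F i i k\<bar> \<le> q * (2 * exp 5 * base_const) * ln R * pair_prod P i k ^ 3" for i k
  proof -
    have "\<bar>F i i k\<bar> \<le> q * (2 * exp 5 * base_const) * ln R * pair_prod P i k"
      using corr3_pair[of Q R i k] Q R by (simp add: F_def q_def P_def)
    also have "\<dots> \<le> q * (2 * exp 5 * base_const) * ln R * pair_prod P i k ^ 3"
      using pair_prod_bounds base_const_pos q R by (intro mult_left_mono) auto
    finally show ?thesis .
  qed
  have comm: "pair_prod P i j = pair_prod P j i" for i j by (simp add: pair_prod_def pair_factor_commute)
  \<comment> \<open>Symmetry brings all three positions of the repeated shift into the form covered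
    by \<open>corr3_pair\<close>.\<close>
  have pairs: "\<bar>F i i j + F i j i + F i j j\<bar> \<le> 3 * (q * (2 * exp 5 * base_const) * ln R) * pair_prod P i j ^ 3" for i j
  proof -
    have "F i j i = F i i j" by (rule sym(1))
    moreover have "F i j j = F j j i" by (rule sym(2))
    ultimately show ?thesis using pair[of i j] pair[of j i] comm[of i j] by simp
  qed
  have dist: "\<bar>F i j k\<bar> \<le> q * base_const / 3 * (pair_prod P i j ^ 3 + pair_prod P i k ^ 3 + pair_prod P j k ^ 3)" for i j k
  proof -
    have "\<bar>F i j k\<bar> \<le> q * base_const * (pair_prod P i j * pair_prod P i k * pair_prod P j k)"
      using corr3_distinct[of Q R i j k] Q by (simp add: F_def q_def P_def mult_ac)
    also have "\<dots> \<le> q * base_const * ((pair_prod P i j ^ 3 + pair_prod P i k ^ 3 + pair_prod P j k ^ 3) / 3)"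
      using pair_prod_nn q base_const_pos by (intro mult_left_mono product3_le_cubes) auto
    finally show ?thesis by simp
  qed
  have eq: "mean P (\<lambda>n. (large_sum h n) ^ 3) = (\<Sum>i=1..h. F i i i) + (\<Sum>i=1..h. \<Sum>j\<in>{1..h} - {i}. F i i j + F i j i + F i j j)
     + (\<Sum>i=1..h. \<Sum>j\<in>{1..h} - {i}. \<Sum>k\<in>{1..h} - {i} - {j}. F i j k)"
    unfolding mean_large_sum_cube F_def by (rule sum_triple_split) simp
  have d: "(\<Sum>i=1..h. F i i i) = h * F 1 1 1"
  proof -
    have "(\<Sum>i=1..h. F i i i) = (\<Sum>i=1..h. F 1 1 1)"
      unfolding F_def by (rule sum.cong[OF refl corr3_diagonal_const])
    then show ?thesis by simp
  qed
  have "\<bar>\<Sum>i=1..h. \<Sum>j\<in>{1..h} - {i}. F i i j + F i j i + F i j j\<bar> \<le>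
    (\<Sum>i=1..h. \<Sum>j\<in>{1..h} - {i}. 3 * (q * (2 * exp 5 * base_const) * ln R) * pair_prod P i j ^ 3)"
    by (intro order_trans[OF sum_abs] sum_mono pairs)
  also have "\<dots> = 3 * (q * (2 * exp 5 * base_const) * ln R) * (\<Sum>i=1..h. \<Sum>j\<in>{1..h} - {i}. pair_prod P i j ^ 3)"
    by (simp add: sum_distrib_left)
  also have "\<dots> \<le> 3 * (q * (2 * exp 5 * base_const) * ln R) * (2 * pair_const * real h ^ 2)"
    using q base_const_pos R by (intro mult_left_mono sum_off_diagonal_pair_prod) auto
  finally have 1: "\<bar>\<Sum>i=1..h. \<Sum>j\<in>{1..h} - {i}. F i i j + F i j i + F i j j\<bar> \<le> q * (base_const * pair_const) * (12 * exp 5 * ln R * real h ^ 2)"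
    by (simp add: mult_ac)
  have "\<bar>\<Sum>i=1..h. \<Sum>j\<in>{1..h} - {i}. \<Sum>k\<in>{1..h} - {i} - {j}. F i j k\<bar> \<le>
    (\<Sum>i=1..h. \<Sum>j\<in>{1..h} - {i}. \<Sum>k\<in>{1..h} - {i} - {j}. q * base_const / 3 * (pair_prod P i j ^ 3 + pair_prod P i k ^ 3 + pair_prod P j k ^ 3))"
    by (intro order_trans[OF sum_abs] sum_mono dist)
  also have "\<dots> = q * base_const / 3 * (\<Sum>i=1..h. \<Sum>j\<in>{1..h} - {i}. \<Sum>k\<in>{1..h} - {i} - {j}. pair_prod P i j ^ 3 + pair_prod P i k ^ 3 + pair_prod P j k ^ 3)"
    by (simp only: sum_distrib_left)
  also have "\<dots> \<le> q * base_const / 3 * (6 * pair_const * real h ^ 3)"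
    using q base_const_pos by (intro mult_left_mono sum_distinct_pair_prod) auto
  finally have 2: "\<bar>\<Sum>i=1..h. \<Sum>j\<in>{1..h} - {i}. \<Sum>k\<in>{1..h} - {i} - {j}. F i j k\<bar> \<le> q * (base_const * pair_const) * (2 * real h ^ 3)"
    by (simp add: mult_ac)
  have "\<bar>mean P (\<lambda>n. (large_sum h n) ^ 3) - h * F 1 1 1\<bar> \<le> q * (base_const * pair_const) * (12 * exp 5 * ln R * real h ^ 2) + q * (base_const * pair_const) * (2 * real h ^ 3)"
    unfolding eq d using 1 2 by linarith
  then show ?thesis by (simp only: F_def q_def ring_distribs)
qed


lemma mean_centred: "mean P (\<lambda>n. small_sum h n + large_sum h n) = 0"
proof -
  have "mean P (small_sum h) = 0" "mean P (large_sum h) = 0"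
    by (rule mean_short_sum_zero; use small_large_subset sqf_sets_split(2) in blast)+
  then show ?thesis by (simp add: mean_add)
qed

lemma mean_short_sum: "mean P (short_sum (sqf_sets R) h) = h"
proof -
  have "mean P (\<lambda>n. real h + (small_sum h n + large_sum h n)) = h"
    using mean_add[of P "\<lambda>_. real h" "\<lambda>n. small_sum h n + large_sum h n"] by (simp add: mean_centred mean_const[OF P])
  then show ?thesis by (simp flip: short_sum_split)
qed

lemma mean_short_sum_power_split:
  "mean P (\<lambda>n. (short_sum (sqf_sets R) h n)\<^sup>2) = real h ^ 2 + mean P (\<lambda>n. (small_sum h n + large_sum h n)\<^sup>2)"
  "mean P (\<lambda>n. (short_sum (sqf_sets R) h n) ^ 3) = real h ^ 3 + 3 * real h * mean P (\<lambda>n. (small_sum h n + large_sum h n)\<^sup>2) + mean P (\<lambda>n. (small_sum h n + large_sum h n) ^ 3)"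
proof -
  define f where "f n = small_sum h n + large_sum h n" for n
  have f: "mean P f = 0" unfolding f_def by (rule mean_centred)
  have S: "short_sum (sqf_sets R) h n = real h + f n" for n by (simp add: short_sum_split f_def)
  have "(short_sum (sqf_sets R) h n)\<^sup>2 = real h ^ 2 + (2 * real h) * f n + (f n)\<^sup>2" for n
    unfolding S by (simp add: power2_eq_square algebra_simps)
  then show "mean P (\<lambda>n. (short_sum (sqf_sets R) h n)\<^sup>2) = real h ^ 2 + mean P (\<lambda>n. (small_sum h n + large_sum h n)\<^sup>2)"
    by (simp add: mean_add mean_cmult mean_const[OF P] f flip: f_def)
  have "(short_sum (sqf_sets R) h n) ^ 3 = real h ^ 3 + (3 * real h ^ 2) * f n + (3 * real h) * (f n)\<^sup>2 + (f n) ^ 3" for n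
    unfolding S by (simp add: power2_eq_square power3_eq_cube algebra_simps)
  then show "mean P (\<lambda>n. (short_sum (sqf_sets R) h n) ^ 3) = real h ^ 3 + 3 * real h * mean P (\<lambda>n. (small_sum h n + large_sum h n)\<^sup>2) + mean P (\<lambda>n. (small_sum h n + large_sum h n) ^ 3)"
    by (simp add: mean_add mean_cmult mean_const[OF P] f flip: f_def)
qed

lemma mean_small_sum_square_bounds: "0 \<le> mean P (\<lambda>n. (small_sum h n)\<^sup>2)" "mean P (\<lambda>n. (small_sum h n)\<^sup>2) \<le> (Q ^ 3)\<^sup>2"
proof -
  have "(small_sum h n)\<^sup>2 \<le> (Q ^ 3)\<^sup>2" for n using power_mono[OF short_sum_small_bound[OF Q, of R h n], of 2] by simp
  then have "mean P (\<lambda>n. (small_sum h n)\<^sup>2) \<le> mean P (\<lambda>_. (Q ^ 3)\<^sup>2)" by (rule mean_mono)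
  then show "mean P (\<lambda>n. (small_sum h n)\<^sup>2) \<le> (Q ^ 3)\<^sup>2" by (simp only: mean_const[OF P])
  have "mean P (\<lambda>_. 0) \<le> mean P (\<lambda>n. (small_sum h n)\<^sup>2)" by (rule mean_mono) simp
  then show "0 \<le> mean P (\<lambda>n. (small_sum h n)\<^sup>2)" by (simp only: mean_const[OF P])
qed

text \<open>For \<open>a\<close> the small part, bounded pointwise, and \<open>b\<close> the large
  part, whose second moment is known: the term linear in \<open>b\<close> is brought to a second
  moment by \<open>\<bar>b\<bar> \<le> 1 + b^2\<close>.\<close>

lemma abs_cube_add_diff_le:
  fixes a b D :: real
  assumes "\<bar>a\<bar> \<le> D" "D \<ge> 1"
  shows "\<bar>(a + b) ^ 3 - b ^ 3\<bar> \<le> 6 * D\<^sup>2 * b\<^sup>2 + 4 * D ^ 3"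
proof -
  have D: "D \<le> D\<^sup>2" "D\<^sup>2 \<le> D ^ 3" using power_increasing[OF _ assms(2), of 1 2] power_increasing[OF _ assms(2), of 2 3] by auto
  have a2: "a\<^sup>2 \<le> D\<^sup>2" using power_mono[OF assms(1), of 2] by simp
  have a3: "\<bar>a ^ 3\<bar> \<le> D ^ 3" using power_mono[OF assms(1), of 3] by (simp add: power_abs)
  have b: "\<bar>b\<bar> \<le> 1 + b\<^sup>2"
  proof -
    have "0 \<le> (\<bar>b\<bar> - 1)\<^sup>2 + \<bar>b\<bar>" by simp
    then show ?thesis by (simp add: power2_diff)
  qed
  have "(a + b) ^ 3 - b ^ 3 = 3 * (a * b\<^sup>2) + 3 * (a\<^sup>2 * b) + a ^ 3"
    by (simp add: power2_eq_square power3_eq_cube algebra_simps)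
  also have "\<bar>\<dots>\<bar> \<le> 3 * \<bar>a * b\<^sup>2\<bar> + 3 * \<bar>a\<^sup>2 * b\<bar> + \<bar>a ^ 3\<bar>" by linarith
  also have "\<bar>a * b\<^sup>2\<bar> \<le> D\<^sup>2 * b\<^sup>2" using assms D(1) by (auto simp: abs_mult intro!: mult_right_mono)
  also have "\<bar>a\<^sup>2 * b\<bar> \<le> D\<^sup>2 * (1 + b\<^sup>2)" unfolding abs_mult using a2 b by (intro mult_mono) auto
  finally show ?thesis using a3 D(2) by (simp add: ring_distribs)
qed

lemma mean_centred_cube_approx:
  "\<bar>mean P (\<lambda>n. (small_sum h n + large_sum h n) ^ 3) - mean P (\<lambda>n. (large_sum h n) ^ 3)\<bar> \<le> 6 * (Q^3)\<^sup>2 * mean P (\<lambda>n. (large_sum h n)\<^sup>2) + 4 * (Q^3) ^ 3"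
proof -
  have "\<bar>mean P (\<lambda>n. (small_sum h n + large_sum h n) ^ 3) - mean P (\<lambda>n. (large_sum h n) ^ 3)\<bar> \<le> mean P (\<lambda>n. \<bar>(small_sum h n + large_sum h n) ^ 3 - (large_sum h n) ^ 3\<bar>)"
    unfolding mean_diff[symmetric] by (rule abs_mean_le)
  also have "\<dots> \<le> mean P (\<lambda>n. (6 * (Q^3)\<^sup>2) * (large_sum h n)\<^sup>2 + 4 * (Q^3) ^ 3)"
    by (intro mean_mono abs_cube_add_diff_le short_sum_small_bound Q one_le_power)
  also have "\<dots> = 6 * (Q^3)\<^sup>2 * mean P (\<lambda>n. (large_sum h n)\<^sup>2) + 4 * (Q^3) ^ 3"
    by (simp only: mean_add mean_cmult mean_const[OF P])
  finally show ?thesis .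
qed

context
  fixes CL CT
  assumes CL: "\<bar>totient_sum R - ln R\<bar> \<le> CL"
    and CT: "\<bar>quad_sum (quad_weight_on (primes_le R)) R R R - 3 / 4 * (ln R)\<^sup>2\<bar> \<le> CT * ln R"
begin

lemma mean_large_sum_square_ln:
  "\<bar>mean P (\<lambda>n. (large_sum h n)\<^sup>2) - h * ln R\<bar> \<le> (2 * Q + CL) * h + 2 * (base_const * pair_const) * Q powr (-(1/4)) * real h ^ 2"
proof -
  have "\<bar>h * totient_sum R - h * ln R\<bar> \<le> h * CL" unfolding right_diff_distrib[symmetric] abs_mult using CL by (simp add: mult_left_mono)
  then show ?thesis using mean_large_sum_square_approx[of h] unfolding ring_distribs by (simp add: mult_ac)
qed

lemma mean_large_sum_square_le:
  "mean P (\<lambda>n. (large_sum h n)\<^sup>2) \<le> (2 * Q + CL + 1) * (h * ln R) + 2 * (base_const * pair_const) * Q powr (-(1/4)) * real h ^ 2"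
proof -
  have CL0: "CL \<ge> 0" using CL by linarith
  have "(2 * Q + CL) * (real h * 1) \<le> (2 * Q + CL) * (real h * ln R)" using R Q CL0 by (intro mult_left_mono) auto
  then show ?thesis using mean_large_sum_square_ln[of h] unfolding ring_distribs by simp
qed

lemma mean_centred_square_approx:
  assumes "h \<ge> 1"
  shows "\<bar>mean P (\<lambda>n. (small_sum h n + large_sum h n)\<^sup>2) - h * ln R\<bar> \<le>
    ((Q^3)\<^sup>2 + 2 * Q + CL) * h + 2 * (base_const * pair_const) * Q powr (-(1/4)) * real h ^ 2"
proof -
  have "(Q^3)\<^sup>2 * 1 \<le> (Q^3)\<^sup>2 * real h" using assms by (intro mult_left_mono) auto
  then show ?thesis unfolding mean_small_large_square
    using mean_small_sum_square_bounds[of h] mean_large_sum_square_ln[of h] unfolding ring_distribs by (simp only: abs_le_iff) linarith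
qed

definition cube_err :: real where
  "cube_err = 6 * (Q^3)\<^sup>2 * (2 * Q + CL + 1 + 2 * (base_const * pair_const)) + 4 * (Q^3) ^ 3 + CT + 1 + 3 * (1 + ((Q^3)\<^sup>2 + 2 * Q + CL) + 2 * (base_const * pair_const))"

text \<open>The moment identities are used at \<open>h = 1\<close>, where the third moment is a
  single correlation. For the full family it is \<open>T\<close>, known from the quadruple sum; for
  the large family it is \<open>c\<close>. Here \<open>T = 1 + 3 * V + U\<close> with
  \<open>V\<close> of order \<open>ln R\<close>, and exchanging \<open>U\<close> for
  \<open>c\<close> costs another multiple of \<open>ln R\<close>.\<close>

lemma corr3_large_diagonal_approx: "\<bar>corr3 P (large Q R) 1 1 1 - 3 / 4 * (ln R)\<^sup>2\<bar> \<le> cube_err * ln R"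
proof -
  define q where "q = Q powr (-(1/4))"
  define BK where "BK = base_const * pair_const"
  define U where "U = mean P (\<lambda>n. (small_sum 1 n + large_sum 1 n) ^ 3)"
  define V where "V = mean P (\<lambda>n. (small_sum 1 n + large_sum 1 n)\<^sup>2)"
  define W where "W = mean P (\<lambda>n. (large_sum 1 n)\<^sup>2)"
  define D where "D = Q ^ 3"
  define T where "T = corr3 P (sqf_sets R) 1 1 1"
  define c where "c = corr3 P (large Q R) 1 1 1"
  define E where "E = D\<^sup>2 + 2 * Q + CL"
  have D: "D \<ge> 1" unfolding D_def using Q by (rule one_le_power)
  have q: "0 \<le> q" "q \<le> 1" using Q powr_mono[of "-(1/4)" 0 Q] by (auto simp: q_def)
  have BK: "BK \<ge> 0" using base_const_pos by (simp add: BK_def pair_const_def)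
  have CL0: "CL \<ge> 0" using CL by linarith
  have qBK: "BK * q \<le> BK" using q BK by (simp add: mult_left_le)
  have "mean P (\<lambda>n. (short_sum (sqf_sets R) 1 n) ^ 3) = T"
    using mean_short_sum_cube[of "sqf_sets R" 1] sqf_sets_subset_P by (simp add: T_def)
  then have T: "T = 1 + 3 * V + U" using mean_short_sum_power_split(2)[of 1] by (simp add: U_def V_def)
  have "T = quad_sum (quad_weight_on (primes_le R)) R R R"
    using corr3_diagonal[of R 1] by (simp add: T_def P_def)
  then have T': "\<bar>T - 3 / 4 * (ln R)\<^sup>2\<bar> \<le> CT * ln R" using CT by simp
  have V: "\<bar>V - ln R\<bar> \<le> E + 2 * (BK * q)"
    using mean_centred_square_approx[of 1] by (simp add: V_def E_def D_def BK_def q_def)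
  have W: "W \<le> (2 * Q + CL + 1) * ln R + 2 * (BK * q)"
    using mean_large_sum_square_le[of 1] by (simp add: W_def BK_def q_def)
  have c: "mean P (\<lambda>n. (large_sum 1 n) ^ 3) = c" unfolding mean_large_sum_cube by (simp add: c_def)
  have U: "\<bar>U - c\<bar> \<le> 6 * D\<^sup>2 * W + 4 * D ^ 3"
    using mean_centred_cube_approx[of 1] unfolding c by (simp add: U_def W_def D_def)
  have L: "BK \<le> BK * ln R" "E \<le> E * ln R" "4 * D ^ 3 \<le> 4 * D ^ 3 * ln R"
  proof -
    have *: "x \<le> x * ln R" if "x \<ge> 0" for x using mult_left_mono[OF R(2) that] by simp
    show "BK \<le> BK * ln R" "E \<le> E * ln R" "4 * D ^ 3 \<le> 4 * D ^ 3 * ln R"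
      by (rule *, use BK D Q CL0 in \<open>simp add: E_def\<close>)+
  qed
  have "6 * D\<^sup>2 * W \<le> 6 * D\<^sup>2 * ((2 * Q + CL + 1) * ln R + 2 * (BK * ln R))"
    using W qBK L(1) by (intro mult_left_mono) auto
  then have "\<bar>U - c\<bar> \<le> (6 * D\<^sup>2 * (2 * Q + CL + 1 + 2 * BK) + 4 * D ^ 3) * ln R"
    using U L(3) unfolding ring_distribs by simp
  moreover have "\<bar>V\<bar> \<le> (1 + E + 2 * BK) * ln R"
    using V L qBK R(2) unfolding ring_distribs by linarith
  ultimately have "\<bar>c - 3 / 4 * (ln R)\<^sup>2\<bar> \<le> (6 * D\<^sup>2 * (2 * Q + CL + 1 + 2 * BK) + 4 * D ^ 3) * ln R + CT * ln R + 1 * ln R + 3 * ((1 + E + 2 * BK) * ln R)"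
    using T T' R(2) by linarith
  also have "\<dots> = cube_err * ln R"
    by (simp add: cube_err_def D_def E_def BK_def algebra_simps)
  finally show ?thesis by (simp only: c_def)
qed

text \<open>Collects all contributions that grow with \<open>Q\<close>. It involves
  \<open>Q\<close>, \<open>CL\<close>, \<open>CT\<close> and absolute constants, but neither
  \<open>R\<close> nor \<open>h\<close>.\<close>

definition moment_err :: real where
  "moment_err = cube_err + 6 * (Q^3)\<^sup>2 * (2 * Q + CL + 1) + 4 * (Q^3) ^ 3 + 3 * ((Q^3)\<^sup>2 + 2 * Q + CL) + 12 * (Q^3)\<^sup>2 * (base_const * pair_const)"

text \<open>In terms of \<open>h\<close> and \<open>ln R\<close> the main terms are of degree 3. The
  first error is of degree 3 as well but carries \<open>Q powr (-(1/4))\<close>; the second is only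
  of degree 2 and may therefore have a constant depending badly on \<open>Q\<close>.\<close>

lemma mean_short_sum_cube_approx:
  assumes h: "h \<ge> 1"
  shows "\<bar>mean P (\<lambda>n. (short_sum (sqf_sets R) h n) ^ 3) - (real h ^ 3 + 3 * real h ^ 2 * ln R + 3 / 4 * real h * (ln R)\<^sup>2)\<bar> \<le>
    base_const * pair_const * (12 * exp 5 + 8) * Q powr (-(1/4)) * (real h ^ 2 * ln R + real h ^ 3) + moment_err * (h * ln R + real h ^ 2)"
proof -
  define q where "q = Q powr (-(1/4))"
  define BK where "BK = base_const * pair_const"
  define H where "H = real h"
  define L where "L = ln R"
  define U where "U = mean P (\<lambda>n. (small_sum h n + large_sum h n) ^ 3)"
  define V where "V = mean P (\<lambda>n. (small_sum h n + large_sum h n)\<^sup>2)"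
  define W where "W = mean P (\<lambda>n. (large_sum h n)\<^sup>2)"
  define W3 where "W3 = mean P (\<lambda>n. (large_sum h n) ^ 3)"
  define D where "D = Q ^ 3"
  define c where "c = corr3 P (large Q R) 1 1 1"
  define E where "E = D\<^sup>2 + 2 * Q + CL"
  define E2 where "E2 = 2 * Q + CL + 1"
  have H: "H \<ge> 1" using h by (simp add: H_def)
  have L: "L \<ge> 1" using R by (simp add: L_def)
  have D: "D \<ge> 1" unfolding D_def using Q by (rule one_le_power)
  have q: "0 \<le> q" "q \<le> 1" using Q powr_mono[of "-(1/4)" 0 Q] by (auto simp: q_def)
  have BK: "BK \<ge> 0" using base_const_pos by (simp add: BK_def pair_const_def)
  have CL0: "CL \<ge> 0" using CL by linarith
  have E: "E \<ge> 0" "E2 \<ge> 0" using CL0 Q by (auto simp: E_def E2_def)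
  have CT0: "CT \<ge> 0"
  proof -
    have "0 \<le> CT * ln R" using CT by linarith
    then show ?thesis using R(2) by (simp add: zero_le_mult_iff)
  qed
  have ce: "cube_err \<ge> 0" using CT0 BK Q CL0 by (auto simp: cube_err_def BK_def intro!: add_nonneg_nonneg mult_nonneg_nonneg)
  have V: "\<bar>V - H * L\<bar> \<le> E * H + 2 * BK * q * H ^ 2"
    using mean_centred_square_approx[OF h] by (simp add: V_def E_def D_def BK_def q_def H_def L_def)
  have W: "W \<le> E2 * (H * L) + 2 * BK * q * H ^ 2"
    using mean_large_sum_square_le[of h] by (simp add: W_def E2_def BK_def q_def H_def L_def)
  have U: "\<bar>U - W3\<bar> \<le> 6 * D\<^sup>2 * W + 4 * D ^ 3"
    using mean_centred_cube_approx[of h] by (simp add: U_def W_def W3_def D_def)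
  have W3: "\<bar>W3 - H * c\<bar> \<le> q * BK * (12 * exp 5 * L * H ^ 2 + 2 * H ^ 3)"
    using mean_large_sum_cube_approx[of h] by (simp only: W3_def c_def H_def q_def BK_def L_def)
  have "\<bar>c - 3 / 4 * L\<^sup>2\<bar> \<le> cube_err * L"
    using corr3_large_diagonal_approx by (simp add: c_def L_def)
  then have c: "\<bar>H * c - H * (3 / 4 * L\<^sup>2)\<bar> \<le> H * (cube_err * L)"
    unfolding right_diff_distrib[symmetric] abs_mult using H by (simp add: mult_left_mono)
  have 1: "3 * (H * \<bar>V - H * L\<bar>) \<le> 3 * (H * (E * H + 2 * BK * q * H ^ 2))"
    using V H by (intro mult_left_mono) auto
  have 2: "6 * D\<^sup>2 * W \<le> 6 * D\<^sup>2 * (E2 * (H * L) + 2 * BK * 1 * H ^ 2)"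
    using W q BK by (intro mult_left_mono order_trans[OF W] add_left_mono mult_right_mono) auto
  have "1 * 1 \<le> H * L" using H L by (intro mult_mono) auto
  then have 3: "4 * D ^ 3 * 1 \<le> 4 * D ^ 3 * (H * L)" using D by (intro mult_left_mono) auto
  have "mean P (\<lambda>n. (short_sum (sqf_sets R) h n) ^ 3) - (H ^ 3 + 3 * H ^ 2 * L + 3 / 4 * H * L\<^sup>2) = 3 * (H * (V - H * L)) + (U - W3) + (W3 - H * c) + (H * c - H * (3 / 4 * L\<^sup>2))"
    unfolding mean_short_sum_power_split(2) H_def[symmetric] U_def[symmetric] V_def[symmetric]
    by (simp add: power2_eq_square power3_eq_cube algebra_simps)
  moreover have "\<bar>H * (V - H * L)\<bar> = H * \<bar>V - H * L\<bar>" using H by (simp add: abs_mult)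
  ultimately have "\<bar>mean P (\<lambda>n. (short_sum (sqf_sets R) h n) ^ 3) - (H ^ 3 + 3 * H ^ 2 * L + 3 / 4 * H * L\<^sup>2)\<bar> \<le>
     3 * (H * (E * H + 2 * BK * q * H ^ 2)) + (6 * D\<^sup>2 * (E2 * (H * L) + 2 * BK * 1 * H ^ 2) + 4 * D ^ 3 * (H * L))
     + q * BK * (12 * exp 5 * L * H ^ 2 + 2 * H ^ 3) + H * (cube_err * L)"
    using 1 2 3 U W3 c by linarith
  also have "\<dots> = BK * q * (12 * exp 5 * (H ^ 2 * L) + 8 * H ^ 3) + ((cube_err + 6 * D\<^sup>2 * E2 + 4 * D ^ 3) * (H * L) + (3 * E + 12 * D\<^sup>2 * BK) * H ^ 2)"
    by (simp add: power2_eq_square power3_eq_cube algebra_simps)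
  also have "\<dots> \<le> BK * q * ((12 * exp 5 + 8) * (H ^ 2 * L) + (12 * exp 5 + 8) * H ^ 3) + (moment_err * (H * L) + moment_err * H ^ 2)"
  proof (intro add_mono mult_left_mono mult_right_mono)
    show "cube_err + 6 * D\<^sup>2 * E2 + 4 * D ^ 3 \<le> moment_err" "3 * E + 12 * D\<^sup>2 * BK \<le> moment_err"
      using ce E BK D by (auto simp: moment_err_def D_def[symmetric] BK_def[symmetric] E_def[symmetric] E2_def[symmetric])
  qed (use H L BK q in auto)
  also have "\<dots> = BK * (12 * exp 5 + 8) * q * (H ^ 2 * L + H ^ 3) + moment_err * (H * L + H ^ 2)"
    by (simp only: ring_distribs mult_ac)
  finally show ?thesis by (simp only: H_def L_def BK_def q_def)
qed

lemma mean_short_sum_square_approx: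
  assumes h: "h \<ge> 1"
  shows "\<bar>mean P (\<lambda>n. (short_sum (sqf_sets R) h n)\<^sup>2) - (real h ^ 2 + real h * ln R)\<bar> \<le>
    base_const * pair_const * (12 * exp 5 + 8) * Q powr (-(1/4)) * real h ^ 2 + moment_err * real h"
proof -
  have CL0: "CL \<ge> 0" using CL by linarith
  have BK: "base_const * pair_const \<ge> 0" using base_const_pos by (simp add: pair_const_def)
  have CT0: "CT \<ge> 0"
  proof -
    have "0 \<le> CT * ln R" using CT by linarith
    then show ?thesis using R(2) by (simp add: zero_le_mult_iff)
  qed
  have "0 \<le> cube_err" "0 \<le> 6 * (Q^3)\<^sup>2 * (2 * Q + CL + 1)" "0 \<le> 4 * (Q^3) ^ 3" "0 \<le> 12 * (Q^3)\<^sup>2 * (base_const * pair_const)"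
    using BK Q CL0 CT0 by (auto simp: cube_err_def intro!: add_nonneg_nonneg mult_nonneg_nonneg)
  moreover have "0 \<le> (Q^3)\<^sup>2 + 2 * Q + CL" using Q CL0 by (auto intro!: add_nonneg_nonneg)
  moreover have "x \<le> a + b + c + 3 * x + d" if "0 \<le> a" "0 \<le> b" "0 \<le> c" "0 \<le> d" "0 \<le> x" for a b c d x :: real
    using that by linarith
  ultimately have "(Q^3)\<^sup>2 + 2 * Q + CL \<le> moment_err" unfolding moment_err_def by blast
  then have "((Q^3)\<^sup>2 + 2 * Q + CL) * real h \<le> moment_err * real h" by (rule mult_right_mono) simp
  moreover have "2 * (base_const * pair_const) * (Q powr (-(1/4)) * real h ^ 2) \<le> (base_const * pair_const * (12 * exp 5 + 8)) * (Q powr (-(1/4)) * real h ^ 2)"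
  proof (rule mult_right_mono)
    have "base_const * pair_const * 2 \<le> base_const * pair_const * (12 * exp 5 + 8)" using exp_ge_zero[of "5::real"] BK by (intro mult_left_mono) auto
    then show "2 * (base_const * pair_const) \<le> base_const * pair_const * (12 * exp 5 + 8)" by (simp only: mult_ac)
  qed simp
  ultimately show ?thesis unfolding mean_short_sum_power_split(1) using mean_centred_square_approx[OF h]
    by (simp only: abs_le_iff mult.assoc) linarith
qed

end

end

text \<open>The order of quantifiers matters: \<open>C\<close> precedes \<open>Q\<close>,
  \<open>F\<close> may depend on \<open>Q\<close>, and both are uniform in \<open>R\<close> and
  \<open>h\<close>. A large \<open>Q\<close> makes the first error small relative to the main term,
  then a large \<open>R\<close> the second.\<close>

lemma short_sum_moments_approx:
  "\<exists>C\<ge>0. \<forall>Q\<ge>1. \<exists>F. \<forall>R h. R > 1 \<longrightarrow> ln R \<ge> 1 \<longrightarrow> h \<ge> 1 \<longrightarrow>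
     \<bar>mean (primes_le R) (\<lambda>n. (short_sum (sqf_sets R) h n)\<^sup>2) - (real h ^ 2 + real h * ln R)\<bar> \<le> C * Q powr (-(1/4)) * real h ^ 2 + F * real h \<and>
     \<bar>mean (primes_le R) (\<lambda>n. (short_sum (sqf_sets R) h n) ^ 3) - (real h ^ 3 + 3 * real h ^ 2 * ln R + 3 / 4 * real h * (ln R)\<^sup>2)\<bar> \<le>
       C * Q powr (-(1/4)) * (real h ^ 2 * ln R + real h ^ 3) + F * (real h * ln R + real h ^ 2)"
proof -
  obtain CL where CL: "\<And>R. R \<ge> 1 \<Longrightarrow> \<bar>totient_sum R - ln R\<bar> \<le> CL" using totient_sum_asymp by blast
  obtain CT where CT: "\<And>R P. R > 0 \<Longrightarrow> ln R \<ge> 1 \<Longrightarrow> finite P \<Longrightarrow> \<forall>p\<in>P. prime p \<Longrightarrow>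
      \<bar>quad_sum (quad_weight_on P) R R R - 3/4*(ln R)\<^sup>2\<bar> \<le> CT * ln R"
    using quad_sum_primes_asymp by blast
  have CT': "\<bar>quad_sum (quad_weight_on (primes_le R)) R R R - 3/4*(ln R)\<^sup>2\<bar> \<le> CT * ln R" if "R > 1" "ln R \<ge> 1" for R
    by (rule CT) (use that primes_leD finite_primes_le in auto)
  have "base_const * pair_const * (12 * exp 5 + 8) \<ge> 0" using base_const_pos by (simp add: pair_const_def)
  then show ?thesis
  proof (rule exI[of _ "base_const * pair_const * (12 * exp 5 + 8)", OF conjI], intro allI impI)
    fix Q :: real assume Q: "Q \<ge> 1"
    show "\<exists>F. \<forall>R h. R > 1 \<longrightarrow> ln R \<ge> 1 \<longrightarrow> h \<ge> 1 \<longrightarrow>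
     \<bar>mean (primes_le R) (\<lambda>n. (short_sum (sqf_sets R) h n)\<^sup>2) - (real h ^ 2 + real h * ln R)\<bar> \<le>
       base_const * pair_const * (12 * exp 5 + 8) * Q powr (-(1/4)) * real h ^ 2 + F * real h \<and>
     \<bar>mean (primes_le R) (\<lambda>n. (short_sum (sqf_sets R) h n) ^ 3) - (real h ^ 3 + 3 * real h ^ 2 * ln R + 3 / 4 * real h * (ln R)\<^sup>2)\<bar> \<le>
       base_const * pair_const * (12 * exp 5 + 8) * Q powr (-(1/4)) * (real h ^ 2 * ln R + real h ^ 3) + F * (real h * ln R + real h ^ 2)"
    proof (rule exI[of _ "moment_err Q CL CT"], intro allI impI conjI)
      fix R :: real and h :: nat
      assume R: "R > 1" "ln R \<ge> 1" and h: "h \<ge> 1"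
      then have CL': "\<bar>totient_sum R - ln R\<bar> \<le> CL" by (intro CL) simp
      note * = R Q CL' CT'[OF R] h
      show "\<bar>mean (primes_le R) (\<lambda>n. (short_sum (sqf_sets R) h n)\<^sup>2) - (real h ^ 2 + real h * ln R)\<bar> \<le>
        base_const * pair_const * (12 * exp 5 + 8) * Q powr (-(1/4)) * real h ^ 2 + moment_err Q CL CT * real h"
        by (rule mean_short_sum_square_approx[OF *])
      show "\<bar>mean (primes_le R) (\<lambda>n. (short_sum (sqf_sets R) h n) ^ 3) - (real h ^ 3 + 3 * real h ^ 2 * ln R + 3 / 4 * real h * (ln R)\<^sup>2)\<bar> \<le>
        base_const * pair_const * (12 * exp 5 + 8) * Q powr (-(1/4)) * (real h ^ 2 * ln R + real h ^ 3) + moment_err Q CL CT * (real h * ln R + real h ^ 2)"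
        by (rule mean_short_sum_cube_approx[OF *])
    qed
  qed
qed

section \<open>From the full period to n \<le> N\<close>

text \<open>The total weight \<open>B\<close> is built up with the function, so that closure under
  products and the comparison with the mean follow by rule induction. With \<open>s \<ge> 1\<close>
  one period starting at 0 can be rewritten as an interval starting at 1.\<close>

inductive ap_comb :: "nat \<Rightarrow> real \<Rightarrow> (nat \<Rightarrow> real) \<Rightarrow> bool" for M where
  zero: "B \<ge> 0 \<Longrightarrow> ap_comb M B (\<lambda>_. 0)"
| dvd_ind: "m dvd M \<Longrightarrow> s \<ge> 1 \<Longrightarrow> ap_comb M 1 (\<lambda>n. dvd_ind m (n + s))"
| add: "ap_comb M B f \<Longrightarrow> ap_comb M C g \<Longrightarrow> ap_comb M (B + C) (\<lambda>n. f n + g n)"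
| cmult: "ap_comb M B f \<Longrightarrow> ap_comb M (\<bar>c\<bar> * B) (\<lambda>n. c * f n)"

lemma ap_comb_nonneg: "ap_comb M B f \<Longrightarrow> B \<ge> 0"
  by (induction rule: ap_comb.induct) auto

text \<open>Two residue classes are disjoint or meet in one class modulo the least common multiple,
  which still divides \<open>M\<close>.\<close>

lemma dvd_ind_mult_dvd_ind:
  assumes "m dvd M" "m' dvd M" "M > 0"
  shows "ap_comb M 1 (\<lambda>n. dvd_ind m (n + s) * dvd_ind m' (n + s'))"
proof (cases "\<exists>a. m dvd a + s \<and> m' dvd a + s'")
  case False
  then have "(\<lambda>n. dvd_ind m (n + s) * dvd_ind m' (n + s')) = (\<lambda>_. 0)" by (auto simp: dvd_ind_def fun_eq_iff)
  then show ?thesis using ap_comb.zero[of 1 M] by simp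
next
  case True
  then obtain a where a: "m dvd a + s" "m' dvd a + s'" by blast
  define l where "l = lcm m m'"
  \<comment> \<open>A positive natural number congruent to \<open>- a\<close> modulo
    \<open>l\<close>, where \<open>a\<close> lies in both classes.\<close>
  define t where "t = l * (a + 1) - a"
  have lM: "l dvd M" unfolding l_def using assms by (intro lcm_least)
  then have "l > 0" using assms(3) by (auto intro: Nat.gr0I)
  then have la: "l * (a + 1) \<ge> a + 1" by (metis One_nat_def Suc_leI mult_le_mono1 nat_mult_1)
  have *: "d dvd n + t \<longleftrightarrow> d dvd n + r" if "d dvd l" "d dvd a + r" for d n r
  proof -
    have "n + t + (a + r) = (n + r) + l * (a + 1)" using la by (simp add: t_def)
    moreover have "d dvd l * (a + 1)" using that(1) by (rule dvd_mult2)
    ultimately show ?thesis using that(2) by (metis dvd_add_left_iff)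
  qed
  have "l dvd n + t \<longleftrightarrow> m dvd n + s \<and> m' dvd n + s'" for n
    using *[of m s n] *[of m' s' n] a by (auto simp: l_def)
  then have "(\<lambda>n. dvd_ind m (n + s) * dvd_ind m' (n + s')) = (\<lambda>n. dvd_ind l (n + t))"
    by (auto simp: dvd_ind_def fun_eq_iff)
  moreover have "t \<ge> 1" using la by (simp add: t_def)
  ultimately show ?thesis using ap_comb.dvd_ind[OF lM] by simp
qed

lemma ap_comb_mult:
  assumes "ap_comb M B f" "ap_comb M C g" "M > 0"
  shows "ap_comb M (B * C) (\<lambda>n. f n * g n)"
  using assms(1)
proof (induction rule: ap_comb.induct)
  case (zero B)
  then show ?case using ap_comb.zero[of "B * C" M] ap_comb_nonneg[OF assms(2)] by simp
next
  case (dvd_ind m s)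
  show ?case using assms(2)
  proof (induction rule: ap_comb.induct)
    case (zero C)
    then show ?case using ap_comb.zero[of C M] by simp
  next
    case (dvd_ind m' s')
    then show ?case using dvd_ind_mult_dvd_ind[OF \<open>m dvd M\<close> dvd_ind(1) assms(3), of s s'] by simp
  next
    case (add B f C g)
    then show ?case using ap_comb.add[OF add.IH] by (simp add: ring_distribs)
  next
    case (cmult B f c)
    then show ?case using ap_comb.cmult[OF cmult.IH, of c] by (simp add: mult_ac)
  qed
next
  case (add B f C g)
  then show ?case using ap_comb.add[OF add.IH] by (simp add: ring_distribs)
next
  case (cmult B f c)
  then show ?case using ap_comb.cmult[OF cmult.IH, of c] by (simp add: mult_ac)
qed

lemma ap_comb_1: "ap_comb M 1 (\<lambda>_. 1)"
  using ap_comb.dvd_ind[of 1 M 1] by (simp add: dvd_ind_def)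

lemma ap_comb_sum:
  assumes "finite X" "\<And>x. x \<in> X \<Longrightarrow> ap_comb M (B x) (f x)"
  shows "ap_comb M (\<Sum>x\<in>X. B x) (\<lambda>n. \<Sum>x\<in>X. f x n)"
  using assms by (induction X rule: finite_induct) (auto intro: ap_comb.intros)

lemma ap_comb_prod:
  assumes "finite X" "\<And>x. x \<in> X \<Longrightarrow> ap_comb M (B x) (f x)" "M > 0"
  shows "ap_comb M (\<Prod>x\<in>X. B x) (\<lambda>n. \<Prod>x\<in>X. f x n)"
  using assms(1,2) by (induction X rule: finite_induct) (auto intro!: ap_comb_1 ap_comb_mult assms(3))

lemma ap_comb_power:
  assumes "ap_comb M B f" "M > 0"
  shows "ap_comb M (B ^ k) (\<lambda>n. f n ^ k)"
  by (induction k) (auto intro!: ap_comb_1 ap_comb_mult assms)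

text \<open>An interval meets one residue class in its expected number of points up to 1, and the
  weights add up to \<open>B\<close>. The period does not enter the bound; it will be the product of
  all primes up to a power of \<open>N\<close>, far beyond \<open>N\<close>.\<close>

lemma ap_comb_sum_approx:
  assumes "ap_comb M B f" "M > 0"
  shows "\<bar>(\<Sum>n=1..N. f n) - N * ((\<Sum>n<M. f n) / M)\<bar> \<le> B"
  using assms(1)
proof (induction rule: ap_comb.induct)
  case (dvd_ind m s)
  have m: "m > 0" using dvd_ind assms(2) by (auto intro: Nat.gr0I)
  have "(\<Sum>n<M. dvd_ind m (n + s)) = (\<Sum>n=1..M. dvd_ind m ((s - 1) + n))"
    using dvd_ind(2) by (intro sum.reindex_bij_witness[of _ "\<lambda>j. j - 1" Suc]) (auto simp: add.commute)
  also have "\<dots> = real ((s - 1 + M) div m) - real ((s - 1) div m)"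
    by (rule sum_dvd_ind_interval[OF m])
  also have "\<dots> = M / m"
    using dvd_ind(1) m by (auto simp: elim!: dvdE)
  finally have "(\<Sum>n<M. dvd_ind m (n + s)) / M = 1 / m" using assms(2) by simp
  then show ?case using sum_dvd_ind_interval_approx[OF m, where h = N and n = s] by (simp add: add.commute)
next
  case (add B f C g)
  have "(\<Sum>n=1..N. f n + g n) - N * ((\<Sum>n<M. f n + g n) / M) = ((\<Sum>n=1..N. f n) - N * ((\<Sum>n<M. f n) / M)) + ((\<Sum>n=1..N. g n) - N * ((\<Sum>n<M. g n) / M))"
    by (simp add: sum.distrib add_divide_distrib ring_distribs)
  then show ?case by (simp only:) (rule order_trans[OF abs_triangle_ineq add_mono[OF add.IH]])
next
  case (cmult B f c)
  have "(\<Sum>n=1..N. c * f n) - N * ((\<Sum>n<M. c * f n) / M) = c * ((\<Sum>n=1..N. f n) - N * ((\<Sum>n<M. f n) / M))"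
    by (simp add: right_diff_distrib flip: sum_distrib_left)
  then show ?case by (simp only: abs_mult) (rule mult_left_mono[OF cmult.IH abs_ge_zero])
qed simp

lemma ap_comb_lam_set:
  assumes P: "finite P" "\<And>p. p \<in> P \<Longrightarrow> prime p" "S \<subseteq> P" and j: "j \<ge> 1"
  shows "ap_comb (\<Prod>P) (\<Prod>p\<in>S. (real p + 1) / (real p - 1)) (\<lambda>n. lambda_term S (n + j))"
  unfolding lambda_term_def
proof (rule ap_comb_prod)
  show "finite S" using P finite_subset by blast
  show "\<Prod>P > 0" using P by (intro prod_pos) (auto simp: prime_gt_0_nat)
  fix p assume p: "p \<in> S"
  then have pp: "prime p" "p dvd \<Prod>P" using P by (auto intro: dvd_prodI)
  have p1: "real p > 1" using prime_gt_1_nat[OF pp(1)] by simp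
  have eq: "local_factor p (n + j) / (real p - 1) = 1 / (real p - 1) * (1 + (- real p) * dvd_ind p (n + j))" for n
    by (simp add: local_factor_dvd_ind)
  have "ap_comb (\<Prod>P) (1 + \<bar>- real p\<bar> * 1) (\<lambda>n. 1 + (- real p) * dvd_ind p (n + j))"
    by (intro ap_comb.add ap_comb_1 ap_comb.cmult ap_comb.dvd_ind pp j)
  from ap_comb.cmult[OF this, of "1 / (real p - 1)"]
  show "ap_comb (\<Prod>P) ((real p + 1) / (real p - 1)) (\<lambda>n. local_factor p (n + j) / (real p - 1))"
    unfolding eq using p1 by (simp add: add.commute)
qed

text \<open>The multiplicative function with values \<open>(p + 1) / (p - 1) = 1 + O(1 / p)\<close>
  has bounded average, again by \<open>sum_divisor_product_le\<close>. A bound linear in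
  \<open>R\<close>, without an additional power, is what admits every exponent below
  \<open>1 / k\<close>.\<close>

lemma sum_sqf_sets_le:
  assumes R: "R \<ge> 1"
  shows "(\<Sum>S\<in>sqf_sets R. \<Prod>p\<in>S. (real p + 1) / (real p - 1)) \<le> exp 8 * R"
proof -
  define P where "P = primes_le R"
  have P: "finite P" "\<And>p. p \<in> P \<Longrightarrow> prime p" by (auto simp: P_def primes_leD)
  define g where "g p = 2 / (real p - 1)" for p
  have g: "0 \<le> g p" "1 + g p = (real p + 1) / (real p - 1)" "g p / p \<le> 4 * real p powr (-1-1)" if "prime p" for p
  proof -
    have p: "real p \<ge> 2" using prime_ge_2_nat[OF that] by simp
    show "0 \<le> g p" "1 + g p = (real p + 1) / (real p - 1)" using p by (auto simp: g_def field_simps)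
    have "real p powr (-1-1) = 1 / real p ^ 2" using p by (simp add: powr_minus powr_numeral divide_inverse)
    moreover have "g p / p \<le> 4 / real p ^ 2" using p by (simp add: g_def field_simps power2_eq_square)
    ultimately show "g p / p \<le> 4 * real p powr (-1-1)" by simp
  qed
  define F where "F r = (\<Prod>p\<in>P. if p dvd r then 1 + g p else 1)" for r
  have sqf: "q > 0" if "squarefree q" for q :: nat using that not_squarefree_0 by (cases "q = 0") auto
  have F0: "F r \<ge> 0" for r unfolding F_def using g(1) P(2) by (intro prod_nonneg) (auto intro: add_nonneg_nonneg)
  have "(\<Sum>S\<in>sqf_sets R. \<Prod>p\<in>S. (real p + 1) / (real p - 1)) = (\<Sum>q | squarefree q \<and> real q \<le> R. \<Prod>p\<in>prime_factors q. (real p + 1) / (real p - 1))"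
    by (rule sum_squarefree_eq_sum_sqf_sets[symmetric])
  also have "\<dots> = (\<Sum>q | squarefree q \<and> real q \<le> R. F q)"
  proof (intro sum.cong refl)
    fix q assume "q \<in> {q. squarefree q \<and> real q \<le> R}"
    then have q: "q > 0" "real q \<le> R" using sqf by auto
    have "real p \<le> R" if "p dvd q" for p using dvd_imp_le[OF that q(1)] q(2) by linarith
    then have sub: "prime_factors q = {p\<in>P. p dvd q}"
      using q(1) by (auto simp: P_def primes_le_def prime_factors_dvd)
    have "F q = (\<Prod>p\<in>{p\<in>P. p dvd q}. 1 + g p)"
      unfolding F_def using P(1) by (simp add: prod.inter_filter)
    then show "(\<Prod>p\<in>prime_factors q. (real p + 1) / (real p - 1)) = F q"
      unfolding sub using g(2) P(2) by simp
  qed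
  also have "\<dots> \<le> (\<Sum>q=1..nat \<lfloor>R\<rfloor>. F q)"
  proof (rule sum_mono2)
    show "{q. squarefree q \<and> real q \<le> R} \<subseteq> {1..nat \<lfloor>R\<rfloor>}"
      using sqf by (auto simp: le_nat_iff le_floor_iff Suc_le_eq)
  qed (use F0 in auto)
  also have "\<dots> \<le> nat \<lfloor>R\<rfloor> * (\<Prod>p\<in>P. 1 + g p / p)"
    unfolding F_def by (rule sum_divisor_product_le[OF P]) (use P(2) g(1) in auto)
  also have "\<dots> \<le> R * exp (4 * (1 + 1/1))"
  proof (intro mult_mono prod_primes_bounded)
    show "p \<ge> 1" if "p \<in> P" for p using P(2)[OF that] prime_ge_1_nat by blast
    show "0 \<le> 1 + g p / p \<and> 1 + g p / p \<le> 1 + 4 * real p powr (-1-1)" if "p \<in> P" for p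
      using g[OF P(2)[OF that]] by (auto intro: add_nonneg_nonneg)
    show "0 \<le> (\<Prod>p\<in>P. 1 + g p / p)" using g(1) P(2) by (intro prod_nonneg) (auto intro: add_nonneg_nonneg)
  qed (use R P in auto)
  finally show ?thesis by (simp add: mult.commute)
qed

text \<open>Each shift has weight at most \<open>exp 8 * R\<close>; \<open>h\<close> shifts add and
  the \<open>k\<close>-th power multiplies these weights.\<close>

lemma sum_power_short_sum_approx:
  assumes R: "R \<ge> 1"
  shows "\<bar>(\<Sum>n=1..N. short_sum (sqf_sets R) h n ^ k) - N * mean (primes_le R) (\<lambda>n. short_sum (sqf_sets R) h n ^ k)\<bar> \<le> (h * (exp 8 * R)) ^ k"
proof -
  define P where "P = primes_le R"
  define B where "B = (\<Sum>S\<in>sqf_sets R. \<Prod>p\<in>S. (real p + 1) / (real p - 1))"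
  have P: "finite P" "\<And>p. p \<in> P \<Longrightarrow> prime p" by (auto simp: P_def primes_leD)
  have pos: "\<Prod>P > 0" using P by (intro prod_pos) (auto simp: prime_gt_0_nat)
  have ap: "ap_comb (\<Prod>P) (\<Sum>j=1..h. B) (short_sum (sqf_sets R) h)"
    unfolding short_sum_def B_def
    by (intro ap_comb_sum ap_comb_lam_set P finite_sqf_sets) (use sqf_setsD(4) in \<open>auto simp: P_def\<close>)
  then have B0: "0 \<le> real h * B" using ap_comb_nonneg by fastforce
  have "\<bar>(\<Sum>n=1..N. short_sum (sqf_sets R) h n ^ k) - N * mean P (\<lambda>n. short_sum (sqf_sets R) h n ^ k)\<bar> \<le> (\<Sum>j=1..h. B) ^ k"
    unfolding mean_def by (rule ap_comb_sum_approx[OF ap_comb_power[OF ap pos] pos])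
  also have "\<dots> \<le> (h * (exp 8 * R)) ^ k"
    using B0 sum_sqf_sets_le[OF R] by (auto simp: B_def intro!: power_mono mult_left_mono)
  finally show ?thesis by (simp only: P_def)
qed

lemma psi_R_diff: "psi_R R (real (n + h)) - psi_R R (real n) = short_sum (sqf_sets R) h n"
proof (induction h)
  case (Suc h)
  have "{1..int (n + Suc h)} = insert (int (n + Suc h)) {1..int (n + h)}" by auto
  then have "psi_R R (real (n + Suc h)) = lambda_R R (int (n + Suc h)) + psi_R R (real (n + h))"
    by (simp add: psi_R_def)
  also have "lambda_R R (int (n + Suc h)) = (\<Sum>S\<in>sqf_sets R. lambda_term S (n + Suc h))"
    by (rule lambda_R_eq_sum_sqf_sets) simp
  finally show ?case using Suc by (simp add: short_sum_def)
qed (simp add: short_sum_def)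

lemma moment_psi_R_approx:
  assumes "R \<ge> 1"
  shows "\<bar>moment k N h (psi_R R) - N * mean (primes_le R) (\<lambda>n. short_sum (sqf_sets R) h n ^ k)\<bar> \<le> (h * (exp 8 * R)) ^ k"
  using sum_power_short_sum_approx[OF assms, where k = k and N = N and h = h] by (simp only: moment_def psi_R_diff)

section \<open>Passage to asymptotic equivalence\<close>

lemma asymp_equiv_iff_eps:
  fixes f g :: "nat \<Rightarrow> real"
  shows "f \<sim>[at_top] g \<longleftrightarrow> (\<forall>\<epsilon>>0. \<forall>\<^sub>F N in at_top. \<bar>f N - g N\<bar> \<le> \<epsilon> * \<bar>g N\<bar>)"
  unfolding asymp_equiv_altdef smallo_def by simp

definition second_main :: "real \<Rightarrow> real \<Rightarrow> real" where "second_main x L = x ^ 2 + x * L"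

definition third_main :: "real \<Rightarrow> real \<Rightarrow> real" where "third_main x L = x ^ 3 + 3 * x ^ 2 * L + 3 / 4 * x * L\<^sup>2"

text \<open>The threshold \<open>T\<close> depends on \<epsilon> alone and the estimate is uniform
  in \<open>h\<close>, so no relation between \<open>h\<close> and \<open>R\<close> has to be fixed
  at this stage.\<close>

definition mean_power_approx :: "nat \<Rightarrow> (real \<Rightarrow> real \<Rightarrow> real) \<Rightarrow> bool" where
  "mean_power_approx k G \<longleftrightarrow> (\<forall>\<epsilon>>0. \<exists>T. \<forall>R h. R > 1 \<longrightarrow> ln R \<ge> T \<longrightarrow> h \<ge> 1 \<longrightarrow>
     \<bar>mean (primes_le R) (\<lambda>n. short_sum (sqf_sets R) h n ^ k) - G (real h) (ln R)\<bar> \<le> \<epsilon> * G (real h) (ln R))"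

lemma mean_power_approx_1: "mean_power_approx 1 (\<lambda>x L. x)"
  unfolding mean_power_approx_def
proof (intro allI impI exI[of _ 1])
  fix \<epsilon> R :: real and h :: nat
  assume "\<epsilon> > 0" "R > 1" "ln R \<ge> 1"
  then show "\<bar>mean (primes_le R) (\<lambda>n. short_sum (sqf_sets R) h n ^ 1) - real h\<bar> \<le> \<epsilon> * real h"
    using mean_short_sum[of R 1 h] by simp
qed

text \<open>Once \<open>L\<close> exceeds \<open>6 * \<bar>F\<bar> / \<epsilon>\<close>, a
  lower-order term with constant \<open>F\<close> gains a factor \<open>L\<close> and becomes at
  most \<epsilon>/6 of terms that occur in the main part.\<close>

lemma relative_error_le:
  fixes H L x F \<epsilon> :: real
  assumes "H \<ge> 1" "L \<ge> 1" "0 \<le> x" "x \<le> \<epsilon> / 2" "\<bar>F\<bar> * 6 / \<epsilon> \<le> L" "\<epsilon> > 0"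
  shows "x * H ^ 2 + F * H \<le> \<epsilon> * second_main H L"
    and "x * (H ^ 2 * L + H ^ 3) + F * (H * L + H ^ 2) \<le> \<epsilon> * third_main H L"
proof -
  have F: "F \<le> \<epsilon> / 6 * L" using assms by (simp add: field_simps)
  have HL: "0 \<le> H * L" "0 \<le> H ^ 2 * L" using assms by auto
  have "x * H ^ 2 \<le> \<epsilon> * H ^ 2" using assms by (intro mult_right_mono) auto
  moreover have "F * H \<le> (\<epsilon> / 6 * L) * H" using F assms by (intro mult_right_mono) auto
  moreover have "\<epsilon> / 6 * (H * L) \<le> \<epsilon> * (H * L)" using HL assms by (intro mult_right_mono) auto
  ultimately show "x * H ^ 2 + F * H \<le> \<epsilon> * second_main H L"
    unfolding second_main_def ring_distribs by (simp add: mult_ac)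
  have "x * (H ^ 2 * L + H ^ 3) \<le> \<epsilon> / 2 * (H ^ 2 * L + H ^ 3)" using assms HL by (intro mult_right_mono) auto
  moreover have "F * (H * L + H ^ 2) \<le> (\<epsilon> / 6 * L) * (H * L + H ^ 2)" using F HL by (intro mult_right_mono) auto
  moreover have "\<epsilon> / 2 * (H ^ 2 * L + H ^ 3) + (\<epsilon> / 6 * L) * (H * L + H ^ 2) \<le> \<epsilon> * third_main H L"
  proof -
    have "0 \<le> \<epsilon> * (1 / 2 * H ^ 3 + (3 - 1/2 - 1/6) * (H ^ 2 * L) + (3/4 - 1/6) * (H * L ^ 2))"
      using assms HL by (intro mult_nonneg_nonneg add_nonneg_nonneg) auto
    also have "\<dots> = \<epsilon> * third_main H L - (\<epsilon> / 2 * (H ^ 2 * L + H ^ 3) + (\<epsilon> / 6 * L) * (H * L + H ^ 2))"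
      by (simp add: third_main_def power2_eq_square power3_eq_cube field_simps)
    finally show ?thesis by simp
  qed
  ultimately show "x * (H ^ 2 * L + H ^ 3) + F * (H * L + H ^ 2) \<le> \<epsilon> * third_main H L" by linarith
qed

lemma mean_power_approx_2_3: "mean_power_approx 2 second_main" "mean_power_approx 3 third_main"
proof -
  obtain C where C: "C \<ge> 0" "\<And>Q. Q \<ge> 1 \<Longrightarrow> \<exists>F. \<forall>R h. R > 1 \<longrightarrow> ln R \<ge> 1 \<longrightarrow> h \<ge> 1 \<longrightarrow>
     \<bar>mean (primes_le R) (\<lambda>n. (short_sum (sqf_sets R) h n)\<^sup>2) - (real h ^ 2 + real h * ln R)\<bar> \<le> C * Q powr (-(1/4)) * real h ^ 2 + F * real h \<and>
     \<bar>mean (primes_le R) (\<lambda>n. (short_sum (sqf_sets R) h n) ^ 3) - (real h ^ 3 + 3 * real h ^ 2 * ln R + 3 / 4 * real h * (ln R)\<^sup>2)\<bar> \<le>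
       C * Q powr (-(1/4)) * (real h ^ 2 * ln R + real h ^ 3) + F * (real h * ln R + real h ^ 2)"
    using short_sum_moments_approx by blast
  have "\<exists>T. \<forall>R h. R > 1 \<longrightarrow> ln R \<ge> T \<longrightarrow> h \<ge> 1 \<longrightarrow>
      \<bar>mean (primes_le R) (\<lambda>n. (short_sum (sqf_sets R) h n)\<^sup>2) - second_main h (ln R)\<bar> \<le> \<epsilon> * second_main h (ln R) \<and>
      \<bar>mean (primes_le R) (\<lambda>n. short_sum (sqf_sets R) h n ^ 3) - third_main h (ln R)\<bar> \<le> \<epsilon> * third_main h (ln R)" if \<epsilon>: "\<epsilon> > 0" for \<epsilon> :: real
  proof -
    have "((\<lambda>Q::real. C * Q powr (-(1/4))) \<longlongrightarrow> C * 0) at_top"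
      by (intro tendsto_mult tendsto_const tendsto_neg_powr filterlim_ident) auto
    then have "\<forall>\<^sub>F Q in at_top. C * Q powr (-(1/4)) < \<epsilon> / 2" using \<epsilon> by (intro order_tendstoD(2)) auto
    then have "\<forall>\<^sub>F Q in at_top. C * Q powr (-(1/4)) < \<epsilon> / 2 \<and> Q \<ge> 1" using eventually_ge_at_top[of 1] by eventually_elim auto
    then obtain Q where Q: "C * Q powr (-(1/4)) < \<epsilon> / 2" "Q \<ge> 1" using eventually_happens by force
    obtain F where F: "\<And>R h. R > 1 \<Longrightarrow> ln R \<ge> 1 \<Longrightarrow> h \<ge> 1 \<Longrightarrow>
     \<bar>mean (primes_le R) (\<lambda>n. (short_sum (sqf_sets R) h n)\<^sup>2) - (real h ^ 2 + real h * ln R)\<bar> \<le> C * Q powr (-(1/4)) * real h ^ 2 + F * real h \<and>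
     \<bar>mean (primes_le R) (\<lambda>n. (short_sum (sqf_sets R) h n) ^ 3) - (real h ^ 3 + 3 * real h ^ 2 * ln R + 3 / 4 * real h * (ln R)\<^sup>2)\<bar> \<le>
       C * Q powr (-(1/4)) * (real h ^ 2 * ln R + real h ^ 3) + F * (real h * ln R + real h ^ 2)"
      using C(2)[OF Q(2)] by blast
    show ?thesis
    proof (rule exI[of _ "max 1 (\<bar>F\<bar> * 6 / \<epsilon>)"], intro allI impI)
      fix R :: real and h :: nat
      assume R: "R > 1" "max 1 (\<bar>F\<bar> * 6 / \<epsilon>) \<le> ln R" and h: "h \<ge> 1"
      then have L: "ln R \<ge> 1" "\<bar>F\<bar> * 6 / \<epsilon> \<le> ln R" by auto
      have "real h \<ge> 1" "0 \<le> C * Q powr (-(1/4))" "C * Q powr (-(1/4)) \<le> \<epsilon> / 2" using h C(1) Q(1) by auto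
      note e = relative_error_le[OF this(1) L(1) this(2,3) L(2) \<epsilon>]
      show "\<bar>mean (primes_le R) (\<lambda>n. (short_sum (sqf_sets R) h n)\<^sup>2) - second_main h (ln R)\<bar> \<le> \<epsilon> * second_main h (ln R) \<and>
        \<bar>mean (primes_le R) (\<lambda>n. short_sum (sqf_sets R) h n ^ 3) - third_main h (ln R)\<bar> \<le> \<epsilon> * third_main h (ln R)"
        using F[OF R(1) L(1) h] e unfolding second_main_def third_main_def by linarith
    qed
  qed
  then show "mean_power_approx 2 second_main" "mean_power_approx 3 third_main"
    unfolding mean_power_approx_def by blast+
qed

text \<open>Half of \<epsilon> pays for replacing the mean by \<open>G\<close>, the other half for
  replacing the sum over \<open>n\<close> by the mean. The latter costs
  \<open>(h * exp 8 * R) ^ k = o(N)\<close>, and \<open>G \<ge> 1\<close> makes this small relative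
  to the main term.\<close>

lemma moment_asymp:
  assumes h: "\<And>N. h N > 0" and hK: "\<forall>\<^sub>F N in at_top. real (h N) \<le> K * ln (real N)"
    and k: "k \<ge> 1" and \<theta>: "0 < \<theta>" "\<theta> < 1 / real k"
    and G: "mean_power_approx k G" "\<And>x L. x \<ge> 1 \<Longrightarrow> L \<ge> 1 \<Longrightarrow> G x L \<ge> 1"
  shows "(\<lambda>N. moment k N (h N) (psi_R (real N powr \<theta>))) \<sim>[at_top] (\<lambda>N. N * G (h N) (\<theta> * ln (real N)))"
  unfolding asymp_equiv_iff_eps
proof (intro allI impI)
  fix \<epsilon> :: real assume \<epsilon>: "\<epsilon> > 0"
  from G(1) obtain T where T: "\<And>R h. R > 1 \<Longrightarrow> ln R \<ge> T \<Longrightarrow> h \<ge> 1 \<Longrightarrow>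
     \<bar>mean (primes_le R) (\<lambda>n. short_sum (sqf_sets R) h n ^ k) - G (real h) (ln R)\<bar> \<le> \<epsilon> / 2 * G (real h) (ln R)"
    unfolding mean_power_approx_def using \<epsilon> half_gt_zero by blast
  define \<delta> where "\<delta> = 1 / real k - \<theta>"
  have \<delta>: "\<delta> > 0" using \<theta> by (simp add: \<delta>_def)
  have lim: "((\<lambda>N. (K * exp 8 * (ln (real N) / real N powr \<delta>)) ^ k) \<longlongrightarrow> (K * exp 8 * 0) ^ k) at_top"
    by (intro tendsto_power tendsto_mult tendsto_const lim_ln_over_power \<delta>)
  have "\<forall>\<^sub>F N in at_top. (K * exp 8 * (ln (real N) / real N powr \<delta>)) ^ k < \<epsilon> / 2"
    using k \<epsilon> by (intro order_tendstoD(2)[OF lim]) (simp add: zero_power)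
  moreover have "filterlim (\<lambda>N. \<theta> * ln (real N)) at_top at_top"
    using \<theta>(1) by (intro filterlim_tendsto_pos_mult_at_top[OF tendsto_const] filterlim_compose[OF ln_at_top filterlim_real_sequentially])
  then have "\<forall>\<^sub>F N in at_top. \<theta> * ln (real N) \<ge> max 1 T" unfolding filterlim_at_top by blast
  ultimately show "\<forall>\<^sub>F N in at_top. \<bar>moment k N (h N) (psi_R (real N powr \<theta>)) - N * G (h N) (\<theta> * ln (real N))\<bar> \<le> \<epsilon> * \<bar>N * G (h N) (\<theta> * ln (real N))\<bar>"
    using hK eventually_gt_at_top[of 1]
  proof eventually_elim
    case (elim N)
    define R where "R = real N powr \<theta>"
    define M where "M = mean (primes_le R) (\<lambda>n. short_sum (sqf_sets R) (h N) n ^ k)"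
    define g where "g = G (h N) (ln R)"
    have R: "R > 1" "ln R = \<theta> * ln (real N)" using elim \<theta> by (auto simp: R_def ln_powr)
    have h1: "h N \<ge> 1" using h[of N] by simp
    have g: "g \<ge> 1" unfolding g_def using h1 elim R(2) by (intro G(2)) auto
    have "\<bar>M - g\<bar> \<le> \<epsilon> / 2 * g" unfolding M_def g_def using elim R h1 by (intro T) auto
    then have "real N * \<bar>M - g\<bar> \<le> N * (\<epsilon> / 2 * g)" by (rule mult_left_mono) simp
    then have 1: "\<bar>N * M - N * g\<bar> \<le> N * (\<epsilon> / 2 * g)"
      by (simp only: right_diff_distrib[symmetric] abs_mult abs_of_nat)
    have "real N powr (1 / real k) = R * real N powr \<delta>"
      unfolding R_def \<delta>_def by (simp flip: powr_add)
    moreover have "(real N powr (1 / real k)) ^ k = N" using elim k by (simp add: powr_realpow[symmetric] powr_powr)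
    \<comment> \<open>Writing \<open>N\<close> as a \<open>k\<close>-th power lets the error be
      compared under the exponent: the ratio of the bases is
      \<open>K * exp 8 * ln N / N powr \<delta>\<close>, which tends to 0.\<close>
    ultimately have N: "real N = (R * real N powr \<delta>) ^ k" by simp
    have "\<bar>moment k N (h N) (psi_R R) - N * M\<bar> \<le> (h N * (exp 8 * R)) ^ k"
      unfolding M_def using R by (intro moment_psi_R_approx) auto
    also have "\<dots> \<le> (K * ln (real N) * (exp 8 * R)) ^ k"
      using elim R by (intro power_mono mult_right_mono) auto
    also have "\<dots> = ((K * exp 8 * (ln (real N) / real N powr \<delta>)) * (R * real N powr \<delta>)) ^ k"
      using elim by (simp add: mult_ac)
    also have "\<dots> = (K * exp 8 * (ln (real N) / real N powr \<delta>)) ^ k * (R * real N powr \<delta>) ^ k"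
      by (rule power_mult_distrib)
    also have "\<dots> \<le> \<epsilon> / 2 * (R * real N powr \<delta>) ^ k"
      using elim R by (intro mult_right_mono) auto
    also have "\<dots> = \<epsilon> / 2 * (real N * 1)" unfolding N[symmetric] by simp
    also have "\<dots> \<le> \<epsilon> / 2 * (N * g)"
      using g \<epsilon> by (intro mult_left_mono) auto
    finally have 2: "\<bar>moment k N (h N) (psi_R R) - N * M\<bar> \<le> \<epsilon> / 2 * (N * g)" .
    have "\<bar>moment k N (h N) (psi_R R) - N * g\<bar> \<le> \<epsilon> / 2 * (N * g) + N * (\<epsilon> / 2 * g)"
      using 1 2 by linarith
    also have "\<dots> = \<epsilon> * \<bar>N * g\<bar>" using g by simp
    finally show ?case by (simp only: R_def[symmetric] g_def R(2))
  qed
qed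

text \<open>From \<open>\<epsilon> \<le> 1\<close> follows \<open>y \<le> 2 * x\<close>, hence
  \<open>y^2 + y * x + x^2 \<le> 7 * x^2\<close>; the cubic term decides the constant 7.\<close>

lemma main_perturb:
  fixes x y L \<epsilon> :: real
  assumes "x \<ge> 0" "y \<ge> 0" "L \<ge> 0" "\<bar>y - x\<bar> \<le> \<epsilon> * x" "\<epsilon> \<le> 1"
  shows "\<bar>second_main y L - second_main x L\<bar> \<le> 7 * \<epsilon> * second_main x L" "\<bar>third_main y L - third_main x L\<bar> \<le> 7 * \<epsilon> * third_main x L"
proof -
  have ex: "0 \<le> \<epsilon> * x" "\<epsilon> * x \<le> 1 * x" using assms by (linarith, intro mult_right_mono) auto
  then have y: "y \<le> 2 * x" using assms by linarith
  have "\<bar>y - x\<bar> * (y + x) \<le> (\<epsilon> * x) * (3 * x)" using assms y ex by (intro mult_mono) auto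
  moreover have "y\<^sup>2 - x\<^sup>2 = (y - x) * (y + x)" by (simp add: power2_eq_square algebra_simps)
  ultimately have sq: "\<bar>y\<^sup>2 - x\<^sup>2\<bar> \<le> 3 * (\<epsilon> * x * x)" using assms by (simp add: abs_mult mult_ac)
  have "y * y \<le> (2 * x) * (2 * x)" "y * x \<le> (2 * x) * x" using assms y by (intro mult_mono; simp)+
  then have "\<bar>y - x\<bar> * (y * y + y * x + x * x) \<le> (\<epsilon> * x) * (7 * (x * x))" using assms ex by (intro mult_mono) auto
  moreover have "y ^ 3 - x ^ 3 = (y - x) * (y * y + y * x + x * x)" by (simp add: power3_eq_cube algebra_simps)
  ultimately have cu: "\<bar>y ^ 3 - x ^ 3\<bar> \<le> 7 * (\<epsilon> * x * x * x)" using assms by (simp add: abs_mult mult_ac)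
  have nn: "0 \<le> \<epsilon> * x * x" "0 \<le> \<epsilon> * x * L" "0 \<le> \<epsilon> * x * x * L" "0 \<le> \<epsilon> * x * (L * L)" using ex assms by auto
  have l: "\<bar>y * L - x * L\<bar> \<le> \<epsilon> * x * L" "\<bar>y * L\<^sup>2 - x * L\<^sup>2\<bar> \<le> \<epsilon> * x * L\<^sup>2" "\<bar>y\<^sup>2 * L - x\<^sup>2 * L\<bar> \<le> 3 * (\<epsilon> * x * x) * L"
    unfolding left_diff_distrib[symmetric] abs_mult using assms sq by (auto intro!: mult_right_mono)
  have "\<bar>second_main y L - second_main x L\<bar> \<le> 3 * (\<epsilon> * x * x) + \<epsilon> * x * L" unfolding second_main_def using sq l(1) by linarith
  also have "\<dots> \<le> 7 * (\<epsilon> * x * x) + 7 * (\<epsilon> * x * L)" using nn by linarith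
  finally show "\<bar>second_main y L - second_main x L\<bar> \<le> 7 * \<epsilon> * second_main x L" by (simp add: second_main_def power2_eq_square algebra_simps)
  have gen: "\<bar>a + 3 * b + 3 / 4 * c\<bar> \<le> A + 3 * B + 3 / 4 * C"
    if "\<bar>a\<bar> \<le> A" "\<bar>b\<bar> \<le> B" "\<bar>c\<bar> \<le> C" for a b c A B C :: real using that by linarith
  have "third_main y L - third_main x L = (y ^ 3 - x ^ 3) + 3 * (y\<^sup>2 * L - x\<^sup>2 * L) + 3 / 4 * (y * L\<^sup>2 - x * L\<^sup>2)"
    by (simp add: third_main_def algebra_simps)
  then have "\<bar>third_main y L - third_main x L\<bar> \<le> 7 * (\<epsilon> * x * x * x) + 3 * (3 * (\<epsilon> * x * x) * L) + 3 / 4 * (\<epsilon> * x * L\<^sup>2)"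
    using gen[OF cu l(3,2)] by (simp only:)
  also have "\<dots> = 7 * (\<epsilon> * x * x * x) + 9 * (\<epsilon> * x * x * L) + 3 / 4 * (\<epsilon> * x * (L * L))"
    by (simp add: power2_eq_square)
  also have "\<dots> \<le> 7 * (\<epsilon> * x * x * x) + 21 * (\<epsilon> * x * x * L) + 7 * (3 / 4 * (\<epsilon> * x * (L * L)))"
    using mult_right_mono[OF _ nn(3), of 9 21] mult_right_mono[OF _ nn(4), of "3/4" "7 * (3/4)"] by simp
  finally show "\<bar>third_main y L - third_main x L\<bar> \<le> 7 * \<epsilon> * third_main x L"
    by (simp add: third_main_def power2_eq_square power3_eq_cube algebra_simps)
qed

lemma main_asymp:
  assumes h: "(\<lambda>N. real (h N)) \<sim>[at_top] (\<lambda>N. x N)" and x: "\<forall>\<^sub>F N in at_top. x N \<ge> 0" and L: "\<forall>\<^sub>F N in at_top. L N \<ge> 0"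
    and G: "G = second_main \<or> G = third_main"
  shows "(\<lambda>N. real N * G (h N) (L N)) \<sim>[at_top] (\<lambda>N. real N * G (x N) (L N))"
proof (intro asymp_equiv_intros)
  show "(\<lambda>N. G (h N) (L N)) \<sim>[at_top] (\<lambda>N. G (x N) (L N))"
    unfolding asymp_equiv_iff_eps
  proof (intro allI impI)
    fix \<epsilon> :: real assume "\<epsilon> > 0"
    then have e: "min 1 (\<epsilon> / 7) > 0" by simp
    with h have "\<forall>\<^sub>F N in at_top. \<bar>real (h N) - x N\<bar> \<le> min 1 (\<epsilon> / 7) * \<bar>x N\<bar>" unfolding asymp_equiv_iff_eps by blast
    then show "\<forall>\<^sub>F N in at_top. \<bar>G (h N) (L N) - G (x N) (L N)\<bar> \<le> \<epsilon> * \<bar>G (x N) (L N)\<bar>"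
      using x L
    proof eventually_elim
      case (elim N)
      then have nn: "0 \<le> G (x N) (L N)" using G by (auto simp: second_main_def third_main_def)
      have "\<bar>G (h N) (L N) - G (x N) (L N)\<bar> \<le> 7 * min 1 (\<epsilon> / 7) * G (x N) (L N)"
        using G main_perturb[of "x N" "real (h N)" "L N" "min 1 (\<epsilon> / 7)"] elim by auto
      also have "\<dots> \<le> \<epsilon> * G (x N) (L N)" using nn by (intro mult_right_mono) auto
      finally show ?case using nn by simp
    qed
  qed
qed

text \<open>\<open>lam\<close> may vary with \<open>N\<close> and even tend to 0. The moments are
  therefore first compared with main terms in \<open>h\<close> itself, uniformly, and
  \<open>h\<close> is replaced by \<open>lam N * ln (real N)\<close> only afterwards.\<close>

theorem corollary1:
  fixes lam :: "nat \<Rightarrow> real" and h :: "nat \<Rightarrow> nat" and \<theta> :: "nat \<Rightarrow> real"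
  assumes lam_pos: "\<And>N. lam N > 0"
    and lam_bounded: "lam \<in> O(\<lambda>_. 1)"
    and h_pos: "\<And>N. h N > 0"
    and h_asymp: "(\<lambda>N. real (h N)) \<sim>[at_top] (\<lambda>N. lam N * ln (real N))"
    and theta: "\<And>k. k \<in> {1..3} \<Longrightarrow> 0 < \<theta> k \<and> \<theta> k < 1 / real k"
  shows "(\<lambda>N. moment 1 N (h N) (psi_R (real N powr \<theta> 1)))
           \<sim>[at_top] (\<lambda>N. lam N * real N * ln (real N)) \<and>
         (\<lambda>N. moment 2 N (h N) (psi_R (real N powr \<theta> 2)))
           \<sim>[at_top] (\<lambda>N. (\<theta> 2 * lam N + (lam N)\<^sup>2) * real N * (ln (real N))\<^sup>2) \<and>
         (\<lambda>N. moment 3 N (h N) (psi_R (real N powr \<theta> 3)))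
           \<sim>[at_top] (\<lambda>N. (3 / 4 * (\<theta> 3)\<^sup>2 * lam N + 3 * \<theta> 3 * (lam N)\<^sup>2 + (lam N) ^ 3)
                              * real N * (ln (real N)) ^ 3)"
proof -
  define x where "x N = lam N * ln (real N)" for N
  have ln_nn: "\<forall>\<^sub>F N in at_top. ln (real N) \<ge> 0" using eventually_ge_at_top[of 1] by eventually_elim auto
  then have x_nn: "\<forall>\<^sub>F N in at_top. x N \<ge> 0" by eventually_elim (use lam_pos in \<open>simp add: x_def less_imp_le\<close>)
  have hx: "(\<lambda>N. real (h N)) \<sim>[at_top] (\<lambda>N. x N)" using h_asymp by (simp add: x_def)
  obtain K where K: "\<forall>\<^sub>F N in at_top. \<bar>lam N\<bar> \<le> K" using lam_bounded by (auto elim!: landau_o.bigE)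
  \<comment> \<open>The equivalence with \<epsilon> = 1 gives \<open>h \<le> 2 * x\<close>
    eventually; with \<open>lam\<close> bounded this is a bound by a multiple of
    \<open>ln N\<close>.\<close>
  have "\<forall>\<^sub>F N in at_top. \<bar>real (h N) - x N\<bar> \<le> 1 * \<bar>x N\<bar>"
    using hx unfolding asymp_equiv_iff_eps by (metis zero_less_one)
  then have hK: "\<forall>\<^sub>F N in at_top. real (h N) \<le> (2 * K) * ln (real N)"
    using ln_nn x_nn K
  proof eventually_elim
    case (elim N)
    have "real (h N) \<le> 2 * x N" using elim by linarith
    also have "x N \<le> K * ln (real N)" unfolding x_def using elim by (intro mult_right_mono) auto
    finally show ?case by simp
  qed
  have \<theta>: "0 < \<theta> 1" "\<theta> 1 < 1 / real 1" "0 < \<theta> 2" "\<theta> 2 < 1 / real 2" "0 < \<theta> 3" "\<theta> 3 < 1 / real 3"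
    using theta[of 1] theta[of 2] theta[of 3] by auto
  have main_ge: "second_main a L \<ge> 1" "third_main a L \<ge> 1" if "a \<ge> 1" "L \<ge> 1" for a L
    using that one_le_power[of a 2] one_le_power[of a 3]
    by (auto simp: second_main_def third_main_def intro!: add_increasing2)
  have L: "\<forall>\<^sub>F N in at_top. \<theta> k * ln (real N) \<ge> 0" if "k \<in> {1..3}" for k
    using ln_nn by eventually_elim (use theta[OF that] in simp)
  have "(\<lambda>N. moment 1 N (h N) (psi_R (real N powr \<theta> 1))) \<sim>[at_top] (\<lambda>N. real N * real (h N))"
    by (rule moment_asymp[OF h_pos hK _ \<theta>(1,2) mean_power_approx_1]) auto
  also have "\<dots> \<sim>[at_top] (\<lambda>N. real N * x N)" by (intro asymp_equiv_intros hx)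
  also have "(\<lambda>N. real N * x N) = (\<lambda>N. lam N * real N * ln (real N))" by (simp add: x_def mult_ac)
  finally have 1: "(\<lambda>N. moment 1 N (h N) (psi_R (real N powr \<theta> 1))) \<sim>[at_top] (\<lambda>N. lam N * real N * ln (real N))" .
  have "(\<lambda>N. moment 2 N (h N) (psi_R (real N powr \<theta> 2))) \<sim>[at_top] (\<lambda>N. real N * second_main (h N) (\<theta> 2 * ln (real N)))"
    by (rule moment_asymp[OF h_pos hK _ \<theta>(3,4) mean_power_approx_2_3(1)]) (auto intro: main_ge)
  also have "\<dots> \<sim>[at_top] (\<lambda>N. real N * second_main (x N) (\<theta> 2 * ln (real N)))" by (intro main_asymp hx x_nn L) auto
  also have "(\<lambda>N. real N * second_main (x N) (\<theta> 2 * ln (real N))) = (\<lambda>N. (\<theta> 2 * lam N + (lam N)\<^sup>2) * real N * (ln (real N))\<^sup>2)"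
    by (simp add: fun_eq_iff x_def second_main_def power2_eq_square algebra_simps)
  finally have 2: "(\<lambda>N. moment 2 N (h N) (psi_R (real N powr \<theta> 2))) \<sim>[at_top] (\<lambda>N. (\<theta> 2 * lam N + (lam N)\<^sup>2) * real N * (ln (real N))\<^sup>2)" .
  have "(\<lambda>N. moment 3 N (h N) (psi_R (real N powr \<theta> 3))) \<sim>[at_top] (\<lambda>N. real N * third_main (h N) (\<theta> 3 * ln (real N)))"
    by (rule moment_asymp[OF h_pos hK _ \<theta>(5,6) mean_power_approx_2_3(2)]) (auto intro: main_ge)
  also have "\<dots> \<sim>[at_top] (\<lambda>N. real N * third_main (x N) (\<theta> 3 * ln (real N)))" by (intro main_asymp hx x_nn L) auto
  also have "(\<lambda>N. real N * third_main (x N) (\<theta> 3 * ln (real N))) = (\<lambda>N. (3 / 4 * (\<theta> 3)\<^sup>2 * lam N + 3 * \<theta> 3 * (lam N)\<^sup>2 + (lam N) ^ 3) * real N * (ln (real N)) ^ 3)"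
    by (simp add: fun_eq_iff x_def third_main_def power2_eq_square power3_eq_cube algebra_simps)
  finally have 3: "(\<lambda>N. moment 3 N (h N) (psi_R (real N powr \<theta> 3))) \<sim>[at_top] (\<lambda>N. (3 / 4 * (\<theta> 3)\<^sup>2 * lam N + 3 * \<theta> 3 * (lam N)\<^sup>2 + (lam N) ^ 3) * real N * (ln (real N)) ^ 3)" .
  show ?thesis using 1 2 3 by blast
qed

end
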